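(* Assume $q=2$ and $J^{\min}>0$, and let $\mathbf n\in S^{d-1}$. Then, for $\beta$ large enough, there exists $c>0$ such that, for all $r>0$, $$I_{\mathbf n}(\tau^q(\mathbf n)-r)\ge c\,r^2.$$
   Context: Fix $d\ge 2$ and $\beta\ge 0$; here $q=2$. For $x,y\in\mathbb Z^d$ write $x\sim y$ if $\|x-y\|_2=1$; for $\Lambda\subset\mathbb Z^d$ let $E(\Lambda)=\{\{x,y\}:x,y\in\Lambda,\ x\sim y\}$. The couplings $J=(J_e)_{e\in E(\mathbb Z^d)}$ are i.i.d. with values in $[0,1]$ under the product measure $\mathbb P$. $J^{\min}=\inf\{\lambda\ge0:\mathbb P(J_e<\lambda)>0\}$. Random cluster model: for finite $E\subset E(\mathbb Z^d)$, boundary condition $\pi\in\{0,1\}^{E^c}$ and $\omega\in\{0,1\}^E$, $\Phi^{J,\pi,q}_{E,\beta}(\{\omega\})=\frac1Z\prod_{e\in E}p_e^{\omega_e}(1-p_e)^{1-\omega_e}\,q^{C^\pi_E(\omega)}$ with $p_e=1-e^{-\beta J_e}$, where $C^\pi_E(\omega)$ is the number of clusters of the set of vertices touched by $E$ when connections use the open edges of $\omega$ in $E$ and of $\pi$ outside $E$, and $Z$ is the normalizing constant. The boundary condition $w$ (wired) is $\pi\equiv1$. Geometry: $S^{d-1}$ is the Euclidean unit sphere. For $\mathbf n\in S^{d-1}$, $\mathbb S_{\mathbf n}$ is the set of the $(d-1)$-dimensional unit cubes $\{\sum_{k=1}^{d-1}t_k\mathbf u_k: t_k\in[-\frac12,\frac12]\}$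 with $(\mathbf u_1,\dots,\mathbf u_{d-1},\mathbf n)$ an orthonormal basis of $\mathbb R^d$. $\mathcal R_{x,L,H}(\mathcal S,\mathbf n)=x+L\mathcal S+[-H,H]\mathbf n$. For such $\mathcal R$, $\hat{\mathcal R}$ is the set of points of $\mathbb Z^d$ in the interior of $\mathcal R$; $\partial\hat{\mathcal R}=\{y\in\hat{\mathcal R}:\exists z\in\mathbb Z^d\setminus\hat{\mathcal R},\ z\sim y\}$; $\partial^+\hat{\mathcal R}=\{y\in\partial\hat{\mathcal R}:(y-x)\cdot\mathbf n\ge0\}$, $\partial^-\hat{\mathcal R}=\{y\in\partial\hat{\mathcal R}:(y-x)\cdot\mathbf n<0\}$. $\Phi^{J,w}_{\mathcal R}$ is $\Phi^{J,w,q}_{E(\hat{\mathcal R}),\beta}$. Surface tension: $\mathcal D_{\mathcal R}$ is the event that no $\omega$-open path in $E(\hat{\mathcal R})$ joins $\partial^+\hat{\mathcal R}$ to $\partial^-\hat{\mathcal R}$, and $\tau^J_{\mathcal R}=-\frac1{L^{d-1}}\log\Phi^{J,w}_{\mathcal R}(\mathcal D_{\mathcal R})$. The quenched surface tension $\tau^q(\mathbf n)=\tau^q_\beta(\mathbf n)$ is the limit in $\mathbb P$-probability of $\tau^J_{\mathcal R_{0,N,\delta N}(\mathcal S,\mathbf n)}$ as $N\to\infty$ (it exists and does not depend on $\delta>0$, $\mathcal S\in\mathbb S_{\mathbf n}$); $\tau^{\min}(\mathbf n)$ is the same limit for the constant couplings $J\equiv J^{\min}$. Rate function (depending on $\beta$):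 for $\tau>\tau^{\min}(\mathbf n)$, $I_{\mathbf n}(\tau)=\lim_{N}-\frac1{N^{d-1}}\log\mathbb P(\tau^J_{\mathcal R_{0,N,\delta N}(\mathcal S,\mathbf n)}\le\tau)\in[0,\infty)$ (it exists and does not depend on $\delta>0$, $\mathcal S\in\mathbb S_{\mathbf n}$); $I_{\mathbf n}(\tau)=+\infty$ for $\tau<\tau^{\min}(\mathbf n)$ and $I_{\mathbf n}(\tau^{\min}(\mathbf n))=\lim_{\varepsilon\to0^+}I_{\mathbf n}(\tau^{\min}(\mathbf n)+\varepsilon)$. *)

theory Defs
  imports "HOL-Probability.Probability"
begin

section \<open>The lattice and the random cluster model\<close>

text \<open>The dimension is \<open>d = CARD('d)\<close>; \<open>\<int>\<^sup>d\<close> is realised inside \<open>real ^ 'd\<close>.\<close>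

definition int_lattice :: "(real ^ 'd) set" where
  "int_lattice = {x. \<forall>i. x $ i \<in> \<int>}"

definition edges :: "(real ^ 'd) set \<Rightarrow> (real ^ 'd) set set" where
  "edges \<Lambda> = {{x, y} | x y. x \<in> \<Lambda> \<and> y \<in> \<Lambda> \<and> dist x y = 1}"

text \<open>An edge configuration in \<open>{0,1}\<^sup>E\<close> is represented by its set of open edges, a subset
  of \<open>E\<close>; likewise a boundary condition is a subset of the complement of \<open>E\<close>.\<close>

definition connections :: "'v set set \<Rightarrow> ('v \<times> 'v) set" where
  "connections \<omega> = {(x, y). {x, y} \<in> \<omega>}\<^sup>*"

definition num_clusters :: "'v set set \<Rightarrow> 'v set set \<Rightarrow> 'v set set \<Rightarrow> nat" where
  "num_clusters E \<pi> \<omega> = card (\<Union>E // (connections (\<omega> \<union> \<pi>) \<inter> \<Union>E \<times> \<Union>E))"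

definition edge_prob :: "real \<Rightarrow> ('e \<Rightarrow> real) \<Rightarrow> 'e \<Rightarrow> real" where
  "edge_prob \<beta> J e = 1 - exp (- \<beta> * J e)"

definition rc_weight ::
    "real \<Rightarrow> real \<Rightarrow> 'v set set \<Rightarrow> 'v set set \<Rightarrow> ('v set \<Rightarrow> real) \<Rightarrow> 'v set set \<Rightarrow> real" where
  "rc_weight q \<beta> E \<pi> J \<omega> =
     (\<Prod>e\<in>E. if e \<in> \<omega> then edge_prob \<beta> J e else 1 - edge_prob \<beta> J e) * q ^ num_clusters E \<pi> \<omega>"

definition rc_prob ::
    "real \<Rightarrow> real \<Rightarrow> 'v set set \<Rightarrow> 'v set set \<Rightarrow> ('v set \<Rightarrow> real) \<Rightarrow> 'v set set set \<Rightarrow> real" where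
  "rc_prob q \<beta> E \<pi> J A =
     (\<Sum>\<omega>\<in>Pow E \<inter> A. rc_weight q \<beta> E \<pi> J \<omega>) / (\<Sum>\<omega>\<in>Pow E. rc_weight q \<beta> E \<pi> J \<omega>)"

definition wired :: "(real ^ 'd) set set \<Rightarrow> (real ^ 'd) set set" where
  "wired E = edges int_lattice - E"


section \<open>Rectangular parallelepipeds\<close>

definition unit_cubes :: "real ^ 'd \<Rightarrow> (real ^ 'd) set set" where
  "unit_cubes n = {{\<Sum>u\<in>B. t u *\<^sub>R u | t. \<forall>u\<in>B. t u \<in> {-1/2..1/2}} | B.
     n \<notin> B \<and> pairwise orthogonal (insert n B) \<and> (\<forall>u\<in>insert n B. norm u = 1) \<and>
     span (insert n B) = UNIV}"

definition rect ::
    "real ^ 'd \<Rightarrow> real \<Rightarrow> real \<Rightarrow> (real ^ 'd) set \<Rightarrow> real ^ 'd \<Rightarrow> (real ^ 'd) set" where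
  "rect x L H S n = {x + L *\<^sub>R s + h *\<^sub>R n | s h. s \<in> S \<and> h \<in> {-H..H}}"

definition lattice_interior :: "(real ^ 'd) set \<Rightarrow> (real ^ 'd) set" where
  "lattice_interior R = interior R \<inter> int_lattice"

definition lattice_boundary :: "(real ^ 'd) set \<Rightarrow> (real ^ 'd) set" where
  "lattice_boundary \<Lambda> = {y \<in> \<Lambda>. \<exists>z \<in> int_lattice - \<Lambda>. dist z y = 1}"

definition upper_boundary :: "real ^ 'd \<Rightarrow> real ^ 'd \<Rightarrow> (real ^ 'd) set \<Rightarrow> (real ^ 'd) set" where
  "upper_boundary x n \<Lambda> = {y \<in> lattice_boundary \<Lambda>. (y - x) \<bullet> n \<ge> 0}"

definition lower_boundary :: "real ^ 'd \<Rightarrow> real ^ 'd \<Rightarrow> (real ^ 'd) set \<Rightarrow> (real ^ 'd) set" where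
  "lower_boundary x n \<Lambda> = {y \<in> lattice_boundary \<Lambda>. (y - x) \<bullet> n < 0}"


section \<open>Surface tension\<close>

definition disconnection :: "real ^ 'd \<Rightarrow> real ^ 'd \<Rightarrow> (real ^ 'd) set \<Rightarrow> (real ^ 'd) set set set" where
  "disconnection x n \<Lambda> = {\<omega>. \<omega> \<subseteq> edges \<Lambda> \<and>
     (\<forall>y \<in> upper_boundary x n \<Lambda>. \<forall>z \<in> lower_boundary x n \<Lambda>. (y, z) \<notin> connections \<omega>)}"

definition rect_tension ::
    "real \<Rightarrow> real \<Rightarrow> ((real ^ 'd) set \<Rightarrow> real) \<Rightarrow>
     real ^ 'd \<Rightarrow> real \<Rightarrow> real \<Rightarrow> (real ^ 'd) set \<Rightarrow> real ^ 'd \<Rightarrow> real" where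
  "rect_tension q \<beta> J x L H S n =
     (let \<Lambda> = lattice_interior (rect x L H S n); E = edges \<Lambda>
      in - (1 / L ^ (CARD('d) - 1)) * ln (rc_prob q \<beta> E (wired E) J (disconnection x n \<Lambda>)))"

text \<open>\<open>\<nu>\<close> is the law of a single coupling, a probability measure on the interval \<open>[0,1]\<close>.\<close>

definition coupling_law :: "real measure \<Rightarrow> bool" where
  "coupling_law \<nu> \<longleftrightarrow> prob_space \<nu> \<and> sets \<nu> = sets (restrict_space borel {0..1})"

definition disorder :: "real measure \<Rightarrow> ((real ^ 'd) set \<Rightarrow> real) measure" where
  "disorder \<nu> = (\<Pi>\<^sub>M e\<in>edges int_lattice. \<nu>)"

definition J_min :: "real measure \<Rightarrow> real" where
  "J_min \<nu> = Inf {l. 0 \<le> l \<and> measure \<nu> {j \<in> space \<nu>. j < l} > 0}"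

text \<open>In the following limits the value is required to be the same for all heights \<open>\<delta> > 0\<close> and
  all cubes \<open>S\<close>.\<close>

definition quenched_tension :: "real \<Rightarrow> real \<Rightarrow> real measure \<Rightarrow> real ^ 'd \<Rightarrow> real" where
  "quenched_tension q \<beta> \<nu> n = (THE t. \<forall>\<delta>>0. \<forall>S\<in>unit_cubes n. \<forall>\<epsilon>>0.
     (\<lambda>N. measure (disorder \<nu>) {J \<in> space (disorder \<nu>).
        \<bar>rect_tension q \<beta> J 0 (real N) (\<delta> * real N) S n - t\<bar> > \<epsilon>}) \<longlonglongrightarrow> 0)"

definition minimal_tension :: "real \<Rightarrow> real \<Rightarrow> real measure \<Rightarrow> real ^ 'd \<Rightarrow> real" where
  "minimal_tension q \<beta> \<nu> n = (THE t. \<forall>\<delta>>0. \<forall>S\<in>unit_cubes n.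
     (\<lambda>N. rect_tension q \<beta> (\<lambda>_. J_min \<nu>) 0 (real N) (\<delta> * real N) S n) \<longlonglongrightarrow> t)"


section \<open>Rate function for lower deviations\<close>

text \<open>Since \<open>ln 0 = 0\<close> for reals, the value \<open>- log 0 = \<infinity>\<close> is given explicitly.\<close>

definition neg_log :: "real \<Rightarrow> ereal" where
  "neg_log p = (if p = 0 then \<infinity> else ereal (- ln p))"

definition deviation_cost ::
    "real \<Rightarrow> real \<Rightarrow> real measure \<Rightarrow> real \<Rightarrow> (real ^ 'd) set \<Rightarrow> real ^ 'd \<Rightarrow> real \<Rightarrow> nat \<Rightarrow> ereal" where
  "deviation_cost q \<beta> \<nu> \<delta> S n \<tau> N =
     neg_log (measure (disorder \<nu>) {J \<in> space (disorder \<nu>).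
       rect_tension q \<beta> J 0 (real N) (\<delta> * real N) S n \<le> \<tau>}) / ereal (real N ^ (CARD('d) - 1))"

definition rate_above :: "real \<Rightarrow> real \<Rightarrow> real measure \<Rightarrow> real ^ 'd \<Rightarrow> real \<Rightarrow> ereal" where
  "rate_above q \<beta> \<nu> n \<tau> =
     (THE v. \<forall>\<delta>>0. \<forall>S\<in>unit_cubes n. deviation_cost q \<beta> \<nu> \<delta> S n \<tau> \<longlonglongrightarrow> v)"

definition rate_function :: "real \<Rightarrow> real \<Rightarrow> real measure \<Rightarrow> real ^ 'd \<Rightarrow> real \<Rightarrow> ereal" where
  "rate_function q \<beta> \<nu> n \<tau> =
     (let \<tau>m = minimal_tension q \<beta> \<nu> n in
      if \<tau> < \<tau>m then \<infinity>
      else if \<tau> = \<tau>m then Lim (at_right 0) (\<lambda>\<epsilon>. rate_above q \<beta> \<nu> n (\<tau>m + \<epsilon>))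
      else rate_above q \<beta> \<nu> n \<tau>)"

end

theory Submission
  imports Defs
begin

text \<open>The rate function is bounded below as soon as the tension of a box of side \<open>N\<close> is shown
  to concentrate around its mean like a sum of order \<open>N\<^bsup>d-1\<^esup>\<close> of independent terms: if
  \<open>P(T \<le> E T - t) \<le> exp (2 C N\<^bsup>d-1\<^esup> s\<^sup>2 - s t)\<close> for all \<open>s \<le> exp (- \<beta>)\<close>, then \<open>t = r N\<^bsup>d-1\<^esup> / 2\<close>
  and \<open>s\<close> a small multiple of \<open>r\<close> give a cost of at least \<open>c r\<^sup>2 N\<^bsup>d-1\<^esup>\<close> (\<open>quadratic_cost\<close>).
  This choice of \<open>s\<close> is possible for all relevant \<open>r\<close> because the tension is nonnegative, so
  only \<open>r \<le> \<tau>\<^sup>q\<close> matters.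

  For \<open>q = 2\<close> everything is read off from Ising sums. By the Edwards-Sokal coupling
  (\<open>edwards_sokal\<close>) the probability of disconnection is \<open>Z\<^sub>\<plusminus> / Z\<^sub>+\<close>, the ratio of the Ising
  partition functions with mixed and with plus boundary condition; the wired boundary condition
  corresponds to a single boundary cluster since the complement of a box is connected
  (\<open>box_complement_connected\<close>). So the tension times \<open>N\<^bsup>d-1\<^esup>\<close> is \<open>T(J) = ln (Z\<^sub>+ / Z\<^sub>\<plusminus>)\<close>. Call
  an edge unsatisfied if its two spins differ. Lowering one coupling \<open>J\<^sub>e\<close> to \<open>J\<^bsup>min\<^esup>\<close> lowers
  \<open>T\<close> by at most \<open>exp \<beta> (P\<^sub>\<plusminus>(e unsatisfied) - P\<^sub>+(e unsatisfied))\<close>, a number in \<open>[0, exp \<beta>]\<close> by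
  Ginibre's inequality (\<open>ginibre\<close>, \<open>one_coupling\<close>). The sum of these differences is at most the
  mean size of the interface forced by the mixed boundary condition, and a Peierls argument
  bounds that size by \<open>T + O(N\<^bsup>d-1\<^esup>) = O(N\<^bsup>d-1\<^esup>)\<close> (\<open>interface_bound\<close>). This is where \<open>\<beta>\<close> has to
  be large and \<open>J\<^bsup>min\<^esup> > 0\<close>: the weights \<open>exp (- \<beta> J\<^sub>e)\<close> are then uniformly small. The
  topological input is that the star-connected interface can be removed by flipping spins
  (\<open>interface_flip\<close>), which rests on the exactness of closed cochains on the lattice
  (\<open>closed_cochain_exact\<close>). Hence the squares of the changes of \<open>T\<close> sum to \<open>O(N\<^bsup>d-1\<^esup>)\<close>
  (\<open>sensitivity\<close>), and the entropy method, that is tensorization and the argument of Herbst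
  (\<open>entropy_tensorization\<close>, \<open>herbst\<close>), yields the concentration inequality
  (\<open>tension_concentration\<close>).

  It remains to see that the quantities in the statement, which are defined as limits, exist. A
  large box is covered along its middle hyperplane by small boxes up to a relative error that
  vanishes (\<open>covering\<close>), and Ginibre's inequality allows all spins outside these boxes to be
  frozen (\<open>pinning\<close>, \<open>gluing\<close>); so the tension of the large box is at most the sum of the
  tensions of the small ones plus a small error (\<open>subadditivity\<close>). With an elementary limit
  lemma (\<open>common_limit\<close>) this gives the minimal tension, the mean tension, and, since disjoint
  boxes are independent, the rate function above the minimal tension (\<open>cost_subadditive\<close>). By
  concentration the mean tension is the quenched tension. Below the minimal tension the rate is
  infinite, and at the minimal tension the bound passes to the limit from the right.\<close>

section \<open>Ising sums and correlation inequalities\<close>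

text \<open>A spin configuration is coded by the set \<open>A\<close> of its minus spins. Then \<open>char_sign B A\<close> is
  the product of the spins in \<open>B\<close>.\<close>

definition char_sign :: "'v set \<Rightarrow> 'v set \<Rightarrow> real" where
  "char_sign B A = (-1) ^ card (B \<inter> A)"

text \<open>An edge is unsatisfied if it has one end in \<open>A\<close> and one outside, which for an edge with
  two ends means an odd intersection with \<open>A\<close>. With \<open>w e = exp (- \<beta> J\<^sub>e)\<close> this is the Ising
  weight, normalised so that the plus configuration has weight 1.\<close>

definition boltzmann :: "'v set set \<Rightarrow> ('v set \<Rightarrow> real) \<Rightarrow> 'v set \<Rightarrow> real" where
  "boltzmann E w A = (\<Prod>e\<in>E. if odd (card (e \<inter> A)) then w e else 1)"

text \<open>The partition function in which the spins in \<open>V\<close> are free, those in \<open>X\<close> are frozen to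
  minus and all others to plus. So \<open>X = {}\<close> is the plus boundary condition.\<close>

definition spin_sum :: "'v set set \<Rightarrow> ('v set \<Rightarrow> real) \<Rightarrow> 'v set \<Rightarrow> 'v set \<Rightarrow> real" where
  "spin_sum E w V X = (\<Sum>A\<in>Pow V. boltzmann E w (A \<union> X))"

definition char_sum :: "'v set set \<Rightarrow> ('v set \<Rightarrow> real) \<Rightarrow> 'v set \<Rightarrow> 'v set \<Rightarrow> 'v set \<Rightarrow> real" where
  "char_sum E w V X B = (\<Sum>A\<in>Pow V. char_sign B (A \<union> X) * boltzmann E w (A \<union> X))"

lemma odd_card_sym_diff:
  assumes "finite e"
  shows "odd (card (e \<inter> sym_diff A B)) \<longleftrightarrow> odd (card (e \<inter> A)) \<noteq> odd (card (e \<inter> B))"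
proof -
  have a: "card (e \<inter> A) = card (e \<inter> (A - B)) + card (e \<inter> A \<inter> B)"
    by (subst card_Un_disjoint[symmetric]) (use assms in \<open>auto intro!: arg_cong[of _ _ card]\<close>)
  have b: "card (e \<inter> B) = card (e \<inter> (B - A)) + card (e \<inter> A \<inter> B)"
    by (subst card_Un_disjoint[symmetric]) (use assms in \<open>auto intro!: arg_cong[of _ _ card]\<close>)
  have c: "card (e \<inter> sym_diff A B) = card (e \<inter> (A - B)) + card (e \<inter> (B - A))"
    by (subst card_Un_disjoint[symmetric]) (use assms in \<open>auto intro!: arg_cong[of _ _ card]\<close>)
  show ?thesis unfolding a b c by auto
qed

lemma char_sign_cases: "char_sign B A = (if odd (card (B \<inter> A)) then -1 else 1)"
  by (auto simp: char_sign_def)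

lemma char_sign_sym_diff:
  assumes "finite B"
  shows "char_sign B (sym_diff A A') = char_sign B A * char_sign B A'"
  using odd_card_sym_diff[OF assms, of A A'] by (auto simp: char_sign_cases)

lemma char_sign_commute: "char_sign A B = char_sign B A"
  by (simp add: char_sign_def Int_commute)

text \<open>A character sums to zero over the free spins unless it is constant in them.\<close>

lemma sum_char_sign_nonneg:
  assumes "finite V" "finite B"
  shows "(\<Sum>A\<in>Pow V. char_sign B A) \<ge> 0"
proof (cases "B \<inter> V = {}")
  case True
  have "(\<Sum>A\<in>Pow V. char_sign B A) = (\<Sum>A\<in>Pow V. 1)"
  proof (rule sum.cong[OF refl])
    fix A assume "A \<in> Pow V"
    hence "B \<inter> A = {}" using True by auto
    thus "char_sign B A = 1" by (simp add: char_sign_def)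
  qed
  thus ?thesis by simp
next
  case False
  then obtain v where v: "v \<in> B" "v \<in> V" by auto
  have bij: "bij_betw (\<lambda>A. sym_diff A {v}) (Pow V) (Pow V)"
    by (rule bij_betwI[where g = "\<lambda>A. sym_diff A {v}"]) (use v in auto)
  have "(\<Sum>A\<in>Pow V. char_sign B A) = (\<Sum>A\<in>Pow V. char_sign B (sym_diff A {v}))"
    by (rule sum.reindex_bij_betw[OF bij, symmetric])
  also have "\<dots> = (\<Sum>A\<in>Pow V. - char_sign B A)"
  proof (rule sum.cong[OF refl])
    fix A
    have "char_sign B {v} = -1" using v by (simp add: char_sign_def)
    thus "char_sign B (sym_diff A {v}) = - char_sign B A"
      using char_sign_sym_diff[OF assms(2), of A "{v}"] by simp
  qed
  finally show ?thesis by (simp add: sum_negf)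
qed

text \<open>Expanding the product turns the left-hand side into a combination with nonnegative
  coefficients of sums of characters, because a product of characters is a character. This is
  the first inequality of Griffiths.\<close>

lemma griffiths_first:
  assumes "finite V" "finite F" "\<And>e. e \<in> F \<Longrightarrow> finite e" "finite B"
    and "\<And>e. e \<in> F \<Longrightarrow> a e \<ge> 0" "\<And>e. e \<in> F \<Longrightarrow> b e \<ge> 0"
  shows "(\<Sum>A\<in>Pow V. char_sign B A * (\<Prod>e\<in>F. a e + b e * char_sign e A)) \<ge> 0"
  using assms(2-6)
proof (induction F arbitrary: B rule: finite_induct)
  case empty
  then show ?case using sum_char_sign_nonneg[OF assms(1), of B] by simp
next
  case (insert e F)
  let ?P = "\<lambda>A. \<Prod>e\<in>F. a e + b e * char_sign e A"
  have sd: "char_sign B A * char_sign e A = char_sign (sym_diff B e) A" if "A \<in> Pow V" for A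
  proof -
    have "finite A" using that assms(1) finite_subset by auto
    from char_sign_sym_diff[OF this, of B e] show ?thesis by (simp only: char_sign_commute[of A])
  qed
  have "(\<Sum>A\<in>Pow V. char_sign B A * (\<Prod>e\<in>insert e F. a e + b e * char_sign e A))
      = (\<Sum>A\<in>Pow V. a e * (char_sign B A * ?P A) + b e * (char_sign (sym_diff B e) A * ?P A))"
    by (rule sum.cong[OF refl]) (use insert.hyps in \<open>simp add: sd[symmetric] algebra_simps\<close>)
  also have "\<dots> = a e * (\<Sum>A\<in>Pow V. char_sign B A * ?P A)
      + b e * (\<Sum>A\<in>Pow V. char_sign (sym_diff B e) A * ?P A)"
    by (simp only: sum.distrib sum_distrib_left)
  also have "\<dots> \<ge> 0"
    by (intro add_nonneg_nonneg mult_nonneg_nonneg insert.IH) (use insert.prems in auto)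
  finally show ?case .
qed

text \<open>Dividing by the two partition functions, the inequality says that \<open>s\<close> times the
  expectation of the spin product \<open>\<sigma>\<^sub>B\<close> under the weights \<open>w'\<close> and the boundary condition \<open>X\<close> is
  at most its expectation under the weights \<open>w\<close> and the plus boundary condition. Following
  Ginibre, the two systems are taken side by side and the second configuration is written as the
  first one times a relative configuration \<open>S\<close>. For fixed \<open>S\<close> the joint weight is a product of
  factors \<open>a\<^sub>e + b\<^sub>e \<sigma>\<^sub>e\<close> with nonnegative coefficients, so that the first inequality of
  Griffiths applies to the sum over the first configuration.\<close>

lemma ginibre:
  assumes V: "finite V" and E: "finite E" "\<And>e. e \<in> E \<Longrightarrow> finite e" and B: "finite B"
    and X: "X \<inter> V = {}"
    and w: "\<And>e. e \<in> E \<Longrightarrow> 0 \<le> w e" "\<And>e. e \<in> E \<Longrightarrow> w e \<le> w' e" "\<And>e. e \<in> E \<Longrightarrow> w' e \<le> 1"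
    and s: "\<bar>s\<bar> \<le> 1"
  shows "s * spin_sum E w V {} * char_sum E w' V X B \<le> spin_sum E w' V X * char_sum E w V {} B"
proof -
  define G where "G A A' = boltzmann E w A * boltzmann E w' (A' \<union> X)
       * (char_sign B A - s * char_sign B (A' \<union> X))" for A A'
  have "spin_sum E w' V X * char_sum E w V {} B - s * spin_sum E w V {} * char_sum E w' V X B
      = (\<Sum>A\<in>Pow V. \<Sum>A'\<in>Pow V. G A A')"
  proof -
    have "(\<Sum>A\<in>Pow V. \<Sum>A'\<in>Pow V. G A A') =
       (\<Sum>A\<in>Pow V. \<Sum>A'\<in>Pow V. (char_sign B A * boltzmann E w A) * boltzmann E w' (A' \<union> X))
      - s * (\<Sum>A\<in>Pow V. \<Sum>A'\<in>Pow V. boltzmann E w A * (char_sign B (A' \<union> X) * boltzmann E w' (A' \<union> X)))"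
      by (simp add: G_def sum_subtractf[symmetric] sum_distrib_left algebra_simps)
    thus ?thesis unfolding spin_sum_def char_sum_def sum_product[symmetric]
      by (simp add: mult_ac)
  qed
  also have "\<dots> = (\<Sum>A\<in>Pow V. \<Sum>S\<in>Pow V. G A (sym_diff A S))"
  proof (rule sum.cong[OF refl])
    fix A assume A: "A \<in> Pow V"
    have bij: "bij_betw (\<lambda>S. sym_diff A S) (Pow V) (Pow V)"
      by (rule bij_betwI[where g = "\<lambda>S. sym_diff A S"]) (use A in auto)
    show "(\<Sum>A'\<in>Pow V. G A A') = (\<Sum>S\<in>Pow V. G A (sym_diff A S))"
      by (rule sum.reindex_bij_betw[OF bij, symmetric])
  qed
  also have "\<dots> = (\<Sum>S\<in>Pow V. \<Sum>A\<in>Pow V. G A (sym_diff A S))"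
    by (rule sum.swap)
  also have "\<dots> \<ge> 0"
  proof (rule sum_nonneg)
    fix S assume S: "S \<in> Pow V"
    define T where "T = S \<union> X"
    \<comment> \<open>The joint weight of \<open>e\<close> takes one value if \<open>e\<close> is satisfied in the first system and
      another if not; \<open>a e\<close> and \<open>b e\<close> are half the sum and half the difference of these
      values.\<close>
    define a where "a e = (if odd (card (e \<inter> T)) then (w' e + w e) / 2 else (1 + w e * w' e) / 2)" for e
    define b where "b e = (if odd (card (e \<inter> T)) then (w' e - w e) / 2 else (1 - w e * w' e) / 2)" for e
    have "G A (sym_diff A S) = (1 - s * char_sign B T) *
       (char_sign B A * (\<Prod>e\<in>E. a e + b e * char_sign e A))" if A: "A \<in> Pow V" for A
    proof -
      have AT: "sym_diff A S \<union> X = sym_diff A T"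
        using A S X by (auto simp: T_def)
      have "boltzmann E w A * boltzmann E w' (sym_diff A T) = (\<Prod>e\<in>E. a e + b e * char_sign e A)"
        unfolding boltzmann_def prod.distrib[symmetric]
      proof (rule prod.cong[OF refl])
        fix e assume "e \<in> E"
        note od = odd_card_sym_diff[OF E(2)[OF this], of A T]
        show "(if odd (card (e \<inter> A)) then w e else 1) *
            (if odd (card (e \<inter> sym_diff A T)) then w' e else 1) = a e + b e * char_sign e A"
          unfolding od by (auto simp: a_def b_def char_sign_cases field_simps)
      qed
      thus ?thesis
        unfolding G_def AT char_sign_sym_diff[OF B] by (simp add: algebra_simps)
    qed
    hence "(\<Sum>A\<in>Pow V. G A (sym_diff A S)) = (1 - s * char_sign B T) *
       (\<Sum>A\<in>Pow V. char_sign B A * (\<Prod>e\<in>E. a e + b e * char_sign e A))"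
      by (simp add: sum_distrib_left)
    also have "\<dots> \<ge> 0"
    proof (rule mult_nonneg_nonneg[OF _ griffiths_first[OF V E B]])
      show "0 \<le> 1 - s * char_sign B T" using s by (auto simp: char_sign_cases)
      fix e assume e: "e \<in> E"
      have "w e * w' e \<le> 1" using w[OF e] mult_mono[of "w e" 1 "w' e" 1] by auto
      then show "0 \<le> b e" "0 \<le> a e" using w[OF e] by (auto simp: a_def b_def)
    qed
    finally show "0 \<le> (\<Sum>A\<in>Pow V. G A (sym_diff A S))" .
  qed
  finally show ?thesis by simp
qed

lemma boltzmann_nonneg:
  assumes "\<And>e. e \<in> E \<Longrightarrow> 0 \<le> w e"
  shows "0 \<le> boltzmann E w A"
  unfolding boltzmann_def by (intro prod_nonneg) (use assms in auto)

lemma spin_sum_nonneg: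
  assumes "\<And>e. e \<in> E \<Longrightarrow> 0 \<le> w e"
  shows "0 \<le> spin_sum E w V X"
  unfolding spin_sum_def by (intro sum_nonneg boltzmann_nonneg assms)

lemma spin_sum_pos:
  assumes "finite V" "\<And>e. e \<in> E \<Longrightarrow> 0 < w e"
  shows "0 < spin_sum E w V X"
  unfolding spin_sum_def boltzmann_def
  by (intro sum_pos prod_pos) (use assms in auto)

lemma spin_sum_plus_ge_1:
  assumes "finite V" "\<And>e. e \<in> E \<Longrightarrow> 0 \<le> w e"
  shows "1 \<le> spin_sum E w V {}"
proof -
  have "boltzmann E w ({} \<union> {}) \<le> spin_sum E w V {}"
    unfolding spin_sum_def
    by (rule member_le_sum) (use assms in \<open>auto intro: boltzmann_nonneg\<close>)
  thus ?thesis by (simp add: boltzmann_def)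
qed

lemma sum_Pow_remove:
  assumes "finite V" "v \<in> V"
  shows "sum g (Pow V) = sum g (Pow (V - {v})) + (\<Sum>A\<in>Pow (V - {v}). g (insert v A))"
proof -
  have "Pow V = Pow (V - {v}) \<union> insert v ` Pow (V - {v})"
    using assms Pow_insert[of v "V - {v}"] by (simp add: insert_absorb)
  hence "sum g (Pow V) = sum g (Pow (V - {v})) + sum g (insert v ` Pow (V - {v}))"
    using assms by (subst sum.union_disjoint[symmetric]) auto
  moreover have "sum g (insert v ` Pow (V - {v})) = (\<Sum>A\<in>Pow (V - {v}). g (insert v A))"
    by (subst sum.reindex) (auto simp: inj_on_def)
  ultimately show ?thesis by simp
qed

text \<open>In terms of probabilities: under the boundary condition \<open>X\<close>, a single spin takes a
  prescribed value (minus if \<open>v \<in> Y\<close>, plus if not) with at most the probability of plus under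
  the plus boundary condition. This is Ginibre's inequality for \<open>B = {v}\<close> with \<open>s = -1\<close> or
  \<open>s = 1\<close>.\<close>

lemma pin_one:
  assumes V: "finite V" and E: "finite E" "\<And>e. e \<in> E \<Longrightarrow> finite e"
    and X: "X \<inter> V = {}" and w: "\<And>e. e \<in> E \<Longrightarrow> 0 \<le> w e" "\<And>e. e \<in> E \<Longrightarrow> w e \<le> 1"
    and v: "v \<in> V" and Y: "Y \<subseteq> {v}"
  shows "spin_sum E w (V - {v}) (X \<union> Y) * spin_sum E w V {}
       \<le> spin_sum E w V X * spin_sum E w (V - {v}) {}"
proof -
  have vX: "v \<notin> X" using X v by auto
  have sp: "spin_sum E w V Z = spin_sum E w (V - {v}) Z + spin_sum E w (V - {v}) (Z \<union> {v})" for Z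
    unfolding spin_sum_def by (subst sum_Pow_remove[OF V v]) simp
  have ch: "char_sum E w V Z {v} = spin_sum E w (V - {v}) Z - spin_sum E w (V - {v}) (Z \<union> {v})"
    if "v \<notin> Z" for Z
  proof -
    have "(\<Sum>A\<in>Pow (V - {v}). char_sign {v} (A \<union> Z) * boltzmann E w (A \<union> Z)) =
       spin_sum E w (V - {v}) Z"
      unfolding spin_sum_def
    proof (rule sum.cong[OF refl])
      fix A assume "A \<in> Pow (V - {v})"
      hence "{v} \<inter> (A \<union> Z) = {}" using that by auto
      thus "char_sign {v} (A \<union> Z) * boltzmann E w (A \<union> Z) = boltzmann E w (A \<union> Z)"
        by (simp add: char_sign_def)
    qed
    moreover have "(\<Sum>A\<in>Pow (V - {v}). char_sign {v} (insert v A \<union> Z) * boltzmann E w (insert v A \<union> Z)) =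
       - spin_sum E w (V - {v}) (Z \<union> {v})"
      unfolding spin_sum_def sum_negf[symmetric]
      by (rule sum.cong) (use that in \<open>auto simp: char_sign_def\<close>)
    ultimately show ?thesis
      unfolding char_sum_def by (subst sum_Pow_remove[OF V v]) simp
  qed
  define s :: real where "s = (if v \<in> Y then -1 else 1)"
  have "s * spin_sum E w V {} * char_sum E w V X {v} \<le> spin_sum E w V X * char_sum E w V {} {v}"
    by (rule ginibre) (use assms in \<open>auto simp: s_def\<close>)
  moreover have "Y = {} \<or> Y = {v}" using Y by auto
  ultimately show ?thesis
    unfolding ch[OF vX] ch[of "{}", simplified] s_def
    by (auto simp: sp[of X] sp[of "{}"] algebra_simps)
qed

text \<open>Freezing the spins in \<open>Q\<close>, to an arbitrary pattern in the sum with boundary condition \<open>X\<close>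
  and to plus in the sum with plus boundary condition, can only lower the ratio of the two sums.
  The spins are frozen one at a time.\<close>

lemma pinning:
  assumes V: "finite V" and E: "finite E" "\<And>e. e \<in> E \<Longrightarrow> finite e"
    and X: "X \<inter> V = {}" and w: "\<And>e. e \<in> E \<Longrightarrow> 0 \<le> w e" "\<And>e. e \<in> E \<Longrightarrow> w e \<le> 1"
    and Q: "Q \<subseteq> V" and Y: "Y \<subseteq> Q"
  shows "spin_sum E w (V - Q) (X \<union> Y) * spin_sum E w V {}
       \<le> spin_sum E w V X * spin_sum E w (V - Q) {}"
proof -
  have "finite Q" using Q V finite_subset by blast
  thus ?thesis using Q Y
  proof (induction Q arbitrary: Y rule: finite_induct)
    case empty
    then show ?case by simp
  next
    case (insert v Q)
    let ?Y = "Y - {v}" and ?V = "V - Q"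
    have IH: "spin_sum E w ?V (X \<union> ?Y) * spin_sum E w V {} \<le> spin_sum E w V X * spin_sum E w ?V {}"
      by (rule insert.IH) (use insert.prems in auto)
    have one: "spin_sum E w (?V - {v}) ((X \<union> ?Y) \<union> (Y \<inter> {v})) * spin_sum E w ?V {}
       \<le> spin_sum E w ?V (X \<union> ?Y) * spin_sum E w (?V - {v}) {}"
      by (rule pin_one) (use insert.prems insert.hyps V E X w in auto)
    have eq: "?V - {v} = V - insert v Q" "(X \<union> ?Y) \<union> (Y \<inter> {v}) = X \<union> Y" by auto
    have pos: "spin_sum E w ?V {} > 0"
      using spin_sum_plus_ge_1[of ?V E w] V w by fastforce
    let ?a = "spin_sum E w (V - insert v Q) (X \<union> Y)" and ?b = "spin_sum E w V {}"
      and ?c = "spin_sum E w ?V {}" and ?d = "spin_sum E w ?V (X \<union> ?Y)"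
      and ?e = "spin_sum E w (V - insert v Q) {}" and ?f = "spin_sum E w V X"
    have nn: "?e \<ge> 0" "?b \<ge> 0" by (intro spin_sum_nonneg w; assumption)+
    have "(?a * ?b) * ?c = (?a * ?c) * ?b" by simp
    also have "\<dots> \<le> (?d * ?e) * ?b"
      using one nn unfolding eq by (intro mult_right_mono)
    also have "\<dots> = (?d * ?b) * ?e" by simp
    also have "\<dots> \<le> (?f * ?c) * ?e"
      using IH nn by (intro mult_right_mono)
    finally show ?case using pos by simp
  qed
qed

text \<open>Divided by \<open>spin_sum E w V X\<close> this is the probability that the edge \<open>e\<close> is unsatisfied.\<close>

definition cut_sum :: "'v set set \<Rightarrow> ('v set \<Rightarrow> real) \<Rightarrow> 'v set \<Rightarrow> 'v set \<Rightarrow> 'v set \<Rightarrow> real" where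
  "cut_sum E w V X e = (\<Sum>A\<in>Pow V. if odd (card (e \<inter> (A \<union> X))) then boltzmann E w (A \<union> X) else 0)"

lemma cut_sum_char: "2 * cut_sum E w V X e = spin_sum E w V X - char_sum E w V X e"
  unfolding cut_sum_def spin_sum_def char_sum_def sum_subtractf[symmetric] sum_distrib_left
  by (rule sum.cong) (auto simp: char_sign_cases)

text \<open>The probability that an edge is unsatisfied grows when the boundary condition changes
  from plus to \<open>X\<close> and when weights are raised, that is, when couplings become weaker.\<close>

lemma cut_sum_comparison:
  assumes V: "finite V" and E: "finite E" "\<And>e. e \<in> E \<Longrightarrow> finite e" "finite e"
    and X: "X \<inter> V = {}"
    and w: "\<And>e. e \<in> E \<Longrightarrow> 0 \<le> w e" "\<And>e. e \<in> E \<Longrightarrow> w e \<le> w' e" "\<And>e. e \<in> E \<Longrightarrow> w' e \<le> 1"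
  shows "cut_sum E w V {} e * spin_sum E w' V X \<le> cut_sum E w' V X e * spin_sum E w V {}"
proof -
  have "1 * spin_sum E w V {} * char_sum E w' V X e \<le> spin_sum E w' V X * char_sum E w V {} e"
    by (rule ginibre) (use assms in auto)
  moreover have eqs: "cut_sum E w V {} e = (spin_sum E w V {} - char_sum E w V {} e) / 2"
     "cut_sum E w' V X e = (spin_sum E w' V X - char_sum E w' V X e) / 2"
    using cut_sum_char[of E w V "{}" e] cut_sum_char[of E w' V X e] by simp_all
  ultimately show ?thesis unfolding eqs by (simp add: field_simps)
qed

lemma boltzmann_cong:
  assumes "\<And>e. e \<in> E \<Longrightarrow> e \<inter> A = e \<inter> A'"
  shows "boltzmann E w A = boltzmann E w A'"
  unfolding boltzmann_def by (rule prod.cong) (use assms in auto)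

lemma boltzmann_Un:
  assumes "finite E" "finite E'" "E \<inter> E' = {}"
  shows "boltzmann (E \<union> E') w A = boltzmann E w A * boltzmann E' w A"
  unfolding boltzmann_def using assms by (rule prod.union_disjoint)

lemma spin_sum_Un:
  assumes "finite E" "finite E'" "E \<inter> E' = {}" "finite V" "finite V'" "V \<inter> V' = {}"
    and "\<And>e. e \<in> E \<Longrightarrow> e \<inter> V' = {}" "\<And>e. e \<in> E' \<Longrightarrow> e \<inter> V = {}"
  shows "spin_sum (E \<union> E') w (V \<union> V') X = spin_sum E w V X * spin_sum E' w V' X"
proof -
  have bij: "bij_betw (\<lambda>(A, A'). A \<union> A') (Pow V \<times> Pow V') (Pow (V \<union> V'))"
    by (rule bij_betwI[where g = "\<lambda>A. (A \<inter> V, A \<inter> V')"]) (use assms(6) in auto)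
  have "spin_sum (E \<union> E') w (V \<union> V') X =
     (\<Sum>(A, A')\<in>Pow V \<times> Pow V'. boltzmann (E \<union> E') w (A \<union> A' \<union> X))"
    unfolding spin_sum_def
    by (subst sum.reindex_bij_betw[OF bij, symmetric]) (simp add: case_prod_beta)
  also have "\<dots> = (\<Sum>(A, A')\<in>Pow V \<times> Pow V'. boltzmann E w (A \<union> X) * boltzmann E' w (A' \<union> X))"
  proof (rule sum.cong[OF refl], clarsimp)
    fix A A' assume A: "A \<subseteq> V" "A' \<subseteq> V'"
    have "boltzmann E w (A \<union> A' \<union> X) = boltzmann E w (A \<union> X)"
      "boltzmann E' w (A \<union> A' \<union> X) = boltzmann E' w (A' \<union> X)"
      using A assms(7,8) by (intro boltzmann_cong; fast)+
    thus "boltzmann (E \<union> E') w (A \<union> A' \<union> X) = boltzmann E w (A \<union> X) * boltzmann E' w (A' \<union> X)"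
      by (simp add: boltzmann_Un assms)
  qed
  also have "\<dots> = spin_sum E w V X * spin_sum E' w V' X"
    unfolding spin_sum_def by (simp add: sum_product sum.cartesian_product)
  finally show ?thesis .
qed

text \<open>When the spins between the blocks \<open>V k\<close> are frozen, the blocks do not interact, and the
  edges in \<open>E0\<close> see frozen spins only.\<close>

lemma spin_sum_UNION:
  assumes "finite K" "\<And>k. k \<in> K \<Longrightarrow> finite (E k)" "\<And>k. k \<in> K \<Longrightarrow> finite (V k)"
    and "\<And>k l. k \<in> K \<Longrightarrow> l \<in> K \<Longrightarrow> k \<noteq> l \<Longrightarrow> E k \<inter> E l = {} \<and> V k \<inter> V l = {}"
    and "\<And>k l e. k \<in> K \<Longrightarrow> l \<in> K \<Longrightarrow> k \<noteq> l \<Longrightarrow> e \<in> E k \<Longrightarrow> e \<inter> V l = {}"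
    and "finite E0" "\<And>k. k \<in> K \<Longrightarrow> E0 \<inter> E k = {}" "\<And>k e. k \<in> K \<Longrightarrow> e \<in> E0 \<Longrightarrow> e \<inter> V k = {}"
  shows "spin_sum (E0 \<union> (\<Union>k\<in>K. E k)) w (\<Union>k\<in>K. V k) X =
     boltzmann E0 w X * (\<Prod>k\<in>K. spin_sum (E k) w (V k) X)"
  using assms
proof (induction K rule: finite_induct)
  case empty
  then show ?case by (simp add: spin_sum_def)
next
  case (insert k K)
  let ?E = "E0 \<union> (\<Union>k\<in>K. E k)" and ?V = "\<Union>k\<in>K. V k"
  have "spin_sum (E0 \<union> (\<Union>k\<in>insert k K. E k)) w (\<Union>k\<in>insert k K. V k) X
      = spin_sum (?E \<union> E k) w (?V \<union> V k) X"
    by (simp add: Un_ac)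
  also have "\<dots> = spin_sum ?E w ?V X * spin_sum (E k) w (V k) X"
  proof (rule spin_sum_Un)
    have kl: "l \<in> K \<Longrightarrow> k \<noteq> l" for l using insert.hyps by auto
    show "?E \<inter> E k = {}" using insert.prems(3,6) kl insert.prems by blast
    show "?V \<inter> V k = {}" using insert.prems(3) kl by blast
    show "e \<inter> V k = {}" if "e \<in> ?E" for e using that insert.prems(4,7) kl by blast
    show "e \<inter> ?V = {}" if "e \<in> E k" for e using that insert.prems(4) kl by blast
  qed (use insert in auto)
  also have "spin_sum ?E w ?V X = boltzmann E0 w X * (\<Prod>k\<in>K. spin_sum (E k) w (V k) X)"
  proof (rule insert.IH)
    show "e \<inter> V l = {}" if "j \<in> K" "l \<in> K" "j \<noteq> l" "e \<in> E j" for j l e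
      using insert.prems(4)[of j l e] that by simp
  qed (use insert.prems in simp_all)
  finally show ?case using insert.hyps by (simp add: mult_ac)
qed

lemma spin_sum_cong:
  assumes "\<And>e. e \<in> E \<Longrightarrow> e \<inter> X = e \<inter> X'"
  shows "spin_sum E w V X = spin_sum E w V X'"
  unfolding spin_sum_def by (intro sum.cong refl boltzmann_cong) (use assms in blast)

section \<open>The Edwards-Sokal representation\<close>

text \<open>The spins are constant along the open edges of \<open>\<omega>\<close>, the constraint of the Edwards-Sokal
  coupling.\<close>

definition compatible :: "'v set set \<Rightarrow> 'v set \<Rightarrow> bool" where
  "compatible \<omega> A \<longleftrightarrow> (\<forall>e\<in>\<omega>. even (card (e \<inter> A)))"

definition graph_edges :: "'v set set \<Rightarrow> bool" where
  "graph_edges E \<longleftrightarrow> (\<forall>e\<in>E. \<exists>x y. x \<noteq> y \<and> e = {x, y})"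

lemma graph_edges_finite_Union: "finite E \<Longrightarrow> graph_edges E \<Longrightarrow> finite (\<Union>E)"
  by (rule finite_Union) (auto simp: graph_edges_def)

lemma odd_card_pair: "x \<noteq> y \<Longrightarrow> odd (card ({x, y} \<inter> A)) \<longleftrightarrow> (x \<in> A) \<noteq> (y \<in> A)"
  by (cases "x \<in> A"; cases "y \<in> A") (auto simp: Int_insert_left)

lemma connections_refl: "(x, x) \<in> connections \<omega>"
  by (simp add: connections_def)

lemma connections_trans: "(x, y) \<in> connections \<omega> \<Longrightarrow> (y, z) \<in> connections \<omega> \<Longrightarrow> (x, z) \<in> connections \<omega>"
  unfolding connections_def by (rule rtrancl_trans)

lemma connections_sym: "(x, y) \<in> connections \<omega> \<Longrightarrow> (y, x) \<in> connections \<omega>"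
proof -
  have "sym {(x, y). {x, y} \<in> \<omega>}" by (auto simp: sym_def insert_commute)
  thus "(x, y) \<in> connections \<omega> \<Longrightarrow> (y, x) \<in> connections \<omega>"
    unfolding connections_def by (meson sym_rtrancl symD)
qed

lemma connections_edge: "{x, y} \<in> \<omega> \<Longrightarrow> (x, y) \<in> connections \<omega>"
  unfolding connections_def by (rule r_into_rtrancl) simp

lemma connections_mono: "\<omega> \<subseteq> \<omega>' \<Longrightarrow> connections \<omega> \<subseteq> connections \<omega>'"
  unfolding connections_def by (rule rtrancl_mono) auto

lemma compatible_pair:
  assumes "compatible \<omega> A" "{x, y} \<in> \<omega>"
  shows "x \<in> A \<longleftrightarrow> y \<in> A"
proof (cases "x = y")
  case False
  thus ?thesis using assms odd_card_pair[OF False, of A] by (auto simp: compatible_def)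
qed simp

lemma compatibleI:
  assumes "graph_edges \<omega>" "\<And>x y. {x, y} \<in> \<omega> \<Longrightarrow> x \<in> A \<Longrightarrow> y \<in> A"
  shows "compatible \<omega> A"
  unfolding compatible_def
proof
  fix e assume e: "e \<in> \<omega>"
  then obtain x y where xy: "x \<noteq> y" "e = {x, y}" using assms(1) by (auto simp: graph_edges_def)
  moreover have "x \<in> A \<longleftrightarrow> y \<in> A" using assms(2)[of x y] assms(2)[of y x] e xy by (auto simp: insert_commute)
  ultimately show "even (card (e \<inter> A))" using odd_card_pair[OF xy(1), of A] by auto
qed

lemma compatible_connections:
  assumes "compatible \<omega> A" "(x, y) \<in> connections \<omega>"
  shows "x \<in> A \<longleftrightarrow> y \<in> A"
proof -
  from assms(2)[unfolded connections_def] show ?thesis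
  proof (induction rule: rtrancl_induct)
    case (step y z)
    then show ?case using compatible_pair[OF assms(1), of y z] by auto
  qed simp
qed

text \<open>A configuration compatible with \<open>\<omega>\<close> that is plus on \<open>D\<close> amounts to a free sign for each
  cluster that avoids \<open>D\<close>. As \<open>\<pi>\<close> connects \<open>D\<close> within itself and touches nothing else, exactly
  one cluster meets \<open>D\<close> if \<open>D\<close> contains vertices at all; it accounts for the factor 2.\<close>

lemma card_compatible:
  assumes E: "finite E" "graph_edges E" and \<omega>: "\<omega> \<subseteq> E"
    and H1: "\<And>e. e \<in> \<pi> \<Longrightarrow> e \<inter> \<Union>E \<subseteq> D"
    and H2: "\<And>x y. x \<in> D \<inter> \<Union>E \<Longrightarrow> y \<in> D \<inter> \<Union>E \<Longrightarrow> (x, y) \<in> connections \<pi>"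
  shows "2 ^ num_clusters E \<pi> \<omega> = (if D \<inter> \<Union>E = {} then 1 else 2) *
     card {A \<in> Pow (\<Union>E - D). compatible \<omega> A}"
proof -
  let ?V = "\<Union>E"
  define r where "r = connections (\<omega> \<union> \<pi>) \<inter> ?V \<times> ?V"
  have finV: "finite ?V" by (rule graph_edges_finite_Union[OF E])
  have eq: "equiv ?V r"
    by (rule equivI) (auto simp: r_def refl_on_def sym_def trans_def
        intro: connections_refl connections_sym connections_trans)
  define C0 where "C0 = {C \<in> ?V // r. C \<inter> D \<noteq> {}}"
  have finQ: "finite (?V // r)" using finV by (simp add: finite_quotient[OF finV] r_def)
  have c0: "card C0 = (if D \<inter> ?V = {} then 0 else 1)"
  proof (cases "D \<inter> ?V = {}")
    case True
    have "C0 = {}"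
    proof (rule equals0I)
      fix C assume "C \<in> C0"
      then obtain x where x: "C \<in> ?V // r" "x \<in> C" "x \<in> D" by (auto simp: C0_def)
      from x(1,2) have "x \<in> \<Union>(?V // r)" by (rule UnionI)
      hence "x \<in> ?V" by (simp only: Union_quotient[OF eq])
      with x(3) True show False by (simp add: disjoint_iff)
    qed
    thus ?thesis using True by simp
  next
    case False
    then obtain d where d: "d \<in> D" "d \<in> ?V" by auto
    have "C0 = {r `` {d}}"
    proof (intro equalityI subsetI)
      fix C assume "C \<in> C0"
      then obtain x where x: "C \<in> ?V // r" "x \<in> C" "x \<in> D" by (auto simp: C0_def)
      from x(1) obtain z where z: "C = r `` {z}" "z \<in> ?V" by (rule quotientE)
      have zx: "(z, x) \<in> r" using x(2) z(1) by simp
      hence xV: "x \<in> ?V" by (simp add: r_def)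
      have "(d, x) \<in> connections \<pi>" by (rule H2) (use d x xV in simp_all)
      hence "(d, x) \<in> r" unfolding r_def using d xV
          connections_mono[of \<pi> "\<omega> \<union> \<pi>"] by blast
      hence "r `` {d} = r `` {x}" by (rule equiv_class_eq[OF eq])
      also have "\<dots> = r `` {z}" using equiv_class_eq[OF eq zx] by (rule sym)
      finally show "C \<in> {r `` {d}}" using z(1) by simp
    next
      fix C assume "C \<in> {r `` {d}}"
      moreover have "d \<in> r `` {d}" using equiv_class_self[OF eq d(2)] .
      ultimately show "C \<in> C0" using d quotientI[OF d(2), of r] by (auto simp: C0_def)
    qed
    thus ?thesis using False by simp
  qed
  have closed: "y \<in> A" if A: "A \<subseteq> ?V - D" "compatible \<omega> A" and x: "x \<in> A" and xy: "(x, y) \<in> r" for A x y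
  proof -
    have "(x, y) \<in> {(x, y). {x, y} \<in> \<omega> \<union> \<pi>}\<^sup>*" using xy by (simp add: r_def connections_def)
    thus ?thesis
    proof (induction rule: rtrancl_induct)
      case base then show ?case by (rule x)
    next
      case (step y z)
      have "y \<in> ?V" "y \<notin> D" using step.IH A(1) by blast+
      hence "{y, z} \<notin> \<pi>" using H1[of "{y, z}"] by blast
      hence "{y, z} \<in> \<omega>" using step.hyps by auto
      thus ?case using compatible_pair[OF A(2)] step.IH by blast
    qed
  qed
  have "bij_betw \<Union> (Pow (?V // r - C0)) {A \<in> Pow (?V - D). compatible \<omega> A}"
  proof (rule bij_betwI[where g = "\<lambda>A. {C \<in> ?V // r. C \<subseteq> A}"])
    show "\<Union> \<in> Pow (?V // r - C0) \<rightarrow> {A \<in> Pow (?V - D). compatible \<omega> A}"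
    proof (rule funcsetI)
      fix \<C> assume c: "\<C> \<in> Pow (?V // r - C0)"
      have "\<Union>\<C> \<subseteq> ?V - D" using c Union_quotient[OF eq] by (fastforce simp: C0_def)
      moreover have "compatible \<omega> (\<Union>\<C>)"
      proof (rule compatibleI)
        show "graph_edges \<omega>" using E \<omega> by (auto simp: graph_edges_def)
        fix x y assume xy: "{x, y} \<in> \<omega>" "x \<in> \<Union>\<C>"
        then obtain C where C: "C \<in> \<C>" "x \<in> C" by auto
        have "(x, y) \<in> r" unfolding r_def
          using xy \<omega> connections_edge[of x y "\<omega> \<union> \<pi>"] by auto
        hence "y \<in> C" using C c in_quotient_imp_closed[OF eq, of C x y] by auto
        thus "y \<in> \<Union>\<C>" using C by auto
      qed
      ultimately show "\<Union>\<C> \<in> {A \<in> Pow (?V - D). compatible \<omega> A}" by simp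
    qed
    show "(\<lambda>A. {C \<in> ?V // r. C \<subseteq> A}) \<in> {A \<in> Pow (?V - D). compatible \<omega> A} \<rightarrow> Pow (?V // r - C0)"
      by (auto simp: C0_def)
    show "{C \<in> ?V // r. C \<subseteq> \<Union>\<C>} = \<C>" if "\<C> \<in> Pow (?V // r - C0)" for \<C>
    proof safe
      fix C assume C: "C \<in> ?V // r" "C \<subseteq> \<Union>\<C>"
      obtain x where x: "x \<in> C" using in_quotient_imp_non_empty[OF eq C(1)] by auto
      then obtain C' where C': "C' \<in> \<C>" "x \<in> C'" using C by auto
      hence "C = C'" using quotient_disj[OF eq C(1), of C'] that x by auto
      thus "C \<in> \<C>" using C' by simp
    qed (use that in auto)
    show "\<Union>{C \<in> ?V // r. C \<subseteq> A} = A" if A: "A \<in> {A \<in> Pow (?V - D). compatible \<omega> A}" for A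
    proof safe
      fix x assume x: "x \<in> A"
      hence xV: "x \<in> ?V" using A by auto
      have "r `` {x} \<subseteq> A" using closed[of A x] A x by auto
      thus "x \<in> \<Union>{C \<in> ?V // r. C \<subseteq> A}"
        using quotientI[OF xV, of r] equiv_class_self[OF eq xV] by blast
    qed auto
  qed
  hence "card {A \<in> Pow (?V - D). compatible \<omega> A} = 2 ^ (card (?V // r - C0))"
    using bij_betw_same_card finQ by (metis card_Pow finite_Diff)
  also have "card (?V // r - C0) = card (?V // r) - card C0"
    by (rule card_Diff_subset) (use finQ in \<open>auto simp: C0_def\<close>)
  finally have 1: "card {A \<in> Pow (?V - D). compatible \<omega> A} = 2 ^ (num_clusters E \<pi> \<omega> - card C0)"
    by (simp add: num_clusters_def r_def)
  have "card C0 \<le> num_clusters E \<pi> \<omega>"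
    unfolding num_clusters_def r_def[symmetric] by (rule card_mono) (use finQ in \<open>auto simp: C0_def\<close>)
  hence "2 ^ num_clusters E \<pi> \<omega> = 2 ^ card C0 * (2 ^ (num_clusters E \<pi> \<omega> - card C0) :: nat)"
    by (simp add: power_add[symmetric])
  thus ?thesis unfolding 1 c0 by simp
qed

text \<open>Compatible configurations that are plus on \<open>U\<close> and minus on \<open>L\<close> exist only if \<open>\<omega>\<close> does
  not connect \<open>U\<close> with \<open>L\<close>; in that case flipping all clusters that meet \<open>L\<close> puts them in
  bijection with those that are plus on both.\<close>

lemma card_compatible_shift:
  assumes E: "finite E" "graph_edges E" and \<omega>: "\<omega> \<subseteq> E" and UL: "D = U \<union> L" "U \<inter> L = {}"
  shows "card {A \<in> Pow (\<Union>E - D). compatible \<omega> (A \<union> L)} =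
     (if \<forall>y\<in>U. \<forall>z\<in>L. (y, z) \<notin> connections \<omega> then card {A \<in> Pow (\<Union>E - D). compatible \<omega> A} else 0)"
proof (cases "\<forall>y\<in>U. \<forall>z\<in>L. (y, z) \<notin> connections \<omega>")
  case False
  then obtain y z where yz: "y \<in> U" "z \<in> L" "(y, z) \<in> connections \<omega>" by auto
  have "\<not> compatible \<omega> (A \<union> L)" if "A \<subseteq> \<Union>E - D" for A
  proof
    assume "compatible \<omega> (A \<union> L)"
    from compatible_connections[OF this yz(3)] show False using yz UL that by auto
  qed
  hence "{A \<in> Pow (\<Union>E - D). compatible \<omega> (A \<union> L)} = {}" by auto
  hence "card {A \<in> Pow (\<Union>E - D). compatible \<omega> (A \<union> L)} = 0" by (simp only: card.empty)
  also have "\<dots> = (if \<forall>y\<in>U. \<forall>z\<in>L. (y, z) \<notin> connections \<omega> then card {A \<in> Pow (\<Union>E - D). compatible \<omega> A} else 0)"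
    by (rule if_not_P[OF False, symmetric])
  finally show ?thesis .
next
  case True
  define K where "K = {x. \<exists>z\<in>L. (z, x) \<in> connections \<omega>}"
  have LK: "L \<subseteq> K" by (auto simp: K_def intro: connections_refl)
  have KU: "K \<inter> U = {}"
  proof (rule equals0I)
    fix x assume "x \<in> K \<inter> U"
    then obtain z where z: "z \<in> L" "(z, x) \<in> connections \<omega>" "x \<in> U" by (auto simp: K_def)
    from connections_sym[OF z(2)] show False using True z(1,3) by simp
  qed
  have ge: "graph_edges \<omega>" using E \<omega> by (auto simp: graph_edges_def)
  have K: "x \<in> K \<longleftrightarrow> y \<in> K" if "{x, y} \<in> \<omega>" for x y
  proof -
    note xy = connections_edge[OF that]
    note yx = connections_sym[OF xy]
    have "(z, x) \<in> connections \<omega> \<longleftrightarrow> (z, y) \<in> connections \<omega>" for z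
      using connections_trans[OF _ xy, of z] connections_trans[OF _ yx, of z] by (rule iffI)
    thus ?thesis by (simp add: K_def)
  qed
  define f where "f A = sym_diff A (K \<inter> \<Union>E - D)" for A
  have KD: "x \<in> L" if "x \<in> K" "x \<in> D" for x using that KU UL(1) by (auto simp: disjoint_iff)
  have m1: "x \<in> f A \<longleftrightarrow> (x \<in> A \<union> L) \<noteq> (x \<in> K)" if "x \<in> \<Union>E" "A \<subseteq> \<Union>E - D" for x A
  proof (cases "x \<in> D")
    case True
    hence "x \<notin> A" "x \<in> L \<longleftrightarrow> x \<in> K" using that LK KD by (blast, blast)
    thus ?thesis using True by (simp add: f_def)
  next
    case False
    hence "x \<notin> L" using UL(1) by simp
    thus ?thesis using False that(1) by (auto simp: f_def)
  qed
  have m2: "x \<in> f A \<union> L \<longleftrightarrow> (x \<in> A) \<noteq> (x \<in> K)" if "x \<in> \<Union>E" "A \<subseteq> \<Union>E - D" for x A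
  proof (cases "x \<in> D")
    case True
    hence "x \<notin> A" "x \<in> L \<longleftrightarrow> x \<in> K" using that LK KD by (blast, blast)
    thus ?thesis using True by (simp add: f_def)
  next
    case False
    hence "x \<notin> L" using UL(1) by simp
    thus ?thesis using False that(1) by (auto simp: f_def)
  qed
  have "bij_betw f {A \<in> Pow (\<Union>E - D). compatible \<omega> (A \<union> L)} {A \<in> Pow (\<Union>E - D). compatible \<omega> A}"
  proof (rule bij_betwI[where g = f])
    show "f \<in> {A \<in> Pow (\<Union>E - D). compatible \<omega> (A \<union> L)} \<rightarrow> {A \<in> Pow (\<Union>E - D). compatible \<omega> A}"
    proof (rule funcsetI, clarify)
      fix A assume A: "A \<subseteq> \<Union>E - D" "compatible \<omega> (A \<union> L)"
      have "compatible \<omega> (f A)"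
      proof (rule compatibleI[OF ge])
        fix x y assume xy: "{x, y} \<in> \<omega>" "x \<in> f A"
        note c = compatible_pair[OF A(2) xy(1)] K[OF xy(1)]
        have "x \<in> \<Union>E" using xy(1) \<omega> by blast
        moreover have "y \<in> \<Union>E" using xy(1) \<omega> by blast
        ultimately show "y \<in> f A" using xy(2) c(1,2) by (simp only: m1[OF _ A(1)] not_False_eq_True)
      qed
      moreover have "f A \<subseteq> \<Union>E - D" using A(1) unfolding f_def by blast
      ultimately show "f A \<in> Pow (\<Union>E - D) \<and> compatible \<omega> (f A)" by simp
    qed
    show "f \<in> {A \<in> Pow (\<Union>E - D). compatible \<omega> A} \<rightarrow> {A \<in> Pow (\<Union>E - D). compatible \<omega> (A \<union> L)}"
    proof (rule funcsetI, clarify)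
      fix A assume A: "A \<subseteq> \<Union>E - D" "compatible \<omega> A"
      have "compatible \<omega> (f A \<union> L)"
      proof (rule compatibleI[OF ge])
        fix x y assume xy: "{x, y} \<in> \<omega>" "x \<in> f A \<union> L"
        note c = compatible_pair[OF A(2) xy(1)] K[OF xy(1)]
        have "x \<in> \<Union>E" using xy(1) \<omega> by blast
        moreover have "y \<in> \<Union>E" using xy(1) \<omega> by blast
        ultimately show "y \<in> f A \<union> L" using xy(2) c(1,2) by (simp only: m2[OF _ A(1)] not_False_eq_True)
      qed
      moreover have "f A \<subseteq> \<Union>E - D" using A(1) unfolding f_def by blast
      ultimately show "f A \<in> Pow (\<Union>E - D) \<and> compatible \<omega> (f A \<union> L)" by simp
    qed
  qed (simp_all only: f_def, blast+)
  from bij_betw_same_card[OF this] show ?thesis by (simp only: if_P[OF True])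
qed

text \<open>In the joint sum over edges and spins, summing over the edge configuration first leaves
  for each edge the factor \<open>p e + (1 - p e) = 1\<close> if it is satisfied and \<open>1 - p e\<close> if it is not,
  which is the Ising weight.\<close>

lemma sum_rc_compatible:
  assumes E: "finite E" and fV: "finite V"
  shows "(\<Sum>\<omega>\<in>Pow E. (\<Prod>e\<in>E. if e \<in> \<omega> then p e else 1 - p e) * real (card {A \<in> Pow V. compatible \<omega> (A \<union> X)}))
     = spin_sum E (\<lambda>e. 1 - p e) V X"
proof -
  have "(\<Sum>\<omega>\<in>Pow E. (\<Prod>e\<in>E. if e \<in> \<omega> then p e else 1 - p e) * real (card {A \<in> Pow V. compatible \<omega> (A \<union> X)}))
      = (\<Sum>\<omega>\<in>Pow E. \<Sum>A\<in>Pow V. (\<Prod>e\<in>E. if e \<in> \<omega> then p e else 1 - p e) * of_bool (compatible \<omega> (A \<union> X)))"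
  proof (rule sum.cong[OF refl])
    fix \<omega>
    have "real (card {A \<in> Pow V. compatible \<omega> (A \<union> X)}) = (\<Sum>A\<in>Pow V. of_bool (compatible \<omega> (A \<union> X)))"
      using fV by (simp add: of_bool_def sum.If_cases Int_def)
    thus "(\<Prod>e\<in>E. if e \<in> \<omega> then p e else 1 - p e) * real (card {A \<in> Pow V. compatible \<omega> (A \<union> X)})
      = (\<Sum>A\<in>Pow V. (\<Prod>e\<in>E. if e \<in> \<omega> then p e else 1 - p e) * of_bool (compatible \<omega> (A \<union> X)))"
      by (simp add: sum_distrib_left)
  qed
  also have "\<dots> = (\<Sum>A\<in>Pow V. \<Sum>\<omega>\<in>Pow E. (\<Prod>e\<in>E. if e \<in> \<omega> then p e else 1 - p e) * of_bool (compatible \<omega> (A \<union> X)))"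
    by (rule sum.swap)
  also have "\<dots> = (\<Sum>A\<in>Pow V. boltzmann E (\<lambda>e. 1 - p e) (A \<union> X))"
  proof (rule sum.cong[OF refl])
    fix A
    let ?a = "\<lambda>e. if odd (card (e \<inter> (A \<union> X))) then 0 else p e"
    have "(\<Sum>\<omega>\<in>Pow E. (\<Prod>e\<in>E. if e \<in> \<omega> then p e else 1 - p e) * of_bool (compatible \<omega> (A \<union> X)))
       = (\<Sum>\<omega>\<in>Pow E. (\<Prod>e\<in>\<omega>. ?a e) * (\<Prod>e\<in>E - \<omega>. 1 - p e))"
    proof (rule sum.cong[OF refl])
      fix \<omega> assume w: "\<omega> \<in> Pow E"
      have fw: "finite \<omega>" using w E finite_subset by auto
      have "(\<Prod>e\<in>E. if e \<in> \<omega> then p e else 1 - p e) = (\<Prod>e\<in>\<omega>. p e) * (\<Prod>e\<in>E - \<omega>. 1 - p e)"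
        using w E by (simp add: prod.If_cases Int_absorb1 Diff_eq Collect_neg_eq)
      moreover have "(\<Prod>e\<in>\<omega>. p e) * of_bool (compatible \<omega> (A \<union> X)) = (\<Prod>e\<in>\<omega>. ?a e)"
      proof (cases "compatible \<omega> (A \<union> X)")
        case True
        thus ?thesis by (auto simp: compatible_def intro!: prod.cong)
      next
        case False
        hence "(\<Prod>e\<in>\<omega>. ?a e) = 0" using fw by (auto simp: compatible_def)
        thus ?thesis using False by simp
      qed
      ultimately show "(\<Prod>e\<in>E. if e \<in> \<omega> then p e else 1 - p e) * of_bool (compatible \<omega> (A \<union> X))
         = (\<Prod>e\<in>\<omega>. ?a e) * (\<Prod>e\<in>E - \<omega>. 1 - p e)"
        by (metis mult.commute mult.left_commute)
    qed
    also have "\<dots> = (\<Prod>e\<in>E. ?a e + (1 - p e))"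
      by (rule prod_add[OF E, symmetric])
    also have "\<dots> = boltzmann E (\<lambda>e. 1 - p e) (A \<union> X)"
      unfolding boltzmann_def by (rule prod.cong) auto
    finally show "(\<Sum>\<omega>\<in>Pow E. (\<Prod>e\<in>E. if e \<in> \<omega> then p e else 1 - p e) * of_bool (compatible \<omega> (A \<union> X)))
      = boltzmann E (\<lambda>e. 1 - p e) (A \<union> X)" .
  qed
  finally show ?thesis by (simp add: spin_sum_def)
qed

text \<open>With \<open>q = 2\<close> the factor \<open>2\<close> per cluster counts the choices of a sign for each cluster.
  Summing out the edges turns the total weight into the Ising sum with plus boundary condition
  and the weight of the disconnection event into the one with boundary condition minus on \<open>L\<close>
  and plus on \<open>U\<close>. The boundary is a single cluster of \<open>\<pi>\<close>, so the factor 2 for its sign is the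
  same in numerator and denominator.\<close>

lemma edwards_sokal:
  assumes E: "finite E" "graph_edges E" and UL: "U \<inter> L = {}"
    and H1: "\<And>e. e \<in> \<pi> \<Longrightarrow> e \<inter> \<Union>E \<subseteq> U \<union> L"
    and H2: "\<And>x y. x \<in> (U \<union> L) \<inter> \<Union>E \<Longrightarrow> y \<in> (U \<union> L) \<inter> \<Union>E \<Longrightarrow> (x, y) \<in> connections \<pi>"
  shows "rc_prob 2 \<beta> E \<pi> J {\<omega>. \<omega> \<subseteq> E \<and> (\<forall>y\<in>U. \<forall>z\<in>L. (y, z) \<notin> connections \<omega>)} =
     spin_sum E (\<lambda>e. exp (- \<beta> * J e)) (\<Union>E - (U \<union> L)) L / spin_sum E (\<lambda>e. exp (- \<beta> * J e)) (\<Union>E - (U \<union> L)) {}"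
proof -
  let ?D = "U \<union> L" and ?p = "edge_prob \<beta> J"
  let ?W = "\<lambda>\<omega>. \<Prod>e\<in>E. if e \<in> \<omega> then ?p e else 1 - ?p e"
  define k :: real where "k = (if ?D \<inter> \<Union>E = {} then 1 else 2)"
  have fV: "finite (\<Union>E - ?D)" by (rule finite_Diff[OF graph_edges_finite_Union[OF E]])
  have cc: "2 ^ num_clusters E \<pi> \<omega> = k * real (card {A \<in> Pow (\<Union>E - ?D). compatible \<omega> A})"
    if "\<omega> \<subseteq> E" for \<omega>
  proof -
    have "real (2 ^ num_clusters E \<pi> \<omega>) =
        real ((if ?D \<inter> \<Union>E = {} then 1 else 2) * card {A \<in> Pow (\<Union>E - ?D). compatible \<omega> A})"
      by (subst card_compatible[OF E that, of \<pi> ?D]) (use H1 H2 in auto)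
    thus ?thesis by (simp add: k_def)
  qed
  have den: "(\<Sum>\<omega>\<in>Pow E. rc_weight 2 \<beta> E \<pi> J \<omega>) = k * spin_sum E (\<lambda>e. 1 - ?p e) (\<Union>E - ?D) {}"
    unfolding sum_rc_compatible[OF E(1) fV, symmetric] sum_distrib_left
    by (rule sum.cong) (auto simp: rc_weight_def cc)
  have "(\<Sum>\<omega>\<in>Pow E \<inter> {\<omega>. \<omega> \<subseteq> E \<and> (\<forall>y\<in>U. \<forall>z\<in>L. (y, z) \<notin> connections \<omega>)}. rc_weight 2 \<beta> E \<pi> J \<omega>)
     = (\<Sum>\<omega>\<in>Pow E. if \<forall>y\<in>U. \<forall>z\<in>L. (y, z) \<notin> connections \<omega> then rc_weight 2 \<beta> E \<pi> J \<omega> else 0)"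
    using E(1) by (subst sum.inter_filter[symmetric]) (auto intro!: sum.cong)
  also have "\<dots> = k * spin_sum E (\<lambda>e. 1 - ?p e) (\<Union>E - ?D) L"
    unfolding sum_rc_compatible[OF E(1) fV, symmetric] sum_distrib_left
  proof (rule sum.cong[OF refl])
    fix \<omega> assume w: "\<omega> \<in> Pow E"
    show "(if \<forall>y\<in>U. \<forall>z\<in>L. (y, z) \<notin> connections \<omega> then rc_weight 2 \<beta> E \<pi> J \<omega> else 0) =
       k * (?W \<omega> * real (card {A \<in> Pow (\<Union>E - ?D). compatible \<omega> (A \<union> L)}))"
      by (subst card_compatible_shift[OF E _ refl UL]) (use w cc[of \<omega>] in \<open>auto simp: rc_weight_def\<close>)
  qed
  finally show ?thesis unfolding rc_prob_def den
    by (simp add: edge_prob_def k_def)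
qed

section \<open>Entropy and concentration on product spaces\<close>

text \<open>The gap \<open>\<phi> a - \<phi> b - \<phi>' b (a - b)\<close> between \<open>\<phi> x = x ln x\<close> and its tangent at \<open>b\<close>.\<close>

definition entropy_defect :: "real \<Rightarrow> real \<Rightarrow> real" where
  "entropy_defect a b = a * ln (a / b) - a + b"

lemma (in prob_space) integrable_bounded:
  fixes g :: "'a \<Rightarrow> real"
  assumes "g \<in> borel_measurable M" "\<And>x. x \<in> space M \<Longrightarrow> \<bar>g x\<bar> \<le> K"
  shows "integrable M g"
  by (rule integrable_const_bound[where B = K]) (use assms in \<open>auto intro!: AE_I2\<close>)

lemma abs_ln_div_le:
  fixes a b :: real
  assumes "0 < l" "l \<le> a" "a \<le> u" "l \<le> b" "b \<le> u"
  shows "\<bar>ln (a / b)\<bar> \<le> ln u - ln l"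
proof -
  have "ln l \<le> ln a" "ln a \<le> ln u" "ln l \<le> ln b" "ln b \<le> ln u" using assms by auto
  moreover have "ln (a / b) = ln a - ln b" using assms by (simp add: ln_div)
  ultimately show ?thesis by simp
qed

lemma abs_entropy_defect_le:
  assumes "0 < l" "l \<le> a" "a \<le> u" "l \<le> b" "b \<le> u"
  shows "\<bar>entropy_defect a b\<bar> \<le> u * (ln u - ln l) + 2 * u"
proof -
  have "\<bar>a * ln (a / b)\<bar> \<le> u * (ln u - ln l)"
    unfolding abs_mult using assms abs_ln_div_le[OF assms] by (intro mult_mono) auto
  thus ?thesis unfolding entropy_defect_def using assms by linarith
qed

lemma ln_ge_one_minus_inverse: "0 < x \<Longrightarrow> ln x \<ge> 1 - 1 / (x::real)"
  using ln_le_minus_one[of "1/x"] by (simp add: ln_div)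

text \<open>The entropy of \<open>g\<close> is the minimum over \<open>c\<close> of the mean gap between \<open>\<phi> x = x ln x\<close> and its
  tangent at \<open>c\<close>, attained at the mean of \<open>g\<close>.\<close>

lemma (in prob_space) entropy_le_defect:
  fixes g :: "'a \<Rightarrow> real"
  assumes g: "g \<in> borel_measurable M" and b: "0 < l" "\<And>x. x \<in> space M \<Longrightarrow> l \<le> g x \<and> g x \<le> u"
    and c: "0 < c"
  shows "(\<integral>x. g x * ln (g x) \<partial>M) - (\<integral>x. g x \<partial>M) * ln (\<integral>x. g x \<partial>M)
      \<le> (\<integral>x. entropy_defect (g x) c \<partial>M)"
proof -
  define G where "G = (\<integral>x. g x \<partial>M)"
  have i1: "integrable M g"
    by (rule integrable_bounded[where K = u]) (use g b in force)+
  have "\<bar>g x * ln (g x)\<bar> \<le> u * (\<bar>ln l\<bar> + \<bar>ln u\<bar>)" if x: "x \<in> space M" for x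
  proof -
    have "ln l \<le> ln (g x)" "ln (g x) \<le> ln u" using b(1) b(2)[OF x] by auto
    hence "\<bar>ln (g x)\<bar> \<le> \<bar>ln l\<bar> + \<bar>ln u\<bar>" by linarith
    thus ?thesis unfolding abs_mult using b(1) b(2)[OF x] by (intro mult_mono) auto
  qed
  hence i2: "integrable M (\<lambda>x. g x * ln (g x))"
    using g by (intro integrable_bounded) auto
  have "l \<le> G"
    using integral_mono[of M "\<lambda>_. l" g] i1 b(2) by (simp add: G_def prob_space)
  hence G: "G > 0" using b by simp
  have "(\<integral>x. entropy_defect (g x) c \<partial>M) = (\<integral>x. g x * ln (g x) - (ln c + 1) * g x + c \<partial>M)"
  proof (rule Bochner_Integration.integral_cong[OF refl])
    fix x assume "x \<in> space M"
    hence "g x > 0" using b by force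
    thus "entropy_defect (g x) c = g x * ln (g x) - (ln c + 1) * g x + c"
      using c by (simp add: entropy_defect_def ln_div algebra_simps)
  qed
  also have "\<dots> = (\<integral>x. g x * ln (g x) \<partial>M) - (ln c + 1) * G + c"
    using i1 i2 by (simp add: G_def prob_space)
  finally have eq: "(\<integral>x. entropy_defect (g x) c \<partial>M) = (\<integral>x. g x * ln (g x) \<partial>M) - (ln c + 1) * G + c" .
  have "ln (G / c) \<ge> 1 - c / G" using ln_ge_one_minus_inverse[of "G / c"] G c by simp
  hence "G * ln (G / c) \<ge> G * (1 - c / G)" using G by (intro mult_left_mono) auto
  hence "G * (ln G - ln c) \<ge> G - c" using G c by (simp add: ln_div algebra_simps)
  thus ?thesis unfolding eq G_def[symmetric] by (simp add: algebra_simps)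
qed

text \<open>Jensen's inequality for \<open>entropy_defect\<close>, which is jointly convex. The proof integrates
  the tangent plane at the point of the means.\<close>

lemma (in prob_space) defect_convex:
  fixes g h :: "'a \<Rightarrow> real"
  assumes g: "g \<in> borel_measurable M" "h \<in> borel_measurable M" and b: "0 < l"
    "\<And>x. x \<in> space M \<Longrightarrow> l \<le> g x \<and> g x \<le> u"
    "\<And>x. x \<in> space M \<Longrightarrow> l \<le> h x \<and> h x \<le> u"
  shows "entropy_defect (\<integral>x. g x \<partial>M) (\<integral>x. h x \<partial>M) \<le> (\<integral>x. entropy_defect (g x) (h x) \<partial>M)"
proof -
  define G where "G = (\<integral>x. g x \<partial>M)"
  define H where "H = (\<integral>x. h x \<partial>M)"
  have i1: "integrable M g" "integrable M h"
    by (rule integrable_bounded[where K = u]; use g b in force)+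
  have "l \<le> G" "l \<le> H"
    using integral_mono[of M "\<lambda>_. l" g] integral_mono[of M "\<lambda>_. l" h] i1 b
    by (simp_all add: G_def H_def prob_space)
  hence G: "G > 0" "H > 0" using b by simp_all
  have i2: "integrable M (\<lambda>x. entropy_defect (g x) (h x))"
  proof (rule integrable_bounded)
    show "(\<lambda>x. entropy_defect (g x) (h x)) \<in> borel_measurable M"
      unfolding entropy_defect_def using g by measurable
    show "\<bar>entropy_defect (g x) (h x)\<bar> \<le> u * (ln u - ln l) + 2 * u" if "x \<in> space M" for x
      using abs_entropy_defect_le[of l "g x" u "h x"] b that by auto
  qed
  have "(\<integral>x. g x * ln (G / H) + (1 - G / H) * h x \<partial>M) \<le> (\<integral>x. entropy_defect (g x) (h x) \<partial>M)"
  proof (rule integral_mono)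
    fix x assume x: "x \<in> space M"
    have p: "g x > 0" "h x > 0" using b(1) b(2,3)[OF x] by auto
    have "ln ((g x / h x) / (G / H)) \<ge> 1 - 1 / ((g x / h x) / (G / H))"
      by (rule ln_ge_one_minus_inverse) (use p G in simp)
    moreover have "ln ((g x / h x) / (G / H)) = ln (g x / h x) - ln (G / H)"
      using p G by (subst ln_div) auto
    ultimately have "g x * (ln (g x / h x) - ln (G / H)) \<ge> g x * (1 - 1 / ((g x / h x) / (G / H)))"
      using p by (intro mult_left_mono) auto
    also have "g x * (1 - 1 / ((g x / h x) / (G / H))) = g x - (G / H) * h x"
      using p G by (simp add: field_simps)
    finally show "g x * ln (G / H) + (1 - G / H) * h x \<le> entropy_defect (g x) (h x)"
      unfolding entropy_defect_def by (simp add: algebra_simps)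
  qed (use i1 i2 in auto)
  also have "(\<integral>x. g x * ln (G / H) + (1 - G / H) * h x \<partial>M) = G * ln (G / H) + (1 - G / H) * H"
    using i1 by (simp add: G_def H_def)
  also have "\<dots> = entropy_defect G H" using G by (simp add: entropy_defect_def field_simps)
  finally show ?thesis by (simp add: G_def H_def)
qed

text \<open>The entropy of a function of independent variables splits into the mean of the entropies
  in the last variable and the entropy of the partial mean over that variable. For the first
  part the last variable may be reset to the constant \<open>c\<close> by \<open>entropy_le_defect\<close>; for the second
  part the induction hypothesis for the partial mean is pulled back to the function by
  \<open>defect_convex\<close>. Resetting to a constant instead of resampling is what fits a comparison with
  the smallest coupling.\<close>

lemma (in prob_space) entropy_tensorization:
  fixes Y :: "('i \<Rightarrow> 'a) \<Rightarrow> real"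
  assumes "finite I" and c: "c \<in> space M"
    and "Y \<in> borel_measurable (\<Pi>\<^sub>M i\<in>I. M)" and "0 < l"
    and "\<And>x. x \<in> space (\<Pi>\<^sub>M i\<in>I. M) \<Longrightarrow> l \<le> Y x \<and> Y x \<le> u"
  shows "(\<integral>x. Y x * ln (Y x) \<partial>(\<Pi>\<^sub>M i\<in>I. M)) - (\<integral>x. Y x \<partial>(\<Pi>\<^sub>M i\<in>I. M)) * ln (\<integral>x. Y x \<partial>(\<Pi>\<^sub>M i\<in>I. M))
      \<le> (\<Sum>i\<in>I. \<integral>x. entropy_defect (Y x) (Y (x(i := c))) \<partial>(\<Pi>\<^sub>M i\<in>I. M))"
  using assms(1,3-5)
proof (induction I arbitrary: Y rule: finite_induct)
  case empty
  interpret P: prob_space "\<Pi>\<^sub>M i\<in>{}. M" by (rule prob_space_PiM) (rule prob_space_axioms)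
  show ?case by (simp add: PiM_empty lebesgue_integral_count_space_finite)
next
  case (insert i I)
  let ?P = "\<Pi>\<^sub>M i\<in>I. M" and ?Q = "\<Pi>\<^sub>M i\<in>insert i I. M"
  interpret pp: product_prob_space "\<lambda>_. M" by unfold_locales
  interpret P: prob_space ?P by (rule prob_space_PiM) (rule prob_space_axioms)
  interpret Q: prob_space ?Q by (rule prob_space_PiM) (rule prob_space_axioms)
  have Y[measurable]: "Y \<in> borel_measurable ?Q" and l: "0 < l" by (fact insert.prems)+
  have sp: "x(i := y) \<in> space ?Q" if "x \<in> space ?P" "y \<in> space M" for x y
    using that by (auto simp: space_PiM PiE_def extensional_def)
  have bd: "l \<le> Y (x(i := y)) \<and> Y (x(i := y)) \<le> u" if "x \<in> space ?P" "y \<in> space M" for x y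
    using insert.prems(3)[OF sp[OF that]] .
  have upd: "(\<lambda>x. x(j := c)) \<in> measurable (\<Pi>\<^sub>M i\<in>J. M) (\<Pi>\<^sub>M i\<in>J. M)" if "j \<in> J" for j :: 'i and J :: "'i set"
    by (rule measurable_fun_upd[where J = J]) (use that c in auto)
  have updsp: "x(j := c) \<in> space (\<Pi>\<^sub>M i\<in>J. M)" if "j \<in> J" "x \<in> space (\<Pi>\<^sub>M i\<in>J. M)" for j :: 'i and J x
    using measurable_space[OF upd[OF that(1)] that(2)] .
  have jm: "(\<lambda>(x, y). x(i := y)) \<in> measurable (?P \<Otimes>\<^sub>M M) ?Q"
    by (rule measurable_add_dim)
  have m2: "(\<lambda>(x, y). g (x(i := y))) \<in> borel_measurable (?P \<Otimes>\<^sub>M M)"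
    if "g \<in> borel_measurable ?Q" for g :: "_ \<Rightarrow> real"
    using measurable_compose[OF jm that] by (simp add: case_prod_beta)
  have m1: "(\<lambda>y. g (x(i := y))) \<in> borel_measurable M"
    if "g \<in> borel_measurable ?Q" "x \<in> space ?P" for g :: "_ \<Rightarrow> real" and x
    using measurable_compose[OF measurable_Pair1'[OF that(2)] m2[OF that(1)]] by simp
  have m0: "(\<lambda>x. \<integral>y. g (x(i := y)) \<partial>M) \<in> borel_measurable ?P"
    if "g \<in> borel_measurable ?Q" for g :: "_ \<Rightarrow> real"
    using borel_measurable_lebesgue_integral[OF m2[OF that]] by simp
  have fub: "(\<integral>x. g x \<partial>?Q) = (\<integral>x. (\<integral>y. g (x(i := y)) \<partial>M) \<partial>?P)"
      "integrable ?P (\<lambda>x. \<integral>y. g (x(i := y)) \<partial>M)"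
    if g: "g \<in> borel_measurable ?Q" "\<And>x. x \<in> space ?Q \<Longrightarrow> \<bar>g x\<bar> \<le> K" for g :: "_ \<Rightarrow> real" and K
  proof -
    have "integrable ?Q g" by (rule Q.integrable_bounded) (use g in auto)
    thus "(\<integral>x. g x \<partial>?Q) = (\<integral>x. (\<integral>y. g (x(i := y)) \<partial>M) \<partial>?P)"
      by (rule pp.product_integral_insert[OF insert.hyps])
    show "integrable ?P (\<lambda>x. \<integral>y. g (x(i := y)) \<partial>M)"
    proof (rule P.integrable_bounded[OF m0[OF g(1)]])
      fix x assume x: "x \<in> space ?P"
      have "integrable M (\<lambda>y. g (x(i := y)))"
        by (rule integrable_bounded[OF m1[OF g(1) x]]) (use g(2) sp[OF x] in auto)
      hence "(\<integral>y. norm (g (x(i := y))) \<partial>M) \<le> (\<integral>y. K \<partial>M)"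
        by (intro integral_mono) (use g(2) sp[OF x] in auto)
      hence "norm (\<integral>y. g (x(i := y)) \<partial>M) \<le> (\<integral>y. K \<partial>M)"
        using integral_norm_bound[of M "\<lambda>y. g (x(i := y))"] by linarith
      thus "\<bar>\<integral>y. g (x(i := y)) \<partial>M\<bar> \<le> K" by (simp add: prob_space)
    qed
  qed
  define Z where "Z x = (\<integral>y. Y (x(i := y)) \<partial>M)" for x
  define D where "D j z = entropy_defect (Y z) (Y (z(j := c)))" for j z
  have Dm: "D j \<in> borel_measurable ?Q" if "j \<in> insert i I" for j
    unfolding D_def entropy_defect_def using measurable_compose[OF upd[OF that] Y] by measurable
  have Db: "\<bar>D j z\<bar> \<le> u * (ln u - ln l) + 2 * u" if "j \<in> insert i I" "z \<in> space ?Q" for j z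
    unfolding D_def using abs_entropy_defect_le[OF l] insert.prems(3)[OF that(2)]
      insert.prems(3)[OF updsp[OF that]] by blast
  have Zm: "Z \<in> borel_measurable ?P" unfolding Z_def by (rule m0[OF Y])
  have Zb: "l \<le> Z x \<and> Z x \<le> u" if x: "x \<in> space ?P" for x
  proof -
    have "integrable M (\<lambda>y. Y (x(i := y)))"
      by (rule integrable_bounded[OF m1[OF Y x], where K = u]) (use bd[OF x] l in force)
    thus ?thesis
      unfolding Z_def using integral_mono[of M "\<lambda>_. l" "\<lambda>y. Y (x(i := y))"]
        integral_mono[of M "\<lambda>y. Y (x(i := y))" "\<lambda>_. u"] bd[OF x] by (simp add: prob_space)
  qed
  define L where "L = u * (\<bar>ln l\<bar> + \<bar>ln u\<bar>)"
  have Lb: "\<bar>a * ln a\<bar> \<le> L" if "l \<le> a" "a \<le> u" for a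
  proof -
    have "ln l \<le> ln a" "ln a \<le> ln u" using l that by auto
    hence "\<bar>ln a\<bar> \<le> \<bar>ln l\<bar> + \<bar>ln u\<bar>" by linarith
    thus ?thesis unfolding abs_mult L_def using l that by (intro mult_mono) auto
  qed
  have YY: "(\<lambda>z. Y z * ln (Y z)) \<in> borel_measurable ?Q" by measurable
  have YYb: "\<bar>Y z * ln (Y z)\<bar> \<le> L" if "z \<in> space ?Q" for z
    using Lb insert.prems(3)[OF that] by blast
  have fYY: "(\<integral>z. Y z * ln (Y z) \<partial>?Q) = (\<integral>x. (\<integral>y. Y (x(i := y)) * ln (Y (x(i := y))) \<partial>M) \<partial>?P)"
    "integrable ?P (\<lambda>x. \<integral>y. Y (x(i := y)) * ln (Y (x(i := y))) \<partial>M)"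
    by (rule fub[OF YY YYb]; assumption)+
  have fY: "(\<integral>z. Y z \<partial>?Q) = (\<integral>x. Z x \<partial>?P)"
    unfolding Z_def using fub(1)[OF Y, of u] insert.prems(3) l by force
  have iZ: "integrable ?P (\<lambda>x. Z x * ln (Z x))"
    by (rule P.integrable_bounded[where K = L]) (use Zm Zb Lb in auto)
  have A: "(\<integral>x. (\<integral>y. Y (x(i := y)) * ln (Y (x(i := y))) \<partial>M) - Z x * ln (Z x) \<partial>?P) \<le> (\<integral>z. D i z \<partial>?Q)"
  proof -
    have i': "i \<in> insert i I" by simp
    have f: "(\<integral>z. D i z \<partial>?Q) = (\<integral>x. (\<integral>y. D i (x(i := y)) \<partial>M) \<partial>?P)"
      "integrable ?P (\<lambda>x. \<integral>y. D i (x(i := y)) \<partial>M)"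
      by (rule fub[OF Dm[OF i'] Db[OF i']]; assumption)+
    show ?thesis unfolding f(1)
    proof (rule integral_mono)
      fix x assume x: "x \<in> space ?P"
      have "(\<integral>y. Y (x(i := y)) * ln (Y (x(i := y))) \<partial>M) - Z x * ln (Z x)
          \<le> (\<integral>y. entropy_defect (Y (x(i := y))) (Y (x(i := c))) \<partial>M)"
        unfolding Z_def
        by (rule entropy_le_defect[OF m1[OF Y x] l]) (use bd[OF x] bd[OF x c] l in auto)
      thus "(\<integral>y. Y (x(i := y)) * ln (Y (x(i := y))) \<partial>M) - Z x * ln (Z x) \<le> (\<integral>y. D i (x(i := y)) \<partial>M)"
        by (simp add: D_def)
    qed (use fYY(2) iZ f(2) in auto)
  qed
  have B: "(\<integral>x. entropy_defect (Z x) (Z (x(j := c))) \<partial>?P) \<le> (\<integral>z. D j z \<partial>?Q)" if j: "j \<in> I" for j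
  proof -
    have j': "j \<in> insert i I" and ne: "j \<noteq> i" using j insert.hyps by auto
    have f: "(\<integral>z. D j z \<partial>?Q) = (\<integral>x. (\<integral>y. D j (x(i := y)) \<partial>M) \<partial>?P)"
      "integrable ?P (\<lambda>x. \<integral>y. D j (x(i := y)) \<partial>M)"
      by (rule fub[OF Dm[OF j'] Db[OF j']]; assumption)+
    show ?thesis unfolding f(1)
    proof (rule integral_mono)
      fix x assume x: "x \<in> space ?P"
      note x' = updsp[OF j x]
      have "entropy_defect (Z x) (Z (x(j := c)))
         \<le> (\<integral>y. entropy_defect (Y (x(i := y))) (Y ((x(j := c))(i := y))) \<partial>M)"
        unfolding Z_def
        by (rule defect_convex[OF m1[OF Y x] m1[OF Y x'] l]) (use bd[OF x] bd[OF x'] in auto)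
      thus "entropy_defect (Z x) (Z (x(j := c))) \<le> (\<integral>y. D j (x(i := y)) \<partial>M)"
        using ne by (simp add: D_def fun_upd_twist)
    next
      show "integrable ?P (\<lambda>x. entropy_defect (Z x) (Z (x(j := c))))"
      proof (rule P.integrable_bounded)
        show "(\<lambda>x. entropy_defect (Z x) (Z (x(j := c)))) \<in> borel_measurable ?P"
          unfolding entropy_defect_def using Zm measurable_compose[OF upd[OF j] Zm] by measurable
        show "\<bar>entropy_defect (Z x) (Z (x(j := c)))\<bar> \<le> u * (ln u - ln l) + 2 * u" if "x \<in> space ?P" for x
          using abs_entropy_defect_le[OF l] Zb[OF that] Zb[OF updsp[OF j that]] by blast
      qed
    qed (use f(2) in auto)
  qed
  have "(\<integral>z. Y z * ln (Y z) \<partial>?Q) - (\<integral>z. Y z \<partial>?Q) * ln (\<integral>z. Y z \<partial>?Q)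
     = (\<integral>x. (\<integral>y. Y (x(i := y)) * ln (Y (x(i := y))) \<partial>M) - Z x * ln (Z x) \<partial>?P)
      + ((\<integral>x. Z x * ln (Z x) \<partial>?P) - (\<integral>x. Z x \<partial>?P) * ln (\<integral>x. Z x \<partial>?P))"
    unfolding fYY(1) fY using fYY(2) iZ by simp
  also have "\<dots> \<le> (\<integral>z. D i z \<partial>?Q) + (\<Sum>j\<in>I. \<integral>x. entropy_defect (Z x) (Z (x(j := c))) \<partial>?P)"
    by (rule add_mono[OF A insert.IH[OF Zm l Zb]])
  also have "\<dots> \<le> (\<integral>z. D i z \<partial>?Q) + (\<Sum>j\<in>I. \<integral>z. D j z \<partial>?Q)"
    by (intro add_left_mono sum_mono B)
  also have "\<dots> = (\<Sum>j\<in>insert i I. \<integral>z. D j z \<partial>?Q)" using insert.hyps by simp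
  finally show ?case unfolding D_def .
qed

lemma exp_le_quadratic:
  fixes x :: real
  assumes "\<bar>x\<bar> \<le> 1"
  shows "exp x \<le> 1 + x + x\<^sup>2"
proof (cases "x \<ge> 0")
  case True
  then show ?thesis using assms exp_bound[of x] by simp
next
  case False
  define y where "y = - x"
  have y: "0 < y" "y \<le> 1" using False assms by (auto simp: y_def)
  have "1 + y \<le> exp y" by (rule exp_ge_add_one_self)
  hence "exp x \<le> 1 / (1 + y)"
    using y by (simp add: y_def exp_minus field_simps)
  also have "\<dots> \<le> 1 - y + y\<^sup>2"
  proof -
    have "(1 - y + y\<^sup>2) * (1 + y) = 1 + y ^ 3" by (simp add: algebra_simps power2_eq_square power3_eq_cube)
    hence "1 \<le> (1 - y + y\<^sup>2) * (1 + y)" using y by simp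
    thus ?thesis using y by (simp add: pos_divide_le_eq)
  qed
  finally show ?thesis by (simp add: y_def)
qed

text \<open>By tensorization, the entropy of \<open>exp (s f)\<close> is at most \<open>s\<^sup>2 v\<close> times its mean. Hence
  \<open>G s = ln (E exp (s f)) / s\<close> satisfies \<open>G s \<le> G (s / 2) + v s\<close>, and summing over
  \<open>s = r, r / 2, r / 4, \<dots>\<close> bounds \<open>G r\<close> by \<open>E f + 2 v r\<close>, since \<open>G\<close> tends to \<open>E f\<close> at 0. Halving
  replaces the differential inequality of the usual argument.\<close>

lemma (in prob_space) herbst:
  fixes f :: "('i \<Rightarrow> 'a) \<Rightarrow> real"
  assumes I: "finite I" and c: "c \<in> space M"
    and f: "f \<in> borel_measurable (\<Pi>\<^sub>M i\<in>I. M)"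
    and b: "\<And>x. x \<in> space (\<Pi>\<^sub>M i\<in>I. M) \<Longrightarrow> \<bar>f x\<bar> \<le> K"
    and d: "\<And>x i. x \<in> space (\<Pi>\<^sub>M i\<in>I. M) \<Longrightarrow> i \<in> I \<Longrightarrow> \<bar>f x - f (x(i := c))\<bar> \<le> D"
    and v: "\<And>x. x \<in> space (\<Pi>\<^sub>M i\<in>I. M) \<Longrightarrow> (\<Sum>i\<in>I. (f x - f (x(i := c)))\<^sup>2) \<le> v"
    and r: "0 < r" "r * D \<le> 1"
  shows "(\<integral>x. exp (r * f x) \<partial>(\<Pi>\<^sub>M i\<in>I. M)) \<le> exp (r * (\<integral>x. f x \<partial>(\<Pi>\<^sub>M i\<in>I. M)) + 2 * v * r\<^sup>2)"
proof -
  let ?P = "\<Pi>\<^sub>M i\<in>I. M"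
  interpret P: prob_space ?P by (rule prob_space_PiM) (rule prob_space_axioms)
  note [measurable] = f
  obtain x0 where x0: "x0 \<in> space ?P" using P.not_empty by (meson ex_in_conv)
  have K0: "K \<ge> 0" using b[OF x0] by linarith
  have v0: "v \<ge> 0" using v[OF x0] sum_nonneg[of I "\<lambda>i. (f x0 - f (x0(i := c)))\<^sup>2"] by force
  note ib = P.integrable_bounded
  have eb: "exp (- \<bar>s\<bar> * K) \<le> exp (s * f x) \<and> exp (s * f x) \<le> exp (\<bar>s\<bar> * K)" if "x \<in> space ?P" for s x
  proof -
    have "\<bar>s * f x\<bar> \<le> \<bar>s\<bar> * K" unfolding abs_mult using b[OF that] by (intro mult_left_mono) auto
    thus ?thesis by (auto simp: abs_le_iff)
  qed
  have ie: "integrable ?P (\<lambda>x. exp (s * f x))" for s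
    by (rule ib[where K = "exp (\<bar>s\<bar> * K)"]) (use eb in auto)
  have iF: "integrable ?P f" by (rule ib[OF f b])
  have ife: "integrable ?P (\<lambda>x. f x * exp (s * f x))" for s
  proof (rule ib[where K = "K * exp (\<bar>s\<bar> * K)"])
    show "\<bar>f x * exp (s * f x)\<bar> \<le> K * exp (\<bar>s\<bar> * K)" if "x \<in> space ?P" for x
      unfolding abs_mult using b[OF that] eb[OF that, of s] K0 by (intro mult_mono) auto
  qed measurable
  define W where "W s = (\<integral>x. exp (s * f x) \<partial>?P)" for s
  have Wpos: "W s > 0" for s
  proof -
    have "exp (- \<bar>s\<bar> * K) \<le> W s"
      using integral_mono[of ?P "\<lambda>_. exp (- \<bar>s\<bar> * K)" "\<lambda>x. exp (s * f x)"] ie eb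
      by (simp add: W_def P.prob_space)
    thus ?thesis using exp_gt_zero[of "- \<bar>s\<bar> * K"] by linarith
  qed
  have updsp: "x(j := c) \<in> space ?P" if "j \<in> I" "x \<in> space ?P" for j x
    using that c by (auto simp: space_PiM PiE_def extensional_def)
  have ent: "(\<integral>x. s * f x * exp (s * f x) \<partial>?P) - W s * ln (W s) \<le> s\<^sup>2 * v * W s"
    if s: "0 < s" "s \<le> r" for s
  proof -
    have "(\<integral>x. exp (s * f x) * ln (exp (s * f x)) \<partial>?P) - W s * ln (W s)
        \<le> (\<Sum>i\<in>I. \<integral>x. entropy_defect (exp (s * f x)) (exp (s * f (x(i := c)))) \<partial>?P)"
      unfolding W_def
      by (rule entropy_tensorization[OF I c]) (use eb in auto)
    also have "\<dots> \<le> (\<Sum>i\<in>I. \<integral>x. s\<^sup>2 * (f x - f (x(i := c)))\<^sup>2 * exp (s * f x) \<partial>?P)"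
    proof (intro sum_mono integral_mono)
      fix i assume i: "i \<in> I"
      have um[measurable]: "(\<lambda>x. f (x(i := c))) \<in> borel_measurable ?P"
        by (rule measurable_compose[OF measurable_fun_upd[where J = I] f]) (use i c in auto)
      show "integrable ?P (\<lambda>x. entropy_defect (exp (s * f x)) (exp (s * f (x(i := c)))))"
      proof (rule ib)
        show "(\<lambda>x. entropy_defect (exp (s * f x)) (exp (s * f (x(i := c))))) \<in> borel_measurable ?P"
          unfolding entropy_defect_def by measurable
        show "\<bar>entropy_defect (exp (s * f x)) (exp (s * f (x(i := c))))\<bar>
            \<le> exp (\<bar>s\<bar> * K) * (ln (exp (\<bar>s\<bar> * K)) - ln (exp (- \<bar>s\<bar> * K))) + 2 * exp (\<bar>s\<bar> * K)"
          if "x \<in> space ?P" for x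
          by (rule abs_entropy_defect_le) (use eb[OF that] eb[OF updsp[OF i that]] in auto)
      qed
      show "integrable ?P (\<lambda>x. s\<^sup>2 * (f x - f (x(i := c)))\<^sup>2 * exp (s * f x))"
      proof (rule ib)
        show "\<bar>s\<^sup>2 * (f x - f (x(i := c)))\<^sup>2 * exp (s * f x)\<bar> \<le> s\<^sup>2 * D\<^sup>2 * exp (\<bar>s\<bar> * K)"
          if x: "x \<in> space ?P" for x
        proof -
          have "(f x - f (x(i := c)))\<^sup>2 \<le> D\<^sup>2"
            using d[OF x i] power_mono[of "\<bar>f x - f (x(i := c))\<bar>" D 2] by auto
          thus ?thesis unfolding abs_mult using eb[OF x, of s]
            by (intro mult_mono) auto
        qed
      qed measurable
      fix x assume x: "x \<in> space ?P"
      define y where "y = s * (f x - f (x(i := c)))"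
      have "\<bar>y\<bar> \<le> 1"
      proof -
        have "\<bar>y\<bar> \<le> s * D" unfolding y_def abs_mult using d[OF x i] s by (intro mult_mono) auto
        also have "s * D \<le> r * D" using s d[OF x i] by (intro mult_right_mono) auto
        finally show ?thesis using r by simp
      qed
      hence q: "exp (- y) \<le> 1 + (- y) + (- y)\<^sup>2" by (intro exp_le_quadratic) simp
      have "entropy_defect (exp (s * f x)) (exp (s * f (x(i := c)))) = exp (s * f x) * (y - 1 + exp (- y))"
      proof -
        have "ln (exp (s * f x) / exp (s * f (x(i := c)))) = y"
          by (simp add: ln_div y_def algebra_simps)
        moreover have "exp (s * f x) * exp (- y) = exp (s * f (x(i := c)))"
          by (simp add: exp_add[symmetric] y_def algebra_simps)
        ultimately show ?thesis unfolding entropy_defect_def by (simp add: algebra_simps)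
      qed
      also have "\<dots> \<le> exp (s * f x) * y\<^sup>2" using q by (intro mult_left_mono) auto
      finally show "entropy_defect (exp (s * f x)) (exp (s * f (x(i := c))))
          \<le> s\<^sup>2 * (f x - f (x(i := c)))\<^sup>2 * exp (s * f x)"
        by (simp add: y_def power_mult_distrib mult_ac)
    qed
    also have "\<dots> = (\<integral>x. s\<^sup>2 * (\<Sum>i\<in>I. (f x - f (x(i := c)))\<^sup>2) * exp (s * f x) \<partial>?P)"
    proof -
      have "integrable ?P (\<lambda>x. s\<^sup>2 * (f x - f (x(i := c)))\<^sup>2 * exp (s * f x))" if i: "i \<in> I" for i
      proof (rule ib)
        have um[measurable]: "(\<lambda>x. f (x(i := c))) \<in> borel_measurable ?P"
          by (rule measurable_compose[OF measurable_fun_upd[where J = I] f]) (use i c in auto)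
        show "(\<lambda>x. s\<^sup>2 * (f x - f (x(i := c)))\<^sup>2 * exp (s * f x)) \<in> borel_measurable ?P" by measurable
        show "\<bar>s\<^sup>2 * (f x - f (x(i := c)))\<^sup>2 * exp (s * f x)\<bar> \<le> s\<^sup>2 * D\<^sup>2 * exp (\<bar>s\<bar> * K)"
          if x: "x \<in> space ?P" for x
        proof -
          have "(f x - f (x(i := c)))\<^sup>2 \<le> D\<^sup>2"
            using d[OF x i] power_mono[of "\<bar>f x - f (x(i := c))\<bar>" D 2] by auto
          thus ?thesis unfolding abs_mult using eb[OF x, of s]
            by (intro mult_mono) auto
        qed
      qed
      thus ?thesis by (subst Bochner_Integration.integral_sum[symmetric])
          (auto simp: sum_distrib_left sum_distrib_right)
    qed
    also have "\<dots> \<le> (\<integral>x. s\<^sup>2 * v * exp (s * f x) \<partial>?P)"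
    proof (rule integral_mono')
      show "integrable ?P (\<lambda>x. s\<^sup>2 * v * exp (s * f x))" using ie by simp
    qed (use v v0 in \<open>auto intro!: mult_right_mono mult_left_mono\<close>)
    also have "\<dots> = s\<^sup>2 * v * W s" by (simp add: W_def)
    finally show ?thesis by (simp add: mult_ac)
  qed
  define G where "G s = ln (W s) / s" for s
  have step: "G s \<le> G (s / 2) + v * s" if s: "0 < s" "s \<le> r" for s
  proof -
    \<comment> \<open>The mean of \<open>f\<close> under the tilted measure; \<open>exp (- s f / 2)\<close> is bounded from below by its
      tangent at \<open>f = m\<close>, which compares \<open>W s\<close> with \<open>W (s / 2)\<close>.\<close>
    define m where "m = (\<integral>x. f x * exp (s * f x) \<partial>?P) / W s"
    have m: "(\<integral>x. f x * exp (s * f x) \<partial>?P) = m * W s" using Wpos[of s] by (simp add: m_def)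
    have "W s * exp (- (s / 2) * m) = (\<integral>x. exp (s * f x) * exp (- (s/2) * m) * (1 - s / 2 * (f x - m)) \<partial>?P)"
    proof -
      have "(\<integral>x. exp (s * f x) * exp (- (s/2) * m) * (1 - s / 2 * (f x - m)) \<partial>?P)
         = (\<integral>x. (exp (- (s/2) * m) * (1 + s / 2 * m)) * exp (s * f x)
               - (exp (- (s/2) * m) * (s / 2)) * (f x * exp (s * f x)) \<partial>?P)"
        by (rule Bochner_Integration.integral_cong) (auto simp: field_simps)
      also have "\<dots> = (exp (- (s/2) * m) * (1 + s / 2 * m)) * W s - (exp (- (s/2) * m) * (s / 2)) * (m * W s)"
        using ie ife by (simp add: W_def m)
      finally show ?thesis by (simp add: algebra_simps)
    qed
    also have "\<dots> \<le> (\<integral>x. exp (s / 2 * f x) \<partial>?P)"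
    proof (rule integral_mono')
      show "integrable ?P (\<lambda>x. exp (s / 2 * f x))" by (rule ie)
      fix x
      have "1 + (- (s / 2 * (f x - m))) \<le> exp (- (s / 2 * (f x - m)))" by (rule exp_ge_add_one_self)
      hence "exp (s * f x) * exp (- (s/2) * m) * (1 - s / 2 * (f x - m))
         \<le> exp (s * f x) * exp (- (s/2) * m) * exp (- (s / 2 * (f x - m)))"
        by (intro mult_left_mono) auto
      also have "\<dots> = exp (s / 2 * f x)" by (simp add: exp_add[symmetric] field_simps)
      finally show "exp (s * f x) * exp (- (s/2) * m) * (1 - s / 2 * (f x - m)) \<le> exp (s / 2 * f x)" .
    qed auto
    finally have "W s * exp (- (s / 2) * m) \<le> W (s / 2)" by (simp add: W_def)
    hence "ln (W s * exp (- (s / 2) * m)) \<le> ln (W (s / 2))"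
      using Wpos by (subst ln_le_cancel_iff) auto
    hence 1: "ln (W s) - s / 2 * m \<le> ln (W (s / 2))"
      using Wpos[of s] by (simp add: ln_mult)
    have "s * (m * W s) - W s * ln (W s) \<le> s\<^sup>2 * v * W s"
      using ent[OF s] by (simp add: mult.assoc m)
    hence "W s * (s * m) \<le> W s * (ln (W s) + s\<^sup>2 * v)" by (simp add: algebra_simps)
    hence 2: "s * m \<le> ln (W s) + s\<^sup>2 * v" using Wpos[of s] by simp
    from 1 2 have "ln (W s) \<le> 2 * ln (W (s / 2)) + s\<^sup>2 * v" by simp
    thus ?thesis using s by (simp add: G_def field_simps power2_eq_square)
  qed
  have iter: "G r \<le> G (r / 2 ^ k) + 2 * v * r * (1 - 1 / 2 ^ k)" for k
  proof (induction k)
    case 0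
    then show ?case by simp
  next
    case (Suc k)
    have "r / 2 ^ k \<le> r" using r divide_left_mono[of 1 "2 ^ k" r] by simp
    hence "G (r / 2 ^ k) \<le> G (r / 2 ^ k / 2) + v * (r / 2 ^ k)"
      using r by (intro step) auto
    with Suc.IH show ?case by (simp add: field_simps)
  qed
  have small: "G s \<le> (\<integral>x. f x \<partial>?P) + s * K\<^sup>2" if s: "0 < s" "s * K \<le> 1" for s
  proof -
    have "W s \<le> (\<integral>x. 1 + s * f x + s\<^sup>2 * K\<^sup>2 \<partial>?P)"
      unfolding W_def
    proof (rule integral_mono)
      fix x assume x: "x \<in> space ?P"
      have a: "\<bar>s * f x\<bar> \<le> s * K" unfolding abs_mult using b[OF x] s by (intro mult_mono) auto
      hence "exp (s * f x) \<le> 1 + s * f x + (s * f x)\<^sup>2" using s by (intro exp_le_quadratic) auto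
      also have "(s * f x)\<^sup>2 \<le> (s * K)\<^sup>2" using a power_mono[OF a, of 2] by simp
      finally show "exp (s * f x) \<le> 1 + s * f x + s\<^sup>2 * K\<^sup>2" by (simp add: power_mult_distrib)
    qed (use ie iF in auto)
    also have "\<dots> = 1 + (s * (\<integral>x. f x \<partial>?P) + s\<^sup>2 * K\<^sup>2)" using iF by (simp add: P.prob_space)
    finally have "ln (W s) \<le> s * (\<integral>x. f x \<partial>?P) + s\<^sup>2 * K\<^sup>2"
      using ln_le_minus_one[OF Wpos[of s]] by simp
    thus ?thesis using s by (simp add: G_def field_simps power2_eq_square)
  qed
  have lim0: "(\<lambda>k. r / 2 ^ k) \<longlonglongrightarrow> 0"
    using tendsto_mult[OF tendsto_const[of r] LIMSEQ_power_zero[of "1/2::real"]]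
    by (simp add: power_divide)
  have "\<forall>\<^sub>F k in sequentially. G r \<le> (\<integral>x. f x \<partial>?P) + (r / 2 ^ k) * K\<^sup>2 + 2 * v * r"
  proof -
    have "\<forall>\<^sub>F k in sequentially. (r / 2 ^ k) * K < 1"
      by (rule order_tendstoD(2)[where y = 0]) (use tendsto_mult_left_zero[OF lim0] in auto)
    thus ?thesis
    proof eventually_elim
      case (elim k)
      have "2 * v * r * (1 - 1 / 2 ^ k) \<le> 2 * v * r * 1"
        using v0 r by (intro mult_left_mono) auto
      thus ?case using iter[of k] small[of "r / 2 ^ k"] elim r by simp
    qed
  qed
  moreover have "(\<lambda>k. (\<integral>x. f x \<partial>?P) + (r / 2 ^ k) * K\<^sup>2 + 2 * v * r) \<longlonglongrightarrow> (\<integral>x. f x \<partial>?P) + 0 * K\<^sup>2 + 2 * v * r"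
    by (intro tendsto_intros lim0)
  ultimately have "G r \<le> (\<integral>x. f x \<partial>?P) + 0 * K\<^sup>2 + 2 * v * r"
    by (intro tendsto_lowerbound[where F = sequentially]) auto
  hence "ln (W r) \<le> r * (\<integral>x. f x \<partial>?P) + 2 * v * r\<^sup>2"
    using r by (simp add: G_def field_simps power2_eq_square)
  moreover have "W r = exp (ln (W r))" using Wpos[of r] by simp
  ultimately have "W r \<le> exp (r * (\<integral>x. f x \<partial>?P) + 2 * v * r\<^sup>2)"
    by (metis exp_le_cancel_iff)
  thus ?thesis by (simp add: W_def)
qed

lemma (in prob_space) concentration:
  fixes f :: "('i \<Rightarrow> 'a) \<Rightarrow> real"
  assumes I: "finite I" and c: "c \<in> space M"
    and f: "f \<in> borel_measurable (\<Pi>\<^sub>M i\<in>I. M)"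
    and b: "\<And>x. x \<in> space (\<Pi>\<^sub>M i\<in>I. M) \<Longrightarrow> \<bar>f x\<bar> \<le> K"
    and d: "\<And>x i. x \<in> space (\<Pi>\<^sub>M i\<in>I. M) \<Longrightarrow> i \<in> I \<Longrightarrow> \<bar>f x - f (x(i := c))\<bar> \<le> D"
    and v: "\<And>x. x \<in> space (\<Pi>\<^sub>M i\<in>I. M) \<Longrightarrow> (\<Sum>i\<in>I. (f x - f (x(i := c)))\<^sup>2) \<le> v"
    and r: "0 < r" "r * D \<le> 1"
  shows "measure (\<Pi>\<^sub>M i\<in>I. M) {x \<in> space (\<Pi>\<^sub>M i\<in>I. M). f x \<ge> (\<integral>x. f x \<partial>(\<Pi>\<^sub>M i\<in>I. M)) + t}
      \<le> exp (2 * v * r\<^sup>2 - r * t)"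
proof -
  let ?P = "\<Pi>\<^sub>M i\<in>I. M"
  interpret P: prob_space ?P by (rule prob_space_PiM) (rule prob_space_axioms)
  note [measurable] = f
  define m where "m = (\<integral>x. f x \<partial>?P)"
  have eb: "exp (r * f x) \<le> exp (r * K)" if "x \<in> space ?P" for x
    using b[OF that] r by auto
  have ie: "integrable ?P (\<lambda>x. exp (r * f x))"
    by (rule P.integrable_bounded[where K = "exp (r * K)"]) (use eb in auto)
  have "measure ?P {x \<in> space ?P. f x \<ge> m + t} = (\<integral>x. indicator {x \<in> space ?P. f x \<ge> m + t} x \<partial>?P)"
    by simp
  also have "\<dots> \<le> (\<integral>x. exp (- r * (m + t)) * exp (r * f x) \<partial>?P)"
  proof (rule integral_mono')
    show "integrable ?P (\<lambda>x. exp (- r * (m + t)) * exp (r * f x))" using ie by simp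
    fix x
    show "indicat_real {x \<in> space ?P. f x \<ge> m + t} x \<le> exp (- r * (m + t)) * exp (r * f x)"
    proof (cases "f x \<ge> m + t")
      case True
      hence "- r * (m + t) + r * f x \<ge> 0" using r mult_left_mono[OF True, of r] by simp
      hence "1 \<le> exp (- r * (m + t)) * exp (r * f x)" by (simp add: exp_add[symmetric])
      thus ?thesis using indicator_le_1 order.trans by blast
    qed (auto simp: indicator_def)
  qed auto
  also have "\<dots> = exp (- r * (m + t)) * (\<integral>x. exp (r * f x) \<partial>?P)" by simp
  also have "\<dots> \<le> exp (- r * (m + t)) * exp (r * m + 2 * v * r\<^sup>2)"
    unfolding m_def by (intro mult_left_mono herbst[OF I c f b d v r]) auto
  also have "\<dots> = exp (2 * v * r\<^sup>2 - r * t)" by (simp add: exp_add[symmetric] algebra_simps)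
  finally show ?thesis unfolding m_def .
qed

section \<open>The integer lattice\<close>

lemma int_lattice_add: "x \<in> int_lattice \<Longrightarrow> y \<in> int_lattice \<Longrightarrow> x + y \<in> int_lattice"
  by (simp add: int_lattice_def)

lemma int_lattice_diff: "x \<in> int_lattice \<Longrightarrow> y \<in> int_lattice \<Longrightarrow> x - y \<in> int_lattice"
  by (simp add: int_lattice_def)

lemma axis_in_int_lattice: "axis i 1 \<in> int_lattice"
  by (simp add: int_lattice_def axis_def)

lemma scaled_axis_in_int_lattice: "a \<in> \<int> \<Longrightarrow> a *\<^sub>R axis i 1 \<in> int_lattice"
  by (simp add: int_lattice_def axis_def)

lemma axis_nth_real: "(axis i (1::real)) $ j = (if i = j then 1 else 0)"
  by (auto simp: axis_def)

lemma unit_lattice_vector: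
  fixes v :: "real ^ 'd"
  assumes "v \<in> int_lattice" "norm v = 1"
  obtains i s where "s = 1 \<or> s = -1" "v = s *\<^sub>R axis i 1"
proof -
  have sq: "(\<Sum>i\<in>UNIV. (v $ i)\<^sup>2) = 1"
    using assms(2) by (simp add: norm_vec_def L2_set_def)
  obtain i where i: "v $ i \<noteq> 0" using assms(2) by (metis norm_zero vec_eq_iff zero_index zero_neq_one)
  have int: "v $ j \<in> \<int>" for j using assms(1) by (simp add: int_lattice_def)
  have ge1: "1 \<le> (v $ i)\<^sup>2"
    using Ints_nonzero_abs_ge1[OF int i] by (simp add: abs_le_square_iff[of 1, simplified])
  have split: "(\<Sum>j\<in>UNIV. (v $ j)\<^sup>2) = (v $ i)\<^sup>2 + (\<Sum>j\<in>UNIV - {i}. (v $ j)\<^sup>2)"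
    by (rule sum.remove) auto
  have nn: "0 \<le> (\<Sum>j\<in>UNIV - {i}. (v $ j)\<^sup>2)" by (rule sum_nonneg) simp
  have 0: "(\<Sum>j\<in>UNIV - {i}. (v $ j)\<^sup>2) = 0" and 1: "(v $ i)\<^sup>2 = 1"
    using sq split ge1 nn by linarith+
  from 0 have z: "v $ j = 0" if "j \<noteq> i" for j
    using that by (subst (asm) sum_nonneg_eq_0_iff) auto
  show ?thesis
  proof (rule that[of "v $ i" i])
    show "v $ i = 1 \<or> v $ i = -1" using 1 by (simp add: power2_eq_1_iff)
    show "v = v $ i *\<^sub>R axis i 1" using z by (auto simp: vec_eq_iff axis_nth_real)
  qed
qed

lemma lattice_neighbour:
  fixes x y :: "real ^ 'd"
  assumes "x \<in> int_lattice" "y \<in> int_lattice" "dist x y = 1"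
  obtains i where "y = x + axis i 1 \<or> x = y + axis i 1"
proof -
  have "norm (y - x) = 1" using assms(3) by (simp add: dist_norm norm_minus_commute)
  from unit_lattice_vector[OF int_lattice_diff[OF assms(2,1)] this]
  obtain i s where s: "s = 1 \<or> s = -1" "y - x = s *\<^sub>R axis i 1" by blast
  have "y = x + s *\<^sub>R axis i 1" using s(2) by (simp add: algebra_simps)
  hence "y = x + axis i 1 \<or> x = y + axis i 1" using s(1) by auto
  thus ?thesis by (rule that)
qed

lemma dist_axis: "dist x (x + axis i (1::real)) = 1" "dist (x + axis i (1::real)) x = 1"
  by (simp_all add: dist_norm)

definition neighbours :: "real ^ 'd \<Rightarrow> (real ^ 'd) set" where
  "neighbours x = {y \<in> int_lattice. dist x y = 1}"

lemma card_neighbours: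
  fixes x :: "real ^ 'd"
  assumes "x \<in> int_lattice"
  shows "finite (neighbours x)" "card (neighbours x) \<le> 2 * CARD('d)"
proof -
  have sub: "neighbours x \<subseteq> (\<lambda>i. x + axis i 1) ` UNIV \<union> (\<lambda>i. x - axis i 1) ` UNIV"
  proof
    fix y assume "y \<in> neighbours x"
    hence y: "y \<in> int_lattice" "dist x y = 1" by (auto simp: neighbours_def)
    obtain i where "y = x + axis i 1 \<or> x = y + axis i 1" by (rule lattice_neighbour[OF assms y])
    hence "y = x + axis i 1 \<or> y = x - axis i 1" by auto
    thus "y \<in> (\<lambda>i. x + axis i 1) ` UNIV \<union> (\<lambda>i. x - axis i 1) ` UNIV" by blast
  qed
  show "finite (neighbours x)" by (rule finite_subset[OF sub]) simp
  have "card (neighbours x) \<le> card ((\<lambda>i. x + axis i 1) ` UNIV \<union> (\<lambda>i. x - axis i 1) ` (UNIV :: 'd set))"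
    by (rule card_mono[OF _ sub]) simp
  also have "\<dots> \<le> card ((\<lambda>i. x + axis i 1) ` (UNIV :: 'd set)) + card ((\<lambda>i. x - axis i 1) ` (UNIV :: 'd set))"
    by (rule card_Un_le)
  also have "\<dots> \<le> CARD('d) + CARD('d)" by (intro add_mono card_image_le) auto
  finally show "card (neighbours x) \<le> 2 * CARD('d)" by simp
qed

lemma edges_mono: "A \<subseteq> B \<Longrightarrow> edges A \<subseteq> edges B"
  by (auto simp: edges_def)

lemma edgesE:
  assumes "e \<in> edges \<Lambda>"
  obtains x y where "e = {x, y}" "x \<in> \<Lambda>" "y \<in> \<Lambda>" "dist x y = 1" "x \<noteq> y"
proof -
  obtain x y where xy: "e = {x, y}" "x \<in> \<Lambda>" "y \<in> \<Lambda>" "dist x y = 1"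
    using assms by (auto simp: edges_def)
  moreover have "x \<noteq> y" using xy(4) by auto
  ultimately show ?thesis by (rule that)
qed

lemma edge_finite: "e \<in> edges \<Lambda> \<Longrightarrow> finite e"
  by (auto simp: edges_def)

lemma edges_subset: "e \<in> edges \<Lambda> \<Longrightarrow> e \<subseteq> \<Lambda>"
  by (auto simp: edges_def)

lemma pair_in_edges: "{x, y} \<in> edges \<Lambda> \<longleftrightarrow> x \<in> \<Lambda> \<and> y \<in> \<Lambda> \<and> dist x y = 1"
  by (auto simp: edges_def doubleton_eq_iff dist_commute)

lemma finite_edges: "finite \<Lambda> \<Longrightarrow> finite (edges \<Lambda>)"
  by (rule finite_subset[of _ "Pow \<Lambda>"]) (auto simp: edges_def)

lemma card_incident_edges:
  fixes Q :: "(real ^ 'd) set"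
  assumes "finite Q" "Q \<subseteq> int_lattice" "F \<subseteq> edges int_lattice" "\<And>e. e \<in> F \<Longrightarrow> e \<inter> Q \<noteq> {}"
  shows "finite F" "card F \<le> 2 * CARD('d) * card Q"
proof -
  have sub: "F \<subseteq> (\<Union>x\<in>Q. (\<lambda>y. {x, y}) ` neighbours x)"
  proof
    fix e assume e: "e \<in> F"
    then obtain x y where xy: "e = {x, y}" "x \<in> int_lattice" "y \<in> int_lattice" "dist x y = 1"
      using assms(3) by (blast elim: edgesE)
    have "x \<in> Q \<or> y \<in> Q" using assms(4)[OF e] xy by auto
    moreover have "y \<in> neighbours x" "x \<in> neighbours y"
      using xy by (simp_all add: neighbours_def dist_commute)
    ultimately show "e \<in> (\<Union>x\<in>Q. (\<lambda>y. {x, y}) ` neighbours x)"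
      unfolding xy(1) by (auto simp: insert_commute)
  qed
  have f: "finite (neighbours x)" if "x \<in> Q" for x using card_neighbours(1) that assms(2) by blast
  show "finite F" by (rule finite_subset[OF sub]) (use assms(1) f in auto)
  have "card F \<le> card (\<Union>x\<in>Q. (\<lambda>y. {x, y}) ` neighbours x)"
    by (rule card_mono[OF _ sub]) (use assms(1) f in auto)
  also have "\<dots> \<le> (\<Sum>x\<in>Q. card ((\<lambda>y. {x, y}) ` neighbours x))" by (rule card_UN_le[OF assms(1)])
  also have "\<dots> \<le> (\<Sum>x\<in>Q. 2 * CARD('d))"
  proof (rule sum_mono)
    fix x assume "x \<in> Q"
    hence x: "x \<in> int_lattice" using assms(2) by auto
    have "card ((\<lambda>y. {x, y}) ` neighbours x) \<le> card (neighbours x)" by (rule card_image_le[OF card_neighbours(1)[OF x]])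
    thus "card ((\<lambda>y. {x, y}) ` neighbours x) \<le> 2 * CARD('d)" using card_neighbours(2)[OF x] by simp
  qed
  finally show "card F \<le> 2 * CARD('d) * card Q" by (simp add: mult.commute)
qed

section \<open>Frames and boxes\<close>

text \<open>The vectors in \<open>B\<close> are the lateral directions of a box with axis \<open>n\<close>.\<close>

definition frame :: "real ^ 'd \<Rightarrow> (real ^ 'd) set \<Rightarrow> bool" where
  "frame n B \<longleftrightarrow> n \<notin> B \<and> pairwise orthogonal (insert n B) \<and> (\<forall>u\<in>insert n B. norm u = 1) \<and>
     span (insert n B) = UNIV"

lemma unit_cubes_frame:
  "unit_cubes n = {{\<Sum>u\<in>B. t u *\<^sub>R u | t. \<forall>u\<in>B. t u \<in> {-1/2..1/2}} | B. frame n B}"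
  by (simp add: unit_cubes_def frame_def)

definition open_box :: "real ^ 'd \<Rightarrow> (real ^ 'd) set \<Rightarrow> real ^ 'd \<Rightarrow> real \<Rightarrow> real \<Rightarrow> (real ^ 'd) set" where
  "open_box n B z L H = {y. (\<forall>u\<in>B. \<bar>(y - z) \<bullet> u\<bar> < L / 2) \<and> \<bar>(y - z) \<bullet> n\<bar> < H}"

context
  fixes n :: "real ^ 'd" and B :: "(real ^ 'd) set"
  assumes fr: "frame n B"
begin

lemma frame_finite: "finite B"
proof -
  have "pairwise orthogonal (insert n B)" using fr by (simp add: frame_def)
  hence "finite (insert n B)" by (rule pairwise_orthogonal_imp_finite)
  thus ?thesis by simp
qed

lemma frame_inner: "u \<in> insert n B \<Longrightarrow> v \<in> insert n B \<Longrightarrow> u \<bullet> v = (if u = v then 1 else 0)"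
  using fr by (auto simp: frame_def pairwise_def orthogonal_def norm_eq_1)

lemma frame_norm: "u \<in> insert n B \<Longrightarrow> norm u = 1"
  using fr unfolding frame_def by blast

lemma frame_notin: "n \<notin> B" using fr by (simp add: frame_def)

lemma frame_independent: "independent (insert n B)"
proof (rule pairwise_orthogonal_independent)
  show "pairwise orthogonal (insert n B)" using fr by (simp add: frame_def)
  show "0 \<notin> insert n B" using frame_norm by fastforce
qed

lemma frame_card: "card (insert n B) = CARD('d)"
proof -
  have "card (insert n B) = dim (UNIV :: (real ^ 'd) set)"
    using frame_independent fr dim_span_eq_card_independent[of "insert n B"] by (simp add: frame_def)
  thus ?thesis by (simp add: dim_UNIV)
qed

lemma frame_card': "card B = CARD('d) - 1"
  using frame_card frame_notin frame_finite by simp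

lemma frame_expand: "x = (\<Sum>u\<in>insert n B. (x \<bullet> u) *\<^sub>R u)"
proof -
  define d where "d = x - (\<Sum>u\<in>insert n B. (x \<bullet> u) *\<^sub>R u)"
  have "orthogonal d v" if v: "v \<in> insert n B" for v
  proof -
    have "(\<Sum>u\<in>insert n B. (x \<bullet> u) *\<^sub>R u) \<bullet> v = (\<Sum>u\<in>insert n B. if u = v then x \<bullet> u else 0)"
      unfolding inner_sum_left by (rule sum.cong[OF refl]) (simp only: inner_scaleR_left frame_inner[OF _ v], simp)
    also have "\<dots> = x \<bullet> v" using v frame_finite by (subst sum.delta) auto
    finally show ?thesis by (simp add: orthogonal_def d_def inner_diff_left)
  qed
  moreover have "d \<in> span (insert n B)" using fr by (simp add: frame_def)
  ultimately have "orthogonal d d" by (intro orthogonal_to_span[of d "insert n B" d])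
  thus ?thesis by (simp add: orthogonal_def d_def)
qed

lemma frame_norm_le: "norm x \<le> (\<Sum>u\<in>insert n B. \<bar>x \<bullet> u\<bar>)"
proof -
  have "norm x = norm (\<Sum>u\<in>insert n B. (x \<bullet> u) *\<^sub>R u)" using frame_expand[of x] by simp
  also have "\<dots> \<le> (\<Sum>u\<in>insert n B. norm ((x \<bullet> u) *\<^sub>R u))" by (rule norm_sum)
  also have "\<dots> = (\<Sum>u\<in>insert n B. \<bar>x \<bullet> u\<bar>)" by (rule sum.cong) (auto simp: frame_norm)
  finally show ?thesis .
qed

lemma frame_inner_le: "u \<in> insert n B \<Longrightarrow> \<bar>x \<bullet> u\<bar> \<le> norm x"
  using Cauchy_Schwarz_ineq2[of x u] frame_norm[of u] by simp

lemma frame_inner_sum: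
  assumes "v \<in> insert n B"
  shows "(\<Sum>u\<in>B. t u *\<^sub>R u) \<bullet> v = (if v \<in> B then t v else 0)"
proof -
  have "(\<Sum>u\<in>B. t u *\<^sub>R u) \<bullet> v = (\<Sum>u\<in>B. if u = v then t u else 0)"
    unfolding inner_sum_left
    by (rule sum.cong[OF refl]) (use assms in \<open>auto simp: frame_inner\<close>)
  thus ?thesis using frame_finite by simp
qed

lemma rect_coords:
  assumes "0 < L"
  shows "rect 0 L H {\<Sum>u\<in>B. t u *\<^sub>R u | t. \<forall>u\<in>B. t u \<in> {-1/2..1/2}} n =
     {y. (\<forall>u\<in>B. \<bar>y \<bullet> u\<bar> \<le> L / 2) \<and> \<bar>y \<bullet> n\<bar> \<le> H}" (is "?R = ?C")
proof
  show "?R \<subseteq> ?C"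
  proof
    fix y assume "y \<in> ?R"
    then obtain t h where t: "\<forall>u\<in>B. t u \<in> {-1/2..1/2}" "h \<in> {-H..H}"
      "y = L *\<^sub>R (\<Sum>u\<in>B. t u *\<^sub>R u) + h *\<^sub>R n" by (auto simp: rect_def)
    have "y \<bullet> u = L * t u" if "u \<in> B" for u
      using that frame_inner_sum[of u t] frame_inner[of n u] frame_notin by (auto simp: t(3) inner_add_left)
    moreover have "y \<bullet> n = h"
      using frame_inner_sum[of n t] frame_inner[of n n] frame_notin by (auto simp: t(3) inner_add_left)
    moreover have "\<bar>L * t u\<bar> \<le> L / 2" if "u \<in> B" for u
    proof -
      have "\<bar>t u\<bar> \<le> 1 / 2" using t(1) that by fastforce
      thus ?thesis using assms by (simp add: abs_mult)
    qed
    ultimately show "y \<in> ?C" using t(2) by auto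
  qed
  show "?C \<subseteq> ?R"
  proof
    fix y assume y: "y \<in> ?C"
    have "y = (\<Sum>u\<in>B. (y \<bullet> u) *\<^sub>R u) + (y \<bullet> n) *\<^sub>R n"
      using frame_expand[of y] frame_finite frame_notin by (simp add: add.commute)
    also have "(\<Sum>u\<in>B. (y \<bullet> u) *\<^sub>R u) = L *\<^sub>R (\<Sum>u\<in>B. ((y \<bullet> u) / L) *\<^sub>R u)"
      using assms by (simp add: scaleR_sum_right)
    finally have e: "y = 0 + L *\<^sub>R (\<Sum>u\<in>B. ((y \<bullet> u) / L) *\<^sub>R u) + (y \<bullet> n) *\<^sub>R n" by simp
    have b: "(y \<bullet> u) / L \<in> {-1/2..1/2}" if "u \<in> B" for u
    proof -
      have "\<bar>y \<bullet> u\<bar> \<le> L / 2" using y that by auto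
      thus ?thesis using assms by (auto simp: field_simps abs_le_iff)
    qed
    have h: "y \<bullet> n \<in> {-H..H}" using y by auto
    have S: "(\<Sum>u\<in>B. ((y \<bullet> u) / L) *\<^sub>R u) \<in> {\<Sum>u\<in>B. t u *\<^sub>R u | t. \<forall>u\<in>B. t u \<in> {-1/2..1/2}}"
      unfolding mem_Collect_eq by (intro exI[of _ "\<lambda>u. (y \<bullet> u) / L"] conjI refl ballI b)
    show "y \<in> ?R" unfolding rect_def
      by (rule CollectI) (intro exI[of _ "\<Sum>u\<in>B. ((y \<bullet> u) / L) *\<^sub>R u"] exI[of _ "y \<bullet> n"] conjI e S h)
  qed
qed

lemma open_open_box: "open (open_box n B z L H)"
proof -
  have "open_box n B z L H = (\<Inter>u\<in>B. {y. \<bar>(y - z) \<bullet> u\<bar> < L / 2}) \<inter> {y. \<bar>(y - z) \<bullet> n\<bar> < H}"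
    by (auto simp: open_box_def)
  also have "open \<dots>"
    by (intro open_Int open_INT frame_finite ballI open_Collect_less continuous_intros)
  finally show ?thesis .
qed

lemma interior_rect:
  assumes "0 < L" "0 < H"
  shows "interior (rect 0 L H {\<Sum>u\<in>B. t u *\<^sub>R u | t. \<forall>u\<in>B. t u \<in> {-1/2..1/2}} n) = open_box n B 0 L H"
proof
  let ?C = "{y. (\<forall>u\<in>B. \<bar>y \<bullet> u\<bar> \<le> L / 2) \<and> \<bar>y \<bullet> n\<bar> \<le> H}"
  show "open_box n B 0 L H \<subseteq> interior (rect 0 L H {\<Sum>u\<in>B. t u *\<^sub>R u | t. \<forall>u\<in>B. t u \<in> {-1/2..1/2}} n)"
    unfolding rect_coords[OF assms(1)]
    by (rule interior_maximal[OF _ open_open_box]) (auto simp: open_box_def less_imp_le)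
  have strict: "\<bar>y \<bullet> u\<bar> < b" if y: "y \<in> interior ?C" and u: "u \<in> insert n B" and b: "0 < b"
      "\<And>x. x \<in> ?C \<Longrightarrow> \<bar>x \<bullet> u\<bar> \<le> b" for y u b
  proof -
    obtain e where e: "e > 0" "ball y e \<subseteq> ?C" using y by (auto simp: mem_interior)
    define s where "s = sgn (y \<bullet> u)"
    have ns: "\<bar>s\<bar> \<le> 1" by (simp add: s_def abs_sgn_eq)
    have "dist y (y + (e/2 * s) *\<^sub>R u) < e"
      using e(1) ns frame_norm[OF u] by (simp add: dist_norm abs_mult)
    hence "\<bar>(y + (e/2 * s) *\<^sub>R u) \<bullet> u\<bar> \<le> b" using e(2) b(2) by auto
    hence "\<bar>y \<bullet> u + e/2 * s\<bar> \<le> b" using frame_inner[OF u u] by (simp add: inner_add_left)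
    thus ?thesis using e(1) b(1) by (auto simp: s_def sgn_if split: if_splits)
  qed
  show "interior (rect 0 L H {\<Sum>u\<in>B. t u *\<^sub>R u | t. \<forall>u\<in>B. t u \<in> {-1/2..1/2}} n) \<subseteq> open_box n B 0 L H"
    unfolding rect_coords[OF assms(1)]
  proof
    fix y assume y: "y \<in> interior ?C"
    have "\<bar>y \<bullet> u\<bar> < L / 2" if "u \<in> B" for u by (rule strict[OF y]) (use that assms in auto)
    moreover have "\<bar>y \<bullet> n\<bar> < H" by (rule strict[OF y]) (use assms in auto)
    ultimately show "y \<in> open_box n B 0 L H" by (simp add: open_box_def)
  qed
qed

lemma open_box_norm:
  assumes "y \<in> open_box n B z L H"
  shows "norm (y - z) \<le> real (card B) * (L / 2) + H"
proof -
  have "norm (y - z) \<le> (\<Sum>u\<in>insert n B. \<bar>(y - z) \<bullet> u\<bar>)" by (rule frame_norm_le)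
  also have "\<dots> = (\<Sum>u\<in>B. \<bar>(y - z) \<bullet> u\<bar>) + \<bar>(y - z) \<bullet> n\<bar>" using frame_finite frame_notin by simp
  also have "\<dots> \<le> (\<Sum>u\<in>B. L / 2) + H"
    using assms by (intro add_mono sum_mono) (auto simp: open_box_def less_imp_le)
  finally show ?thesis by simp
qed

end

lemma frame_prod:
  fixes a b :: real
  assumes fr: "frame (n :: real ^ 'd) B"
  shows "(\<Prod>u\<in>insert n B. if u = n then a else b) = a * b ^ (CARD('d) - 1)"
proof -
  have "(\<Prod>u\<in>insert n B. if u = n then a else b) = a * (\<Prod>u\<in>B. if u = n then a else b)"
    using frame_finite[OF fr] frame_notin[OF fr] by simp
  also have "(\<Prod>u\<in>B. if u = n then a else b) = (\<Prod>u\<in>B. b)"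
    using frame_notin[OF fr] by (intro prod.cong) auto
  finally show ?thesis using frame_card'[OF fr] by simp
qed

section \<open>Connectivity of the complement of a box\<close>

lemma line_walk:
  fixes x :: "real ^ 'd"
  assumes "x \<in> int_lattice" "s = 1 \<or> s = -1"
    and "\<And>k. k \<le> m \<Longrightarrow> x + (real k * s) *\<^sub>R axis i 1 \<notin> \<Lambda>"
  shows "(x, x + (real m * s) *\<^sub>R axis i 1) \<in> connections {e \<in> edges int_lattice. e \<inter> \<Lambda> = {}}"
  using assms(3)
proof (induction m)
  case 0
  then show ?case by (simp add: connections_refl)
next
  case (Suc m)
  let ?p = "x + (real m * s) *\<^sub>R axis i 1" and ?q = "x + (real (Suc m) * s) *\<^sub>R axis i 1"
  have IH: "(x, ?p) \<in> connections {e \<in> edges int_lattice. e \<inter> \<Lambda> = {}}"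
    by (rule Suc.IH) (use Suc.prems in auto)
  have "s \<in> \<int>" using assms(2) by auto
  hence L: "?p \<in> int_lattice" "?q \<in> int_lattice"
    by (intro int_lattice_add assms(1) scaled_axis_in_int_lattice Ints_mult Ints_of_nat; assumption)+
  have "?p - ?q = (- s) *\<^sub>R axis i 1" by (simp add: algebra_simps)
  hence "dist ?p ?q = 1" using assms(2) by (auto simp: dist_norm)
  hence "{?p, ?q} \<in> {e \<in> edges int_lattice. e \<inter> \<Lambda> = {}}"
    using L Suc.prems[of m] Suc.prems[of "Suc m"] by (simp add: pair_in_edges)
  from connections_trans[OF IH connections_edge[OF this]] show ?case .
qed

lemma far_connected:
  fixes x y :: "real ^ 'd"
  assumes x: "x \<in> int_lattice" and y: "y \<in> int_lattice" and i: "x $ i = y $ i"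
    and far: "\<And>z. z $ i = x $ i \<Longrightarrow> z \<notin> \<Lambda>"
  shows "(x, y) \<in> connections {e \<in> edges int_lattice. e \<inter> \<Lambda> = {}}"
proof -
  define mix where "mix S = (\<chi> j. if j \<in> S then y $ j else x $ j)" for S
  have mixL: "mix S \<in> int_lattice" for S using x y by (auto simp: mix_def int_lattice_def)
  have "(x, mix S) \<in> connections {e \<in> edges int_lattice. e \<inter> \<Lambda> = {}}" for S :: "'d set"
  proof -
    have "finite S" by simp
    thus ?thesis
    proof (induction S rule: finite_induct)
      case empty
      have "mix {} = x" by (simp add: mix_def vec_eq_iff)
      then show ?case by (simp add: connections_refl)
    next
      case (insert j S)
      show ?case
      proof (cases "j = i")
        case True
        have "mix (insert j S) = mix S" using True i by (auto simp: mix_def vec_eq_iff)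
        then show ?thesis using insert.IH by simp
      next
        case False
        have "y $ j - x $ j \<in> \<int>" using x y by (simp add: int_lattice_def)
        then obtain m :: int where m: "y $ j - x $ j = of_int m" by (auto elim: Ints_cases)
        define s :: real where "s = (if m \<ge> 0 then 1 else -1)"
        have e: "mix (insert j S) = mix S + (real (nat \<bar>m\<bar>) * s) *\<^sub>R axis j 1"
        proof -
          have "real (nat \<bar>m\<bar>) * s = y $ j - x $ j" unfolding m s_def by auto
          thus ?thesis using insert.hyps by (auto simp: mix_def vec_eq_iff axis_nth_real)
        qed
        have "(mix S, mix (insert j S)) \<in> connections {e \<in> edges int_lattice. e \<inter> \<Lambda> = {}}"
          unfolding e
        proof (rule line_walk[OF mixL])
          show "s = 1 \<or> s = -1" by (simp add: s_def)
          fix k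
          show "mix S + (real k * s) *\<^sub>R axis j 1 \<notin> \<Lambda>"
            by (rule far) (use False i in \<open>simp add: mix_def axis_nth_real\<close>)
        qed
        from connections_trans[OF insert.IH this] show ?thesis .
      qed
    qed
  qed
  from this[of UNIV] show ?thesis by (simp add: mix_def)
qed

text \<open>A lattice point outside the convex box can walk to infinity in a coordinate direction
  along which a functional that separates it from the box increases. Far away it reaches a fixed
  point \<open>hub\<close> by two moves inside coordinate hyperplanes that miss the box, and for the second
  move two different coordinates are needed.\<close>

lemma box_complement_connected:
  fixes x y n :: "real ^ 'd"
  assumes fr: "frame n B" and d: "CARD('d) \<ge> 2"
    and x: "x \<in> int_lattice" "x \<notin> open_box n B 0 L H" and y: "y \<in> int_lattice" "y \<notin> open_box n B 0 L H"
  shows "(x, y) \<in> connections {e \<in> edges int_lattice. e \<inter> open_box n B 0 L H = {}}"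
proof -
  let ?\<Lambda> = "open_box n B 0 L H"
  let ?C = "connections {e \<in> edges int_lattice. e \<inter> ?\<Lambda> = {}}"
  obtain K :: nat where K: "real (card B) * (L / 2) + H < real K" using reals_Archimedean2 by blast
  have bK: "\<bar>z $ i\<bar> < real K" if "z \<in> ?\<Lambda>" for z i
  proof -
    have "\<bar>z $ i\<bar> \<le> norm z" by (rule component_le_norm_cart)
    thus ?thesis using open_box_norm[OF fr that] K by simp
  qed
  define hub :: "real ^ 'd" where "hub = (\<chi> i. real K)"
  have hubL: "hub \<in> int_lattice" by (simp add: hub_def int_lattice_def)
  have toHub: "(x, hub) \<in> ?C" if x: "x \<in> int_lattice" "x \<notin> ?\<Lambda>" for x
  proof -
    obtain a where a: "a \<noteq> 0" "\<And>z. z \<bullet> a \<ge> x \<bullet> a \<Longrightarrow> z \<notin> ?\<Lambda>"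
    proof -
      obtain u b where u: "u \<in> insert n B" "\<bar>x \<bullet> u\<bar> \<ge> b" "\<And>z. z \<in> ?\<Lambda> \<Longrightarrow> \<bar>z \<bullet> u\<bar> < b"
      proof (cases "\<bar>x \<bullet> n\<bar> < H")
        case True
        then obtain u where "u \<in> B" "\<bar>x \<bullet> u\<bar> \<ge> L / 2" using x(2) by (auto simp: open_box_def not_less)
        thus ?thesis using that[of u "L / 2"] by (auto simp: open_box_def)
      next
        case False
        thus ?thesis using that[of n H] by (auto simp: open_box_def)
      qed
      have u0: "u \<noteq> 0" using frame_norm[OF fr u(1)] by auto
      show ?thesis
      proof (cases "x \<bullet> u \<ge> 0")
        case True
        show ?thesis by (rule that[of u]) (use u0 u(2,3) True in force)+
      next
        case False
        show ?thesis
        proof (rule that[of "- u"])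
          fix z assume "x \<bullet> - u \<le> z \<bullet> - u"
          thus "z \<notin> ?\<Lambda>" using u(2) u(3)[of z] False by auto
        qed (use u0 in simp)
      qed
    qed
    obtain i where i: "a $ i \<noteq> 0" using a(1) by (metis vec_eq_iff zero_index)
    define s :: real where "s = sgn (a $ i)"
    have s: "s = 1 \<or> s = -1" using i by (auto simp: s_def sgn_if)
    obtain m :: nat where m: "\<bar>x $ i\<bar> + real K < real m" using reals_Archimedean2 by blast
    define p where "p = x + (real m * s) *\<^sub>R axis i 1"
    have xp: "(x, p) \<in> ?C" unfolding p_def
    proof (rule line_walk[OF x(1) s])
      fix k
      have "axis i 1 \<bullet> a = a $ i" by (simp add: inner_axis' )
      hence "(x + (real k * s) *\<^sub>R axis i 1) \<bullet> a = x \<bullet> a + real k * \<bar>a $ i\<bar>"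
        by (simp add: inner_add_left s_def sgn_mult_self_eq abs_sgn)
      thus "x + (real k * s) *\<^sub>R axis i 1 \<notin> ?\<Lambda>" by (intro a(2)) simp
    qed
    have pL: "p \<in> int_lattice" unfolding p_def using s
      by (intro int_lattice_add x(1) scaled_axis_in_int_lattice Ints_mult Ints_of_nat) auto
    have pi: "\<bar>p $ i\<bar> \<ge> real K"
    proof -
      have "p $ i = x $ i + real m * s" by (simp add: p_def axis_nth_real)
      moreover have "\<bar>real m * s\<bar> = real m" using s by auto
      ultimately show ?thesis using m by linarith
    qed
    define q :: "real ^ 'd" where "q = (\<chi> j. if j = i then p $ i else real K)"
    have qL: "q \<in> int_lattice" using pL by (auto simp: q_def int_lattice_def)
    have pq: "(p, q) \<in> ?C"
    proof (rule far_connected[OF pL qL, of i])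
      show "p $ i = q $ i" by (simp add: q_def)
      fix z :: "real ^ 'd" assume "z $ i = p $ i"
      thus "z \<notin> ?\<Lambda>" using pi bK[of z i] by auto
    qed
    have "\<exists>j. j \<noteq> i"
    proof (rule ccontr)
      assume "\<not> (\<exists>j. j \<noteq> i)"
      hence u: "(UNIV :: 'd set) = {i}" by auto
      have "CARD('d) = 1" unfolding u by simp
      thus False using d by simp
    qed
    then obtain j where j: "j \<noteq> i" by auto
    have qh: "(q, hub) \<in> ?C"
    proof (rule far_connected[OF qL hubL, of j])
      show "q $ j = hub $ j" using j by (simp add: q_def hub_def)
      fix z :: "real ^ 'd" assume "z $ j = q $ j"
      thus "z \<notin> ?\<Lambda>" using bK[of z j] j by (auto simp: q_def)
    qed
    show ?thesis by (rule connections_trans[OF connections_trans[OF xp pq] qh])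
  qed
  show ?thesis by (rule connections_trans[OF toHub[OF x] connections_sym[OF toHub[OF y]]])
qed

section \<open>Volume and lattice points of rotated boxes\<close>

text \<open>Let \<open>B\<close> be the unit ball. The pairs \<open>(x, y)\<close> with \<open>y \<in> A\<close> and \<open>y - g x \<in> B\<close> have mass
  \<open>vol B \<cdot> vol (g -` A)\<close> or \<open>vol B \<cdot> vol A\<close>, depending on the order of integration, because \<open>B\<close>
  is invariant under \<open>g\<close>.\<close>

lemma lborel_orthogonal_vimage:
  fixes g :: "'a::euclidean_space \<Rightarrow> 'a"
  assumes g: "orthogonal_transformation g" and A: "A \<in> sets borel"
  shows "emeasure lborel (g -` A) = emeasure lborel A"
proof -
  define h where "h = inv g"
  have gh: "g (h y) = y" for y
    unfolding h_def using orthogonal_transformation_surj[OF g] by (simp add: surj_f_inv_f)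
  have lin: "linear g" using g by (rule orthogonal_transformation_linear)
  have gm[measurable]: "g \<in> borel_measurable borel"
    by (intro borel_measurable_continuous_onI linear_continuous_on linear_conv_bounded_linear[THEN iffD1] lin)
  note [measurable] = A
  define B :: "'a set" where "B = ball 0 1"
  have Bm[measurable]: "B \<in> sets borel" by (simp add: B_def)
  have shift: "(\<integral>\<^sup>+x. f (t + x) \<partial>lborel) = (\<integral>\<^sup>+x. f x \<partial>lborel)"
    if [measurable]: "f \<in> borel_measurable borel" for f :: "'a \<Rightarrow> ennreal" and t
  proof -
    have "(\<integral>\<^sup>+x. f x \<partial>lborel) = (\<integral>\<^sup>+x. f x \<partial>distr lborel borel ((+) t))"
      by (simp add: lborel_distr_plus)
    also have "\<dots> = (\<integral>\<^sup>+x. f (t + x) \<partial>lborel)" by (subst nn_integral_distr) auto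
    finally show ?thesis by simp
  qed
  have gA[measurable]: "g -` A \<in> sets borel" using measurable_sets[OF gm A] by simp
  have "emeasure lborel (g -` A) * emeasure lborel B = (\<integral>\<^sup>+y. emeasure lborel (g -` A) * indicator B y \<partial>lborel)"
    by (subst nn_integral_cmult_indicator) auto
  also have "\<dots> = (\<integral>\<^sup>+y. (\<integral>\<^sup>+x. indicator A (y + g x) * indicator B y \<partial>lborel) \<partial>lborel)"
  proof (rule nn_integral_cong)
    fix y :: 'a
    have "emeasure lborel (g -` A) = (\<integral>\<^sup>+x. indicator A (g x) \<partial>lborel)"
    proof -
      have "(\<integral>\<^sup>+x. indicator A (g x) \<partial>lborel) = (\<integral>\<^sup>+x. indicator (g -` A) x \<partial>lborel)"
        by (rule nn_integral_cong) (simp add: indicator_def)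
      thus ?thesis by simp
    qed
    also have "\<dots> = (\<integral>\<^sup>+x. indicator A (g (h y + x)) \<partial>lborel)" by (rule shift[symmetric]) measurable
    also have "\<dots> = (\<integral>\<^sup>+x. indicator A (y + g x) \<partial>lborel)"
      by (simp add: linear_add[OF lin] gh)
    finally show "emeasure lborel (g -` A) * indicator B y = (\<integral>\<^sup>+x. indicator A (y + g x) * indicator B y \<partial>lborel)"
      by (subst nn_integral_multc) auto
  qed
  also have "\<dots> = (\<integral>\<^sup>+x. (\<integral>\<^sup>+y. indicator A (y + g x) * indicator B y \<partial>lborel) \<partial>lborel)"
    by (rule lborel_pair.Fubini') measurable
  also have "\<dots> = (\<integral>\<^sup>+x. (\<integral>\<^sup>+y. indicator A y * indicator B (y - g x) \<partial>lborel) \<partial>lborel)"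
  proof (rule nn_integral_cong)
    fix x :: 'a
    have "(\<integral>\<^sup>+y. indicator A y * indicator B (y - g x) \<partial>lborel)
        = (\<integral>\<^sup>+y. indicator A (g x + y) * indicator B ((g x + y) - g x) \<partial>lborel)"
      by (rule shift[symmetric]) measurable
    thus "(\<integral>\<^sup>+y. indicator A (y + g x) * indicator B y \<partial>lborel) = (\<integral>\<^sup>+y. indicator A y * indicator B (y - g x) \<partial>lborel)"
      by (simp add: add.commute)
  qed
  also have "\<dots> = (\<integral>\<^sup>+y. (\<integral>\<^sup>+x. indicator A y * indicator B (y - g x) \<partial>lborel) \<partial>lborel)"
    by (rule lborel_pair.Fubini') measurable
  also have "\<dots> = (\<integral>\<^sup>+y. indicator A y * emeasure lborel B \<partial>lborel)"
  proof (rule nn_integral_cong)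
    fix y :: 'a
    have "(\<integral>\<^sup>+x. indicator B (y - g x) \<partial>lborel) = (\<integral>\<^sup>+x. indicator B (y - g (h y + x)) \<partial>lborel)"
      by (rule shift[symmetric]) measurable
    also have "\<dots> = (\<integral>\<^sup>+x. indicator B x \<partial>lborel)"
      by (rule nn_integral_cong)
        (simp add: linear_add[OF lin] gh B_def indicator_def orthogonal_transformation_norm[OF g])
    finally have "(\<integral>\<^sup>+x. indicator B (y - g x) \<partial>lborel) = emeasure lborel B" by simp
    thus "(\<integral>\<^sup>+x. indicator A y * indicator B (y - g x) \<partial>lborel) = indicator A y * emeasure lborel B"
      by (subst nn_integral_cmult) auto
  qed
  also have "\<dots> = emeasure lborel A * emeasure lborel B" by (subst nn_integral_multc) auto
  finally have e: "emeasure lborel B * emeasure lborel (g -` A) = emeasure lborel B * emeasure lborel A"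
    by (simp add: mult.commute)
  have "emeasure lborel B \<noteq> 0"
  proof -
    have "0 < measure lborel B" unfolding B_def by (rule content_ball_pos) simp
    thus ?thesis by (auto simp: measure_def)
  qed
  moreover have "emeasure lborel B \<noteq> \<top>" unfolding B_def using emeasure_lborel_ball_finite[of "0::'a" 1] by auto
  ultimately show ?thesis using e by (metis ennreal_mult_cancel_left)
qed

lemma frame_box_volume:
  fixes n :: "real ^ 'd" and a b :: "real ^ 'd \<Rightarrow> real"
  assumes fr: "frame n B" and ab: "\<And>u. u \<in> insert n B \<Longrightarrow> a u \<le> b u"
  shows "emeasure lborel {x. \<forall>u\<in>insert n B. a u \<le> x \<bullet> u \<and> x \<bullet> u \<le> b u} = ennreal (\<Prod>u\<in>insert n B. b u - a u)"
    and "emeasure lborel {x. \<forall>u\<in>insert n B. a u < x \<bullet> u \<and> x \<bullet> u < b u} = ennreal (\<Prod>u\<in>insert n B. b u - a u)"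
proof -
  let ?F = "insert n B"
  obtain p :: "'d \<Rightarrow> real ^ 'd" where p: "bij_betw p UNIV ?F"
    using finite_same_card_bij[of "UNIV :: 'd set" ?F] frame_finite[OF fr] frame_card[OF fr] by auto
  have pF: "p i \<in> ?F" for i using p by (auto simp: bij_betw_def)
  have pS: "u \<in> ?F \<Longrightarrow> \<exists>i. u = p i" for u using p by (auto simp: bij_betw_def)
  define T :: "real ^ 'd \<Rightarrow> real ^ 'd" where "T x = (\<chi> i. x \<bullet> p i)" for x
  have "linear T" by (rule linearI) (auto simp: T_def vec_eq_iff inner_add_left)
  moreover have "norm (T x) = norm x" for x
  proof -
    have "x \<bullet> x = x \<bullet> (\<Sum>u\<in>?F. (x \<bullet> u) *\<^sub>R u)" using frame_expand[OF fr, of x] by simp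
    also have "\<dots> = (\<Sum>u\<in>?F. (x \<bullet> u)\<^sup>2)" by (simp add: inner_sum_right power2_eq_square del: sum.insert)
    also have "\<dots> = (\<Sum>i\<in>UNIV. (x \<bullet> p i)\<^sup>2)" by (rule sum.reindex_bij_betw[OF p, symmetric])
    also have "\<dots> = (norm (T x))\<^sup>2" by (simp add: T_def norm_vec_def L2_set_def sum_nonneg)
    finally have "(norm (T x))\<^sup>2 = (norm x)\<^sup>2" by (simp only: power2_norm_eq_inner)
    thus ?thesis by simp
  qed
  ultimately have T: "orthogonal_transformation T" by (simp add: orthogonal_transformation)
  define l :: "real ^ 'd" where "l = (\<chi> i. a (p i))"
  define r :: "real ^ 'd" where "r = (\<chi> i. b (p i))"
  have lr: "l \<bullet> v \<le> r \<bullet> v" if "v \<in> Basis" for v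
    using that ab pF by (auto simp: Basis_vec_def inner_axis l_def r_def)
  have ne: "cbox l r \<noteq> {}" using lr by (auto simp: box_ne_empty)
  have c: "measure lborel (cbox l r) = (\<Prod>u\<in>?F. b u - a u)"
  proof -
    have "measure lborel (cbox l r) = (\<Prod>i\<in>UNIV. b (p i) - a (p i))"
      using content_cbox_cart[OF ne] by (simp add: l_def r_def)
    also have "\<dots> = (\<Prod>u\<in>?F. b u - a u)" by (rule prod.reindex_bij_betw[OF p])
    finally show ?thesis .
  qed
  have "{x. \<forall>u\<in>?F. a u \<le> x \<bullet> u \<and> x \<bullet> u \<le> b u} = T -` cbox l r"
    using pF pS by (force simp: T_def l_def r_def mem_box_cart)
  hence "emeasure lborel {x. \<forall>u\<in>?F. a u \<le> x \<bullet> u \<and> x \<bullet> u \<le> b u} = emeasure lborel (cbox l r)"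
    using lborel_orthogonal_vimage[OF T, of "cbox l r"] by simp
  also have "\<dots> = ennreal (measure lborel (cbox l r))"
    by (rule emeasure_eq_ennreal_measure) (simp add: emeasure_lborel_cbox_eq)
  finally show "emeasure lborel {x. \<forall>u\<in>?F. a u \<le> x \<bullet> u \<and> x \<bullet> u \<le> b u} = ennreal (\<Prod>u\<in>?F. b u - a u)"
    by (simp only: c)
  have "{x. \<forall>u\<in>?F. a u < x \<bullet> u \<and> x \<bullet> u < b u} = T -` box l r"
    using pF pS by (force simp: T_def l_def r_def mem_box_cart)
  hence "emeasure lborel {x. \<forall>u\<in>?F. a u < x \<bullet> u \<and> x \<bullet> u < b u} = emeasure lborel (box l r)"
    using lborel_orthogonal_vimage[OF T, of "box l r"] by simp
  also have "\<dots> = emeasure lborel (cbox l r)"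
    using lr by (simp add: emeasure_lborel_box_eq emeasure_lborel_cbox_eq)
  also have "\<dots> = ennreal (measure lborel (cbox l r))"
    by (rule emeasure_eq_ennreal_measure) (simp add: emeasure_lborel_cbox_eq)
  finally show "emeasure lborel {x. \<forall>u\<in>?F. a u < x \<bullet> u \<and> x \<bullet> u < b u} = ennreal (\<Prod>u\<in>?F. b u - a u)"
    by (simp only: c)
qed

lemma packing_bound:
  assumes "finite K" and "\<And>k. k \<in> K \<Longrightarrow> A k \<in> sets M" and "\<And>k. k \<in> K \<Longrightarrow> emeasure M (A k) = ennreal v"
    and "disjoint_family_on A K" and "\<And>k. k \<in> K \<Longrightarrow> A k \<subseteq> C" and "C \<in> sets M"
    and "emeasure M C \<le> ennreal c" and "0 \<le> v" "0 \<le> c"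
  shows "real (card K) * v \<le> c"
proof -
  have "ennreal (real (card K) * v) = (\<Sum>k\<in>K. emeasure M (A k))"
    using assms(3,8) by (simp add: ennreal_mult ennreal_of_nat_eq_real_of_nat)
  also have "\<dots> = emeasure M (\<Union>k\<in>K. A k)"
    by (rule sum_emeasure) (use assms in auto)
  also have "\<dots> \<le> emeasure M C" by (rule emeasure_mono) (use assms in auto)
  also have "\<dots> \<le> ennreal c" by (rule assms)
  finally show ?thesis using assms(9) by simp
qed

text \<open>The open unit cubes with lower corners at the lattice points of a box are disjoint, have
  volume 1 and lie in the box enlarged by \<open>d\<close> on each side.\<close>

lemma lattice_points_bound:
  fixes n :: "real ^ 'd" and a b :: "real ^ 'd \<Rightarrow> real"
  assumes fr: "frame n B" and ab: "\<And>u. u \<in> insert n B \<Longrightarrow> a u \<le> b u"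
    and Q: "Q \<subseteq> int_lattice" "\<And>x u. x \<in> Q \<Longrightarrow> u \<in> insert n B \<Longrightarrow> a u \<le> x \<bullet> u \<and> x \<bullet> u \<le> b u"
  shows "finite Q" "real (card Q) \<le> (\<Prod>u\<in>insert n B. b u - a u + 2 * real CARD('d))"
proof -
  let ?F = "insert n B" and ?r = "real CARD('d)"
  let ?c = "\<Prod>u\<in>?F. b u - a u + 2 * ?r"
  let ?C = "{x. \<forall>u\<in>?F. a u - ?r \<le> x \<bullet> u \<and> x \<bullet> u \<le> b u + ?r}"
  define U :: "real ^ 'd" where "U = (\<chi> i. 1)"
  have bound: "real (card Q') \<le> ?c" if Q': "finite Q'" "Q' \<subseteq> Q" for Q'
  proof -
    have "real (card Q') * 1 \<le> ?c"
    proof (rule packing_bound[where A = "\<lambda>y. box y (y + U)" and M = lborel and C = ?C])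
      show "emeasure lborel (box y (y + U)) = ennreal 1" for y
      proof -
        have "emeasure lborel (box y (y + U)) = ennreal (\<Prod>v\<in>Basis. (y + U - y) \<bullet> v)"
          by (rule emeasure_lborel_box) (auto simp: Basis_vec_def inner_axis U_def)
        also have "(\<Prod>v\<in>Basis. (y + U - y) \<bullet> v) = 1"
          by (rule prod.neutral) (auto simp: Basis_vec_def inner_axis U_def)
        finally show ?thesis by simp
      qed
      show "disjoint_family_on (\<lambda>y. box y (y + U)) Q'"
      proof (unfold disjoint_family_on_def, intro ballI impI equals0I)
        fix y z x assume y: "y \<in> Q'" "z \<in> Q'" "y \<noteq> z" "x \<in> box y (y + U) \<inter> box z (z + U)"
        have "y $ i = z $ i" for i
        proof -
          have "y $ i \<in> \<int>" "z $ i \<in> \<int>" using y Q' Q(1) by (auto simp: int_lattice_def)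
          then obtain k l where kl: "y $ i = of_int k" "z $ i = of_int l" by (auto elim!: Ints_cases)
          have "y $ i < x $ i" "x $ i < y $ i + 1" "z $ i < x $ i" "x $ i < z $ i + 1"
            using y(4) by (auto simp: mem_box_cart U_def)
          hence "k < l + 1" "l < k + 1" unfolding kl by linarith+
          thus ?thesis by (simp add: kl)
        qed
        thus False using y(3) by (simp add: vec_eq_iff)
      qed
      fix y assume y: "y \<in> Q'"
      show "box y (y + U) \<subseteq> ?C"
      proof
        fix x assume x: "x \<in> box y (y + U)"
        have "norm (x - y) \<le> (\<Sum>i\<in>UNIV. \<bar>(x - y) $ i\<bar>)" by (rule norm_le_l1_cart)
        also have "\<dots> \<le> (\<Sum>i\<in>(UNIV :: 'd set). 1)"
        proof (rule sum_mono)
          fix i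
          have "y $ i < x $ i" "x $ i < y $ i + 1" using x by (auto simp: mem_box_cart U_def)
          thus "\<bar>(x - y) $ i\<bar> \<le> 1" by simp
        qed
        finally have nr: "norm (x - y) \<le> ?r" by simp
        have "a u - ?r \<le> x \<bullet> u \<and> x \<bullet> u \<le> b u + ?r" if u: "u \<in> ?F" for u
        proof -
          have "\<bar>(x - y) \<bullet> u\<bar> \<le> ?r" using frame_inner_le[OF fr u, of "x - y"] nr by simp
          moreover have "a u \<le> y \<bullet> u" "y \<bullet> u \<le> b u" using Q(2)[of y u] y Q' u by auto
          ultimately show ?thesis by (auto simp: inner_diff_left abs_le_iff)
        qed
        thus "x \<in> ?C" by simp
      qed
    next
      have "emeasure lborel ?C = ennreal (\<Prod>u\<in>?F. (b u + ?r) - (a u - ?r))"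
        by (rule frame_box_volume(1)[OF fr]) (use ab in force)
      thus "emeasure lborel ?C \<le> ennreal ?c" by (simp add: algebra_simps)
      show "0 \<le> ?c" by (rule prod_nonneg) (use ab in force)
      have "closed ?C"
      proof -
        have "?C = (\<Inter>u\<in>?F. {x. a u - ?r \<le> x \<bullet> u} \<inter> {x. x \<bullet> u \<le> b u + ?r})" by auto
        also have "closed \<dots>" by (intro closed_INT ballI closed_Int closed_Collect_le continuous_intros)
        finally show ?thesis .
      qed
      thus "?C \<in> sets lborel" by simp
    qed (use that in auto)
    thus ?thesis by simp
  qed
  show fin: "finite Q"
  proof (rule ccontr)
    assume "infinite Q"
    then obtain Q' where "Q' \<subseteq> Q" "finite Q'" "card Q' = Suc (nat \<lceil>?c\<rceil>)"
      using infinite_arbitrarily_large by blast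
    with bound[of Q'] show False by simp linarith
  qed
  show "real (card Q) \<le> ?c" by (rule bound[OF fin order_refl])
qed

section \<open>Closed cochains\<close>

text \<open>Summation modulo 2 along a line.\<close>

lemma int_step_function:
  fixes p :: "int \<Rightarrow> bool"
  shows "\<exists>q :: int \<Rightarrow> bool. \<forall>k. (q (k + 1) \<noteq> q k) \<longleftrightarrow> p k"
proof -
  define N where "N = {m::int. p m}"
  define q where "q k = (if k \<ge> 0 then odd (card ({0..<k} \<inter> N)) else odd (card ({k..<0} \<inter> N)))" for k :: int
  have "(q (k + 1) \<noteq> q k) \<longleftrightarrow> p k" for k
  proof (cases "k \<ge> 0")
    case True
    hence "{0..<k + 1} = insert k {0..<k}" by auto
    hence "card ({0..<k + 1} \<inter> N) = card ({0..<k} \<inter> N) + (if p k then 1 else 0)"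
      by (auto simp: N_def Int_insert_left)
    thus ?thesis using True by (auto simp: q_def)
  next
    case False
    hence "{k..<0} = insert k {k + 1..<0}" by auto
    hence c: "card ({k..<0} \<inter> N) = card ({k + 1..<0} \<inter> N) + (if p k then 1 else 0)"
      by (auto simp: N_def Int_insert_left)
    show ?thesis
    proof (cases "k = -1")
      case True
      thus ?thesis using c by (auto simp: q_def)
    next
      case F: False
      thus ?thesis using False c by (auto simp: q_def)
    qed
  qed
  thus ?thesis by blast
qed

text \<open>A 1-cochain modulo 2 whose sum around every plaquette vanishes is the coboundary of a
  function. The function is built up one direction at a time: if \<open>\<kappa>\<close> serves the directions in
  \<open>I\<close>, the defect \<open>d\<close> in a further direction \<open>j\<close> is, by closedness, invariant under the
  directions in \<open>I\<close>; so summing \<open>d\<close> along the lines in direction \<open>j\<close> corrects \<open>\<kappa>\<close> without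
  spoiling it.\<close>

lemma closed_cochain_exact:
  fixes c :: "real ^ 'd \<Rightarrow> 'd \<Rightarrow> bool"
  assumes closed: "\<And>x i j. x \<in> int_lattice \<Longrightarrow> i \<noteq> j \<Longrightarrow>
      (c x i \<noteq> c (x + axis j 1) i) \<longleftrightarrow> (c x j \<noteq> c (x + axis i 1) j)"
  shows "\<exists>\<kappa> :: real ^ 'd \<Rightarrow> bool. \<forall>x\<in>int_lattice. \<forall>i. c x i \<longleftrightarrow> \<kappa> x \<noteq> \<kappa> (x + axis i 1)"
proof -
  have "\<exists>\<kappa> :: real ^ 'd \<Rightarrow> bool. \<forall>x\<in>int_lattice. \<forall>i\<in>I. c x i \<longleftrightarrow> \<kappa> x \<noteq> \<kappa> (x + axis i 1)" if "finite I" for I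
    using that
  proof (induction I rule: finite_induct)
    case empty
    then show ?case by simp
  next
    case (insert j I)
    from insert.IH obtain \<kappa> :: "real ^ 'd \<Rightarrow> bool" where \<kappa>0: "\<forall>x\<in>int_lattice. \<forall>i\<in>I. c x i \<longleftrightarrow> \<kappa> x \<noteq> \<kappa> (x + axis i 1)" by blast
    have \<kappa>: "c x i \<longleftrightarrow> \<kappa> x \<noteq> \<kappa> (x + axis i 1)" if "x \<in> int_lattice" "i \<in> I" for x i
      using \<kappa>0 that by simp
    define d where "d x \<longleftrightarrow> (\<kappa> (x + axis j 1) \<noteq> \<kappa> x) \<noteq> c x j" for x
    have dinv: "d (x + axis i 1) = d x" if x: "x \<in> int_lattice" and i: "i \<in> I" for x i
    proof -
      have ij: "i \<noteq> j" using i insert.hyps by auto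
      have xj: "x + axis j 1 \<in> int_lattice" by (intro int_lattice_add x axis_in_int_lattice)
      have e: "x + axis j 1 + axis i 1 = x + axis i 1 + axis j 1" by (simp add: algebra_simps)
      show ?thesis
        using \<kappa>[OF x i] \<kappa>[OF xj i] closed[OF x ij] unfolding d_def e by blast
    qed
    define line where "line x k = (\<chi> l. if l = j then of_int k else x $ l)" for x :: "real ^ 'd" and k :: int
    have lineL: "line x k \<in> int_lattice" if "x \<in> int_lattice" for x k
      using that by (auto simp: line_def int_lattice_def)
    define Q where "Q x = (SOME q :: int \<Rightarrow> bool. \<forall>k. (q (k + 1) \<noteq> q k) \<longleftrightarrow> d (line x k))" for x
    have Q: "(Q x (k + 1) \<noteq> Q x k) \<longleftrightarrow> d (line x k)" for x k
      using someI_ex[OF int_step_function[of "\<lambda>k. d (line x k)"]] unfolding Q_def by blast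
    define g where "g x = Q x \<lfloor>x $ j\<rfloor>" for x
    have Qinv: "Q (x + axis i 1) = Q x" if x: "x \<in> int_lattice" and i: "i \<in> insert j I" for x i
    proof -
      have "d (line (x + axis i 1) k) = d (line x k)" for k
      proof (cases "i = j")
        case True
        hence "line (x + axis i 1) k = line x k" by (auto simp: line_def vec_eq_iff axis_nth_real)
        thus ?thesis by simp
      next
        case False
        hence "line (x + axis i 1) k = line x k + axis i 1" by (auto simp: line_def vec_eq_iff axis_nth_real)
        thus ?thesis using dinv[OF lineL[OF x]] i False by auto
      qed
      thus ?thesis unfolding Q_def by presburger
    qed
    define \<kappa>' where "\<kappa>' x \<longleftrightarrow> \<kappa> x \<noteq> g x" for x
    have "c x i \<longleftrightarrow> \<kappa>' x \<noteq> \<kappa>' (x + axis i 1)" if x: "x \<in> int_lattice" and i: "i \<in> insert j I" for x i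
    proof (cases "i = j")
      case True
      obtain m where m: "x $ j = of_int m" using x by (auto simp: int_lattice_def elim!: Ints_cases)
      have "line x m = x" using m by (auto simp: line_def vec_eq_iff)
      moreover have "g x = Q x m" by (simp add: g_def m)
      moreover have "g (x + axis j 1) = Q x (m + 1)"
        using Qinv[OF x, of j] by (simp add: g_def m axis_nth_real)
      ultimately have "g (x + axis j 1) \<noteq> g x \<longleftrightarrow> d x" using Q[of x m] by simp
      thus ?thesis unfolding True \<kappa>'_def d_def by blast
    next
      case False
      have "g (x + axis i 1) = g x" using Qinv[OF x i] False by (simp add: g_def axis_nth_real)
      thus ?thesis using \<kappa>[OF x, of i] i False unfolding \<kappa>'_def by blast
    qed
    thus ?case by blast
  qed
  from this[OF finite_class.finite_UNIV] show ?thesis by simp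
qed

section \<open>Energy and entropy of an interface\<close>

text \<open>The part of \<open>S\<close> that can be reached from the roots \<open>R\<close> by steps in \<open>S\<close>. The roots lie
  outside \<open>S\<close> in the application and do not belong to the cluster.\<close>

inductive_set cluster :: "('e \<Rightarrow> 'e \<Rightarrow> bool) \<Rightarrow> 'e set \<Rightarrow> 'e set \<Rightarrow> 'e set"
  for adj :: "'e \<Rightarrow> 'e \<Rightarrow> bool" and R S :: "'e set" where
  root: "f \<in> R \<Longrightarrow> adj f e \<Longrightarrow> e \<in> S \<Longrightarrow> e \<in> cluster adj R S"
| step: "f \<in> cluster adj R S \<Longrightarrow> adj f e \<Longrightarrow> e \<in> S \<Longrightarrow> e \<in> cluster adj R S"

text \<open>The elements whose membership in \<open>S\<close> decides whether \<open>G\<close> is the cluster of \<open>S\<close>.\<close>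

definition closed_nbhd :: "('e \<Rightarrow> 'e \<Rightarrow> bool) \<Rightarrow> 'e set \<Rightarrow> 'e set \<Rightarrow> 'e set \<Rightarrow> 'e set" where
  "closed_nbhd adj R E G = {e \<in> E. e \<in> G \<or> (\<exists>f\<in>G \<union> R. adj f e)}"

lemma cluster_subset: "cluster adj R S \<subseteq> S"
proof
  fix e assume "e \<in> cluster adj R S" thus "e \<in> S" by cases auto
qed

text \<open>Exploring the cluster from the roots reveals only its closed neighbourhood.\<close>

lemma cluster_determined:
  assumes G: "G = cluster adj R S0" and S: "S \<subseteq> E" "S \<inter> closed_nbhd adj R E G = G"
  shows "cluster adj R S = G"
proof
  show "cluster adj R S \<subseteq> G"
  proof
    fix e assume "e \<in> cluster adj R S"
    thus "e \<in> G"
    proof induction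
      case (root f e)
      hence "e \<in> S \<inter> closed_nbhd adj R E G" using S(1) by (auto simp: closed_nbhd_def)
      thus ?case using S(2) by simp
    next
      case (step f e)
      hence "e \<in> S \<inter> closed_nbhd adj R E G" using S(1) by (auto simp: closed_nbhd_def)
      thus ?case using S(2) by simp
    qed
  qed
  have GS: "G \<subseteq> S" using S(2) by auto
  show "G \<subseteq> cluster adj R S"
  proof
    fix e assume "e \<in> G"
    hence "e \<in> cluster adj R S0" using G by simp
    thus "e \<in> cluster adj R S"
    proof induction
      case (root f e)
      have "e \<in> cluster adj R S0" using root by (rule cluster.root)
      hence "e \<in> S" using GS G by auto
      thus ?case using root by (blast intro: cluster.root)
    next
      case (step f e)
      have "e \<in> cluster adj R S0" using step(1-3) by (rule cluster.step)
      hence "e \<in> S" using GS G by auto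
      thus ?case using step by (blast intro: cluster.step)
    qed
  qed
qed

lemma card_closed_nbhd:
  assumes E: "finite E" and G: "G \<subseteq> E" and deg: "\<And>f. f \<in> E \<Longrightarrow> card {e \<in> E. adj f e} \<le> \<Delta>"
    and r: "card {e \<in> E. \<exists>f\<in>R. adj f e} \<le> r"
  shows "card (closed_nbhd adj R E G) \<le> (\<Delta> + 1) * card G + r"
proof -
  have fG: "finite G" using G E finite_subset by auto
  have sub: "closed_nbhd adj R E G \<subseteq> G \<union> (\<Union>f\<in>G. {e \<in> E. adj f e}) \<union> {e \<in> E. \<exists>f\<in>R. adj f e}"
    by (auto simp: closed_nbhd_def)
  have "card (closed_nbhd adj R E G) \<le> card (G \<union> (\<Union>f\<in>G. {e \<in> E. adj f e}) \<union> {e \<in> E. \<exists>f\<in>R. adj f e})"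
    by (rule card_mono[OF _ sub]) (use fG E in auto)
  also have "\<dots> \<le> card (G \<union> (\<Union>f\<in>G. {e \<in> E. adj f e})) + card {e \<in> E. \<exists>f\<in>R. adj f e}"
    by (rule card_Un_le)
  also have "\<dots> \<le> (card G + card (\<Union>f\<in>G. {e \<in> E. adj f e})) + r"
    by (intro add_mono card_Un_le r)
  also have "card (\<Union>f\<in>G. {e \<in> E. adj f e}) \<le> (\<Sum>f\<in>G. card {e \<in> E. adj f e})"
    by (rule card_UN_le[OF fG])
  also have "\<dots> \<le> (\<Sum>f\<in>G. \<Delta>)" by (rule sum_mono) (use G deg in auto)
  finally show ?thesis by (simp add: algebra_simps)
qed

text \<open>A bound on the number of possible clusters of each size, without enumeration: a uniformly
  random subset of \<open>E\<close> has cluster \<open>G\<close> with probability at least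
  \<open>2 ^ - card (closed_nbhd adj R E G)\<close>, and these events are disjoint for different \<open>G\<close>. The
  degree bound \<open>\<Delta>\<close> and the number \<open>r\<close> of elements next to a root turn the exponent into
  \<open>(\<Delta> + 1) card G + r\<close>.\<close>

lemma sum_cluster_weights:
  assumes E: "finite E" and fC: "\<C> \<subseteq> cluster adj R ` Pow E"
    and deg: "\<And>f. f \<in> E \<Longrightarrow> card {e \<in> E. adj f e} \<le> \<Delta>"
    and r: "card {e \<in> E. \<exists>f\<in>R. adj f e} \<le> r"
  shows "(\<Sum>G\<in>\<C>. (1 / 2 ^ (\<Delta> + 1)) ^ card G) \<le> (2::real) ^ r"
proof -
  define F where "F G = {S \<in> Pow E. S \<inter> closed_nbhd adj R E G = G}" for G
  have finC: "finite \<C>" using fC E by (meson finite_Pow_iff finite_imageI finite_subset)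
  have GE: "G \<subseteq> E" if "G \<in> \<C>" for G
    using that fC cluster_subset by fastforce
  have "real (card (F G)) \<ge> 2 ^ card E * (1 / 2 ^ (\<Delta> + 1)) ^ card G / 2 ^ r" if G: "G \<in> \<C>" for G
  proof -
    let ?W = "closed_nbhd adj R E G"
    have WE: "?W \<subseteq> E" by (auto simp: closed_nbhd_def)
    have GW: "G \<subseteq> ?W" using GE[OF G] by (auto simp: closed_nbhd_def)
    have bij: "bij_betw (\<lambda>S. G \<union> S) (Pow (E - ?W)) (F G)"
      by (rule bij_betwI[where g = "\<lambda>S. S - ?W"]) (use WE GW GE[OF G] in \<open>auto simp: F_def\<close>)
    have "card (F G) = 2 ^ card (E - ?W)"
      using bij_betw_same_card[OF bij] E by (simp add: card_Pow)
    also have "card (E - ?W) = card E - card ?W" using WE E by (simp add: card_Diff_subset finite_subset)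
    finally have c: "real (card (F G)) = 2 ^ (card E - card ?W)" by simp
    have cW: "card ?W \<le> card E" by (rule card_mono[OF E WE])
    have "card ?W \<le> (\<Delta> + 1) * card G + r" by (rule card_closed_nbhd[OF E GE[OF G] deg r])
    hence "(2::real) ^ card ?W \<le> 2 ^ ((\<Delta> + 1) * card G + r)" by (intro power_increasing) auto
    hence "(2::real) ^ card E / 2 ^ ((\<Delta> + 1) * card G + r) \<le> 2 ^ card E / 2 ^ card ?W"
      by (intro divide_left_mono) auto
    also have "\<dots> = 2 ^ (card E - card ?W)" using cW by (simp add: power_diff)
    finally show ?thesis unfolding c
      by (simp add: power_add power_mult power_one_over field_simps)
  qed
  hence "(\<Sum>G\<in>\<C>. 2 ^ card E * (1 / 2 ^ (\<Delta> + 1)) ^ card G / 2 ^ r) \<le> (\<Sum>G\<in>\<C>. real (card (F G)))"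
    by (rule sum_mono)
  also have "\<dots> = real (card (\<Union>G\<in>\<C>. F G))"
  proof (subst card_UN_disjoint[OF finC])
    show "\<forall>G\<in>\<C>. finite (F G)" using E by (simp add: F_def)
    show "\<forall>G\<in>\<C>. \<forall>G'\<in>\<C>. G \<noteq> G' \<longrightarrow> F G \<inter> F G' = {}"
    proof (intro ballI impI equals0I)
      fix G G' S assume a: "G \<in> \<C>" "G' \<in> \<C>" "G \<noteq> G'" "S \<in> F G \<inter> F G'"
      obtain S0 S1 where s: "G = cluster adj R S0" "G' = cluster adj R S1" using a(1,2) fC by blast
      have "cluster adj R S = G" by (rule cluster_determined[OF s(1), of S E]) (use a in \<open>auto simp: F_def\<close>)
      moreover have "cluster adj R S = G'" by (rule cluster_determined[OF s(2), of S E]) (use a in \<open>auto simp: F_def\<close>)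
      ultimately show False using a(3) by simp
    qed
  qed simp
  also have "\<dots> \<le> real (card (Pow E))"
    by (intro of_nat_mono card_mono) (use E in \<open>auto simp: F_def\<close>)
  also have "\<dots> = 2 ^ card E" using E by (simp add: card_Pow)
  finally have "2 ^ card E / 2 ^ r * (\<Sum>G\<in>\<C>. (1 / 2 ^ (\<Delta> + 1)) ^ card G) \<le> (2::real) ^ card E"
    by (simp add: sum_distrib_left mult_ac)
  thus ?thesis by (simp add: field_simps)
qed

lemma spin_sum_mono:
  assumes "\<And>e. e \<in> E \<Longrightarrow> 0 \<le> w e" "\<And>e. e \<in> E \<Longrightarrow> w e \<le> w' e"
  shows "spin_sum E w V X \<le> spin_sum E w' V X"
  unfolding spin_sum_def boltzmann_def
  by (intro sum_mono prod_mono) (use assms in auto)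

text \<open>The left-hand side is the sum over \<open>e\<close> of the difference of the probabilities that \<open>e\<close> is
  unsatisfied under the boundary condition \<open>X\<close> and under plus, cleared of denominators. Let the
  interface \<open>\<Gamma>\<close> of a configuration be the cluster of its unsatisfied edges attached to the
  roots. By assumption \<open>flip\<close> there is a set of spins whose flipping removes exactly the
  interface. It maps the configurations with interface \<open>G\<close> to those with plus boundary condition
  and no unsatisfied edge in the closed neighbourhood of \<open>G\<close>, and the weight loses the factor
  \<open>\<Prod>e\<in>G. w e\<close>. This has two consequences. First, given the interface, the other edges are
  unsatisfied with at most the probability they have under plus (by \<open>cut_sum_comparison\<close>, with
  the weight 0 in the closed neighbourhood), so the sum in question is at most the mean of
  \<open>card \<Gamma>\<close>. Secondly, as the weights beat the number of clusters, the mean of \<open>exp (card \<Gamma>)\<close> is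
  at most \<open>2 ^ r\<close> times \<open>spin_sum E w V {} / spin_sum E w V X\<close>, and Jensen's inequality bounds
  the mean of \<open>card \<Gamma>\<close>.\<close>

lemma interface_bound:
  assumes V: "finite V" and E: "finite E" "\<And>e. e \<in> E \<Longrightarrow> finite e" and X: "X \<inter> V = {}"
    and w: "\<And>e. e \<in> E \<Longrightarrow> 0 < w e" "\<And>e. e \<in> E \<Longrightarrow> w e \<le> exp (-1) / 2 ^ (\<Delta> + 1)"
    and flip: "\<And>A. A \<subseteq> V \<Longrightarrow> \<exists>K\<subseteq>V. \<forall>e\<in>E. odd (card (e \<inter> (K \<union> X))) \<longleftrightarrow>
        e \<in> cluster adj R {e \<in> E. odd (card (e \<inter> (A \<union> X)))}"
    and deg: "\<And>f. f \<in> E \<Longrightarrow> card {e \<in> E. adj f e} \<le> \<Delta>"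
    and r: "card {e \<in> E. \<exists>f\<in>R. adj f e} \<le> r"
  shows "(\<Sum>e\<in>E. cut_sum E w V X e * spin_sum E w V {} - cut_sum E w V {} e * spin_sum E w V X)
    \<le> (ln (spin_sum E w V {} / spin_sum E w V X) + real r * ln 2 + 1) * spin_sum E w V {} * spin_sum E w V X"
proof -
  let ?Zp = "spin_sum E w V {}" and ?Zm = "spin_sum E w V X"
  have w1: "w e \<le> 1" if "e \<in> E" for e
  proof -
    have "w e \<le> exp (-1) / 2 ^ (\<Delta> + 1)" by (rule w(2)[OF that])
    also have "\<dots> \<le> 1 / 1" by (intro frac_le one_le_power) auto
    finally show ?thesis by simp
  qed
  have Zp: "?Zp > 0" and Zm: "?Zm > 0" using spin_sum_pos[OF V] w(1) by blast+
  have bn: "0 \<le> boltzmann E w A" for A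
    using w(1) by (intro boltzmann_nonneg) (auto intro: less_imp_le)
  define S where "S A = {e \<in> E. odd (card (e \<inter> (A \<union> X)))}" for A
  define \<gamma> where "\<gamma> A = cluster adj R (S A)" for A
  define \<C> where "\<C> = \<gamma> ` Pow V"
  have finC: "finite \<C>" using V by (simp add: \<C>_def)
  have CE: "G \<subseteq> E" if "G \<in> \<C>" for G
    using that cluster_subset[of adj R] by (fastforce simp: \<C>_def \<gamma>_def S_def)
  define Zf where "Zf G = (\<Sum>A\<in>{A \<in> Pow V. \<gamma> A = G}. boltzmann E w (A \<union> X))" for G
  define Df where "Df G e = (\<Sum>A\<in>{A \<in> Pow V. \<gamma> A = G}. if odd (card (e \<inter> (A \<union> X))) then boltzmann E w (A \<union> X) else 0)" for G e
  have Zm_split: "?Zm = (\<Sum>G\<in>\<C>. Zf G)"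
    unfolding spin_sum_def \<C>_def Zf_def by (rule sum.image_gen) (use V in simp)
  have Dm_split: "cut_sum E w V X e = (\<Sum>G\<in>\<C>. Df G e)" for e
    unfolding cut_sum_def \<C>_def Df_def by (rule sum.image_gen) (use V in simp)
  \<comment> \<open>Weight 0 forbids unsatisfied edges in the closed neighbourhood of \<open>G\<close>.\<close>
  define wG where "wG G e = (if e \<in> closed_nbhd adj R E G then 0 else w e)" for G e
  define pw where "pw G = (\<Prod>e\<in>G. w e)" for G
  have fib: "Zf G = pw G * spin_sum E (wG G) V {} \<and>
      (\<forall>e\<in>E. Df G e \<le> (if e \<in> G then Zf G else pw G * cut_sum E (wG G) V {} e))" if G: "G \<in> \<C>" for G
  proof -
    let ?W = "closed_nbhd adj R E G"
    obtain A0 where A0: "A0 \<subseteq> V" "G = \<gamma> A0" using G by (auto simp: \<C>_def)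
    obtain K where K: "K \<subseteq> V" "\<And>e. e \<in> E \<Longrightarrow> odd (card (e \<inter> (K \<union> X))) \<longleftrightarrow> e \<in> G"
      using flip[OF A0(1)] A0(2) unfolding \<gamma>_def S_def by blast
    have GW: "G \<subseteq> ?W" using CE[OF G] by (auto simp: closed_nbhd_def)
    define f where "f A = sym_diff A K" for A
    have ff: "f (f A) = A" for A by (auto simp: f_def)
    have fV: "A \<subseteq> V \<Longrightarrow> f A \<subseteq> V" for A using K(1) by (auto simp: f_def)
    have cut: "odd (card (e \<inter> (A \<union> X))) \<longleftrightarrow> odd (card (e \<inter> f A)) \<noteq> (e \<in> G)" if "e \<in> E" "A \<subseteq> V" for e A
    proof -
      have "A \<union> X = sym_diff (f A) (K \<union> X)" using that(2) K(1) X by (auto simp: f_def)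
      thus ?thesis using odd_card_sym_diff[OF E(2)[OF that(1)], of "f A" "K \<union> X"] K(2)[OF that(1)] by simp
    qed
    have Sf: "S A = {e \<in> E. odd (card (e \<inter> f A)) \<noteq> (e \<in> G)}" if "A \<subseteq> V" for A
      unfolding S_def using cut[OF _ that] by blast
    define T where "T = {A' \<in> Pow V. \<forall>e\<in>?W. even (card (e \<inter> A'))}"
    have bij: "bij_betw f {A \<in> Pow V. \<gamma> A = G} T"
    proof (rule bij_betwI[where g = f])
      show "f \<in> {A \<in> Pow V. \<gamma> A = G} \<rightarrow> T"
      proof (rule funcsetI, unfold T_def, intro CollectI conjI ballI)
        fix A assume "A \<in> {A \<in> Pow V. \<gamma> A = G}"
        hence A: "A \<subseteq> V" "\<gamma> A = G" by auto
        show "f A \<in> Pow V" using fV[OF A(1)] by simp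
        fix e assume e: "e \<in> ?W"
        hence eE: "e \<in> E" by (simp add: closed_nbhd_def)
        have "e \<in> S A \<longrightarrow> e \<in> G"
        proof
          assume eS: "e \<in> S A"
          show "e \<in> G"
          proof (cases "e \<in> G")
            case False
            then obtain f where "f \<in> G \<union> R" "adj f e" using e by (auto simp: closed_nbhd_def)
            thus ?thesis using A(2) eS unfolding \<gamma>_def by (blast intro: cluster.intros)
          qed
        qed
        moreover have "e \<in> G \<longrightarrow> e \<in> S A" using A(2) cluster_subset[of adj R "S A"] by (auto simp: \<gamma>_def)
        ultimately show "even (card (e \<inter> f A))" using Sf[OF A(1)] eE by blast
      qed
      show "f \<in> T \<rightarrow> {A \<in> Pow V. \<gamma> A = G}"
      proof (rule funcsetI, intro CollectI conjI)
        fix A' assume A': "A' \<in> T"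
        hence A'V: "A' \<subseteq> V" by (simp add: T_def)
        thus "f A' \<in> Pow V" using fV by simp
        have "S (f A') = {e \<in> E. odd (card (e \<inter> A')) \<noteq> (e \<in> G)}"
          using Sf[OF fV[OF A'V]] ff by simp
        hence "S (f A') \<inter> ?W = G" "S (f A') \<subseteq> E"
          using A' GW CE[OF G] by (auto simp: T_def)
        thus "\<gamma> (f A') = G" unfolding \<gamma>_def
          using cluster_determined[of G adj R "S A0" "S (f A')" E] A0(2) by (simp add: \<gamma>_def)
      qed
    qed (use ff in auto)
    have wt: "boltzmann E w (f A' \<union> X) = pw G * boltzmann E (wG G) A'" if A': "A' \<in> T" for A'
    proof -
      have A'V: "A' \<subseteq> V" using A' by (simp add: T_def)
      have "boltzmann E w (f A' \<union> X) = (\<Prod>e\<in>E. (if e \<in> G then w e else 1) * (if odd (card (e \<inter> A')) then wG G e else 1))"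
        unfolding boltzmann_def
      proof (rule prod.cong[OF refl])
        fix e assume e: "e \<in> E"
        have "e \<in> ?W \<Longrightarrow> even (card (e \<inter> A'))" using A' by (simp add: T_def)
        thus "(if odd (card (e \<inter> (f A' \<union> X))) then w e else 1) =
          (if e \<in> G then w e else 1) * (if odd (card (e \<inter> A')) then wG G e else 1)"
          using cut[OF e fV[OF A'V]] GW ff[of A'] by (auto simp: wG_def)
      qed
      also have "\<dots> = (\<Prod>e\<in>E. if e \<in> G then w e else 1) * boltzmann E (wG G) A'"
        by (simp add: prod.distrib boltzmann_def)
      also have "(\<Prod>e\<in>E. if e \<in> G then w e else 1) = pw G"
        unfolding pw_def using CE[OF G] E(1) by (simp add: prod.If_cases Int_absorb1)
      finally show ?thesis .
    qed
    have zero: "boltzmann E (wG G) A' = 0" if "A' \<in> Pow V - T" for A'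
    proof -
      have "\<exists>e\<in>?W. odd (card (e \<inter> A'))" using that by (simp add: T_def)
      then obtain e where e: "e \<in> ?W" "odd (card (e \<inter> A'))" by blast
      hence "e \<in> E" by (simp add: closed_nbhd_def)
      thus ?thesis unfolding boltzmann_def using e E(1) by (intro prod_zero bexI[of _ e]) (auto simp: wG_def)
    qed
    have TV: "T \<subseteq> Pow V" by (auto simp: T_def)
    have "Zf G = (\<Sum>A'\<in>T. boltzmann E w (f A' \<union> X))"
    proof -
      have "(\<Sum>A\<in>{A \<in> Pow V. \<gamma> A = G}. boltzmann E w (f (f A) \<union> X)) = (\<Sum>A'\<in>T. boltzmann E w (f A' \<union> X))"
        by (rule sum.reindex_bij_betw[OF bij])
      thus ?thesis by (simp add: Zf_def ff)
    qed
    also have "\<dots> = pw G * (\<Sum>A'\<in>T. boltzmann E (wG G) A')" by (simp add: wt sum_distrib_left)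
    also have "(\<Sum>A'\<in>T. boltzmann E (wG G) A') = spin_sum E (wG G) V {}"
      unfolding spin_sum_def using V zero by (intro sum.mono_neutral_cong_left TV) auto
    finally have Z: "Zf G = pw G * spin_sum E (wG G) V {}" .
    have "Df G e \<le> (if e \<in> G then Zf G else pw G * cut_sum E (wG G) V {} e)" if e: "e \<in> E" for e
    proof (cases "e \<in> G")
      case True
      have "Df G e \<le> Zf G" unfolding Df_def Zf_def
        by (rule sum_mono) (simp add: bn)
      thus ?thesis using True by simp
    next
      case False
      have "Df G e = (\<Sum>A'\<in>T. if odd (card (e \<inter> (f A' \<union> X))) then boltzmann E w (f A' \<union> X) else 0)"
      proof -
        have "(\<Sum>A\<in>{A \<in> Pow V. \<gamma> A = G}. if odd (card (e \<inter> (f (f A) \<union> X))) then boltzmann E w (f (f A) \<union> X) else 0)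
          = (\<Sum>A'\<in>T. if odd (card (e \<inter> (f A' \<union> X))) then boltzmann E w (f A' \<union> X) else 0)"
          by (rule sum.reindex_bij_betw[OF bij])
        thus ?thesis unfolding ff Df_def .
      qed
      also have "\<dots> = (\<Sum>A'\<in>T. pw G * (if odd (card (e \<inter> A')) then boltzmann E (wG G) A' else 0))"
      proof (rule sum.cong[OF refl])
        fix A' assume A': "A' \<in> T"
        hence "A' \<subseteq> V" by (simp add: T_def)
        from cut[OF e fV[OF this]] show "(if odd (card (e \<inter> (f A' \<union> X))) then boltzmann E w (f A' \<union> X) else 0) =
          pw G * (if odd (card (e \<inter> A')) then boltzmann E (wG G) A' else 0)"
          using wt[OF A'] False ff[of A'] by simp
      qed
      also have "\<dots> = pw G * (\<Sum>A'\<in>T. if odd (card (e \<inter> A')) then boltzmann E (wG G) A' else 0)"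
        by (simp add: sum_distrib_left)
      also have "(\<Sum>A'\<in>T. if odd (card (e \<inter> A')) then boltzmann E (wG G) A' else 0) = cut_sum E (wG G) V {} e"
        unfolding cut_sum_def using V zero by (intro sum.mono_neutral_cong_left TV) auto
      finally show ?thesis using False by simp
    qed
    thus ?thesis using Z by blast
  qed
  have pw0: "0 \<le> pw G" if "G \<in> \<C>" for G
    unfolding pw_def using CE[OF that] w(1) by (intro prod_nonneg) (auto intro: less_imp_le)
  have wGb: "0 \<le> wG G e" "wG G e \<le> w e" if "e \<in> E" for G e
    using w(1)[OF that] by (auto simp: wG_def)
  have Zf0: "0 \<le> Zf G" for G
    unfolding Zf_def by (intro sum_nonneg bn)
  have D: "Df G e * ?Zp \<le> (if e \<in> G then Zf G * ?Zp else 0) + cut_sum E w V {} e * Zf G" if G: "G \<in> \<C>" and e: "e \<in> E" for G e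
  proof (cases "e \<in> G")
    case True
    have "0 \<le> cut_sum E w V {} e" unfolding cut_sum_def
      by (intro sum_nonneg) (simp add: bn)
    hence "0 \<le> cut_sum E w V {} e * Zf G" using Zf0 by simp
    moreover have "Df G e * ?Zp \<le> Zf G * ?Zp"
      using conjunct2[OF fib[OF G]] e True Zp by (intro mult_right_mono) auto
    ultimately show ?thesis using True by simp
  next
    case False
    have "cut_sum E (wG G) V {} e * ?Zp \<le> cut_sum E w V {} e * spin_sum E (wG G) V {}"
      by (rule cut_sum_comparison) (use V E e wGb w1 in auto)
    hence "pw G * (cut_sum E (wG G) V {} e * ?Zp) \<le> pw G * (cut_sum E w V {} e * spin_sum E (wG G) V {})"
      by (intro mult_left_mono pw0 G)
    moreover have "Df G e * ?Zp \<le> pw G * cut_sum E (wG G) V {} e * ?Zp"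
      using conjunct2[OF fib[OF G]] e False Zp by (intro mult_right_mono) auto
    ultimately show ?thesis using False conjunct1[OF fib[OF G]] by (simp add: mult_ac)
  qed
  have "(\<Sum>e\<in>E. cut_sum E w V X e * ?Zp - cut_sum E w V {} e * ?Zm)
     \<le> (\<Sum>e\<in>E. \<Sum>G\<in>\<C>. if e \<in> G then Zf G * ?Zp else 0)"
  proof (rule sum_mono)
    fix e assume e: "e \<in> E"
    have "cut_sum E w V X e * ?Zp = (\<Sum>G\<in>\<C>. Df G e * ?Zp)" by (simp add: Dm_split sum_distrib_right)
    also have "\<dots> \<le> (\<Sum>G\<in>\<C>. (if e \<in> G then Zf G * ?Zp else 0) + cut_sum E w V {} e * Zf G)"
      by (rule sum_mono) (rule D[OF _ e])
    also have "\<dots> = (\<Sum>G\<in>\<C>. if e \<in> G then Zf G * ?Zp else 0) + cut_sum E w V {} e * ?Zm"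
      by (simp add: sum.distrib Zm_split sum_distrib_left)
    finally show "cut_sum E w V X e * ?Zp - cut_sum E w V {} e * ?Zm \<le> (\<Sum>G\<in>\<C>. if e \<in> G then Zf G * ?Zp else 0)"
      by simp
  qed
  also have "\<dots> = (\<Sum>G\<in>\<C>. \<Sum>e\<in>E. if e \<in> G then Zf G * ?Zp else 0)" by (rule sum.swap)
  also have "\<dots> = (\<Sum>G\<in>\<C>. real (card G) * Zf G * ?Zp)"
  proof (rule sum.cong[OF refl])
    fix G assume "G \<in> \<C>"
    from CE[OF this] show "(\<Sum>e\<in>E. if e \<in> G then Zf G * ?Zp else 0) = real (card G) * Zf G * ?Zp"
      using E(1) by (simp add: sum.If_cases Int_absorb1)
  qed
  also have "\<dots> = ?Zp * (\<Sum>G\<in>\<C>. real (card G) * Zf G)" by (simp add: sum_distrib_left mult_ac)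
  also have "\<dots> \<le> ?Zp * ((ln (?Zp / ?Zm) + real r * ln 2 + 1) * ?Zm)"
  proof (rule mult_left_mono)
    \<comment> \<open>Jensen's inequality in the form \<open>x \<le> a + exp (x - a)\<close>, with \<open>a\<close> the logarithm of the
      bound on the exponential moment.\<close>
    define a where "a = ln (?Zp / ?Zm) + real r * ln 2"
    have ea: "exp a * ?Zm = 2 ^ r * ?Zp"
      using Zp Zm by (simp add: a_def exp_add exp_of_nat_mult[of r "ln 2"])
    have "(\<Sum>G\<in>\<C>. exp (real (card G)) * Zf G) \<le> (\<Sum>G\<in>\<C>. (1 / 2 ^ (\<Delta> + 1)) ^ card G * ?Zp)"
    proof (rule sum_mono)
      fix G assume G: "G \<in> \<C>"
      have "pw G \<le> (\<Prod>e\<in>G. exp (-1) / 2 ^ (\<Delta> + 1))"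
        unfolding pw_def by (rule prod_mono) (use CE[OF G] w in \<open>auto intro: less_imp_le\<close>)
      hence "pw G \<le> (exp (-1) / 2 ^ (\<Delta> + 1)) ^ card G" by simp
      moreover have "spin_sum E (wG G) V {} \<le> ?Zp" by (rule spin_sum_mono[OF wGb])
      moreover have "0 \<le> spin_sum E (wG G) V {}" by (rule spin_sum_nonneg[OF wGb(1)])
      ultimately have "Zf G \<le> (exp (-1) / 2 ^ (\<Delta> + 1)) ^ card G * ?Zp"
        using conjunct1[OF fib[OF G]] by (simp only:) (intro mult_mono; simp)
      hence "exp (real (card G)) * Zf G \<le> exp (real (card G)) * ((exp (-1) / 2 ^ (\<Delta> + 1)) ^ card G * ?Zp)"
        by (intro mult_left_mono) auto
      also have "\<dots> = (exp 1 * (exp (-1) / 2 ^ (\<Delta> + 1))) ^ card G * ?Zp"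
      proof -
        have "exp (real (card G)) = exp 1 ^ card G" using exp_of_nat_mult[of "card G" "1::real"] by simp
        thus ?thesis by (simp only: power_mult_distrib mult.assoc)
      qed
      also have "exp 1 * (exp (-1) / 2 ^ (\<Delta> + 1)) = (1::real) / 2 ^ (\<Delta> + 1)"
        by (simp add: exp_minus)
      finally show "exp (real (card G)) * Zf G \<le> (1 / 2 ^ (\<Delta> + 1)) ^ card G * ?Zp" .
    qed
    also have "\<dots> = (\<Sum>G\<in>\<C>. (1 / 2 ^ (\<Delta> + 1)) ^ card G) * ?Zp" by (simp add: sum_distrib_right)
    also have "\<dots> \<le> 2 ^ r * ?Zp"
    proof (rule mult_right_mono)
      show "(\<Sum>G\<in>\<C>. (1 / 2 ^ (\<Delta> + 1)) ^ card G) \<le> (2::real) ^ r"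
        by (rule sum_cluster_weights[OF E(1) _ deg r]) (auto simp: \<C>_def \<gamma>_def S_def)
    qed (use Zp in simp)
    finally have ex: "(\<Sum>G\<in>\<C>. exp (real (card G)) * Zf G) \<le> exp a * ?Zm" unfolding ea .
    have "(\<Sum>G\<in>\<C>. real (card G) * Zf G) \<le> (\<Sum>G\<in>\<C>. a * Zf G + exp (- a) * (exp (real (card G)) * Zf G))"
    proof (rule sum_mono)
      fix G :: "'a set set"
      have "1 + (real (card G) - a) \<le> exp (real (card G) - a)" by (rule exp_ge_add_one_self)
      hence "real (card G) \<le> a + exp (- a) * exp (real (card G))"
        by (simp add: exp_add[symmetric] algebra_simps)
      from mult_right_mono[OF this Zf0[of G]]
      show "real (card G) * Zf G \<le> a * Zf G + exp (- a) * (exp (real (card G)) * Zf G)"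
        by (simp add: algebra_simps)
    qed
    also have "\<dots> = a * ?Zm + exp (- a) * (\<Sum>G\<in>\<C>. exp (real (card G)) * Zf G)"
      by (simp add: sum.distrib Zm_split sum_distrib_left)
    also have "\<dots> \<le> a * ?Zm + exp (- a) * (exp a * ?Zm)"
      using ex by (intro add_left_mono mult_left_mono) auto
    also have "\<dots> = (a + 1) * ?Zm" by (simp add: exp_minus algebra_simps)
    finally show "(\<Sum>G\<in>\<C>. real (card G) * Zf G) \<le> (ln (?Zp / ?Zm) + real r * ln 2 + 1) * ?Zm"
      by (simp add: a_def)
  qed (use Zp in simp)
  finally show ?thesis by (simp add: mult_ac)
qed

section \<open>Surface tension as a ratio of Ising sums\<close>

definition box_lattice :: "real ^ 'd \<Rightarrow> (real ^ 'd) set \<Rightarrow> real \<Rightarrow> real \<Rightarrow> (real ^ 'd) set" where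
  "box_lattice n B L H = open_box n B 0 L H \<inter> int_lattice"

text \<open>The spins in the core are free; those of the boundary vertices are frozen by the boundary
  condition.\<close>

definition core :: "(real ^ 'd) set \<Rightarrow> (real ^ 'd) set" where
  "core \<Lambda> = \<Lambda> - lattice_boundary \<Lambda>"

text \<open>\<open>ln (Z\<^sub>+ / Z\<^sub>\<plusminus>)\<close> for the mixed boundary condition that is minus on the lower part of the
  boundary.\<close>

definition spin_tension :: "real \<Rightarrow> ((real ^ 'd) set \<Rightarrow> real) \<Rightarrow> real ^ 'd \<Rightarrow> (real ^ 'd) set \<Rightarrow> real" where
  "spin_tension \<beta> J n \<Lambda> =
     ln (spin_sum (edges \<Lambda>) (\<lambda>e. exp (- \<beta> * J e)) (core \<Lambda>) {} /
         spin_sum (edges \<Lambda>) (\<lambda>e. exp (- \<beta> * J e)) (core \<Lambda>) (lower_boundary 0 n \<Lambda>))"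

lemma core_neighbour:
  assumes "x \<in> core \<Lambda>" "y \<in> int_lattice" "dist x y = 1"
  shows "y \<in> \<Lambda>"
  using assms by (auto simp: core_def lattice_boundary_def dist_commute)

lemma core_subset: "core \<Lambda> \<subseteq> \<Lambda>" by (auto simp: core_def)

lemma boundary_split: "upper_boundary x n \<Lambda> \<union> lower_boundary x n \<Lambda> = lattice_boundary \<Lambda>"
  "upper_boundary x n \<Lambda> \<inter> lower_boundary x n \<Lambda> = {}"
  by (auto simp: upper_boundary_def lower_boundary_def)

lemma lower_core_disjoint: "lower_boundary x n \<Lambda> \<inter> core \<Lambda> = {}"
  by (auto simp: lower_boundary_def core_def)

lemma edge_meets_core:
  assumes "e \<in> edges int_lattice" "e \<inter> core \<Lambda> \<noteq> {}"
  shows "e \<in> edges \<Lambda>"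
proof -
  obtain x y where e: "e = {x, y}" "x \<in> int_lattice" "y \<in> int_lattice" "dist x y = 1"
    using assms(1) by (blast elim: edgesE)
  have "x \<in> \<Lambda> \<and> y \<in> \<Lambda>"
    using assms(2) e core_neighbour[of x \<Lambda> y] core_neighbour[of y \<Lambda> x] core_subset[of \<Lambda>]
    by (auto simp: dist_commute)
  thus ?thesis using e by (simp add: pair_in_edges)
qed

lemma graph_edges_edges: "graph_edges (edges \<Lambda>)"
  unfolding graph_edges_def by (blast elim: edgesE)

context
  fixes n :: "real ^ 'd" and B :: "(real ^ 'd) set" and L H :: real and \<Lambda> :: "(real ^ 'd) set"
  assumes fr: "frame n B" and d2: "CARD('d) \<ge> 2" and L0: "L > 0" and H0: "H > 0"
    and \<Lambda>: "\<Lambda> = box_lattice n B L H"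
begin

lemma box_sub_lattice: "\<Lambda> \<subseteq> int_lattice" by (simp add: \<Lambda> box_lattice_def)

lemma box_bounds:
  assumes "x \<in> \<Lambda>"
  shows "u \<in> B \<Longrightarrow> \<bar>x \<bullet> u\<bar> < L / 2" "\<bar>x \<bullet> n\<bar> < H"
  using assms by (auto simp: \<Lambda> box_lattice_def open_box_def)

lemma box_finite: "finite \<Lambda>"
proof (rule lattice_points_bound(1)[OF fr])
  show "- (if u = n then H else L) \<le> (if u = n then H else L)" for u using L0 H0 by simp
  fix x u assume x: "x \<in> \<Lambda>" and u: "u \<in> insert n B"
  show "- (if u = n then H else L) \<le> x \<bullet> u \<and> x \<bullet> u \<le> (if u = n then H else L)"
    using box_bounds(1)[OF x, of u] box_bounds(2)[OF x] u L0 by (auto simp: abs_less_iff)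
qed (rule box_sub_lattice)

text \<open>Both vertices have neighbours outside the box, and the complement of the box is
  connected.\<close>

lemma boundary_wired:
  assumes "x \<in> lattice_boundary \<Lambda>" "y \<in> lattice_boundary \<Lambda>"
  shows "(x, y) \<in> connections (wired (edges \<Lambda>))"
proof -
  obtain x' y' where xy: "x' \<in> int_lattice" "x' \<notin> \<Lambda>" "dist x' x = 1" "x \<in> \<Lambda>"
     "y' \<in> int_lattice" "y' \<notin> \<Lambda>" "dist y' y = 1" "y \<in> \<Lambda>"
    using assms by (auto simp: lattice_boundary_def)
  have "{x, x'} \<in> wired (edges \<Lambda>)" "{y', y} \<in> wired (edges \<Lambda>)"
    using xy box_sub_lattice by (auto simp: wired_def pair_in_edges dist_commute)
  moreover have "(x', y') \<in> connections {e \<in> edges int_lattice. e \<inter> open_box n B 0 L H = {}}"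
    by (rule box_complement_connected[OF fr d2]) (use xy in \<open>auto simp: \<Lambda> box_lattice_def\<close>)
  moreover have "{e \<in> edges int_lattice. e \<inter> open_box n B 0 L H = {}} \<subseteq> wired (edges \<Lambda>)"
  proof
    fix e assume e: "e \<in> {e \<in> edges int_lattice. e \<inter> open_box n B 0 L H = {}}"
    moreover have "e \<notin> edges \<Lambda>"
    proof
      assume "e \<in> edges \<Lambda>"
      then obtain a b where "e = {a, b}" "a \<in> \<Lambda>" by (rule edgesE)
      thus False using e by (auto simp: \<Lambda> box_lattice_def)
    qed
    ultimately show "e \<in> wired (edges \<Lambda>)" by (simp add: wired_def)
  qed
  ultimately show ?thesis
    using connections_trans connections_edge connections_mono by (meson subsetD)
qed

lemma wired_meets_boundary:
  assumes "e \<in> wired (edges \<Lambda>)"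
  shows "e \<inter> \<Lambda> \<subseteq> lattice_boundary \<Lambda>"
  using assms edge_meets_core[of e \<Lambda>] by (auto simp: wired_def core_def)

lemma core_in_edges: "\<Union>(edges \<Lambda>) - lattice_boundary \<Lambda> = core \<Lambda>"
proof
  show "\<Union>(edges \<Lambda>) - lattice_boundary \<Lambda> \<subseteq> core \<Lambda>" using edges_subset by (fastforce simp: core_def)
  show "core \<Lambda> \<subseteq> \<Union>(edges \<Lambda>) - lattice_boundary \<Lambda>"
  proof
    fix x assume x: "x \<in> core \<Lambda>"
    hence xL: "x \<in> \<Lambda>" using core_subset by auto
    have y: "x + axis undefined 1 \<in> int_lattice"
      using xL box_sub_lattice by (intro int_lattice_add axis_in_int_lattice) auto
    have "x + axis undefined 1 \<in> \<Lambda>" by (rule core_neighbour[OF x y dist_axis(1)])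
    hence "{x, x + axis undefined 1} \<in> edges \<Lambda>" using xL by (simp add: pair_in_edges dist_axis)
    thus "x \<in> \<Union>(edges \<Lambda>) - lattice_boundary \<Lambda>" using x by (auto simp: core_def)
  qed
qed

lemma disconnection_prob:
  "rc_prob 2 \<beta> (edges \<Lambda>) (wired (edges \<Lambda>)) J (disconnection 0 n \<Lambda>) =
     spin_sum (edges \<Lambda>) (\<lambda>e. exp (- \<beta> * J e)) (core \<Lambda>) (lower_boundary 0 n \<Lambda>) /
     spin_sum (edges \<Lambda>) (\<lambda>e. exp (- \<beta> * J e)) (core \<Lambda>) {}"
proof -
  have "rc_prob 2 \<beta> (edges \<Lambda>) (wired (edges \<Lambda>)) J {\<omega>. \<omega> \<subseteq> edges \<Lambda> \<and>
     (\<forall>y\<in>upper_boundary 0 n \<Lambda>. \<forall>z\<in>lower_boundary 0 n \<Lambda>. (y, z) \<notin> connections \<omega>)} =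
     spin_sum (edges \<Lambda>) (\<lambda>e. exp (- \<beta> * J e)) (\<Union>(edges \<Lambda>) - (upper_boundary 0 n \<Lambda> \<union> lower_boundary 0 n \<Lambda>)) (lower_boundary 0 n \<Lambda>) /
     spin_sum (edges \<Lambda>) (\<lambda>e. exp (- \<beta> * J e)) (\<Union>(edges \<Lambda>) - (upper_boundary 0 n \<Lambda> \<union> lower_boundary 0 n \<Lambda>)) {}"
  proof (rule edwards_sokal[OF finite_edges[OF box_finite] graph_edges_edges boundary_split(2)])
    show "e \<inter> \<Union>(edges \<Lambda>) \<subseteq> upper_boundary 0 n \<Lambda> \<union> lower_boundary 0 n \<Lambda>" if "e \<in> wired (edges \<Lambda>)" for e
      using wired_meets_boundary[OF that] edges_subset unfolding boundary_split by blast
    show "(x, y) \<in> connections (wired (edges \<Lambda>))"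
      if "x \<in> (upper_boundary 0 n \<Lambda> \<union> lower_boundary 0 n \<Lambda>) \<inter> \<Union>(edges \<Lambda>)"
         "y \<in> (upper_boundary 0 n \<Lambda> \<union> lower_boundary 0 n \<Lambda>) \<inter> \<Union>(edges \<Lambda>)" for x y
      using that boundary_wired unfolding boundary_split by blast
  qed
  thus ?thesis unfolding boundary_split core_in_edges disconnection_def .
qed

lemma rect_tension_spin:
  assumes S: "S = {\<Sum>u\<in>B. t u *\<^sub>R u | t. \<forall>u\<in>B. t u \<in> {-1/2..1/2}}"
  shows "rect_tension 2 \<beta> J 0 L H S n = spin_tension \<beta> J n \<Lambda> / L ^ (CARD('d) - 1)"
proof -
  have L: "lattice_interior (rect 0 L H S n) = \<Lambda>"
    unfolding lattice_interior_def S interior_rect[OF fr L0 H0] \<Lambda> box_lattice_def ..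
  have pos: "spin_sum (edges \<Lambda>) (\<lambda>e. exp (- \<beta> * J e)) (core \<Lambda>) X > 0" for X
    by (rule spin_sum_pos) (use box_finite in \<open>auto simp: core_def\<close>)
  have lnd: "ln (spin_sum (edges \<Lambda>) (\<lambda>e. exp (- \<beta> * J e)) (core \<Lambda>) X / spin_sum (edges \<Lambda>) (\<lambda>e. exp (- \<beta> * J e)) (core \<Lambda>) Y)
    = ln (spin_sum (edges \<Lambda>) (\<lambda>e. exp (- \<beta> * J e)) (core \<Lambda>) X) - ln (spin_sum (edges \<Lambda>) (\<lambda>e. exp (- \<beta> * J e)) (core \<Lambda>) Y)" for X Y
    using pos[of X] pos[of Y] by (subst ln_div) auto
  show ?thesis
    unfolding rect_tension_def Let_def L disconnection_prob spin_tension_def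
      lnd by (simp add: diff_divide_distrib)
qed

lemma spin_tension_nonneg:
  assumes "\<And>e. e \<in> edges \<Lambda> \<Longrightarrow> 0 \<le> \<beta> * J e"
  shows "0 \<le> spin_tension \<beta> J n \<Lambda>"
proof -
  let ?E = "edges \<Lambda>" and ?w = "\<lambda>e. exp (- \<beta> * J e)"
  let ?Zm = "spin_sum ?E ?w (core \<Lambda>) (lower_boundary 0 n \<Lambda>)" and ?Zp = "spin_sum ?E ?w (core \<Lambda>) {}"
  have pos: "spin_sum ?E ?w (core \<Lambda>) X > 0" for X
    by (rule spin_sum_pos) (use box_finite in \<open>auto simp: core_def\<close>)
  have "rc_prob 2 \<beta> ?E (wired ?E) J (disconnection 0 n \<Lambda>) \<le> 1"
  proof -
    have w0: "0 \<le> rc_weight 2 \<beta> ?E (wired ?E) J \<omega>" for \<omega>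
      unfolding rc_weight_def edge_prob_def
      using assms by (intro mult_nonneg_nonneg prod_nonneg) (auto simp: mult_nonneg_nonneg)
    have "(\<Sum>\<omega>\<in>Pow ?E \<inter> disconnection 0 n \<Lambda>. rc_weight 2 \<beta> ?E (wired ?E) J \<omega>)
       \<le> (\<Sum>\<omega>\<in>Pow ?E. rc_weight 2 \<beta> ?E (wired ?E) J \<omega>)"
      by (rule sum_mono2) (use w0 finite_edges[OF box_finite] in auto)
    thus ?thesis unfolding rc_prob_def
      using sum_nonneg[of "Pow ?E" "rc_weight 2 \<beta> ?E (wired ?E) J"] w0
      by (metis divide_le_eq_1 divide_eq_0_iff less_eq_real_def zero_le_one)
  qed
  hence "?Zm / ?Zp \<le> 1" unfolding disconnection_prob .
  hence "?Zm \<le> ?Zp" using pos[of "{}"] by simp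
  thus ?thesis unfolding spin_tension_def using pos by (simp add: le_divide_eq)
qed

end

section \<open>Plaquettes\<close>

definition plaquette :: "real ^ 'd \<Rightarrow> 'd \<Rightarrow> 'd \<Rightarrow> (real ^ 'd) set set" where
  "plaquette x i j = {{x, x + axis i 1}, {x + axis j 1, x + axis j 1 + axis i 1},
     {x, x + axis j 1}, {x + axis i 1, x + axis i 1 + axis j 1}}"

text \<open>Edges on a common plaquette; the dual faces of such edges share a cell of codimension 2.\<close>

definition star_adj :: "(real ^ 'd) set \<Rightarrow> (real ^ 'd) set \<Rightarrow> bool" where
  "star_adj e f \<longleftrightarrow> (\<exists>x i j. x \<in> int_lattice \<and> i \<noteq> j \<and> e \<in> plaquette x i j \<and> f \<in> plaquette x i j)"

lemma plaquette_vertex: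
  assumes "e \<in> plaquette x i j" "y \<in> e"
  obtains a b where "a \<in> {0, 1::real}" "b \<in> {0, 1::real}" "y = x + a *\<^sub>R axis i 1 + b *\<^sub>R axis j 1"
proof -
  have "y = x + 0 *\<^sub>R axis i 1 + 0 *\<^sub>R axis j 1 \<or> y = x + 1 *\<^sub>R axis i 1 + 0 *\<^sub>R axis j 1 \<or>
     y = x + 0 *\<^sub>R axis i 1 + 1 *\<^sub>R axis j 1 \<or> y = x + 1 *\<^sub>R axis i 1 + 1 *\<^sub>R axis j 1"
    using assms by (auto simp: plaquette_def algebra_simps)
  thus ?thesis using that by (metis insertI1 insertI2)
qed

lemma star_adj_close:
  assumes "star_adj e f" "y \<in> e" "z \<in> f"
  shows "norm (y - z) \<le> 2"
proof -
  obtain x i j where p: "e \<in> plaquette x i j" "f \<in> plaquette x i j" using assms(1) by (auto simp: star_adj_def)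
  obtain a b where y: "a \<in> {0, 1::real}" "b \<in> {0, 1::real}" "y = x + a *\<^sub>R axis i 1 + b *\<^sub>R axis j 1"
    by (rule plaquette_vertex[OF p(1) assms(2)])
  obtain a' b' where z: "a' \<in> {0, 1::real}" "b' \<in> {0, 1::real}" "z = x + a' *\<^sub>R axis i 1 + b' *\<^sub>R axis j 1"
    by (rule plaquette_vertex[OF p(2) assms(3)])
  have "y - z = (a - a') *\<^sub>R axis i 1 + (b - b') *\<^sub>R axis j 1" by (simp add: y z algebra_simps)
  also have "norm \<dots> \<le> norm ((a - a') *\<^sub>R axis i (1::real)) + norm ((b - b') *\<^sub>R axis j (1::real))"
    by (rule norm_triangle_ineq)
  also have "\<dots> = \<bar>a - a'\<bar> + \<bar>b - b'\<bar>" by simp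
  also have "\<dots> \<le> 2" using y(1,2) z(1,2) by auto
  finally show ?thesis .
qed

text \<open>The unsatisfied edges of a configuration \<open>M\<close> meet every plaquette in an even number. A
  set \<open>\<Gamma>\<close> of them that is closed under star-adjacency contains all or none of those on a
  plaquette, so it is a closed cochain and hence the set of unsatisfied edges of another
  configuration.\<close>

lemma cochain_cut:
  fixes M :: "(real ^ 'd) set" and \<Gamma> :: "(real ^ 'd) set set"
  assumes sub: "\<And>e. e \<in> \<Gamma> \<Longrightarrow> e \<in> edges int_lattice \<and> odd (card (e \<inter> M))"
    and closed: "\<And>e f. e \<in> \<Gamma> \<Longrightarrow> f \<in> edges int_lattice \<Longrightarrow> odd (card (f \<inter> M)) \<Longrightarrow> star_adj e f \<Longrightarrow> f \<in> \<Gamma>"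
  obtains K where "\<And>e. e \<in> edges int_lattice \<Longrightarrow> odd (card (e \<inter> K)) \<longleftrightarrow> e \<in> \<Gamma>"
proof -
  define c where "c x i \<longleftrightarrow> {x, x + axis i 1} \<in> \<Gamma>" for x :: "real ^ 'd" and i
  have ed: "{x, x + axis i 1} \<in> edges int_lattice" if "x \<in> int_lattice" for x :: "real ^ 'd" and i
    using that by (simp add: pair_in_edges dist_axis int_lattice_add axis_in_int_lattice)
  have ne: "x \<noteq> x + axis i (1::real)" for x and i :: 'd by simp
  have "(c x i \<noteq> c (x + axis j 1) i) \<longleftrightarrow> (c x j \<noteq> c (x + axis i 1) j)"
    if x: "x \<in> int_lattice" and ij: "i \<noteq> j" for x i j
  proof (cases "plaquette x i j \<inter> \<Gamma> = {}")
    case True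
    thus ?thesis unfolding c_def plaquette_def by blast
  next
    case False
    then obtain f where f: "f \<in> plaquette x i j" "f \<in> \<Gamma>" by auto
    have xi: "x + axis i 1 \<in> int_lattice" "x + axis j 1 \<in> int_lattice"
      using x by (auto intro: int_lattice_add axis_in_int_lattice)
    have *: "e \<in> \<Gamma> \<longleftrightarrow> odd (card (e \<inter> M))" if "e \<in> plaquette x i j" for e
    proof -
      have "e \<in> edges int_lattice" using that ed x xi by (auto simp: plaquette_def)
      moreover have "star_adj f e" using f that x ij by (auto simp: star_adj_def)
      ultimately show ?thesis using closed[OF f(2)] sub by blast
    qed
    have pl: "{x, x + axis i 1} \<in> plaquette x i j" "{x + axis j 1, x + axis j 1 + axis i 1} \<in> plaquette x i j"
       "{x, x + axis j 1} \<in> plaquette x i j" "{x + axis i 1, x + axis i 1 + axis j 1} \<in> plaquette x i j"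
      by (simp_all add: plaquette_def)
    have e: "x + axis j 1 + axis i 1 = x + axis i 1 + axis j 1" by (simp add: algebra_simps)
    show ?thesis unfolding c_def
      unfolding *[OF pl(1)] *[OF pl(2)] *[OF pl(3)] *[OF pl(4)] odd_card_pair[OF ne] unfolding e by blast
  qed
  from closed_cochain_exact[of c, OF this] obtain \<kappa> :: "real ^ 'd \<Rightarrow> bool"
    where \<kappa>: "\<And>x i. x \<in> int_lattice \<Longrightarrow> c x i \<longleftrightarrow> \<kappa> x \<noteq> \<kappa> (x + axis i 1)" by blast
  show ?thesis
  proof (rule that[of "{x. \<kappa> x}"])
    fix e :: "(real ^ 'd) set" assume "e \<in> edges int_lattice"
    then obtain x y where xy: "e = {x, y}" "x \<in> int_lattice" "y \<in> int_lattice" "dist x y = 1" by (rule edgesE)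
    obtain i where "y = x + axis i 1 \<or> x = y + axis i 1" by (rule lattice_neighbour[OF xy(2-4)])
    then obtain v where v: "v \<in> int_lattice" "e = {v, v + axis i 1}" using xy by (auto simp: insert_commute)
    show "odd (card (e \<inter> {x. \<kappa> x})) \<longleftrightarrow> e \<in> \<Gamma>"
      using \<kappa>[OF v(1), of i] unfolding v(2) odd_card_pair[OF ne] c_def by simp
  qed
qed

section \<open>Interfaces in a box\<close>

text \<open>Bounds the number of edges that are star-adjacent to a given one.\<close>

definition degree_bound :: "nat \<Rightarrow> nat" where "degree_bound d = 2 * d * (4 + 2 * d) ^ d"

context
  fixes n :: "real ^ 'd" and B :: "(real ^ 'd) set" and L H :: real and \<Lambda> :: "(real ^ 'd) set"
  assumes fr: "frame n B" and d2: "CARD('d) \<ge> 2" and L0: "L > 0" and H0: "H > 0"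
    and \<Lambda>: "\<Lambda> = box_lattice n B L H"
begin

text \<open>The unsatisfied edges that do not belong to the box, when the lower half-space is minus.
  They are the roots of the interface.\<close>

definition outer_cut :: "(real ^ 'd) set set" where
  "outer_cut = {e \<in> edges int_lattice - edges \<Lambda>. odd (card (e \<inter> {x. x \<bullet> n < 0}))}"

text \<open>The configuration is continued to the whole lattice by minus in the lower half-space. The
  interface together with the outer cut is then a union of star-components of unsatisfied edges,
  hence itself the set of unsatisfied edges of some \<open>K\<close>. It remains to arrange that \<open>K\<close>
  satisfies the boundary condition.\<close>

lemma interface_flip:
  assumes A: "A \<subseteq> core \<Lambda>"
  shows "\<exists>K\<subseteq>core \<Lambda>. \<forall>e\<in>edges \<Lambda>. odd (card (e \<inter> (K \<union> lower_boundary 0 n \<Lambda>))) \<longleftrightarrow>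
     e \<in> cluster star_adj outer_cut {e \<in> edges \<Lambda>. odd (card (e \<inter> (A \<union> lower_boundary 0 n \<Lambda>)))}"
proof -
  let ?X = "lower_boundary 0 n \<Lambda>" and ?E = "edges \<Lambda>"
  let ?S = "{e \<in> ?E. odd (card (e \<inter> (A \<union> ?X)))}"
  let ?G = "cluster star_adj outer_cut ?S"
  define M where "M = A \<union> ({x. x \<bullet> n < 0} - core \<Lambda>)"
  define \<Gamma> where "\<Gamma> = outer_cut \<union> ?G"
  note sl = box_sub_lattice[OF fr d2 L0 H0 \<Lambda>]
  have EI: "?E \<subseteq> edges int_lattice" by (rule edges_mono[OF sl])
  have Min: "e \<inter> M = e \<inter> (A \<union> ?X)" if "e \<in> ?E" for e
    using edges_subset[OF that] A by (auto simp: M_def core_def lower_boundary_def)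
  have Mout: "e \<inter> M = e \<inter> {x. x \<bullet> n < 0}" if "e \<in> edges int_lattice - ?E" for e
    using edge_meets_core[of e \<Lambda>] that A by (auto simp: M_def)
  have GS: "?G \<subseteq> ?S" by (rule cluster_subset)
  obtain K where K: "\<And>e. e \<in> edges int_lattice \<Longrightarrow> odd (card (e \<inter> K)) \<longleftrightarrow> e \<in> \<Gamma>"
  proof (rule cochain_cut[of \<Gamma> M])
    fix e assume e: "e \<in> \<Gamma>"
    show "e \<in> edges int_lattice \<and> odd (card (e \<inter> M))"
    proof (cases "e \<in> outer_cut")
      case True
      thus ?thesis using Mout[of e] by (auto simp: outer_cut_def)
    next
      case False
      hence "e \<in> ?S" using e GS by (auto simp: \<Gamma>_def)
      thus ?thesis using Min[of e] EI by auto
    qed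
  next
    fix e f assume e: "e \<in> \<Gamma>" and f: "f \<in> edges int_lattice" "odd (card (f \<inter> M))" "star_adj e f"
    show "f \<in> \<Gamma>"
    proof (cases "f \<in> ?E")
      case True
      hence "f \<in> ?S" using f(2) Min[OF True] by auto
      thus ?thesis using e f(3) by (auto simp: \<Gamma>_def intro: cluster.intros)
    next
      case False
      thus ?thesis using f Mout[of f] by (auto simp: \<Gamma>_def outer_cut_def)
    qed
  qed blast
  \<comment> \<open>Outside the box \<open>M\<close> and \<open>K\<close> have the same unsatisfied edges, and the edges outside the box
    connect all boundary vertices; so on the boundary \<open>M\<close> and \<open>K\<close> are equal or opposite. In
    the second case \<open>K\<close> is replaced by its complement.\<close>
  have par: "x \<in> sym_diff M K \<longleftrightarrow> y \<in> sym_diff M K"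
    if "x \<in> lattice_boundary \<Lambda>" "y \<in> lattice_boundary \<Lambda>" for x y
  proof (rule compatible_connections[OF _ boundary_wired[OF fr d2 L0 H0 \<Lambda> that]])
    show "compatible (wired ?E) (sym_diff M K)"
      unfolding compatible_def
    proof
      fix e assume e: "e \<in> wired ?E"
      hence e': "e \<in> edges int_lattice" "e \<notin> ?E" by (auto simp: wired_def)
      have "odd (card (e \<inter> M)) \<longleftrightarrow> e \<in> outer_cut" using Mout[of e] e' by (simp add: outer_cut_def)
      moreover have "e \<in> \<Gamma> \<longleftrightarrow> e \<in> outer_cut" using e' GS by (auto simp: \<Gamma>_def)
      ultimately show "even (card (e \<inter> sym_diff M K))"
        using odd_card_sym_diff[OF edge_finite[OF e'(1)], of M K] K[OF e'(1)] by blast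
    qed
  qed
  have "\<exists>K'. (\<forall>e\<in>edges int_lattice. odd (card (e \<inter> K')) \<longleftrightarrow> e \<in> \<Gamma>) \<and> K' \<inter> lattice_boundary \<Lambda> = M \<inter> lattice_boundary \<Lambda>"
  proof (cases "sym_diff M K \<inter> lattice_boundary \<Lambda> = {}")
    case True
    hence "K \<inter> lattice_boundary \<Lambda> = M \<inter> lattice_boundary \<Lambda>" by blast
    thus ?thesis using K by blast
  next
    case False
    then obtain y where y: "y \<in> sym_diff M K" "y \<in> lattice_boundary \<Lambda>" by blast
    have all: "x \<in> sym_diff M K" if "x \<in> lattice_boundary \<Lambda>" for x using par[OF that y(2)] y(1) by simp
    have "odd (card (e \<inter> - K)) \<longleftrightarrow> e \<in> \<Gamma>" if e: "e \<in> edges int_lattice" for e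
    proof -
      obtain a b where ab: "e = {a, b}" "a \<noteq> b" using e by (blast elim: edgesE)
      show ?thesis using K[OF e] unfolding ab(1) odd_card_pair[OF ab(2)] by blast
    qed
    moreover have "- K \<inter> lattice_boundary \<Lambda> = M \<inter> lattice_boundary \<Lambda>" using all by blast
    ultimately show ?thesis by blast
  qed
  then obtain K' where K': "\<And>e. e \<in> edges int_lattice \<Longrightarrow> odd (card (e \<inter> K')) \<longleftrightarrow> e \<in> \<Gamma>"
     "K' \<inter> lattice_boundary \<Lambda> = M \<inter> lattice_boundary \<Lambda>" by blast
  have MX: "M \<inter> lattice_boundary \<Lambda> = ?X"
    using A by (auto simp: M_def lower_boundary_def core_def lattice_boundary_def)
  show ?thesis
  proof (intro exI[of _ "K' \<inter> core \<Lambda>"] conjI ballI)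
    fix e assume e: "e \<in> ?E"
    have "e \<inter> (K' \<inter> core \<Lambda> \<union> ?X) = e \<inter> K'"
      using edges_subset[OF e] K'(2) MX by (auto simp: core_def)
    moreover have "e \<in> \<Gamma> \<longleftrightarrow> e \<in> ?G" using e by (auto simp: \<Gamma>_def outer_cut_def)
    ultimately show "odd (card (e \<inter> (K' \<inter> core \<Lambda> \<union> ?X))) \<longleftrightarrow> e \<in> ?G" using K'(1)[of e] e EI by auto
  qed simp
qed

text \<open>The points of the box near the hyperplane number \<open>O(L\<^bsup>d-1\<^esup>)\<close>, whatever the height of the
  box.\<close>

lemma card_near_plane:
  assumes F: "F \<subseteq> edges int_lattice" and h: "h \<ge> 0"
    and near: "\<And>e. e \<in> F \<Longrightarrow> \<exists>x\<in>e. x \<in> \<Lambda> \<and> \<bar>x \<bullet> n\<bar> \<le> h"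
  shows "real (card F) \<le> 2 * real CARD('d) * ((2 * h + 2 * real CARD('d)) * (L + 2 * real CARD('d)) ^ (CARD('d) - 1))"
proof -
  define Q where "Q = {x \<in> \<Lambda>. \<bar>x \<bullet> n\<bar> \<le> h}"
  let ?a = "\<lambda>u. if u = n then h else L / 2"
  have QL: "Q \<subseteq> int_lattice" using box_sub_lattice[OF fr d2 L0 H0 \<Lambda>] by (auto simp: Q_def)
  have b: "- ?a u \<le> x \<bullet> u \<and> x \<bullet> u \<le> ?a u" if "x \<in> Q" "u \<in> insert n B" for x u
    using that box_bounds(1)[OF fr d2 L0 H0 \<Lambda>, of x u] by (auto simp: Q_def abs_le_iff abs_less_iff)
  have le: "- ?a u \<le> ?a u" for u using h L0 by simp
  have fQ: "finite Q" by (rule lattice_points_bound(1)[OF fr le QL b])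
  have "real (card Q) \<le> (\<Prod>u\<in>insert n B. ?a u - (- ?a u) + 2 * real CARD('d))"
    by (rule lattice_points_bound(2)[OF fr le QL b])
  also have "\<dots> = (\<Prod>u\<in>insert n B. if u = n then 2 * h + 2 * real CARD('d) else L + 2 * real CARD('d))"
    by (rule prod.cong) auto
  also have "\<dots> = (2 * h + 2 * real CARD('d)) * (L + 2 * real CARD('d)) ^ (CARD('d) - 1)" by (rule frame_prod[OF fr])
  finally have cQ: "real (card Q) \<le> (2 * h + 2 * real CARD('d)) * (L + 2 * real CARD('d)) ^ (CARD('d) - 1)" .
  have "card F \<le> 2 * CARD('d) * card Q"
    by (rule card_incident_edges(2)[OF fQ QL F]) (use near in \<open>fastforce simp: Q_def\<close>)
  hence "real (card F) \<le> 2 * real CARD('d) * real (card Q)" by (metis of_nat_le_iff of_nat_mult of_nat_numeral)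
  also have "\<dots> \<le> 2 * real CARD('d) * ((2 * h + 2 * real CARD('d)) * (L + 2 * real CARD('d)) ^ (CARD('d) - 1))"
    by (intro mult_left_mono cQ) auto
  finally show ?thesis .
qed

lemma star_degree:
  assumes f: "f \<in> edges \<Lambda>"
  shows "card {e \<in> edges \<Lambda>. star_adj f e} \<le> degree_bound CARD('d)"
proof -
  obtain z where z: "z \<in> f" using f by (blast elim: edgesE)
  define Q where "Q = {x \<in> \<Lambda>. norm (z - x) \<le> 2}"
  have QL: "Q \<subseteq> int_lattice" using box_sub_lattice[OF fr d2 L0 H0 \<Lambda>] by (auto simp: Q_def)
  have b: "z \<bullet> u - 2 \<le> x \<bullet> u \<and> x \<bullet> u \<le> z \<bullet> u + 2" if "x \<in> Q" "u \<in> insert n B" for x u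
  proof -
    have "\<bar>(z - x) \<bullet> u\<bar> \<le> 2" using frame_inner_le[OF fr that(2), of "z - x"] that(1) by (simp add: Q_def)
    thus ?thesis by (auto simp: inner_diff_left abs_le_iff)
  qed
  have fQ: "finite Q" by (rule lattice_points_bound(1)[OF fr _ QL b]) auto
  have "real (card Q) \<le> (\<Prod>u\<in>insert n B. (z \<bullet> u + 2) - (z \<bullet> u - 2) + 2 * real CARD('d))"
    by (rule lattice_points_bound(2)[OF fr _ QL b]) auto
  also have "\<dots> = (4 + 2 * real CARD('d)) ^ CARD('d)" using frame_card[OF fr] by simp
  also have "\<dots> = real ((4 + 2 * CARD('d)) ^ CARD('d))" by simp
  finally have cQ: "card Q \<le> (4 + 2 * CARD('d)) ^ CARD('d)" by (simp only: of_nat_le_iff)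
  have "card {e \<in> edges \<Lambda>. star_adj f e} \<le> 2 * CARD('d) * card Q"
  proof (rule card_incident_edges(2)[OF fQ QL])
    show "{e \<in> edges \<Lambda>. star_adj f e} \<subseteq> edges int_lattice"
      using edges_mono[OF box_sub_lattice[OF fr d2 L0 H0 \<Lambda>]] by auto
    fix e assume e: "e \<in> {e \<in> edges \<Lambda>. star_adj f e}"
    then obtain x where "x \<in> e" "x \<in> \<Lambda>" by (blast elim: edgesE)
    thus "e \<inter> Q \<noteq> {}" using star_adj_close[of f e z x] e z by (auto simp: Q_def)
  qed
  also have "\<dots> \<le> 2 * CARD('d) * (4 + 2 * CARD('d)) ^ CARD('d)" using cQ by simp
  finally show ?thesis by (simp add: degree_bound_def)
qed

lemma crossing_edge:
  assumes "e \<in> edges int_lattice" "odd (card (e \<inter> {x. x \<bullet> n < 0}))" "x \<in> e"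
  shows "\<bar>x \<bullet> n\<bar> \<le> 1"
proof -
  obtain a b where ab: "e = {a, b}" "dist a b = 1" "a \<noteq> b" using assms(1) by (blast elim: edgesE)
  have "(a \<bullet> n < 0) \<noteq> (b \<bullet> n < 0)" using assms(2) unfolding ab(1) odd_card_pair[OF ab(3)] by simp
  moreover have "\<bar>(a - b) \<bullet> n\<bar> \<le> 1" using frame_inner_le[OF fr insertI1, of "a - b"] ab(2) by (simp add: dist_norm)
  ultimately have "\<bar>a \<bullet> n\<bar> \<le> 1 \<and> \<bar>b \<bullet> n\<bar> \<le> 1" by (auto simp: inner_diff_left)
  thus ?thesis using assms(3) ab(1) by auto
qed

lemma card_roots:
  "real (card {e \<in> edges \<Lambda>. \<exists>f\<in>outer_cut. star_adj f e})
    \<le> 2 * real CARD('d) * ((2 * 3 + 2 * real CARD('d)) * (L + 2 * real CARD('d)) ^ (CARD('d) - 1))"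
proof (rule card_near_plane)
  show "{e \<in> edges \<Lambda>. \<exists>f\<in>outer_cut. star_adj f e} \<subseteq> edges int_lattice"
    using edges_mono[OF box_sub_lattice[OF fr d2 L0 H0 \<Lambda>]] by auto
  fix e assume "e \<in> {e \<in> edges \<Lambda>. \<exists>f\<in>outer_cut. star_adj f e}"
  then obtain f where f: "e \<in> edges \<Lambda>" "f \<in> outer_cut" "star_adj f e" by auto
  obtain x where x: "x \<in> e" "x \<in> \<Lambda>" using f(1) by (blast elim: edgesE)
  have fe: "f \<in> edges int_lattice" "odd (card (f \<inter> {x. x \<bullet> n < 0}))" using f(2) by (auto simp: outer_cut_def)
  obtain z where z: "z \<in> f" using fe(1) by (blast elim: edgesE)
  have "\<bar>z \<bullet> n\<bar> \<le> 1" by (rule crossing_edge[OF fe z])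
  moreover have "\<bar>(z - x) \<bullet> n\<bar> \<le> 2"
    using frame_inner_le[OF fr insertI1, of "z - x"] star_adj_close[OF f(3) z x(1)] by simp
  ultimately have "\<bar>x \<bullet> n\<bar> \<le> 3" by (simp add: inner_diff_left)
  thus "\<exists>x\<in>e. x \<in> \<Lambda> \<and> \<bar>x \<bullet> n\<bar> \<le> 3" using x by auto
qed simp

end

section \<open>Sensitivity to one coupling\<close>

lemma spin_sum_update:
  assumes "finite E" "e \<in> E"
  shows "spin_sum E (w(e := k * w e)) V X = spin_sum E w V X + (k - 1) * cut_sum E w V X e"
proof -
  have b: "boltzmann E (w(e := k * w e)) A = (if odd (card (e \<inter> A)) then k else 1) * boltzmann E w A" for A
  proof -
    have "boltzmann E (w(e := k * w e)) A =
      (\<Prod>f\<in>E. (if f = e then (if odd (card (e \<inter> A)) then k else 1) else 1) * (if odd (card (f \<inter> A)) then w f else 1))"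
      unfolding boltzmann_def by (rule prod.cong) auto
    also have "\<dots> = (if odd (card (e \<inter> A)) then k else 1) * boltzmann E w A"
      unfolding boltzmann_def prod.distrib using assms by (simp add: prod.delta)
    finally show ?thesis .
  qed
  show ?thesis unfolding spin_sum_def cut_sum_def b sum_distrib_left sum.distrib[symmetric]
    by (rule sum.cong) (auto simp: algebra_simps)
qed

lemma ln_diff_le:
  fixes a b :: real
  assumes "0 \<le> b" "b \<le> a"
  shows "0 \<le> ln (1 + a) - ln (1 + b)" "ln (1 + a) - ln (1 + b) \<le> a - b"
proof -
  show "0 \<le> ln (1 + a) - ln (1 + b)" using assms by simp
  have "ln ((1 + a) / (1 + b)) \<le> (1 + a) / (1 + b) - 1" by (rule ln_le_minus_one) (use assms in simp)
  also have "\<dots> = (a - b) / (1 + b)" using assms by (simp add: field_simps)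
  also have "\<dots> \<le> (a - b) / 1" using assms by (intro divide_left_mono) auto
  finally show "ln (1 + a) - ln (1 + b) \<le> a - b" using assms by (simp add: ln_div)
qed

text \<open>Multiplying the weight of \<open>e\<close> by \<open>k\<close>, that is, weakening its coupling, multiplies each of
  the two partition functions by \<open>1 + (k - 1) P(e unsatisfied)\<close>. By \<open>cut_sum_comparison\<close> this
  probability is larger for the boundary condition \<open>X\<close> than for plus, which determines the sign
  of the change.\<close>

lemma one_coupling:
  assumes V: "finite V" and E: "finite E" "\<And>e. e \<in> E \<Longrightarrow> finite e" "e \<in> E" and X: "X \<inter> V = {}"
    and w: "\<And>e. e \<in> E \<Longrightarrow> 0 < w e" "\<And>e. e \<in> E \<Longrightarrow> w e \<le> 1" and k: "1 \<le> k"
  defines "p \<equiv> cut_sum E w V X e / spin_sum E w V X - cut_sum E w V {} e / spin_sum E w V {}"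
  defines "\<delta> \<equiv> ln (spin_sum E w V {} / spin_sum E w V X)
       - ln (spin_sum E (w(e := k * w e)) V {} / spin_sum E (w(e := k * w e)) V X)"
  shows "0 \<le> p" "p \<le> 1" "0 \<le> \<delta>" "\<delta> \<le> (k - 1) * p"
proof -
  let ?Zm = "spin_sum E w V X" and ?Zp = "spin_sum E w V {}"
  let ?cm = "cut_sum E w V X e" and ?cp = "cut_sum E w V {} e"
  have pos: "?Zm > 0" "?Zp > 0" by (intro spin_sum_pos V w; assumption)+
  have b0: "0 \<le> boltzmann E w A" for A by (intro boltzmann_nonneg less_imp_le w)
  have c0: "0 \<le> cut_sum E w V Y e" for Y unfolding cut_sum_def by (intro sum_nonneg) (simp add: b0)
  have c1: "?cm \<le> ?Zm" unfolding cut_sum_def spin_sum_def by (intro sum_mono) (simp add: b0)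
  have "?cp * ?Zm \<le> ?cm * ?Zp" by (rule cut_sum_comparison) (use V E X w in \<open>auto intro: less_imp_le\<close>)
  hence le: "?cp / ?Zp \<le> ?cm / ?Zm" using pos by (simp add: field_simps)
  show "0 \<le> p" unfolding p_def using le by simp
  have "?cm / ?Zm \<le> 1" using c1 pos by simp
  moreover have "0 \<le> ?cp / ?Zp" using c0 pos by simp
  ultimately show "p \<le> 1" unfolding p_def by linarith
  let ?a = "(k - 1) * (?cm / ?Zm)" and ?b = "(k - 1) * (?cp / ?Zp)"
  have a0: "0 \<le> ?a" and b0: "0 \<le> ?b" using k c0 pos by auto
  have um: "spin_sum E (w(e := k * w e)) V X = ?Zm * (1 + ?a)"
    unfolding spin_sum_update[OF E(1,3)] using pos by (simp add: field_simps)
  have up: "spin_sum E (w(e := k * w e)) V {} = ?Zp * (1 + ?b)"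
    unfolding spin_sum_update[OF E(1,3)] using pos by (simp add: field_simps)
  have "1 + ?a > 0" "1 + ?b > 0" using a0 b0 by linarith+
  hence d: "\<delta> = ln (1 + ?a) - ln (1 + ?b)"
    unfolding \<delta>_def um up using pos by (simp only: ln_div ln_mult mult_eq_0_iff) (simp add: ln_mult)
  have ba: "?b \<le> ?a" using le k by (intro mult_left_mono) auto
  show "0 \<le> \<delta>" unfolding d by (rule ln_diff_le(1)[OF b0 ba])
  have "\<delta> \<le> ?a - ?b" unfolding d by (rule ln_diff_le(2)[OF b0 ba])
  thus "\<delta> \<le> (k - 1) * p" unfolding p_def by (simp add: algebra_simps)
qed

section \<open>Translations\<close>

lemma spin_sum_image:
  assumes "inj g"
  shows "spin_sum ((`) g ` E) w (g ` V) (g ` X) = spin_sum E (\<lambda>e. w (g ` e)) V X"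
proof -
  have "spin_sum ((`) g ` E) w (g ` V) (g ` X) = (\<Sum>A\<in>(`) g ` Pow V. boltzmann ((`) g ` E) w (A \<union> g ` X))"
    by (simp add: spin_sum_def image_Pow_surj)
  also have "\<dots> = (\<Sum>A\<in>Pow V. boltzmann ((`) g ` E) w (g ` A \<union> g ` X))"
    by (subst sum.reindex) (use assms in \<open>auto simp: inj_on_def inj_image_eq_iff\<close>)
  also have "\<dots> = (\<Sum>A\<in>Pow V. boltzmann E (\<lambda>e. w (g ` e)) (A \<union> X))"
  proof (rule sum.cong[OF refl])
    fix A
    have "card (g ` e \<inter> (g ` A \<union> g ` X)) = card (e \<inter> (A \<union> X))" for e
      using assms by (simp add: image_Un[symmetric] image_Int[symmetric] card_image inj_on_subset[OF assms])
    thus "boltzmann ((`) g ` E) w (g ` A \<union> g ` X) = boltzmann E (\<lambda>e. w (g ` e)) (A \<union> X)"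
      unfolding boltzmann_def
      by (subst prod.reindex) (use assms in \<open>auto simp: inj_on_def inj_image_eq_iff\<close>)
  qed
  finally show ?thesis by (simp add: spin_sum_def)
qed

lemma edges_shift: "edges ((+) z ` \<Lambda>) = (`) ((+) z) ` edges \<Lambda>"
proof
  show "edges ((+) z ` \<Lambda>) \<subseteq> (`) ((+) z) ` edges \<Lambda>"
  proof
    fix e assume "e \<in> edges ((+) z ` \<Lambda>)"
    then obtain x y where xy: "e = {x, y}" "x \<in> (+) z ` \<Lambda>" "y \<in> (+) z ` \<Lambda>" "dist x y = 1" by (rule edgesE)
    then obtain x' y' where x: "x = z + x'" "y = z + y'" "x' \<in> \<Lambda>" "y' \<in> \<Lambda>" by blast
    have "{x', y'} \<in> edges \<Lambda>" using x xy(4) by (simp add: pair_in_edges)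
    moreover have "e = (+) z ` {x', y'}" using x xy(1) by simp
    ultimately show "e \<in> (`) ((+) z) ` edges \<Lambda>" by blast
  qed
  show "(`) ((+) z) ` edges \<Lambda> \<subseteq> edges ((+) z ` \<Lambda>)"
    by (auto simp: edges_def) (metis dist_add_cancel imageI)
qed

lemma lattice_boundary_shift:
  assumes "z \<in> int_lattice"
  shows "lattice_boundary ((+) z ` \<Lambda>) = (+) z ` lattice_boundary \<Lambda>"
proof -
  have "z + x \<in> lattice_boundary ((+) z ` \<Lambda>) \<longleftrightarrow> x \<in> lattice_boundary \<Lambda>" for x
  proof
    assume "z + x \<in> lattice_boundary ((+) z ` \<Lambda>)"
    then obtain y where y: "x \<in> \<Lambda>" "y \<in> int_lattice" "y \<notin> (+) z ` \<Lambda>" "dist y (z + x) = 1"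
      by (auto simp: lattice_boundary_def)
    have "y - z \<in> int_lattice" using y assms by (simp add: int_lattice_diff)
    moreover have "y - z \<notin> \<Lambda>" using y(3) by (metis add_diff_cancel_left' diff_add_cancel image_eqI add.commute)
    moreover have "dist (y - z) x = 1" using y(4) by (simp add: dist_norm algebra_simps)
    ultimately show "x \<in> lattice_boundary \<Lambda>" using y(1) by (auto simp: lattice_boundary_def)
  next
    assume "x \<in> lattice_boundary \<Lambda>"
    then obtain y where y: "x \<in> \<Lambda>" "y \<in> int_lattice" "y \<notin> \<Lambda>" "dist y x = 1"
      by (auto simp: lattice_boundary_def)
    have "z + y \<in> int_lattice" "z + y \<notin> (+) z ` \<Lambda>" "dist (z + y) (z + x) = 1"
      using y assms by (auto simp: int_lattice_add)
    thus "z + x \<in> lattice_boundary ((+) z ` \<Lambda>)" using y(1) unfolding lattice_boundary_def by blast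
  qed
  moreover have "lattice_boundary ((+) z ` \<Lambda>) \<subseteq> (+) z ` \<Lambda>" by (auto simp: lattice_boundary_def)
  ultimately show ?thesis by blast
qed

lemma core_shift: "z \<in> int_lattice \<Longrightarrow> core ((+) z ` \<Lambda>) = (+) z ` core \<Lambda>"
  unfolding core_def lattice_boundary_shift by (simp add: image_set_diff)

lemma lower_boundary_shift: "z \<in> int_lattice \<Longrightarrow> lower_boundary z n ((+) z ` \<Lambda>) = (+) z ` lower_boundary 0 n \<Lambda>"
  unfolding lower_boundary_def lattice_boundary_shift by auto

section \<open>Gluing\<close>

text \<open>All spins of the large box outside the cores of the blocks are frozen: to minus on \<open>D\<close>
  and plus off \<open>D\<close> for the mixed boundary condition, and to plus for the plus boundary
  condition. By \<open>pinning\<close> this can only lower \<open>Z\<^sub>\<plusminus> / Z\<^sub>+\<close>. After freezing, both sums factorise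
  over the blocks, and since \<open>D\<close> is on each block the translated lower half-space, a block
  contributes its own \<open>Z\<^sub>\<plusminus> / Z\<^sub>+\<close>. The frozen edges that \<open>D\<close> cuts cost at most \<open>\<beta>\<close> each.\<close>

lemma gluing:
  fixes n :: "real ^ 'd" and \<Lambda> \<Lambda>0 Z :: "(real ^ 'd) set"
  assumes fin: "finite \<Lambda>" "finite \<Lambda>0" "finite Z" and lat: "\<Lambda> \<subseteq> int_lattice" "\<Lambda>0 \<subseteq> int_lattice" "Z \<subseteq> int_lattice"
    and disj: "\<And>z z'. z \<in> Z \<Longrightarrow> z' \<in> Z \<Longrightarrow> z \<noteq> z' \<Longrightarrow> (+) z ` \<Lambda>0 \<inter> (+) z' ` \<Lambda>0 = {}"
    and inside: "\<And>z x. z \<in> Z \<Longrightarrow> x \<in> \<Lambda>0 \<Longrightarrow> z + x \<in> core \<Lambda>"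
    and \<beta>: "0 \<le> \<beta>" and J: "\<And>e. e \<in> edges \<Lambda> \<Longrightarrow> 0 \<le> J e \<and> J e \<le> 1"
    and D: "\<And>z x. z \<in> Z \<Longrightarrow> x \<in> \<Lambda>0 \<Longrightarrow> z + x \<in> D \<longleftrightarrow> x \<bullet> n < 0"
           "\<And>x. x \<notin> (\<Union>z\<in>Z. (+) z ` \<Lambda>0) \<Longrightarrow> x \<in> D \<longleftrightarrow> x \<bullet> n < 0"
  shows "spin_tension \<beta> J n \<Lambda> \<le> (\<Sum>z\<in>Z. spin_tension \<beta> (\<lambda>e. J ((+) z ` e)) n \<Lambda>0)
     + \<beta> * real (card {e \<in> edges \<Lambda> - (\<Union>z\<in>Z. edges ((+) z ` \<Lambda>0)). odd (card (e \<inter> D))})"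
proof -
  let ?E = "edges \<Lambda>" and ?w = "\<lambda>e. exp (- \<beta> * J e)"
  let ?bl = "\<lambda>z. (+) z ` \<Lambda>0"
  define E0 where "E0 = ?E - (\<Union>z\<in>Z. edges (?bl z))"
  define Q where "Q = core \<Lambda> - (\<Union>z\<in>Z. core (?bl z))"
  let ?X = "lower_boundary 0 n \<Lambda>"
  define Y where "Y = Q \<inter> D"
  have finE: "finite ?E" by (rule finite_edges[OF fin(1)])
  have finc: "finite (core \<Lambda>)" using fin(1) by (simp add: core_def)
  have blc: "?bl z \<subseteq> core \<Lambda>" if "z \<in> Z" for z using inside[OF that] by auto
  have cc: "core (?bl z) \<subseteq> core \<Lambda>" if "z \<in> Z" for z using blc[OF that] core_subset[of "?bl z"] by blast
  have VQ: "core \<Lambda> - Q = (\<Union>z\<in>Z. core (?bl z))" using cc by (auto simp: Q_def)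
  have Eun: "?E = E0 \<union> (\<Union>z\<in>Z. edges (?bl z))"
    using edges_mono[OF order.trans[OF blc core_subset]] by (auto simp: E0_def)
  have w01: "0 < ?w e" "e \<in> ?E \<Longrightarrow> ?w e \<le> 1" for e using \<beta> J[of e] by auto
  have Ebl: "e \<subseteq> ?bl z" if "e \<in> edges (?bl z)" for e z using edges_subset[OF that] .
  have Ene: "e \<noteq> {}" if "e \<in> edges \<Lambda>'" for e and \<Lambda>' :: "(real ^ 'd) set" using that by (auto simp: edges_def)
  have fac: "spin_sum ?E ?w (\<Union>z\<in>Z. core (?bl z)) W =
      boltzmann E0 ?w W * (\<Prod>z\<in>Z. spin_sum (edges (?bl z)) ?w (core (?bl z)) W)" for W
    unfolding Eun
  proof (rule spin_sum_UNION[OF fin(3)])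
    show "finite (edges (?bl z))" "finite (core (?bl z))" for z
      using fin(2) by (auto intro: finite_edges simp: core_def)
    show "edges (?bl z) \<inter> edges (?bl z') = {} \<and> core (?bl z) \<inter> core (?bl z') = {}"
      if "z \<in> Z" "z' \<in> Z" "z \<noteq> z'" for z z'
    proof
      show "edges (?bl z) \<inter> edges (?bl z') = {}"
      proof (rule equals0I)
        fix e assume e: "e \<in> edges (?bl z) \<inter> edges (?bl z')"
        have "e \<subseteq> ?bl z \<inter> ?bl z'" using Ebl[of e z] Ebl[of e z'] e by simp
        hence "e = {}" using disj[OF that] by simp
        thus False using Ene[of e "?bl z"] e by simp
      qed
      show "core (?bl z) \<inter> core (?bl z') = {}"
        using disj[OF that] core_subset[of "?bl z"] core_subset[of "?bl z'"] by blast
    qed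
    show "e \<inter> core (?bl z') = {}" if "z \<in> Z" "z' \<in> Z" "z \<noteq> z'" "e \<in> edges (?bl z)" for z z' e
      using disj[OF that(1-3)] Ebl[OF that(4)] core_subset[of "?bl z'"] by blast
    show "finite E0" using finE by (simp add: E0_def)
    show "E0 \<inter> edges (?bl z) = {}" if "z \<in> Z" for z using that by (auto simp: E0_def)
    show "e \<inter> core (?bl z) = {}" if "z \<in> Z" "e \<in> E0" for z e
    proof (rule ccontr)
      assume "e \<inter> core (?bl z) \<noteq> {}"
      moreover have "e \<in> edges int_lattice" using that(2) edges_mono[OF lat(1)] by (auto simp: E0_def)
      ultimately have "e \<in> edges (?bl z)" using edge_meets_core by blast
      thus False using that by (auto simp: E0_def)
    qed
  qed
  have pin: "spin_sum ?E ?w (\<Union>z\<in>Z. core (?bl z)) (?X \<union> Y) * spin_sum ?E ?w (core \<Lambda>) {}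
      \<le> spin_sum ?E ?w (core \<Lambda>) ?X * spin_sum ?E ?w (\<Union>z\<in>Z. core (?bl z)) {}"
    unfolding VQ[symmetric]
    by (rule pinning[OF finc finE _ lower_core_disjoint])
       (use w01 edge_finite in \<open>auto simp: Q_def Y_def intro: less_imp_le\<close>)
  have b1: "boltzmann E0 ?w {} = 1" by (simp add: boltzmann_def)
  let ?F = "{e \<in> E0. odd (card (e \<inter> D))}"
  have bD: "boltzmann E0 ?w (?X \<union> Y) \<ge> exp (- \<beta> * real (card ?F))"
  proof -
    have e: "e \<inter> (?X \<union> Y) = e \<inter> D" if "e \<in> E0" for e
    proof -
      have eE: "e \<in> ?E" using that by (simp add: E0_def)
      have "x \<in> ?X \<union> Y \<longleftrightarrow> x \<in> D" if x: "x \<in> e" for x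
      proof (cases "x \<in> core \<Lambda>")
        case True
        have "x \<notin> core (?bl z)" if "z \<in> Z" for z
        proof
          assume "x \<in> core (?bl z)"
          hence "e \<in> edges (?bl z)"
            using x eE edges_mono[OF lat(1)] edge_meets_core[of e "?bl z"] by blast
          thus False using \<open>e \<in> E0\<close> that by (auto simp: E0_def)
        qed
        hence "x \<in> Q" using True by (auto simp: Q_def)
        moreover have "x \<notin> ?X" using True lower_core_disjoint[of 0 n \<Lambda>] by auto
        ultimately show ?thesis by (auto simp: Y_def)
      next
        case False
        hence xb: "x \<in> lattice_boundary \<Lambda>" using x edges_subset[OF eE] by (auto simp: core_def)
        have "x \<notin> (\<Union>z\<in>Z. ?bl z)" using blc False by blast
        hence "x \<in> D \<longleftrightarrow> x \<bullet> n < 0" by (rule D(2))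
        thus ?thesis using xb False by (auto simp: lower_boundary_def Y_def Q_def)
      qed
      thus ?thesis by blast
    qed
    have "boltzmann E0 ?w (?X \<union> Y) = (\<Prod>e\<in>E0. if odd (card (e \<inter> D)) then ?w e else 1)"
      unfolding boltzmann_def by (rule prod.cong[OF refl]) (simp add: e)
    also have "\<dots> = (\<Prod>e\<in>?F. ?w e)"
    proof (rule prod.mono_neutral_cong_right)
      show "finite E0" using finE by (simp add: E0_def)
    qed auto
    also have "\<dots> \<ge> (\<Prod>e\<in>?F. exp (- \<beta>))"
    proof (rule prod_mono)
      fix e assume "e \<in> ?F"
      hence "J e \<le> 1" using J by (auto simp: E0_def)
      hence "\<beta> * J e \<le> \<beta> * 1" using \<beta> by (intro mult_left_mono) auto
      thus "0 \<le> exp (- \<beta>) \<and> exp (- \<beta>) \<le> exp (- \<beta> * J e)" by simp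
    qed
    finally have "exp (- \<beta>) ^ card ?F \<le> boltzmann E0 ?w (?X \<union> Y)" by simp
    moreover have "exp (- \<beta>) ^ card ?F = exp (- \<beta> * real (card ?F))"
      by (simp add: exp_of_nat_mult[symmetric] mult.commute)
    ultimately show ?thesis by simp
  qed
  have blk: "spin_sum (edges (?bl z)) ?w (core (?bl z)) (?X \<union> Y) =
       spin_sum (edges \<Lambda>0) (\<lambda>e. exp (- \<beta> * J ((+) z ` e))) (core \<Lambda>0) (lower_boundary 0 n \<Lambda>0)"
      "spin_sum (edges (?bl z)) ?w (core (?bl z)) {} =
       spin_sum (edges \<Lambda>0) (\<lambda>e. exp (- \<beta> * J ((+) z ` e))) (core \<Lambda>0) {}" if z: "z \<in> Z" for z
  proof -
    have zL: "z \<in> int_lattice" using z lat by auto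
    have inj: "inj ((+) z)" by simp
    have "spin_sum (edges (?bl z)) ?w (core (?bl z)) (?X \<union> Y) =
       spin_sum (edges (?bl z)) ?w (core (?bl z)) (lower_boundary z n (?bl z))"
    proof (rule spin_sum_cong)
      fix e assume e: "e \<in> edges (?bl z)"
      have "x \<in> ?X \<union> Y \<longleftrightarrow> x \<in> lower_boundary z n (?bl z)" if "x \<in> e" for x
      proof -
        have xb: "x \<in> ?bl z" using Ebl[OF e] that by auto
        then obtain y where y: "x = z + y" "y \<in> \<Lambda>0" by auto
        have xc: "x \<in> core \<Lambda>" using blc[OF z] xb by auto
        hence nX: "x \<notin> ?X" using lower_core_disjoint[of 0 n \<Lambda>] by auto
        have "x \<in> Q \<longleftrightarrow> x \<notin> core (?bl z)"
          using xc xb z disj core_subset unfolding Q_def by blast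
        hence "x \<in> Y \<longleftrightarrow> x \<notin> core (?bl z) \<and> y \<bullet> n < 0" using D(1)[OF z y(2)] y(1) by (auto simp: Y_def)
        also have "\<dots> \<longleftrightarrow> x \<in> lower_boundary z n (?bl z)"
          using xb y(1) by (auto simp: lower_boundary_def core_def)
        finally show ?thesis using nX by auto
      qed
      thus "e \<inter> (?X \<union> Y) = e \<inter> lower_boundary z n (?bl z)" by blast
    qed
    also have "\<dots> = spin_sum (edges \<Lambda>0) (\<lambda>e. exp (- \<beta> * J ((+) z ` e))) (core \<Lambda>0) (lower_boundary 0 n \<Lambda>0)"
      unfolding edges_shift core_shift[OF zL] lower_boundary_shift[OF zL] by (rule spin_sum_image[OF inj])
    finally show "spin_sum (edges (?bl z)) ?w (core (?bl z)) (?X \<union> Y) =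
       spin_sum (edges \<Lambda>0) (\<lambda>e. exp (- \<beta> * J ((+) z ` e))) (core \<Lambda>0) (lower_boundary 0 n \<Lambda>0)" .
    show "spin_sum (edges (?bl z)) ?w (core (?bl z)) {} =
       spin_sum (edges \<Lambda>0) (\<lambda>e. exp (- \<beta> * J ((+) z ` e))) (core \<Lambda>0) {}"
      unfolding edges_shift core_shift[OF zL]
      using spin_sum_image[OF inj, of "edges \<Lambda>0" ?w "core \<Lambda>0" "{}"] by simp
  qed
  let ?Zm = "spin_sum ?E ?w (core \<Lambda>) ?X" and ?Zp = "spin_sum ?E ?w (core \<Lambda>) {}"
  define m where "m z = spin_sum (edges \<Lambda>0) (\<lambda>e. exp (- \<beta> * J ((+) z ` e))) (core \<Lambda>0) (lower_boundary 0 n \<Lambda>0)" for z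
  define p where "p z = spin_sum (edges \<Lambda>0) (\<lambda>e. exp (- \<beta> * J ((+) z ` e))) (core \<Lambda>0) {}" for z
  have finc0: "finite (core \<Lambda>0)" using fin(2) by (simp add: core_def)
  have mp: "m z > 0" "p z > 0" for z unfolding m_def p_def by (intro spin_sum_pos finc0 exp_gt_zero)+
  have nz: "m z \<noteq> 0" "p z \<noteq> 0" for z using mp[of z] by simp_all
  have Mp: "(\<Prod>z\<in>Z. m z) > 0" "(\<Prod>z\<in>Z. p z) > 0" using mp by (auto intro!: prod_pos)
  have Zmp: "?Zm > 0" "?Zp > 0" by (intro spin_sum_pos finc exp_gt_zero)+
  have "(\<Prod>z\<in>Z. spin_sum (edges (?bl z)) ?w (core (?bl z)) (?X \<union> Y)) = (\<Prod>z\<in>Z. m z)"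
    by (rule prod.cong) (simp_all only: blk m_def)
  moreover have "(\<Prod>z\<in>Z. spin_sum (edges (?bl z)) ?w (core (?bl z)) {}) = (\<Prod>z\<in>Z. p z)"
    by (rule prod.cong) (simp_all only: blk p_def)
  ultimately have "boltzmann E0 ?w (?X \<union> Y) * (\<Prod>z\<in>Z. m z) * ?Zp \<le> ?Zm * (\<Prod>z\<in>Z. p z)"
    using pin unfolding fac b1 by simp
  moreover have "exp (- \<beta> * real (card ?F)) * ((\<Prod>z\<in>Z. m z) * ?Zp) \<le> boltzmann E0 ?w (?X \<union> Y) * ((\<Prod>z\<in>Z. m z) * ?Zp)"
    by (rule mult_right_mono[OF bD]) (use Mp Zmp in simp)
  ultimately have main: "exp (- \<beta> * real (card ?F)) * ((\<Prod>z\<in>Z. m z) * ?Zp) \<le> ?Zm * (\<Prod>z\<in>Z. p z)"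
    by (simp add: mult.assoc)
  have "ln (exp (- \<beta> * real (card ?F)) * ((\<Prod>z\<in>Z. m z) * ?Zp)) \<le> ln (?Zm * (\<Prod>z\<in>Z. p z))"
    using main Mp Zmp by (subst ln_le_cancel_iff) auto
  moreover have "ln (exp (- \<beta> * real (card ?F)) * ((\<Prod>z\<in>Z. m z) * ?Zp)) = - \<beta> * real (card ?F) + ((\<Sum>z\<in>Z. ln (m z)) + ln ?Zp)"
    using Mp Zmp mp by (simp add: ln_mult ln_prod fin nz)
  moreover have "ln (?Zm * (\<Prod>z\<in>Z. p z)) = ln ?Zm + (\<Sum>z\<in>Z. ln (p z))"
    using Mp Zmp mp by (simp add: ln_mult ln_prod fin nz)
  ultimately have "ln ?Zp - ln ?Zm \<le> (\<Sum>z\<in>Z. ln (p z)) - (\<Sum>z\<in>Z. ln (m z)) + \<beta> * real (card ?F)" by simp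
  moreover have "spin_tension \<beta> J n \<Lambda> = ln ?Zp - ln ?Zm"
    unfolding spin_tension_def using Zmp by (simp add: ln_div)
  moreover have "(\<Sum>z\<in>Z. spin_tension \<beta> (\<lambda>e. J ((+) z ` e)) n \<Lambda>0) = (\<Sum>z\<in>Z. ln (p z) - ln (m z))"
  proof (rule sum.cong[OF refl])
    fix z show "spin_tension \<beta> (\<lambda>e. J ((+) z ` e)) n \<Lambda>0 = ln (p z) - ln (m z)"
      unfolding spin_tension_def m_def[symmetric] p_def[symmetric] using mp[of z] by (simp add: ln_div)
  qed
  ultimately show ?thesis unfolding E0_def by (simp add: sum_subtractf)
qed

section \<open>Covering a box by smaller boxes\<close>

text \<open>Lattice points in a slab that is thin in the directions \<open>n\<close> and \<open>u0\<close>, hence \<open>O(r\<^bsup>d-2\<^esup>)\<close>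
  of them.\<close>

lemma slab_count:
  fixes n p :: "real ^ 'd"
  assumes fr: "frame n B" and u0: "u0 \<in> B" and nn: "0 \<le> w" "0 \<le> h" "0 \<le> r"
    and Q: "Q \<subseteq> int_lattice" "\<And>x. x \<in> Q \<Longrightarrow> \<bar>x \<bullet> n\<bar> \<le> h" "\<And>x. x \<in> Q \<Longrightarrow> a0 \<le> x \<bullet> u0 \<and> x \<bullet> u0 \<le> a0 + w"
      "\<And>x u. x \<in> Q \<Longrightarrow> u \<in> B \<Longrightarrow> \<bar>(x - p) \<bullet> u\<bar> \<le> r"
  shows "finite Q" "real (card Q) \<le> (w + 2 * real CARD('d)) * (2 * h + 2 * real CARD('d)) * (2 * r + 2 * real CARD('d)) ^ (CARD('d) - 2)"
proof -
  let ?c = "2 * real CARD('d)"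
  define a where "a u = (if u = n then - h else if u = u0 then a0 else p \<bullet> u - r)" for u
  define b where "b u = (if u = n then h else if u = u0 then a0 + w else p \<bullet> u + r)" for u
  have ab: "a u \<le> b u" for u using nn by (auto simp: a_def b_def)
  have q: "a u \<le> x \<bullet> u \<and> x \<bullet> u \<le> b u" if "x \<in> Q" "u \<in> insert n B" for x u
    using Q(2)[OF that(1)] Q(3)[OF that(1)] Q(4)[OF that(1), of u] that(2)
    by (auto simp: a_def b_def abs_le_iff inner_diff_left)
  show "finite Q" by (rule lattice_points_bound(1)[OF fr ab Q(1) q])
  have nB: "n \<notin> B" and fB: "finite B" using frame_notin[OF fr] frame_finite[OF fr] by auto
  have "real (card Q) \<le> (\<Prod>u\<in>insert n B. b u - a u + ?c)" by (rule lattice_points_bound(2)[OF fr ab Q(1) q])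
  also have "\<dots> = (b n - a n + ?c) * ((b u0 - a u0 + ?c) * (\<Prod>u\<in>B - {u0}. b u - a u + ?c))"
    using nB fB u0 by (simp add: prod.remove[OF fB u0])
  also have "b n - a n = 2 * h" by (simp add: a_def b_def)
  also have "b u0 - a u0 = w" using nB u0 by (auto simp: a_def b_def)
  also have "(\<Prod>u\<in>B - {u0}. b u - a u + ?c) = (\<Prod>u\<in>B - {u0}. 2 * r + ?c)"
    by (rule prod.cong) (use nB in \<open>auto simp: a_def b_def\<close>)
  also have "\<dots> = (2 * r + ?c) ^ (CARD('d) - 2)"
    using frame_card'[OF fr] u0 fB by (simp add: numeral_2_eq_2)
  finally show "real (card Q) \<le> (w + ?c) * (2 * h + ?c) * (2 * r + ?c) ^ (CARD('d) - 2)"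
    by (simp add: mult_ac)
qed

text \<open>Two frames with the same axis \<open>n\<close> span the same lateral hyperplane.\<close>

lemma lateral_inner_le:
  fixes n :: "real ^ 'd"
  assumes fr: "frame n B" and fr': "frame n B'" and u: "u \<in> B"
  shows "\<bar>y \<bullet> u\<bar> \<le> (\<Sum>v\<in>B'. \<bar>y \<bullet> v\<bar>)"
proof -
  have nu: "n \<bullet> u = 0" using frame_inner[OF fr, of n u] u frame_notin[OF fr] by auto
  have "y \<bullet> u = (\<Sum>v\<in>insert n B'. (y \<bullet> v) *\<^sub>R v) \<bullet> u" using frame_expand[OF fr', of y] by simp
  also have "\<dots> = (\<Sum>v\<in>B'. (y \<bullet> v) * (v \<bullet> u))"
    using frame_finite[OF fr'] frame_notin[OF fr'] nu by (simp add: inner_add_left inner_sum_left)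
  finally have "\<bar>y \<bullet> u\<bar> \<le> (\<Sum>v\<in>B'. \<bar>(y \<bullet> v) * (v \<bullet> u)\<bar>)" by simp
  also have "\<dots> \<le> (\<Sum>v\<in>B'. \<bar>y \<bullet> v\<bar>)"
  proof (rule sum_mono)
    fix v assume v: "v \<in> B'"
    have "\<bar>v \<bullet> u\<bar> \<le> 1" using frame_inner_le[OF fr, of u v] frame_norm[OF fr', of v] u v by simp
    thus "\<bar>(y \<bullet> v) * (v \<bullet> u)\<bar> \<le> \<bar>y \<bullet> v\<bar>" unfolding abs_mult by (rule mult_left_le) simp
  qed
  finally show ?thesis .
qed

text \<open>Blocks are centred at the points of a grid in the hyperplane orthogonal to \<open>n\<close>, rounded
  to lattice points. Rounding moves a centre by at most \<open>c\<close> in each direction, so the spacing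
  \<open>D = L + 2 * c\<close> keeps the blocks disjoint. The set \<open>S\<close> is the lower half-space, shifted on
  each block along with its centre. Only grid points at distance at least \<open>m\<close> from the lateral
  faces of the large box carry blocks. An edge outside the blocks that \<open>S\<close> cuts lies near the
  hyperplane, and either within \<open>2 * m\<close> of the lateral faces of the large box or near the
  lateral faces of a block; this gives the two terms of the bound. The two boxes may have
  different lateral frames, since the limits have to be independent of the frame.\<close>

lemma covering:
  fixes n :: "real ^ 'd" and L N H H' :: real
  assumes fr: "frame n B" and fr': "frame n B'" and d2: "CARD('d) \<ge> 2"
  defines "c \<equiv> real CARD('d)"
  defines "D \<equiv> L + 2 * c"
  defines "m \<equiv> 2 * c + 2 + c * L + H' + c * D"
  assumes L: "L > 0" and H': "H' > 2 * c + 2" and N: "N \<ge> 1" and H: "H > m"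
  obtains Z S where "finite Z" "Z \<subseteq> int_lattice" "real (card Z) * L ^ (CARD('d) - 1) \<le> N ^ (CARD('d) - 1)"
    and "\<And>z z'. z \<in> Z \<Longrightarrow> z' \<in> Z \<Longrightarrow> z \<noteq> z' \<Longrightarrow> (+) z ` box_lattice n B' L H' \<inter> (+) z' ` box_lattice n B' L H' = {}"
    and "\<And>z x. z \<in> Z \<Longrightarrow> x \<in> box_lattice n B' L H' \<Longrightarrow> z + x \<in> core (box_lattice n B N H)"
    and "\<And>z x. z \<in> Z \<Longrightarrow> x \<in> box_lattice n B' L H' \<Longrightarrow> z + x \<in> S \<longleftrightarrow> x \<bullet> n < 0"
    and "\<And>x. x \<notin> (\<Union>z\<in>Z. (+) z ` box_lattice n B' L H') \<Longrightarrow> x \<in> S \<longleftrightarrow> x \<bullet> n < 0"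
    and "real (card {e \<in> edges (box_lattice n B N H) - (\<Union>z\<in>Z. edges ((+) z ` box_lattice n B' L H')). odd (card (e \<inter> S))})
      \<le> 2 * c * (2 * c * ((2 * m + 2 * c) * (4 * c + 2) * (N + 2 * c) ^ (CARD('d) - 2))
          + real (card Z) * (2 * c * ((4 * c + 1) * (4 * c + 2) * (L + 4 * c) ^ (CARD('d) - 2))))"
proof -
  let ?\<Lambda> = "box_lattice n B N H" and ?bx = "box_lattice n B' L H'"
  have c2: "c \<ge> 2" using d2 by (simp add: c_def)
  have D0: "D > 0" using L c2 by (simp add: D_def)
  have fB: "finite B" "finite B'" using frame_finite[OF fr] frame_finite[OF fr'] by auto
  have cB: "real (card B) = c - 1" "real (card B') = c - 1"
    using frame_card'[OF fr] frame_card'[OF fr'] d2 by (auto simp: c_def of_nat_diff)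
  have nB: "n \<notin> B" "n \<notin> B'" using frame_notin[OF fr] frame_notin[OF fr'] by auto
  have m0: "m \<ge> 0" using c2 L H' D0 by (simp add: m_def)
  have H0: "H > 0" "H' > 0" using H m0 H' c2 by auto
  define p where "p k = (\<Sum>u\<in>B'. (D * of_int (k u)) *\<^sub>R u)" for k :: "real ^ 'd \<Rightarrow> int"
  define z :: "(real ^ 'd \<Rightarrow> int) \<Rightarrow> real ^ 'd" where "z k = (\<chi> i. of_int (round (p k $ i)))" for k
  have pu: "p k \<bullet> u = D * of_int (k u)" if "u \<in> B'" for k u
    unfolding p_def using frame_inner_sum[OF fr', of u "\<lambda>u. D * of_int (k u)"] that by simp
  have pn: "p k \<bullet> n = 0" for k
    unfolding p_def using frame_inner_sum[OF fr', of n "\<lambda>u. D * of_int (k u)"] nB by simp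
  have zL: "z k \<in> int_lattice" for k by (simp add: z_def int_lattice_def)
  have zp: "norm (z k - p k) \<le> c" for k
  proof -
    have "norm (z k - p k) \<le> (\<Sum>i\<in>UNIV. \<bar>(z k - p k) $ i\<bar>)" by (rule norm_le_l1_cart)
    also have "\<dots> \<le> (\<Sum>i\<in>(UNIV :: 'd set). 1)"
    proof (rule sum_mono)
      fix i show "\<bar>(z k - p k) $ i\<bar> \<le> 1"
        using of_int_round_abs_le[of "p k $ i"] by (simp add: z_def)
    qed
    finally show ?thesis by (simp add: c_def)
  qed
  have zpu: "\<bar>z k \<bullet> u - p k \<bullet> u\<bar> \<le> c" if "u \<in> insert n B \<or> u \<in> insert n B'" for k u
  proof -
    have "\<bar>(z k - p k) \<bullet> u\<bar> \<le> norm (z k - p k)"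
      using that frame_inner_le[OF fr, of u] frame_inner_le[OF fr', of u] by blast
    thus ?thesis using zp[of k] by (simp add: inner_diff_left)
  qed
  have zn: "\<bar>z k \<bullet> n\<bar> \<le> c" for k using zpu[of n k] pn[of k] by simp
  define M where "M = \<lceil>c * N\<rceil>"
  define K where "K = {k \<in> B' \<rightarrow>\<^sub>E {-M..M}. \<forall>u\<in>B. \<bar>p k \<bullet> u\<bar> \<le> N / 2 - m}"
  have finK: "finite K" unfolding K_def by (rule finite_subset[OF _ finite_PiE[of B' "\<lambda>_. {-M..M}"]]) (use fB in auto)
  have sep: "\<exists>u\<in>B'. \<bar>p k \<bullet> u - p k' \<bullet> u\<bar> \<ge> D" if "k \<in> K" "k' \<in> K" "k \<noteq> k'" for k k'
  proof -
    have "\<exists>u\<in>B'. k u \<noteq> k' u"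
    proof (rule ccontr)
      assume "\<not> ?thesis"
      hence "k = k'" using that(1,2) by (intro PiE_ext[of k B' "\<lambda>_. {-M..M}" k']) (auto simp: K_def)
      thus False using that(3) by simp
    qed
    then obtain u where u: "u \<in> B'" "k u \<noteq> k' u" by auto
    have "1 \<le> \<bar>real_of_int (k u) - real_of_int (k' u)\<bar>" using u(2) by linarith
    hence "D * 1 \<le> D * \<bar>real_of_int (k u) - real_of_int (k' u)\<bar>" using D0 by (intro mult_left_mono) auto
    also have "\<dots> = \<bar>p k \<bullet> u - p k' \<bullet> u\<bar>" using D0 unfolding pu[OF u(1)] by (simp add: abs_mult right_diff_distrib[symmetric])
    finally show ?thesis using u(1) by auto
  qed
  have zsep: "\<exists>u\<in>B'. \<bar>z k \<bullet> u - z k' \<bullet> u\<bar> \<ge> L" if "k \<in> K" "k' \<in> K" "k \<noteq> k'" for k k'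
  proof -
    from sep[OF that] obtain u where u: "u \<in> B'" "\<bar>p k \<bullet> u - p k' \<bullet> u\<bar> \<ge> D" by auto
    have "\<bar>z k \<bullet> u - p k \<bullet> u\<bar> \<le> c" "\<bar>z k' \<bullet> u - p k' \<bullet> u\<bar> \<le> c" using zpu u by auto
    hence "\<bar>z k \<bullet> u - z k' \<bullet> u\<bar> \<ge> L" using u(2) unfolding D_def by linarith
    thus ?thesis using u(1) by auto
  qed
  have inj: "inj_on z K"
  proof (rule inj_onI, rule ccontr)
    fix k k' assume k: "k \<in> K" "k' \<in> K" "z k = z k'" "k \<noteq> k'"
    obtain u where "\<bar>z k \<bullet> u - z k' \<bullet> u\<bar> \<ge> L" using zsep[OF k(1,2,4)] by auto
    thus False using k(3) L by simp
  qed
  define Z where "Z = z ` K"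
  define S where "S = {x. (\<exists>k\<in>K. x \<in> (+) (z k) ` ?bx \<and> (x - z k) \<bullet> n < 0) \<or> (x \<notin> (\<Union>w\<in>Z. (+) w ` ?bx) \<and> x \<bullet> n < 0)}"
  have blk: "\<bar>x \<bullet> u\<bar> < L / 2" if "x \<in> ?bx" "u \<in> B'" for x u
    using that by (auto simp: box_lattice_def open_box_def)
  have blkn: "\<bar>x \<bullet> n\<bar> < H'" if "x \<in> ?bx" for x using that by (auto simp: box_lattice_def open_box_def)
  have disjK: "(+) (z k) ` ?bx \<inter> (+) (z k') ` ?bx = {}" if k: "k \<in> K" "k' \<in> K" "k \<noteq> k'" for k k'
  proof (rule equals0I)
    fix y assume "y \<in> (+) (z k) ` ?bx \<inter> (+) (z k') ` ?bx"
    then obtain x x' where x: "x \<in> ?bx" "x' \<in> ?bx" "y = z k + x" "y = z k' + x'" by auto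
    obtain u where u: "u \<in> B'" "\<bar>z k \<bullet> u - z k' \<bullet> u\<bar> \<ge> L" using zsep[OF k] by auto
    have "z k + x = z k' + x'" using x by simp
    hence "z k \<bullet> u + x \<bullet> u = z k' \<bullet> u + x' \<bullet> u" by (metis inner_add_left)
    thus False using blk[OF x(1) u(1)] blk[OF x(2) u(1)] u(2) by linarith
  qed
  show ?thesis
  proof (rule that[of Z S])
    show "finite Z" "Z \<subseteq> int_lattice" using finK zL by (auto simp: Z_def)
    show "(+) w ` ?bx \<inter> (+) w' ` ?bx = {}" if "w \<in> Z" "w' \<in> Z" "w \<noteq> w'" for w w'
      using that disjK unfolding Z_def by blast
    show "w + x \<in> core ?\<Lambda>" if w: "w \<in> Z" and x: "x \<in> ?bx" for w x
    proof -
      obtain k where k: "k \<in> K" "w = z k" using w by (auto simp: Z_def)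
      have nx: "norm x \<le> c * L + H'"
      proof -
        have "x \<in> open_box n B' 0 L H'" using x by (simp add: box_lattice_def)
        from open_box_norm[OF fr' this] have "norm x \<le> (c - 1) * (L / 2) + H'" by (simp add: cB)
        also have "\<dots> \<le> c * L + H'" using L c2 by (intro add_right_mono mult_mono) auto
        finally show ?thesis .
      qed
      have wx: "w + x \<in> int_lattice" using k zL x by (auto simp: box_lattice_def int_lattice_add)
      have near: "y \<in> open_box n B 0 N H" if y: "norm (y - (w + x)) \<le> 1" for y
      proof -
        have ye: "y - p k = (y - (w + x)) + x + (z k - p k)" by (simp add: k)
        have "norm (y - p k) \<le> norm (y - (w + x)) + norm x + norm (z k - p k)"
          unfolding ye by (rule norm_triangle_le[OF add_right_mono[OF norm_triangle_ineq]])
        hence ny: "norm (y - p k) \<le> 1 + (c * L + H') + c" using y nx zp[of k] by linarith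
        have a: "\<bar>y \<bullet> u - p k \<bullet> u\<bar> \<le> 1 + (c * L + H') + c" if "u \<in> insert n B" for u
          using frame_inner_le[OF fr that, of "y - p k"] ny by (simp add: inner_diff_left)
        have cD: "c * D \<ge> 0" using c2 D0 by simp
        have "\<bar>y \<bullet> u\<bar> < N / 2" if u: "u \<in> B" for u
        proof -
          have "\<bar>p k \<bullet> u\<bar> \<le> N / 2 - m" using k u by (auto simp: K_def)
          thus ?thesis using a[of u] u c2 cD unfolding m_def by (auto simp: abs_le_iff abs_less_iff)
        qed
        moreover have "\<bar>y \<bullet> n\<bar> < H" using a[of n] pn[of k] H c2 cD unfolding m_def by auto
        ultimately show ?thesis by (simp add: open_box_def)
      qed
      have "w + x \<in> ?\<Lambda>" using near[of "w + x"] wx by (simp add: box_lattice_def)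
      moreover have "w + x \<notin> lattice_boundary ?\<Lambda>"
      proof
        assume "w + x \<in> lattice_boundary ?\<Lambda>"
        then obtain y where "y \<in> int_lattice" "y \<notin> ?\<Lambda>" "dist y (w + x) = 1" by (auto simp: lattice_boundary_def)
        thus False using near[of y] by (auto simp: box_lattice_def dist_norm)
      qed
      ultimately show ?thesis by (simp add: core_def)
    qed
    show "w + x \<in> S \<longleftrightarrow> x \<bullet> n < 0" if w: "w \<in> Z" and x: "x \<in> ?bx" for w x
    proof -
      obtain k where k: "k \<in> K" "w = z k" using w by (auto simp: Z_def)
      have mem: "w + x \<in> (+) (z k) ` ?bx" using x k by auto
      hence un: "w + x \<in> (\<Union>w\<in>Z. (+) w ` ?bx)" using k by (auto simp: Z_def)
      have uniq: "k' = k" if "k' \<in> K" "w + x \<in> (+) (z k') ` ?bx" for k'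
        using disjK[OF that(1) k(1)] that(2) mem by blast
      have "w + x \<in> S \<longleftrightarrow> (\<exists>k'\<in>K. w + x \<in> (+) (z k') ` ?bx \<and> (w + x - z k') \<bullet> n < 0)"
        unfolding S_def using un by blast
      also have "\<dots> \<longleftrightarrow> (w + x - z k) \<bullet> n < 0" using uniq mem k(1) by blast
      finally show ?thesis using k(2) by simp
    qed
    show S2: "x \<in> S \<longleftrightarrow> x \<bullet> n < 0" if "x \<notin> (\<Union>w\<in>Z. (+) w ` ?bx)" for x
      using that unfolding S_def Z_def by blast
    have cZ: "card Z = card K" unfolding Z_def by (rule card_image[OF inj])
    show "real (card Z) * L ^ (CARD('d) - 1) \<le> N ^ (CARD('d) - 1)"
    proof -
      define A where "A k = {x. \<forall>u\<in>insert n B'. (if u = n then -1 else p k \<bullet> u - D / 2) < x \<bullet> u \<and> x \<bullet> u < (if u = n then 1 else p k \<bullet> u + D / 2)}" for k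
      let ?C = "{x. \<forall>u\<in>insert n B. (if u = n then -1 else - N / 2) \<le> x \<bullet> u \<and> x \<bullet> u \<le> (if u = n then 1 else N / 2)}"
      have Amem: "p k \<bullet> v - D / 2 < x \<bullet> v" "x \<bullet> v < p k \<bullet> v + D / 2" if x: "x \<in> A k" and v: "v \<in> B'" for k x v
      proof -
        have ne: "v \<noteq> n" using v nB by auto
        have "\<forall>u\<in>insert n B'. (if u = n then -1 else p k \<bullet> u - D / 2) < x \<bullet> u \<and> x \<bullet> u < (if u = n then 1 else p k \<bullet> u + D / 2)"
          using x unfolding A_def mem_Collect_eq .
        from bspec[OF this insertI2[OF v]] ne show "p k \<bullet> v - D / 2 < x \<bullet> v" "x \<bullet> v < p k \<bullet> v + D / 2" by simp_all
      qed
      have Amemn: "-1 \<le> x \<bullet> n" "x \<bullet> n \<le> 1" if x: "x \<in> A k" for k x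
        using x by (simp_all add: A_def less_imp_le)
      have vA: "emeasure lborel (A k) = ennreal (2 * D ^ (CARD('d) - 1))" for k
      proof -
        have "emeasure lborel (A k) = ennreal (\<Prod>u\<in>insert n B'. (if u = n then 1 else p k \<bullet> u + D / 2) - (if u = n then -1 else p k \<bullet> u - D / 2))"
          unfolding A_def by (rule frame_box_volume(2)[OF fr']) (use D0 in auto)
        also have "(\<Prod>u\<in>insert n B'. (if u = n then 1 else p k \<bullet> u + D / 2) - (if u = n then -1 else p k \<bullet> u - D / 2))
           = (\<Prod>u\<in>insert n B'. if u = n then 2 else D)" by (rule prod.cong) auto
        also have "\<dots> = 2 * D ^ (CARD('d) - 1)" by (rule frame_prod[OF fr'])
        finally show ?thesis .
      qed
      have vC: "emeasure lborel ?C = ennreal (2 * N ^ (CARD('d) - 1))"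
      proof -
        have "emeasure lborel ?C = ennreal (\<Prod>u\<in>insert n B. (if u = n then 1 else N / 2) - (if u = n then -1 else - N / 2))"
          by (rule frame_box_volume(1)[OF fr]) (use N in auto)
        also have "(\<Prod>u\<in>insert n B. (if u = n then 1 else N / 2) - (if u = n then -1 else - N / 2))
           = (\<Prod>u\<in>insert n B. if u = n then 2 else N)" by (rule prod.cong) auto
        also have "\<dots> = 2 * N ^ (CARD('d) - 1)" by (rule frame_prod[OF fr])
        finally show ?thesis .
      qed
      have "real (card K) * (2 * D ^ (CARD('d) - 1)) \<le> 2 * N ^ (CARD('d) - 1)"
      proof (rule packing_bound[where A = A and M = lborel and C = ?C])
        show "A k \<in> sets lborel" for k
        proof -
          have "A k = (\<Inter>u\<in>insert n B'. {x. (if u = n then -1 else p k \<bullet> u - D / 2) < x \<bullet> u} \<inter> {x. x \<bullet> u < (if u = n then 1 else p k \<bullet> u + D / 2)})"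
            unfolding A_def by blast
          moreover have "open \<dots>" using fB by (intro open_INT ballI open_Int open_Collect_less continuous_intros) auto
          ultimately show ?thesis by simp
        qed
        show "disjoint_family_on A K"
        proof (unfold disjoint_family_on_def, intro ballI impI equals0I)
          fix k k' x assume k: "k \<in> K" "k' \<in> K" "k \<noteq> k'" "x \<in> A k \<inter> A k'"
          obtain u where u: "u \<in> B'" "\<bar>p k \<bullet> u - p k' \<bullet> u\<bar> \<ge> D" using sep[OF k(1-3)] by auto
          have "x \<in> A k" "x \<in> A k'" using k(4) by auto
          note Amem[OF this(1) u(1)] Amem[OF this(2) u(1)]
          with u(2) show False by linarith
        qed
        show "A k \<subseteq> ?C" if k: "k \<in> K" for k
        proof
          fix x assume x: "x \<in> A k"
          have xb: "\<bar>(x - p k) \<bullet> v\<bar> \<le> D / 2" if "v \<in> B'" for v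
            using Amem[OF x that] unfolding inner_diff_left by linarith
          have xN: "\<bar>x \<bullet> u\<bar> \<le> N / 2" if u: "u \<in> B" for u
          proof -
            have "\<bar>(x - p k) \<bullet> u\<bar> \<le> (\<Sum>v\<in>B'. \<bar>(x - p k) \<bullet> v\<bar>)" by (rule lateral_inner_le[OF fr fr' u])
            also have "\<dots> \<le> (\<Sum>v\<in>B'. D / 2)" by (intro sum_mono xb)
            also have "\<dots> = (c - 1) * (D / 2)" by (simp add: cB)
            also have "\<dots> \<le> c * D" using c2 D0 by (intro mult_mono) auto
            also have "\<dots> \<le> m" using c2 L H' by (simp add: m_def)
            finally have "\<bar>x \<bullet> u - p k \<bullet> u\<bar> \<le> m" by (simp add: inner_diff_left)
            moreover have "\<bar>p k \<bullet> u\<bar> \<le> N / 2 - m" using k u by (auto simp: K_def)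
            ultimately show ?thesis by linarith
          qed
          show "x \<in> ?C"
          proof (intro CollectI ballI)
            fix u assume "u \<in> insert n B"
            thus "(if u = n then -1 else - N / 2) \<le> x \<bullet> u \<and> x \<bullet> u \<le> (if u = n then 1 else N / 2)"
              using Amemn[OF x] xN[of u] by (cases "u = n") (auto simp: abs_le_iff)
          qed
        qed
        have "?C = (\<Inter>u\<in>insert n B. {x. (if u = n then -1 else - N / 2) \<le> x \<bullet> u} \<inter> {x. x \<bullet> u \<le> (if u = n then 1 else N / 2)})" by blast
        moreover have "closed \<dots>" by (intro closed_INT ballI closed_Int closed_Collect_le continuous_intros)
        ultimately show "?C \<in> sets lborel" by simp
      qed (use finK vA vC D0 N in auto)
      hence "real (card K) * D ^ (CARD('d) - 1) \<le> N ^ (CARD('d) - 1)" by simp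
      moreover have "L ^ (CARD('d) - 1) \<le> D ^ (CARD('d) - 1)" using L c2 by (intro power_mono) (auto simp: D_def)
      ultimately show ?thesis unfolding cZ
        using mult_left_mono[of "L ^ (CARD('d) - 1)" "D ^ (CARD('d) - 1)" "real (card K)"] by simp
    qed
    define F where "F = {e \<in> edges ?\<Lambda> - (\<Union>z\<in>Z. edges ((+) z ` ?bx)). odd (card (e \<inter> S))}"
    define sg where "sg = {1, -1 :: real}"
    \<comment> \<open>\<open>Q1\<close>: points near a lateral face of the large box. \<open>Q2\<close>: points of a grid cell near its
      lateral boundary. Every bad edge has an end in one of these sets.\<close>
    define Q1 where "Q1 u s = {x \<in> int_lattice. \<bar>x \<bullet> n\<bar> \<le> c + 1 \<and> (\<forall>v\<in>B. \<bar>x \<bullet> v\<bar> \<le> N / 2) \<and> N / 2 - 2 * m \<le> s * (x \<bullet> u)}" for u s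
    define Q2 where "Q2 k u s = {x \<in> int_lattice. \<bar>x \<bullet> n\<bar> \<le> c + 1 \<and> (\<forall>v\<in>B'. \<bar>(x - p k) \<bullet> v\<bar> \<le> D / 2) \<and> L / 2 - c - 1 \<le> s * ((x - p k) \<bullet> u)}" for k u s
    define Q where "Q = (\<Union>u\<in>B. \<Union>s\<in>sg. Q1 u s) \<union> (\<Union>k\<in>K. \<Union>u\<in>B'. \<Union>s\<in>sg. Q2 k u s)"
    define q1 where "q1 = (2 * m + 2 * c) * (4 * c + 2) * (N + 2 * c) ^ (CARD('d) - 2)"
    define q2 where "q2 = (4 * c + 1) * (4 * c + 2) * (L + 4 * c) ^ (CARD('d) - 2)"
    have Q1: "finite (Q1 u s)" "real (card (Q1 u s)) \<le> q1" if u: "u \<in> B" and s: "s \<in> sg" for u s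
    proof -
      define a0 where "a0 = (if s = 1 then N / 2 - 2 * m else - N / 2)"
      have xa: "a0 \<le> x \<bullet> u \<and> x \<bullet> u \<le> a0 + 2 * m" if "x \<in> Q1 u s" for x
      proof -
        have "\<bar>x \<bullet> u\<bar> \<le> N / 2" "N / 2 - 2 * m \<le> s * (x \<bullet> u)" using that u by (auto simp: Q1_def)
        thus ?thesis using s by (auto simp: sg_def a0_def abs_le_iff)
      qed
      have "0 \<le> 2 * m" "0 \<le> c + 1" "0 \<le> N / 2" using m0 c2 N by auto
      note sc = slab_count[OF fr u this, of "Q1 u s" a0 0]
      have ce: "2 * (c + 1) + 2 * real CARD('d) = 4 * c + 2" by (simp add: c_def)
      show "finite (Q1 u s)" by (rule sc(1)) (use xa in \<open>auto simp: Q1_def\<close>)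
      have "real (card (Q1 u s)) \<le> (2 * m + 2 * real CARD('d)) * (2 * (c + 1) + 2 * real CARD('d)) * (2 * (N / 2) + 2 * real CARD('d)) ^ (CARD('d) - 2)"
        by (rule sc(2)) (use xa in \<open>auto simp: Q1_def\<close>)
      thus "real (card (Q1 u s)) \<le> q1" unfolding ce q1_def by (simp add: c_def)
    qed
    have Q2: "finite (Q2 k u s)" "real (card (Q2 k u s)) \<le> q2" if u: "u \<in> B'" and s: "s \<in> sg" for k u s
    proof -
      define a0 where "a0 = p k \<bullet> u + (if s = 1 then L / 2 - c - 1 else - D / 2)"
      have xa: "a0 \<le> x \<bullet> u \<and> x \<bullet> u \<le> a0 + (2 * c + 1)" if "x \<in> Q2 k u s" for x
      proof -
        have "\<bar>x \<bullet> u - p k \<bullet> u\<bar> \<le> D / 2" "L / 2 - c - 1 \<le> s * (x \<bullet> u - p k \<bullet> u)"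
          using that u by (auto simp: Q2_def inner_diff_left)
        note b = this
        have b1: "x \<bullet> u - p k \<bullet> u \<le> D / 2" "- (D / 2) \<le> x \<bullet> u - p k \<bullet> u"
          using b(1) unfolding abs_le_iff by linarith+
        from s consider "s = 1" | "s = -1" by (auto simp: sg_def)
        thus ?thesis
        proof cases
          case 1
          have a: "a0 = p k \<bullet> u + (L / 2 - c - 1)" using 1 by (simp add: a0_def)
          have "L / 2 - c - 1 \<le> x \<bullet> u - p k \<bullet> u" using b(2) 1 by simp
          thus ?thesis using b1 by (simp add: a D_def field_simps)
        next
          case 2
          have a: "a0 = p k \<bullet> u - D / 2" using 2 by (simp add: a0_def)
          have "L / 2 - c - 1 \<le> p k \<bullet> u - x \<bullet> u" using b(2) 2 by simp
          thus ?thesis using b1 by (simp add: a D_def field_simps)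
        qed
      qed
      have "0 \<le> 2 * c + 1" "0 \<le> c + 1" "0 \<le> D / 2" using c2 D0 by auto
      note sc = slab_count[OF fr' u this, of "Q2 k u s" a0 "p k"]
      have ce: "2 * (c + 1) + 2 * real CARD('d) = 4 * c + 2" "2 * c + 1 + 2 * real CARD('d) = 4 * c + 1"
         "2 * (D / 2) + 2 * real CARD('d) = L + 4 * c" by (simp_all add: c_def D_def)
      show "finite (Q2 k u s)" by (rule sc(1)) (use xa in \<open>auto simp: Q2_def\<close>)
      have "real (card (Q2 k u s)) \<le> (2 * c + 1 + 2 * real CARD('d)) * (2 * (c + 1) + 2 * real CARD('d)) * (2 * (D / 2) + 2 * real CARD('d)) ^ (CARD('d) - 2)"
        by (rule sc(2)) (use xa in \<open>auto simp: Q2_def\<close>)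
      thus "real (card (Q2 k u s)) \<le> q2" unfolding ce q2_def .
    qed
    have fsg: "finite sg" "card sg = 2" by (auto simp: sg_def)
    have finQ: "finite Q" unfolding Q_def using fB finK fsg Q1(1) Q2(1) by auto
    have QL: "Q \<subseteq> int_lattice" by (auto simp: Q_def Q1_def Q2_def)
    have cardQ: "real (card Q) \<le> 2 * c * q1 + real (card K) * (2 * c * q2)"
    proof -
      have q0: "q1 \<ge> 0" "q2 \<ge> 0" using m0 c2 N L by (auto simp: q1_def q2_def)
      have "card (\<Union>u\<in>B. \<Union>s\<in>sg. Q1 u s) \<le> (\<Sum>u\<in>B. \<Sum>s\<in>sg. card (Q1 u s))"
        by (rule order.trans[OF card_UN_le[OF fB(1)] sum_mono[OF card_UN_le[OF fsg(1)]]])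
      hence "real (card (\<Union>u\<in>B. \<Union>s\<in>sg. Q1 u s)) \<le> real (\<Sum>u\<in>B. \<Sum>s\<in>sg. card (Q1 u s))"
        by (rule of_nat_mono)
      also have "\<dots> = (\<Sum>u\<in>B. \<Sum>s\<in>sg. real (card (Q1 u s)))" by simp
      also have "\<dots> \<le> (\<Sum>u\<in>B. \<Sum>s\<in>sg. q1)" by (intro sum_mono Q1(2))
      also have "\<dots> = (c - 1) * (2 * q1)" by (simp add: cB fsg)
      also have "\<dots> \<le> c * (2 * q1)" using q0 by (intro mult_right_mono) auto
      finally have 1: "real (card (\<Union>u\<in>B. \<Union>s\<in>sg. Q1 u s)) \<le> 2 * c * q1" by simp
      have "card (\<Union>k\<in>K. \<Union>u\<in>B'. \<Union>s\<in>sg. Q2 k u s) \<le> (\<Sum>k\<in>K. \<Sum>u\<in>B'. \<Sum>s\<in>sg. card (Q2 k u s))"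
        by (rule order.trans[OF card_UN_le[OF finK] sum_mono[OF order.trans[OF card_UN_le[OF fB(2)]
            sum_mono[OF card_UN_le[OF fsg(1)]]]]])
      hence "real (card (\<Union>k\<in>K. \<Union>u\<in>B'. \<Union>s\<in>sg. Q2 k u s)) \<le> real (\<Sum>k\<in>K. \<Sum>u\<in>B'. \<Sum>s\<in>sg. card (Q2 k u s))"
        by (rule of_nat_mono)
      also have "\<dots> = (\<Sum>k\<in>K. \<Sum>u\<in>B'. \<Sum>s\<in>sg. real (card (Q2 k u s)))" by simp
      also have "\<dots> \<le> (\<Sum>k\<in>K. \<Sum>u\<in>B'. \<Sum>s\<in>sg. q2)" by (intro sum_mono Q2(2))
      also have "\<dots> = real (card K) * ((c - 1) * (2 * q2))" by (simp add: cB fsg)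
      also have "\<dots> \<le> real (card K) * (c * (2 * q2))" using q0 by (intro mult_left_mono mult_right_mono) auto
      finally have 2: "real (card (\<Union>k\<in>K. \<Union>u\<in>B'. \<Union>s\<in>sg. Q2 k u s)) \<le> real (card K) * (2 * c * q2)" by (simp add: mult_ac)
      have "real (card Q) \<le> real (card (\<Union>u\<in>B. \<Union>s\<in>sg. Q1 u s)) + real (card (\<Union>k\<in>K. \<Union>u\<in>B'. \<Union>s\<in>sg. Q2 k u s))"
        unfolding Q_def of_nat_add[symmetric] by (rule of_nat_mono[OF card_Un_le])
      thus ?thesis using 1 2 by linarith
    qed
    have hgt: "v \<in> S \<Longrightarrow> v \<bullet> n < c" "v \<notin> S \<Longrightarrow> - c \<le> v \<bullet> n" for v
    proof -
      show "v \<bullet> n < c" if "v \<in> S"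
      proof (cases "v \<in> (\<Union>w\<in>Z. (+) w ` ?bx)")
        case True
        then obtain k where "(v - z k) \<bullet> n < 0" using \<open>v \<in> S\<close> unfolding S_def by blast
        thus ?thesis using zn[of k] by (simp add: inner_diff_left)
      next
        case False
        thus ?thesis using S2[OF False] that c2 by simp
      qed
      show "- c \<le> v \<bullet> n" if "v \<notin> S"
      proof (cases "v \<in> (\<Union>w\<in>Z. (+) w ` ?bx)")
        case True
        then obtain k where k: "k \<in> K" "v \<in> (+) (z k) ` ?bx" unfolding Z_def by blast
        hence "\<not> (v - z k) \<bullet> n < 0" using that unfolding S_def by blast
        thus ?thesis using zn[of k] by (simp add: inner_diff_left)
      next
        case False
        thus ?thesis using S2[OF False] that c2 by simp
      qed
    qed
    have meet: "e \<inter> Q \<noteq> {}" if e: "e \<in> F" for e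
    proof -
      have eE: "e \<in> edges ?\<Lambda>" "odd (card (e \<inter> S))" and nob: "\<And>k. k \<in> K \<Longrightarrow> e \<notin> edges ((+) (z k) ` ?bx)"
        using e by (auto simp: F_def Z_def)
      obtain x y where xy: "e = {x, y}" "x \<in> ?\<Lambda>" "y \<in> ?\<Lambda>" "dist x y = 1" "x \<noteq> y" using eE(1) by (rule edgesE)
      have xor: "(x \<in> S) \<noteq> (y \<in> S)" using eE(2) unfolding xy(1) odd_card_pair[OF xy(5)] .
      have dxy: "\<bar>x \<bullet> v - y \<bullet> v\<bar> \<le> 1" if "v \<in> insert n B \<or> v \<in> insert n B'" for v
      proof -
        have "\<bar>(x - y) \<bullet> v\<bar> \<le> norm (x - y)"
          using that frame_inner_le[OF fr, of v] frame_inner_le[OF fr', of v] by blast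
        thus ?thesis using xy(4) by (simp add: dist_norm inner_diff_left)
      qed
      have hx: "\<bar>x \<bullet> n\<bar> \<le> c + 1" "\<bar>y \<bullet> n\<bar> \<le> c + 1"
        using xor hgt[of x] hgt[of y] dxy[of n] by (auto simp: abs_le_iff)
      have xB: "\<bar>x \<bullet> v\<bar> \<le> N / 2" if "v \<in> B" for v
        using xy(2) that by (auto simp: box_lattice_def open_box_def less_imp_le)
      have xL: "x \<in> int_lattice" using xy(2) by (simp add: box_lattice_def)
      \<comment> \<open>The grid cell that contains \<open>x\<close>.\<close>
      define k where "k = (\<lambda>u. if u \<in> B' then round (x \<bullet> u / D) else undefined)"
      have kx: "\<bar>(x - p k) \<bullet> u\<bar> \<le> D / 2" if u: "u \<in> B'" for u
      proof -
        have "\<bar>real_of_int (k u) - x \<bullet> u / D\<bar> \<le> 1 / 2" using u of_int_round_abs_le[of "x \<bullet> u / D"] by (simp add: k_def)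
        hence "D * \<bar>real_of_int (k u) - x \<bullet> u / D\<bar> \<le> D * (1 / 2)" using D0 by (intro mult_left_mono) auto
        also have "D * \<bar>real_of_int (k u) - x \<bullet> u / D\<bar> = \<bar>D * (real_of_int (k u) - x \<bullet> u / D)\<bar>" using D0 by (simp add: abs_mult)
        also have "D * (real_of_int (k u) - x \<bullet> u / D) = p k \<bullet> u - x \<bullet> u" using D0 pu[OF u, of k] by (simp add: algebra_simps)
        finally show ?thesis by (simp add: inner_diff_left abs_minus_commute)
      qed
      have kPi: "k \<in> B' \<rightarrow>\<^sub>E {-M..M}"
      proof (rule PiE_I)
        fix u assume u: "u \<in> B'"
        have "\<bar>x \<bullet> u\<bar> \<le> (\<Sum>v\<in>B. \<bar>x \<bullet> v\<bar>)" by (rule lateral_inner_le[OF fr' fr u])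
        also have "\<dots> \<le> (\<Sum>v\<in>B. N / 2)" by (intro sum_mono xB)
        also have "\<dots> = (c - 1) * (N / 2)" by (simp add: cB)
        finally have x1: "\<bar>x \<bullet> u\<bar> \<le> (c - 1) * (N / 2)" .
        have "\<bar>x \<bullet> u / D\<bar> \<le> \<bar>x \<bullet> u\<bar>" using D0 L c2 by (simp add: abs_divide D_def divide_le_eq mult_le_cancel_left1)
        hence "\<bar>x \<bullet> u / D\<bar> \<le> (c - 1) * (N / 2)" using x1 by (rule order.trans)
        moreover have "\<bar>real_of_int (k u) - x \<bullet> u / D\<bar> \<le> 1 / 2" using u of_int_round_abs_le[of "x \<bullet> u / D"] by (simp add: k_def)
        ultimately have "\<bar>real_of_int (k u)\<bar> \<le> (c - 1) * (N / 2) + 1 / 2" by linarith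
        also have "\<dots> \<le> c * N"
        proof -
          have "0 \<le> c * N" using c2 N by simp
          moreover have "(c - 1) * (N / 2) = (c * N) / 2 - N / 2" by (simp add: left_diff_distrib diff_divide_distrib)
          ultimately show ?thesis using N by linarith
        qed
        finally have "\<bar>k u\<bar> \<le> M" unfolding M_def by linarith
        thus "k u \<in> {-M..M}" by auto
      qed (simp add: k_def)
      have "x \<in> Q"
      proof (cases "k \<in> K")
        case False
        then obtain u where u: "u \<in> B" "\<bar>p k \<bullet> u\<bar> > N / 2 - m" using kPi by (auto simp: K_def not_le)
        have "\<bar>(x - p k) \<bullet> u\<bar> \<le> (\<Sum>v\<in>B'. \<bar>(x - p k) \<bullet> v\<bar>)" by (rule lateral_inner_le[OF fr fr' u(1)])
        also have "\<dots> \<le> (\<Sum>v\<in>B'. D / 2)" by (intro sum_mono kx)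
        also have "\<dots> = (c - 1) * (D / 2)" by (simp add: cB)
        also have "\<dots> \<le> c * D" using c2 D0 by (intro mult_mono) auto
        also have "\<dots> \<le> m" using c2 L H' by (simp add: m_def)
        finally have "\<bar>x \<bullet> u - p k \<bullet> u\<bar> \<le> m" by (simp add: inner_diff_left)
        hence "N / 2 - 2 * m \<le> \<bar>x \<bullet> u\<bar>" using u(2) by linarith
        hence "\<exists>s\<in>sg. N / 2 - 2 * m \<le> s * (x \<bullet> u)" by (auto simp: sg_def abs_if split: if_splits)
        thus ?thesis using u(1) xL hx(1) xB unfolding Q_def Q1_def by blast
      next
        case True
        have "\<not> (x \<in> (+) (z k) ` ?bx \<and> y \<in> (+) (z k) ` ?bx)"
          using nob[OF True] xy(4) unfolding xy(1) pair_in_edges by blast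
        then obtain v where v: "v \<in> {x, y}" "v \<notin> (+) (z k) ` ?bx" by blast
        have "v - z k \<notin> ?bx" using v(2) by (metis add.commute diff_add_cancel image_eqI)
        moreover have "v - z k \<in> int_lattice" using v(1) xy(2,3) zL[of k] by (auto simp: box_lattice_def intro: int_lattice_diff)
        moreover have "\<bar>(v - z k) \<bullet> n\<bar> < H'"
          using v(1) hx zn[of k] H' by (auto simp: inner_diff_left abs_le_iff abs_less_iff)
        ultimately obtain u where u: "u \<in> B'" "\<bar>(v - z k) \<bullet> u\<bar> \<ge> L / 2"
          by (auto simp: box_lattice_def open_box_def not_less)
        have "\<bar>z k \<bullet> u - p k \<bullet> u\<bar> \<le> c" "\<bar>x \<bullet> u - v \<bullet> u\<bar> \<le> 1" using zpu[of u k] dxy[of u] u(1) v(1) by auto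
        hence "L / 2 - c - 1 \<le> \<bar>(x - p k) \<bullet> u\<bar>" using u(2) unfolding inner_diff_left by linarith
        hence "\<exists>s\<in>sg. L / 2 - c - 1 \<le> s * ((x - p k) \<bullet> u)" by (auto simp: sg_def abs_if split: if_splits)
        thus ?thesis using u(1) xL hx(1) kx True unfolding Q_def Q2_def by blast
      qed
      thus ?thesis using xy(1) by auto
    qed
    have "card F \<le> 2 * CARD('d) * card Q"
    proof (rule card_incident_edges(2)[OF finQ QL _ meet])
      have "?\<Lambda> \<subseteq> int_lattice" by (simp add: box_lattice_def)
      from edges_mono[OF this] show "F \<subseteq> edges int_lattice" by (auto simp: F_def)
    qed
    hence "real (card F) \<le> 2 * c * real (card Q)" unfolding c_def by (metis of_nat_le_iff of_nat_mult of_nat_numeral)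
    also have "\<dots> \<le> 2 * c * (2 * c * q1 + real (card K) * (2 * c * q2))" using cardQ c2 by (intro mult_left_mono) auto
    finally show "real (card {e \<in> edges ?\<Lambda> - (\<Union>z\<in>Z. edges ((+) z ` ?bx)). odd (card (e \<inter> S))})
      \<le> 2 * c * (2 * c * ((2 * m + 2 * c) * (4 * c + 2) * (N + 2 * c) ^ (CARD('d) - 2))
          + real (card Z) * (2 * c * ((4 * c + 1) * (4 * c + 2) * (L + 4 * c) ^ (CARD('d) - 2))))"
      unfolding F_def[symmetric] cZ q1_def q2_def .
  qed
qed

section \<open>Approximate subadditivity of the tension\<close>

text \<open>A flat interface, obtained by gluing without any block.\<close>

lemma tension_upper_bound:
  fixes n :: "real ^ 'd"
  assumes fr: "frame n B" and d2: "CARD('d) \<ge> 2" and L0: "L > 0" and H0: "H > 0"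
    and \<beta>: "0 \<le> \<beta>" and J: "\<And>e. e \<in> edges (box_lattice n B L H) \<Longrightarrow> 0 \<le> J e \<and> J e \<le> 1"
  shows "spin_tension \<beta> J n (box_lattice n B L H)
    \<le> \<beta> * (2 * real CARD('d) * ((2 + 2 * real CARD('d)) * (L + 2 * real CARD('d)) ^ (CARD('d) - 1)))"
proof -
  let ?\<Lambda> = "box_lattice n B L H" and ?S = "{x. x \<bullet> n < 0}"
  note fin = box_finite[OF fr d2 L0 H0 refl] and sub = box_sub_lattice[OF fr d2 L0 H0 refl]
  have "spin_tension \<beta> J n ?\<Lambda> \<le> (\<Sum>z\<in>{}. spin_tension \<beta> (\<lambda>e. J ((+) z ` e)) n ?\<Lambda>)
     + \<beta> * real (card {e \<in> edges ?\<Lambda> - (\<Union>z\<in>{}. edges ((+) z ` ?\<Lambda>)). odd (card (e \<inter> ?S))})"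
    by (rule gluing) (use fin sub \<beta> J in auto)
  also have "\<dots> = \<beta> * real (card {e \<in> edges ?\<Lambda>. odd (card (e \<inter> ?S))})" by simp
  also have "\<dots> \<le> \<beta> * (2 * real CARD('d) * ((2 * 1 + 2 * real CARD('d)) * (L + 2 * real CARD('d)) ^ (CARD('d) - 1)))"
  proof (intro mult_left_mono[OF _ \<beta>] card_near_plane[OF fr d2 L0 H0 refl])
    show "{e \<in> edges ?\<Lambda>. odd (card (e \<inter> ?S))} \<subseteq> edges int_lattice" using edges_mono[OF sub] by auto
    fix e assume e: "e \<in> {e \<in> edges ?\<Lambda>. odd (card (e \<inter> ?S))}"
    then obtain x where x: "x \<in> e" "x \<in> ?\<Lambda>" by (blast elim: edgesE)
    have "\<bar>x \<bullet> n\<bar> \<le> 1"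
      by (rule crossing_edge[OF fr d2 L0 H0 refl, of e x]) (use e x edges_mono[OF sub] in auto)
    thus "\<exists>x\<in>e. x \<in> ?\<Lambda> \<and> \<bar>x \<bullet> n\<bar> \<le> 1" using x by auto
  qed auto
  finally show ?thesis by simp
qed

text \<open>In \<open>covering\<close> the bad edges near the lateral faces of the large box are a fraction of
  order \<open>1 / N\<close> of \<open>N\<^bsup>d-1\<^esup>\<close> for fixed \<open>L\<close>, and those near the faces of the blocks a fraction of
  order \<open>1 / L\<close>. The set of translations does not depend on the couplings, which makes the bound
  useful for random \<open>J\<close>.\<close>

lemma subadditivity:
  fixes n :: "real ^ 'd" and \<delta> \<delta>' \<epsilon> :: real
  assumes fr: "frame n B" and fr': "frame n B'" and d2: "CARD('d) \<ge> 2" and pos: "\<delta> > 0" "\<delta>' > 0" "\<epsilon> > 0"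
  shows "\<forall>\<^sub>F L :: nat in sequentially. \<forall>\<^sub>F N :: nat in sequentially. \<exists>Z. finite Z \<and> Z \<subseteq> int_lattice \<and>
    real (card Z) * real L ^ (CARD('d) - 1) \<le> real N ^ (CARD('d) - 1) \<and>
    (\<forall>z\<in>Z. \<forall>z'\<in>Z. z \<noteq> z' \<longrightarrow> (+) z ` box_lattice n B' (real L) (\<delta>' * real L) \<inter> (+) z' ` box_lattice n B' (real L) (\<delta>' * real L) = {}) \<and>
    (\<forall>\<beta>\<ge>0. \<forall>J. (\<forall>e\<in>edges (box_lattice n B (real N) (\<delta> * real N)). 0 \<le> J e \<and> J e \<le> 1) \<longrightarrow>
       spin_tension \<beta> J n (box_lattice n B (real N) (\<delta> * real N))
        \<le> (\<Sum>z\<in>Z. spin_tension \<beta> (\<lambda>e. J ((+) z ` e)) n (box_lattice n B' (real L) (\<delta>' * real L)))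
          + \<beta> * \<epsilon> * real N ^ (CARD('d) - 1))"
proof -
  define c where "c = real CARD('d)"
  have c2: "c \<ge> 2" using d2 by (simp add: c_def)
  define p where "p = CARD('d) - 2"
  have p1: "CARD('d) - 1 = Suc p" using d2 by (simp add: p_def)
  define C2 where "C2 = 4 * c * c * ((4 * c + 1) * (4 * c + 2))"
  have C20: "C2 \<ge> 0" using c2 by (simp add: C2_def)
  define m where "m L = 2 * c + 2 + c * L + \<delta>' * L + c * (L + 2 * c)" for L
  define C1 where "C1 L = 4 * c * c * ((2 * m L + 2 * c) * (4 * c + 2))" for L
  obtain L0 :: nat where L0: "real L0 > max (max (4 * c) ((2 * c + 2) / \<delta>')) (2 * C2 * 2 ^ p / \<epsilon>)"
    using reals_Archimedean2 by blast
  show ?thesis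
  proof (rule eventually_sequentiallyI[of L0])
    fix L :: nat assume "L0 \<le> L"
    hence L: "real L > 4 * c" "real L > (2 * c + 2) / \<delta>'" "real L > 2 * C2 * 2 ^ p / \<epsilon>"
      using L0 by (auto simp: less_le_trans)
    have Lp: "real L > 0" using L(1) c2 by linarith
    have H'L: "\<delta>' * real L > 2 * c + 2" using L(2) pos by (simp add: divide_less_eq mult.commute)
    have mL: "m (real L) \<ge> 0" using c2 Lp pos by (simp add: m_def)
    have C10: "C1 (real L) \<ge> 0" using c2 mL by (simp add: C1_def)
    obtain N0 :: nat where N0: "real N0 > max (max (2 * c) (m (real L) / \<delta>)) (2 * C1 (real L) * 2 ^ p / \<epsilon>)"
      using reals_Archimedean2 by blast
    show "\<forall>\<^sub>F N :: nat in sequentially. \<exists>Z. finite Z \<and> Z \<subseteq> int_lattice \<and>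
      real (card Z) * real L ^ (CARD('d) - 1) \<le> real N ^ (CARD('d) - 1) \<and>
      (\<forall>z\<in>Z. \<forall>z'\<in>Z. z \<noteq> z' \<longrightarrow> (+) z ` box_lattice n B' (real L) (\<delta>' * real L) \<inter> (+) z' ` box_lattice n B' (real L) (\<delta>' * real L) = {}) \<and>
        (\<forall>\<beta>\<ge>0. \<forall>J. (\<forall>e\<in>edges (box_lattice n B (real N) (\<delta> * real N)). 0 \<le> J e \<and> J e \<le> 1) \<longrightarrow>
         spin_tension \<beta> J n (box_lattice n B (real N) (\<delta> * real N))
          \<le> (\<Sum>z\<in>Z. spin_tension \<beta> (\<lambda>e. J ((+) z ` e)) n (box_lattice n B' (real L) (\<delta>' * real L)))
            + \<beta> * \<epsilon> * real N ^ (CARD('d) - 1))"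
    proof (rule eventually_sequentiallyI[of N0])
      fix N :: nat assume "N0 \<le> N"
      hence N: "real N > 2 * c" "real N > m (real L) / \<delta>" "real N > 2 * C1 (real L) * 2 ^ p / \<epsilon>"
        using N0 by (auto simp: less_le_trans)
      have N1: "real N \<ge> 1" using N(1) c2 by linarith
      have HN: "\<delta> * real N > m (real L)" using N(2) pos by (simp add: divide_less_eq mult.commute)
      let ?bN = "box_lattice n B (real N) (\<delta> * real N)" and ?bL = "box_lattice n B' (real L) (\<delta>' * real L)"
      have mm: "2 * real CARD('d) + 2 + real CARD('d) * real L + \<delta>' * real L + real CARD('d) * (real L + 2 * real CARD('d)) = m (real L)"
        by (simp add: m_def c_def)
      obtain Z S where Z: "finite Z" "Z \<subseteq> int_lattice" "real (card Z) * real L ^ (CARD('d) - 1) \<le> real N ^ (CARD('d) - 1)"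
        and disj: "\<And>z z'. z \<in> Z \<Longrightarrow> z' \<in> Z \<Longrightarrow> z \<noteq> z' \<Longrightarrow> (+) z ` ?bL \<inter> (+) z' ` ?bL = {}"
        and ins: "\<And>z x. z \<in> Z \<Longrightarrow> x \<in> ?bL \<Longrightarrow> z + x \<in> core ?bN"
        and S: "\<And>z x. z \<in> Z \<Longrightarrow> x \<in> ?bL \<Longrightarrow> z + x \<in> S \<longleftrightarrow> x \<bullet> n < 0"
           "\<And>x. x \<notin> (\<Union>z\<in>Z. (+) z ` ?bL) \<Longrightarrow> x \<in> S \<longleftrightarrow> x \<bullet> n < 0"
        and card: "real (card {e \<in> edges ?bN - (\<Union>z\<in>Z. edges ((+) z ` ?bL)). odd (card (e \<inter> S))})
          \<le> 2 * c * (2 * c * ((2 * m (real L) + 2 * c) * (4 * c + 2) * (real N + 2 * c) ^ (CARD('d) - 2))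
            + real (card Z) * (2 * c * ((4 * c + 1) * (4 * c + 2) * (real L + 4 * c) ^ (CARD('d) - 2))))"
        by (rule covering[OF fr fr' d2 Lp H'L[unfolded c_def] N1 HN[folded mm], unfolded mm, folded c_def])
          (rule that; assumption)
      let ?F = "{e \<in> edges ?bN - (\<Union>z\<in>Z. edges ((+) z ` ?bL)). odd (card (e \<inter> S))}"
      have "real (card ?F) \<le> \<epsilon> * real N ^ (CARD('d) - 1)"
      proof -
        have n1: "C1 (real L) * (real N + 2 * c) ^ p \<le> \<epsilon> / 2 * real N ^ Suc p"
        proof -
          have "(real N + 2 * c) ^ p \<le> (2 * real N) ^ p" using N(1) c2 by (intro power_mono) auto
          hence "C1 (real L) * (real N + 2 * c) ^ p \<le> C1 (real L) * (2 * real N) ^ p" using C10 by (intro mult_left_mono)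
          also have "\<dots> = (C1 (real L) * 2 ^ p) * real N ^ p" by (simp add: power_mult_distrib)
          also have "\<dots> \<le> (\<epsilon> / 2 * real N) * real N ^ p"
            using N(3) pos by (intro mult_right_mono) (auto simp: field_simps)
          finally show ?thesis by (simp add: mult_ac)
        qed
        have n2: "real (card Z) * (C2 * (real L + 4 * c) ^ p) \<le> \<epsilon> / 2 * real N ^ Suc p"
        proof -
          have "(real L + 4 * c) ^ p \<le> (2 * real L) ^ p" using L(1) c2 by (intro power_mono) auto
          hence "C2 * (real L + 4 * c) ^ p \<le> C2 * (2 * real L) ^ p" using C20 by (intro mult_left_mono)
          also have "\<dots> = (C2 * 2 ^ p) * real L ^ p" by (simp add: power_mult_distrib)
          also have "\<dots> \<le> (\<epsilon> / 2 * real L) * real L ^ p"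
            using L(3) pos by (intro mult_right_mono) (auto simp: field_simps)
          finally have "C2 * (real L + 4 * c) ^ p \<le> \<epsilon> / 2 * real L ^ Suc p" by (simp add: mult_ac)
          hence "real (card Z) * (C2 * (real L + 4 * c) ^ p) \<le> real (card Z) * (\<epsilon> / 2 * real L ^ Suc p)"
            by (intro mult_left_mono) auto
          also have "\<dots> = \<epsilon> / 2 * (real (card Z) * real L ^ Suc p)" by simp
          also have "\<dots> \<le> \<epsilon> / 2 * real N ^ Suc p" using Z(3) pos unfolding p1 by (intro mult_left_mono) auto
          finally show ?thesis .
        qed
        have "real (card ?F) \<le> C1 (real L) * (real N + 2 * c) ^ p + real (card Z) * (C2 * (real L + 4 * c) ^ p)"
          using card unfolding p_def[symmetric] C1_def C2_def by (simp add: algebra_simps)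
        thus ?thesis using n1 n2 unfolding p1 by simp
      qed
      note cF = this
      show "\<exists>Z. finite Z \<and> Z \<subseteq> int_lattice \<and>
        real (card Z) * real L ^ (CARD('d) - 1) \<le> real N ^ (CARD('d) - 1) \<and>
        (\<forall>z\<in>Z. \<forall>z'\<in>Z. z \<noteq> z' \<longrightarrow> (+) z ` ?bL \<inter> (+) z' ` ?bL = {}) \<and>
        (\<forall>\<beta>\<ge>0. \<forall>J. (\<forall>e\<in>edges ?bN. 0 \<le> J e \<and> J e \<le> 1) \<longrightarrow>
           spin_tension \<beta> J n ?bN \<le> (\<Sum>z\<in>Z. spin_tension \<beta> (\<lambda>e. J ((+) z ` e)) n ?bL) + \<beta> * \<epsilon> * real N ^ (CARD('d) - 1))"
      proof (intro exI[of _ Z] conjI ballI allI impI)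
        fix \<beta> :: real and J :: "(real ^ 'd) set \<Rightarrow> real" assume \<beta>: "0 \<le> \<beta>" and J: "\<forall>e\<in>edges ?bN. 0 \<le> J e \<and> J e \<le> 1"
        have HN0: "\<delta> * real N > 0" "\<delta>' * real L > 0" using pos N1 Lp by auto
        have Np: "real N > 0" using N1 by linarith
        have "spin_tension \<beta> J n ?bN \<le> (\<Sum>z\<in>Z. spin_tension \<beta> (\<lambda>e. J ((+) z ` e)) n ?bL) + \<beta> * real (card ?F)"
          by (rule gluing[OF box_finite[OF fr d2 Np HN0(1) refl] box_finite[OF fr' d2 Lp HN0(2) refl] Z(1)
             box_sub_lattice[OF fr d2 Np HN0(1) refl] box_sub_lattice[OF fr' d2 Lp HN0(2) refl] Z(2) disj ins \<beta> _ S])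
            (use J in auto)
        also have "\<dots> \<le> (\<Sum>z\<in>Z. spin_tension \<beta> (\<lambda>e. J ((+) z ` e)) n ?bL) + \<beta> * (\<epsilon> * real N ^ (CARD('d) - 1))"
          using cF \<beta> by (intro add_left_mono mult_left_mono)
        finally show "spin_tension \<beta> J n ?bN \<le> (\<Sum>z\<in>Z. spin_tension \<beta> (\<lambda>e. J ((+) z ` e)) n ?bL) + \<beta> * \<epsilon> * real N ^ (CARD('d) - 1)"
          by (simp add: mult.assoc)
      qed (use Z disj in auto)
    qed
  qed
qed

section \<open>The random couplings\<close>

lemma spin_tension_cong:
  assumes "\<And>e. e \<in> edges \<Lambda> \<Longrightarrow> J e = J' e"
  shows "spin_tension \<beta> J n \<Lambda> = spin_tension \<beta> J' n \<Lambda>"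
proof -
  have "spin_sum (edges \<Lambda>) (\<lambda>e. exp (- \<beta> * J e)) V X = spin_sum (edges \<Lambda>) (\<lambda>e. exp (- \<beta> * J' e)) V X" for V X
    unfolding spin_sum_def boltzmann_def
    by (intro sum.cong prod.cong refl) (use assms in auto)
  thus ?thesis by (simp add: spin_tension_def)
qed

context
  fixes \<nu> :: "real measure"
  assumes nu: "coupling_law \<nu>"
begin

lemma coupling_prob_space: "prob_space \<nu>" using nu by (simp add: coupling_law_def)

lemma coupling_space: "space \<nu> = {0..1}"
proof -
  have "space \<nu> = space (restrict_space borel {0..1::real})"
    using nu by (intro sets_eq_imp_space_eq) (simp add: coupling_law_def)
  thus ?thesis by (simp add: space_restrict_space)
qed

lemma coupling_measurable_id: "(\<lambda>x. x) \<in> measurable \<nu> borel"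
proof -
  have "sets \<nu> = sets (restrict_space borel {0..1})" using nu by (simp add: coupling_law_def)
  hence "measurable \<nu> borel = measurable (restrict_space borel {0..1}) (borel :: real measure)"
    by (rule measurable_cong_sets) simp
  thus ?thesis by (simp add: measurable_restrict_space1)
qed

lemma coupling_sets: "{j \<in> space \<nu>. j < l} \<in> sets \<nu>"
proof -
  have [measurable]: "(\<lambda>x. x) \<in> borel_measurable \<nu>" by (rule coupling_measurable_id)
  show ?thesis by measurable
qed

lemma prob_space_disorder: "prob_space (disorder \<nu>)"
  unfolding disorder_def by (rule prob_space_PiM) (rule coupling_prob_space)

lemma PiM_coupling_bounds:
  assumes "J \<in> space (\<Pi>\<^sub>M e\<in>I. \<nu>)" "e \<in> I"
  shows "0 \<le> J e" "J e \<le> 1"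
  using assms by (auto simp: space_PiM coupling_space PiE_def Pi_def)

lemma coupling_component_measurable:
  assumes "e \<in> I"
  shows "(\<lambda>J. J e) \<in> borel_measurable (\<Pi>\<^sub>M e\<in>I. \<nu>)"
  by (rule measurable_compose[OF measurable_component_singleton[OF assms] coupling_measurable_id])

lemma spin_tension_measurable:
  assumes "\<And>e. e \<in> edges \<Lambda> \<Longrightarrow> (\<lambda>J. g J e) \<in> borel_measurable M"
  shows "(\<lambda>J. spin_tension \<beta> (g J) n \<Lambda>) \<in> borel_measurable M"
proof -
  have "(\<lambda>J. spin_sum (edges \<Lambda>) (\<lambda>e. exp (- \<beta> * g J e)) V X) \<in> borel_measurable M" for V X
    unfolding spin_sum_def boltzmann_def
  proof (intro borel_measurable_sum borel_measurable_prod)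
    fix A e assume e: "e \<in> edges \<Lambda>"
    note [measurable] = assms[OF e]
    show "(\<lambda>J. if odd (card (e \<inter> (A \<union> X))) then exp (- \<beta> * g J e) else 1) \<in> borel_measurable M"
      by measurable
  qed
  thus ?thesis unfolding spin_tension_def by measurable
qed

lemma block_law:
  fixes \<Lambda>0 :: "(real ^ 'd) set"
  assumes z: "z \<in> int_lattice" and \<Lambda>0: "\<Lambda>0 \<subseteq> int_lattice"
  defines "E0 \<equiv> edges \<Lambda>0"
  shows "distr (disorder \<nu>) (\<Pi>\<^sub>M e\<in>E0. \<nu>) (\<lambda>J. \<lambda>e\<in>E0. J ((+) z ` e)) = (\<Pi>\<^sub>M e\<in>E0. \<nu>)"
  unfolding disorder_def
proof (rule distr_PiM_reindex)
  show "prob_space \<nu>" by (rule coupling_prob_space)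
  show "inj_on ((`) ((+) z)) E0" by (rule inj_onI) (simp add: inj_image_eq_iff)
  have "(+) z ` e \<in> edges int_lattice" if "e \<in> E0" for e
  proof -
    have "(+) z ` e \<in> edges ((+) z ` \<Lambda>0)" using that unfolding edges_shift E0_def by blast
    moreover have "(+) z ` \<Lambda>0 \<subseteq> int_lattice" using z \<Lambda>0 by (auto intro: int_lattice_add)
    ultimately show ?thesis using edges_mono by blast
  qed
  thus "(`) ((+) z) \<in> E0 \<rightarrow> edges int_lattice" by blast
qed

lemma shift_measurable:
  fixes \<Lambda>0 :: "(real ^ 'd) set"
  assumes z: "z \<in> int_lattice" and \<Lambda>0: "\<Lambda>0 \<subseteq> int_lattice"
  shows "(\<lambda>J. \<lambda>e\<in>edges \<Lambda>0. J ((+) z ` e)) \<in> measurable (disorder \<nu>) (\<Pi>\<^sub>M e\<in>edges \<Lambda>0. \<nu>)"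
  unfolding disorder_def
proof (rule measurable_restrict)
  fix e assume "e \<in> edges \<Lambda>0"
  hence "(+) z ` e \<in> edges ((+) z ` \<Lambda>0)" unfolding edges_shift by blast
  moreover have "(+) z ` \<Lambda>0 \<subseteq> int_lattice" using z \<Lambda>0 by (auto intro: int_lattice_add)
  ultimately have "(+) z ` e \<in> edges int_lattice" using edges_mono by blast
  thus "(\<lambda>J. J ((+) z ` e)) \<in> measurable (\<Pi>\<^sub>M e\<in>edges int_lattice. \<nu>) \<nu>"
    by (rule measurable_component_singleton)
qed

context
  fixes \<Lambda>0 :: "(real ^ 'd) set" and \<beta> :: real and n :: "real ^ 'd"
  assumes \<Lambda>0: "\<Lambda>0 \<subseteq> int_lattice"
begin

lemma tension_PiM_measurable: "(\<lambda>J. spin_tension \<beta> J n \<Lambda>0) \<in> borel_measurable (\<Pi>\<^sub>M e\<in>edges \<Lambda>0. \<nu>)"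
  by (rule spin_tension_measurable) (rule coupling_component_measurable)

lemma tension_shift:
  "spin_tension \<beta> (\<lambda>e\<in>edges \<Lambda>0. J ((+) z ` e)) n \<Lambda>0 = spin_tension \<beta> (\<lambda>e. J ((+) z ` e)) n \<Lambda>0"
  by (rule spin_tension_cong) simp

lemma tension_shift_measurable:
  assumes z: "z \<in> int_lattice"
  shows "(\<lambda>J. spin_tension \<beta> (\<lambda>e. J ((+) z ` e)) n \<Lambda>0) \<in> borel_measurable (disorder \<nu>)"
  using measurable_compose[OF shift_measurable[OF z \<Lambda>0] tension_PiM_measurable] by (simp add: tension_shift)

lemma tension_measurable: "(\<lambda>J. spin_tension \<beta> J n \<Lambda>0) \<in> borel_measurable (disorder \<nu>)"
proof -
  have "0 \<in> int_lattice" by (simp add: int_lattice_def)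
  from tension_shift_measurable[OF this] show ?thesis by simp
qed

lemma tension_shift_prob:
  assumes z: "z \<in> int_lattice"
  shows "measure (disorder \<nu>) {J \<in> space (disorder \<nu>). spin_tension \<beta> (\<lambda>e. J ((+) z ` e)) n \<Lambda>0 \<le> a}
    = measure (\<Pi>\<^sub>M e\<in>edges \<Lambda>0. \<nu>) {J \<in> space (\<Pi>\<^sub>M e\<in>edges \<Lambda>0. \<nu>). spin_tension \<beta> J n \<Lambda>0 \<le> a}"
proof -
  let ?Q = "\<Pi>\<^sub>M e\<in>edges \<Lambda>0. \<nu>" and ?s = "\<lambda>J. \<lambda>e\<in>edges \<Lambda>0. J ((+) z ` e)"
  note [measurable] = tension_PiM_measurable
  have sm: "?s \<in> measurable (disorder \<nu>) ?Q" by (rule shift_measurable[OF z \<Lambda>0])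
  have "measure ?Q {J \<in> space ?Q. spin_tension \<beta> J n \<Lambda>0 \<le> a} = measure (distr (disorder \<nu>) ?Q ?s) {J \<in> space ?Q. spin_tension \<beta> J n \<Lambda>0 \<le> a}"
    by (simp add: block_law[OF z \<Lambda>0])
  also have "\<dots> = measure (disorder \<nu>) (?s -` {J \<in> space ?Q. spin_tension \<beta> J n \<Lambda>0 \<le> a} \<inter> space (disorder \<nu>))"
    by (rule measure_distr[OF sm]) measurable
  also have "?s -` {J \<in> space ?Q. spin_tension \<beta> J n \<Lambda>0 \<le> a} \<inter> space (disorder \<nu>)
     = {J \<in> space (disorder \<nu>). spin_tension \<beta> (\<lambda>e. J ((+) z ` e)) n \<Lambda>0 \<le> a}"
    using measurable_space[OF sm] by (auto simp: tension_shift)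
  finally show ?thesis by simp
qed

lemma tension_shift_expectation:
  assumes z: "z \<in> int_lattice"
  shows "(\<integral>J. spin_tension \<beta> (\<lambda>e. J ((+) z ` e)) n \<Lambda>0 \<partial>disorder \<nu>) = (\<integral>J. spin_tension \<beta> J n \<Lambda>0 \<partial>(\<Pi>\<^sub>M e\<in>edges \<Lambda>0. \<nu>))"
proof -
  let ?Q = "\<Pi>\<^sub>M e\<in>edges \<Lambda>0. \<nu>" and ?s = "\<lambda>J. \<lambda>e\<in>edges \<Lambda>0. J ((+) z ` e)"
  have "(\<integral>J. spin_tension \<beta> J n \<Lambda>0 \<partial>?Q) = (\<integral>J. spin_tension \<beta> J n \<Lambda>0 \<partial>distr (disorder \<nu>) ?Q ?s)"
    by (simp add: block_law[OF z \<Lambda>0])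
  also have "\<dots> = (\<integral>J. spin_tension \<beta> (?s J) n \<Lambda>0 \<partial>disorder \<nu>)"
    by (rule integral_distr[OF shift_measurable[OF z \<Lambda>0] tension_PiM_measurable])
  finally show ?thesis by (simp add: tension_shift)
qed

lemma tension_prob:
  "measure (disorder \<nu>) {J \<in> space (disorder \<nu>). spin_tension \<beta> J n \<Lambda>0 \<le> a}
    = measure (\<Pi>\<^sub>M e\<in>edges \<Lambda>0. \<nu>) {J \<in> space (\<Pi>\<^sub>M e\<in>edges \<Lambda>0. \<nu>). spin_tension \<beta> J n \<Lambda>0 \<le> a}"
  using tension_shift_prob[of 0 a] by (simp add: int_lattice_def)

lemma tension_expectation:
  "(\<integral>J. spin_tension \<beta> J n \<Lambda>0 \<partial>disorder \<nu>) = (\<integral>J. spin_tension \<beta> J n \<Lambda>0 \<partial>(\<Pi>\<^sub>M e\<in>edges \<Lambda>0. \<nu>))"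
  using tension_shift_expectation[of 0] by (simp add: int_lattice_def)

lemma coordinates_indep:
  "prob_space.indep_vars (disorder \<nu> :: ((real ^ 'd) set \<Rightarrow> real) measure) (\<lambda>_. \<nu>) (\<lambda>e J. J e) (edges int_lattice)"
proof -
  let ?P = "disorder \<nu> :: ((real ^ 'd) set \<Rightarrow> real) measure"
  interpret P: prob_space ?P by (rule prob_space_disorder)
  let ?I = "edges (int_lattice :: (real ^ 'd) set)"
  have ne: "?I \<noteq> {}"
  proof -
    have "{0, 0 + axis undefined 1} \<in> ?I"
      unfolding pair_in_edges using dist_axis(1)[of 0] axis_in_int_lattice by (auto simp: int_lattice_def)
    thus ?thesis by auto
  qed
  have comp: "(\<lambda>J. J e) \<in> measurable ?P \<nu>" if "e \<in> ?I" for e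
    unfolding disorder_def by (rule measurable_component_singleton[OF that])
  have d: "distr ?P \<nu> (\<lambda>J. J e) = \<nu>" if "e \<in> ?I" for e
    unfolding disorder_def by (rule distr_PiM_component) (use that coupling_prob_space in auto)
  show ?thesis
  proof (subst P.indep_vars_iff_distr_eq_PiM'[OF ne comp])
    have "distr ?P (\<Pi>\<^sub>M i\<in>?I. \<nu>) (\<lambda>x. \<lambda>i\<in>?I. x i) = distr ?P ?P (\<lambda>x. x)"
    proof (rule distr_cong)
      fix x assume "x \<in> space ?P"
      thus "(\<lambda>i\<in>?I. x i) = x" by (auto simp: disorder_def space_PiM PiE_def extensional_restrict)
    qed (auto simp: disorder_def)
    also have "\<dots> = ?P" by simp
    also have "\<dots> = (\<Pi>\<^sub>M i\<in>?I. distr ?P \<nu> (\<lambda>x. x i))"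
      unfolding disorder_def[of \<nu>] by (rule PiM_cong[OF refl]) (use d in \<open>simp add: disorder_def\<close>)
    finally show "distr ?P (\<Pi>\<^sub>M i\<in>?I. \<nu>) (\<lambda>x. \<lambda>i\<in>?I. x i) = (\<Pi>\<^sub>M i\<in>?I. distr ?P \<nu> (\<lambda>x. x i))" .
  qed auto
qed

text \<open>Disjoint translates of a box have disjoint sets of edges, and the law of the couplings is
  invariant under lattice translations.\<close>

lemma blocks_independent:
  assumes Z: "finite Z" "Z \<subseteq> int_lattice"
    and disj: "\<And>z z'. z \<in> Z \<Longrightarrow> z' \<in> Z \<Longrightarrow> z \<noteq> z' \<Longrightarrow> (+) z ` \<Lambda>0 \<inter> (+) z' ` \<Lambda>0 = {}"
  shows "measure (disorder \<nu>) {J \<in> space (disorder \<nu>). \<forall>z\<in>Z. spin_tension \<beta> (\<lambda>e. J ((+) z ` e)) n \<Lambda>0 \<le> a z}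
    = (\<Prod>z\<in>Z. measure (disorder \<nu>) {J \<in> space (disorder \<nu>). spin_tension \<beta> J n \<Lambda>0 \<le> a z})"
proof (cases "Z = {}")
  case True
  interpret P: prob_space "disorder \<nu> :: ((real ^ 'd) set \<Rightarrow> real) measure" by (rule prob_space_disorder)
  show ?thesis using True P.prob_space by simp
next
  case False
  let ?P = "disorder \<nu> :: ((real ^ 'd) set \<Rightarrow> real) measure"
  interpret P: prob_space ?P by (rule prob_space_disorder)
  let ?K = "\<lambda>z. edges ((+) z ` \<Lambda>0)"
  have KI: "?K z \<subseteq> edges int_lattice" if "z \<in> Z" for z
    by (rule edges_mono) (use that Z(2) \<Lambda>0 in \<open>auto intro: int_lattice_add\<close>)
  have dK: "disjoint_family_on ?K Z"
  proof (unfold disjoint_family_on_def, intro ballI impI equals0I)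
    fix z z' e assume z: "z \<in> Z" "z' \<in> Z" "z \<noteq> z'" and e: "e \<in> ?K z \<inter> ?K z'"
    have "e \<subseteq> (+) z ` \<Lambda>0 \<inter> (+) z' ` \<Lambda>0"
      using edges_subset[of e "(+) z ` \<Lambda>0"] edges_subset[of e "(+) z' ` \<Lambda>0"] e by simp
    hence "e = {}" using disj[OF z] by simp
    moreover have "e \<noteq> {}" using e by (auto simp: edges_def)
    ultimately show False by simp
  qed
  have i1: "P.indep_vars (\<lambda>z. \<Pi>\<^sub>M e\<in>?K z. \<nu>) (\<lambda>z J. restrict (\<lambda>e. J e) (?K z)) Z"
    by (rule P.indep_vars_restrict[OF coordinates_indep KI dK])
  define Y where "Y z x = spin_tension \<beta> (\<lambda>e. x ((+) z ` e)) n \<Lambda>0" for z and x :: "(real ^ 'd) set \<Rightarrow> real"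
  have Ym: "Y z \<in> borel_measurable (\<Pi>\<^sub>M e\<in>?K z. \<nu>)" for z
    unfolding Y_def
  proof (rule spin_tension_measurable)
    fix e assume "e \<in> edges \<Lambda>0"
    hence "(+) z ` e \<in> ?K z" unfolding edges_shift by blast
    thus "(\<lambda>J. J ((+) z ` e)) \<in> borel_measurable (\<Pi>\<^sub>M e\<in>?K z. \<nu>)" by (rule coupling_component_measurable)
  qed
  have i2: "P.indep_vars (\<lambda>_. borel) (\<lambda>z J. Y z (restrict (\<lambda>e. J e) (?K z))) Z"
    by (rule P.indep_vars_compose2[OF i1 Ym])
  have Yr: "Y z (restrict (\<lambda>e. J e) (?K z)) = spin_tension \<beta> (\<lambda>e. J ((+) z ` e)) n \<Lambda>0" for z J
    unfolding Y_def
  proof (rule spin_tension_cong)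
    fix e assume "e \<in> edges \<Lambda>0"
    hence "(+) z ` e \<in> ?K z" unfolding edges_shift by blast
    thus "restrict (\<lambda>e. J e) (?K z) ((+) z ` e) = J ((+) z ` e)" by simp
  qed
  have "P.prob (\<Inter>z\<in>Z. (\<lambda>J. spin_tension \<beta> (\<lambda>e. J ((+) z ` e)) n \<Lambda>0) -` {..a z} \<inter> space ?P)
     = (\<Prod>z\<in>Z. P.prob ((\<lambda>J. spin_tension \<beta> (\<lambda>e. J ((+) z ` e)) n \<Lambda>0) -` {..a z} \<inter> space ?P))"
    using P.indep_varsD_finite[OF i2 False Z(1), of "\<lambda>z. {..a z}"] unfolding Yr by simp
  moreover have "(\<Inter>z\<in>Z. (\<lambda>J. spin_tension \<beta> (\<lambda>e. J ((+) z ` e)) n \<Lambda>0) -` {..a z} \<inter> space ?P)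
     = {J \<in> space ?P. \<forall>z\<in>Z. spin_tension \<beta> (\<lambda>e. J ((+) z ` e)) n \<Lambda>0 \<le> a z}"
    using False by auto
  moreover have "P.prob ((\<lambda>J. spin_tension \<beta> (\<lambda>e. J ((+) z ` e)) n \<Lambda>0) -` {..a z} \<inter> space ?P)
     = P.prob {J \<in> space ?P. spin_tension \<beta> J n \<Lambda>0 \<le> a z}" if "z \<in> Z" for z
  proof -
    have "(\<lambda>J. spin_tension \<beta> (\<lambda>e. J ((+) z ` e)) n \<Lambda>0) -` {..a z} \<inter> space ?P = {J \<in> space ?P. spin_tension \<beta> (\<lambda>e. J ((+) z ` e)) n \<Lambda>0 \<le> a z}"
      by auto
    thus ?thesis using tension_shift_prob[of z "a z"] that Z(2) by (simp add: tension_prob subsetD)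
  qed
  ultimately show ?thesis by simp
qed

end

section \<open>The essential infimum of the couplings\<close>

lemma J_min_nonempty: "2 \<in> {l. 0 \<le> l \<and> measure \<nu> {j \<in> space \<nu>. j < l} > 0}"
proof -
  interpret prob_space \<nu> by (rule coupling_prob_space)
  have "{j \<in> space \<nu>. j < 2} = space \<nu>" by (auto simp: coupling_space)
  thus ?thesis using prob_space by simp
qed

lemma J_min_bdd: "bdd_below {l. 0 \<le> l \<and> measure \<nu> {j \<in> space \<nu>. j < l} > 0}"
  by (rule bdd_belowI[of _ 0]) auto

lemma J_min_bounds: "0 \<le> J_min \<nu>" "J_min \<nu> \<le> 1"
proof -
  interpret prob_space \<nu> by (rule coupling_prob_space)
  show "0 \<le> J_min \<nu>" unfolding J_min_def
  proof (rule cInf_greatest)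
    show "{l. 0 \<le> l \<and> measure \<nu> {j \<in> space \<nu>. j < l} > 0} \<noteq> {}" using J_min_nonempty by blast
  qed simp
  show "J_min \<nu> \<le> 1"
  proof (rule field_le_epsilon)
    fix e :: real assume e: "0 < e"
    have "{j \<in> space \<nu>. j < 1 + e} = space \<nu>" using e by (auto simp: coupling_space)
    hence "1 + e \<in> {l. 0 \<le> l \<and> measure \<nu> {j \<in> space \<nu>. j < l} > 0}" using prob_space e by simp
    thus "J_min \<nu> \<le> 1 + e" unfolding J_min_def by (rule cInf_lower[OF _ J_min_bdd])
  qed
qed

lemma prob_near_J_min:
  assumes "0 < \<eta>"
  shows "measure \<nu> {j \<in> space \<nu>. j < J_min \<nu> + \<eta>} > 0"
proof -
  interpret prob_space \<nu> by (rule coupling_prob_space)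
  have "Inf {l. 0 \<le> l \<and> measure \<nu> {j \<in> space \<nu>. j < l} > 0} < J_min \<nu> + \<eta>" using assms by (simp add: J_min_def)
  then obtain l where l: "measure \<nu> {j \<in> space \<nu>. j < l} > 0" "l < J_min \<nu> + \<eta>"
    using cInf_lessD[of "{l. 0 \<le> l \<and> measure \<nu> {j \<in> space \<nu>. j < l} > 0}"] J_min_nonempty by blast
  have "measure \<nu> {j \<in> space \<nu>. j < l} \<le> measure \<nu> {j \<in> space \<nu>. j < J_min \<nu> + \<eta>}"
    by (rule finite_measure_mono[OF _ coupling_sets]) (use l(2) in auto)
  thus ?thesis using l(1) by simp
qed

lemma AE_J_min: "AE j in \<nu>. J_min \<nu> \<le> j"
proof -
  interpret prob_space \<nu> by (rule coupling_prob_space)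
  have z: "measure \<nu> {j \<in> space \<nu>. j < l} = 0" if "l < J_min \<nu>" for l
  proof (cases "0 \<le> l")
    case True
    have "l \<notin> {l. 0 \<le> l \<and> measure \<nu> {j \<in> space \<nu>. j < l} > 0}"
      using that cInf_lower[OF _ J_min_bdd, of l] unfolding J_min_def by fastforce
    thus ?thesis using True by (simp add: not_less measure_le_0_iff)
  next
    case False
    hence emp: "{j \<in> space \<nu>. j < l} = {}" by (auto simp: coupling_space)
    show ?thesis unfolding emp by simp
  qed
  have "AE j in \<nu>. \<forall>k::nat. J_min \<nu> - 1 / real (Suc k) \<le> j"
  proof (subst AE_all_countable, rule allI)
    fix k :: nat
    have "{j \<in> space \<nu>. j < J_min \<nu> - 1 / real (Suc k)} \<in> null_sets \<nu>"
      using z[of "J_min \<nu> - 1 / real (Suc k)"] coupling_sets by (simp add: null_sets_def emeasure_eq_measure)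
    from AE_not_in[OF this] show "AE j in \<nu>. J_min \<nu> - 1 / real (Suc k) \<le> j"
      by (rule AE_mp) (auto intro!: AE_I2)
  qed
  thus ?thesis
  proof (rule AE_mp, intro AE_I2 impI)
    fix j assume a: "\<forall>k::nat. J_min \<nu> - 1 / real (Suc k) \<le> j"
    show "J_min \<nu> \<le> j"
    proof (rule field_le_epsilon)
      fix e :: real assume "0 < e"
      then obtain k :: nat where "1 / real (Suc k) < e" using nat_approx_posE by (metis of_nat_Suc)
      thus "J_min \<nu> \<le> j + e" using a[rule_format, of k] by linarith
    qed
  qed
qed

end

section \<open>Concentration of the tension at low temperature\<close>

text \<open>All weights \<open>exp (- \<beta> J\<^sub>e)\<close> with \<open>J\<^sub>e \<ge> j\<close> are then as small as \<open>interface_bound\<close>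
  requires.\<close>

definition low_temperature :: "nat \<Rightarrow> real \<Rightarrow> real \<Rightarrow> bool" where
  "low_temperature d j \<beta> \<longleftrightarrow> 0 \<le> \<beta> \<and> exp (- \<beta> * j) \<le> exp (-1) / 2 ^ (degree_bound d + 1)"

text \<open>\<open>exp (2 \<beta>)\<close> times a bound on the mean size of the interface: the three terms in the
  bracket bound the tension, the number of edges next to the outer cut, and the constant of
  \<open>interface_bound\<close>.\<close>

definition variance_factor :: "nat \<Rightarrow> real \<Rightarrow> real \<Rightarrow> real" where
  "variance_factor d \<beta> L = exp (2 * \<beta>) * (\<beta> * (2 * real d * ((2 + 2 * real d) * (L + 2 * real d) ^ (d - 1)))
     + 2 * real d * ((6 + 2 * real d) * (L + 2 * real d) ^ (d - 1)) + 1)"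

context
  fixes n :: "real ^ 'd" and B :: "(real ^ 'd) set" and L H \<beta> j :: real and \<Lambda> :: "(real ^ 'd) set"
  assumes fr: "frame n B" and d2: "CARD('d) \<ge> 2" and L0: "L > 0" and H0: "H > 0"
    and \<Lambda>: "\<Lambda> = box_lattice n B L H"
    and low: "low_temperature CARD('d) j \<beta>"
begin

text \<open>Lowering \<open>J\<^sub>e\<close> to \<open>j\<close> changes the tension by at most \<open>exp \<beta> * p e\<close>, where \<open>p e \<in> [0, 1]\<close>
  is the excess probability that \<open>e\<close> is unsatisfied under the mixed boundary condition. So the
  squares sum to at most \<open>exp (2 \<beta>)\<close> times the sum of the \<open>p e\<close>, which \<open>interface_bound\<close>
  controls.\<close>

lemma sensitivity:
  assumes J: "\<And>e. e \<in> edges \<Lambda> \<Longrightarrow> j \<le> J e \<and> J e \<le> 1" and j: "0 \<le> j"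
  shows "e \<in> edges \<Lambda> \<Longrightarrow> \<bar>spin_tension \<beta> J n \<Lambda> - spin_tension \<beta> (J(e := j)) n \<Lambda>\<bar> \<le> exp \<beta>"
    and "(\<Sum>e\<in>edges \<Lambda>. (spin_tension \<beta> J n \<Lambda> - spin_tension \<beta> (J(e := j)) n \<Lambda>)\<^sup>2) \<le> variance_factor CARD('d) \<beta> L"
proof -
  let ?E = "edges \<Lambda>" and ?w = "\<lambda>e. exp (- \<beta> * J e)" and ?V = "core \<Lambda>" and ?X = "lower_boundary 0 n \<Lambda>"
  have \<beta>0: "0 \<le> \<beta>" using low by (simp add: low_temperature_def)
  have finL: "finite \<Lambda>" by (rule box_finite[OF fr d2 L0 H0 \<Lambda>])
  have finE: "finite ?E" by (rule finite_edges[OF finL])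
  have finV: "finite ?V" using finL by (simp add: core_def)
  have XV: "?X \<inter> ?V = {}" by (rule lower_core_disjoint)
  have ef: "e \<in> ?E \<Longrightarrow> finite e" for e by (rule edge_finite)
  have w0: "0 < ?w e" for e by simp
  have w1: "?w e \<le> 1" if "e \<in> ?E" for e
    using J[OF that] j \<beta>0 by (simp add: mult_nonneg_nonneg)
  let ?Zp = "spin_sum ?E ?w ?V {}" and ?Zm = "spin_sum ?E ?w ?V ?X"
  have Z: "?Zp > 0" "?Zm > 0" by (intro spin_sum_pos finV w0)+
  define p where "p e = cut_sum ?E ?w ?V ?X e / ?Zm - cut_sum ?E ?w ?V {} e / ?Zp" for e
  define k where "k e = exp (\<beta> * (J e - j))" for e
  define \<delta> where "\<delta> e = spin_tension \<beta> J n \<Lambda> - spin_tension \<beta> (J(e := j)) n \<Lambda>" for e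
  have k: "1 \<le> k e" "k e \<le> exp \<beta>" if "e \<in> ?E" for e
  proof -
    have "0 \<le> J e - j" "J e - j \<le> 1" using J[OF that] j by auto
    hence "0 \<le> \<beta> * (J e - j)" "\<beta> * (J e - j) \<le> \<beta> * 1"
      using \<beta>0 by (intro mult_nonneg_nonneg mult_left_mono; simp)+
    thus "1 \<le> k e" "k e \<le> exp \<beta>" by (simp_all add: k_def)
  qed
  have wu: "(\<lambda>f. exp (- \<beta> * (J(e := j)) f)) = ?w(e := k e * ?w e)" for e
    by (rule ext) (simp add: k_def exp_add[symmetric] algebra_simps)
  have one: "0 \<le> p e" "p e \<le> 1" "0 \<le> \<delta> e" "\<delta> e \<le> (k e - 1) * p e" if e: "e \<in> ?E" for e
  proof -
    note oc = one_coupling[OF finV finE ef e XV w0 w1 k(1)[OF e]]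
    show "0 \<le> p e" "p e \<le> 1" unfolding p_def by (rule oc(1), assumption+) (rule oc(2), assumption+)
    have d: "\<delta> e = ln (?Zp / ?Zm) - ln (spin_sum ?E (?w(e := k e * ?w e)) ?V {} / spin_sum ?E (?w(e := k e * ?w e)) ?V ?X)"
      unfolding \<delta>_def spin_tension_def wu ..
    show "0 \<le> \<delta> e" unfolding d by (rule oc(3), assumption+)
    show "\<delta> e \<le> (k e - 1) * p e" unfolding d p_def by (rule oc(4), assumption+)
  qed
  have db: "\<delta> e \<le> exp \<beta> * p e" if "e \<in> ?E" for e
  proof -
    have "(k e - 1) * p e \<le> exp \<beta> * p e" using k[OF that] one[OF that] by (intro mult_right_mono) auto
    thus ?thesis using one(4)[OF that] by simp
  qed
  show "\<bar>spin_tension \<beta> J n \<Lambda> - spin_tension \<beta> (J(e := j)) n \<Lambda>\<bar> \<le> exp \<beta>" if "e \<in> ?E"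
  proof -
    have "exp \<beta> * p e \<le> exp \<beta> * 1" using one[OF that] by (intro mult_left_mono) auto
    thus ?thesis using db[OF that] one(3)[OF that] unfolding \<delta>_def by linarith
  qed
  define r where "r = card {e \<in> ?E. \<exists>f\<in>outer_cut n \<Lambda>. star_adj f e}"
  have ib: "(\<Sum>e\<in>?E. cut_sum ?E ?w ?V ?X e * ?Zp - cut_sum ?E ?w ?V {} e * ?Zm)
    \<le> (ln (?Zp / ?Zm) + real r * ln 2 + 1) * ?Zp * ?Zm"
  proof (rule interface_bound[where adj = star_adj and R = "outer_cut n \<Lambda>" and \<Delta> = "degree_bound CARD('d)"])
    show "?w e \<le> exp (-1) / 2 ^ (degree_bound CARD('d) + 1)" if "e \<in> ?E" for e
    proof -
      have "- \<beta> * J e \<le> - \<beta> * j" using J[OF that] \<beta>0 by (simp add: mult_left_mono)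
      hence "?w e \<le> exp (- \<beta> * j)" by simp
      thus ?thesis using low unfolding low_temperature_def by linarith
    qed
    show "\<exists>K\<subseteq>?V. \<forall>e\<in>?E. odd (card (e \<inter> (K \<union> ?X))) \<longleftrightarrow> e \<in> cluster star_adj (outer_cut n \<Lambda>) {e \<in> ?E. odd (card (e \<inter> (A \<union> ?X)))}"
      if "A \<subseteq> ?V" for A by (rule interface_flip[OF fr d2 L0 H0 \<Lambda> that])
    show "card {e \<in> ?E. star_adj f e} \<le> degree_bound CARD('d)" if "f \<in> ?E" for f
      by (rule star_degree[OF fr d2 L0 H0 \<Lambda> that])
  qed (use finV finE ef XV in \<open>auto simp: r_def\<close>)
  have "(\<Sum>e\<in>?E. p e) = (\<Sum>e\<in>?E. cut_sum ?E ?w ?V ?X e * ?Zp - cut_sum ?E ?w ?V {} e * ?Zm) / (?Zp * ?Zm)"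
    unfolding p_def sum_divide_distrib by (rule sum.cong[OF refl]) (use Z in \<open>simp add: field_simps\<close>)
  also have "\<dots> \<le> ((ln (?Zp / ?Zm) + real r * ln 2 + 1) * ?Zp * ?Zm) / (?Zp * ?Zm)"
    using ib Z by (intro divide_right_mono) auto
  also have "\<dots> = spin_tension \<beta> J n \<Lambda> + real r * ln 2 + 1" using Z by (simp add: spin_tension_def)
  also have "\<dots> \<le> \<beta> * (2 * real CARD('d) * ((2 + 2 * real CARD('d)) * (L + 2 * real CARD('d)) ^ (CARD('d) - 1)))
     + 2 * real CARD('d) * ((2 * 3 + 2 * real CARD('d)) * (L + 2 * real CARD('d)) ^ (CARD('d) - 1)) * 1 + 1"
  proof (intro add_mono mult_mono order_refl)
    show "spin_tension \<beta> J n \<Lambda> \<le> \<beta> * (2 * real CARD('d) * ((2 + 2 * real CARD('d)) * (L + 2 * real CARD('d)) ^ (CARD('d) - 1)))"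
      unfolding \<Lambda> by (rule tension_upper_bound[OF fr d2 L0 H0 \<beta>0]) (use J j \<Lambda> in force)
    show "real r \<le> 2 * real CARD('d) * ((2 * 3 + 2 * real CARD('d)) * (L + 2 * real CARD('d)) ^ (CARD('d) - 1))"
      unfolding r_def by (rule card_roots[OF fr d2 L0 H0 \<Lambda>])
    show "ln 2 \<le> (1::real)" using ln_2_less_1 by simp
  qed (use L0 in auto)
  finally have sp: "(\<Sum>e\<in>?E. p e) \<le> \<beta> * (2 * real CARD('d) * ((2 + 2 * real CARD('d)) * (L + 2 * real CARD('d)) ^ (CARD('d) - 1)))
     + 2 * real CARD('d) * ((6 + 2 * real CARD('d)) * (L + 2 * real CARD('d)) ^ (CARD('d) - 1)) + 1" by simp
  have "(\<Sum>e\<in>?E. (\<delta> e)\<^sup>2) \<le> (\<Sum>e\<in>?E. exp (2 * \<beta>) * p e)"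
  proof (rule sum_mono)
    fix e assume e: "e \<in> ?E"
    have "(\<delta> e)\<^sup>2 \<le> (exp \<beta> * p e)\<^sup>2" by (rule power_mono[OF db[OF e] one(3)[OF e]])
    also have "\<dots> = exp (2 * \<beta>) * (p e * p e)" by (simp add: power2_eq_square exp_double[symmetric] mult_ac exp_add[symmetric])
    also have "\<dots> \<le> exp (2 * \<beta>) * (p e * 1)" using one[OF e] by (intro mult_left_mono) auto
    finally show "(\<delta> e)\<^sup>2 \<le> exp (2 * \<beta>) * p e" by simp
  qed
  also have "\<dots> = exp (2 * \<beta>) * (\<Sum>e\<in>?E. p e)" by (simp add: sum_distrib_left)
  also have "\<dots> \<le> variance_factor CARD('d) \<beta> L"
    unfolding variance_factor_def using sp by (intro mult_left_mono) auto
  finally show "(\<Sum>e\<in>?E. (spin_tension \<beta> J n \<Lambda> - spin_tension \<beta> (J(e := j)) n \<Lambda>)\<^sup>2) \<le> variance_factor CARD('d) \<beta> L"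
    unfolding \<delta>_def .
qed

lemma tension_concentration:
  assumes nu: "coupling_law \<nu>" and j: "j = J_min \<nu>" and s: "0 < s" "s * exp \<beta> \<le> 1"
  defines "m \<equiv> \<integral>J. spin_tension \<beta> J n \<Lambda> \<partial>disorder \<nu>"
  shows "measure (disorder \<nu>) {J \<in> space (disorder \<nu>). spin_tension \<beta> J n \<Lambda> \<le> m - t}
      \<le> exp (2 * variance_factor CARD('d) \<beta> L * s\<^sup>2 - s * t)"
    and "measure (disorder \<nu>) {J \<in> space (disorder \<nu>). spin_tension \<beta> J n \<Lambda> \<ge> m + t}
      \<le> exp (2 * variance_factor CARD('d) \<beta> L * s\<^sup>2 - s * t)"
proof -
  let ?Q = "\<Pi>\<^sub>M e\<in>edges \<Lambda>. \<nu>"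
  interpret prob_space \<nu> by (rule coupling_prob_space[OF nu])
  interpret Q: prob_space ?Q by (rule prob_space_PiM) (rule prob_space_axioms)
  have \<beta>0: "0 \<le> \<beta>" using low by (simp add: low_temperature_def)
  have sub: "\<Lambda> \<subseteq> int_lattice" by (rule box_sub_lattice[OF fr d2 L0 H0 \<Lambda>])
  have finE: "finite (edges \<Lambda>)" by (rule finite_edges[OF box_finite[OF fr d2 L0 H0 \<Lambda>]])
  have jb: "0 \<le> j" "j \<le> 1" using J_min_bounds[OF nu] j by auto
  hence js: "j \<in> space \<nu>" by (simp add: coupling_space[OF nu])
  \<comment> \<open>The bounds of \<open>sensitivity\<close> need couplings above \<open>j\<close>. This holds almost surely; truncation
    at \<open>j\<close> makes it hold everywhere.\<close>
  define f where "f x = spin_tension \<beta> (\<lambda>e. max (x e) j) n \<Lambda>" for x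
  have fm: "f \<in> borel_measurable ?Q"
    unfolding f_def
  proof (rule spin_tension_measurable[OF nu])
    fix e assume "e \<in> edges \<Lambda>"
    note [measurable] = coupling_component_measurable[OF nu this]
    show "(\<lambda>J. max (J e) j) \<in> borel_measurable ?Q" by measurable
  qed
  define K where "K = \<beta> * (2 * real CARD('d) * ((2 + 2 * real CARD('d)) * (L + 2 * real CARD('d)) ^ (CARD('d) - 1)))"
  have bd: "j \<le> max (x e) j \<and> max (x e) j \<le> 1" if "x \<in> space ?Q" "e \<in> edges \<Lambda>" for x e
    using PiM_coupling_bounds(2)[OF nu that] jb by auto
  have fK: "\<bar>f x\<bar> \<le> K" if x: "x \<in> space ?Q" for x
  proof -
    have "0 \<le> f x" unfolding f_def
      by (rule spin_tension_nonneg[OF fr d2 L0 H0 \<Lambda>]) (use \<beta>0 jb in \<open>auto simp: le_max_iff_disj\<close>)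
    moreover have "f x \<le> K" unfolding f_def K_def \<Lambda>
      by (rule tension_upper_bound[OF fr d2 L0 H0 \<beta>0]) (use bd[OF x] jb \<Lambda> in force)
    ultimately show ?thesis by simp
  qed
  have upd: "f (x(e := j)) = spin_tension \<beta> ((\<lambda>e. max (x e) j)(e := j)) n \<Lambda>" for x e
    unfolding f_def by (rule spin_tension_cong) simp
  have fd: "\<bar>f x - f (x(e := j))\<bar> \<le> exp \<beta>" if "x \<in> space ?Q" "e \<in> edges \<Lambda>" for x e
    unfolding upd unfolding f_def by (rule sensitivity(1)[OF bd[OF that(1)] jb(1) that(2)])
  have fv: "(\<Sum>e\<in>edges \<Lambda>. (f x - f (x(e := j)))\<^sup>2) \<le> variance_factor CARD('d) \<beta> L" if "x \<in> space ?Q" for x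
    unfolding upd unfolding f_def by (rule sensitivity(2)[OF bd[OF that] jb(1)])
  have AEj: "AE x in ?Q. \<forall>e\<in>edges \<Lambda>. j \<le> x e"
  proof (rule AE_finite_allI[OF finE])
    fix e assume e: "e \<in> edges \<Lambda>"
    show "AE x in ?Q. j \<le> x e"
      using AE_PiM_component[of "edges \<Lambda>" "\<lambda>_. \<nu>" e "\<lambda>y. j \<le> y"] prob_space_axioms e AE_J_min[OF nu] j by simp
  qed
  have AEf: "AE x in ?Q. spin_tension \<beta> x n \<Lambda> = f x"
    using AEj
  proof (rule AE_mp, intro AE_I2 impI)
    fix x assume "\<forall>e\<in>edges \<Lambda>. j \<le> x e"
    thus "spin_tension \<beta> x n \<Lambda> = f x" unfolding f_def by (intro spin_tension_cong) (simp add: max_absorb1)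
  qed
  have Tm: "(\<lambda>x. spin_tension \<beta> x n \<Lambda>) \<in> borel_measurable ?Q" by (rule tension_PiM_measurable[OF nu sub])
  have mf: "m = (\<integral>x. f x \<partial>?Q)"
    unfolding m_def tension_expectation[OF nu sub] by (rule integral_cong_AE[OF Tm fm AEf])
  note [measurable] = fm Tm
  have "measure ?Q {x \<in> space ?Q. (- f x) \<ge> (\<integral>x. - f x \<partial>?Q) + t} \<le> exp (2 * variance_factor CARD('d) \<beta> L * s\<^sup>2 - s * t)"
    by (rule concentration[OF finE js _ _ _ _ s, where K = K])
      (use fK fd fv in \<open>auto simp: abs_minus_commute power2_commute\<close>)
  also have "{x \<in> space ?Q. (- f x) \<ge> (\<integral>x. - f x \<partial>?Q) + t} = {x \<in> space ?Q. f x \<le> m - t}"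
    unfolding mf by auto
  finally have 1: "measure ?Q {x \<in> space ?Q. f x \<le> m - t} \<le> exp (2 * variance_factor CARD('d) \<beta> L * s\<^sup>2 - s * t)" .
  have "measure ?Q {x \<in> space ?Q. spin_tension \<beta> x n \<Lambda> \<le> m - t} = measure ?Q {x \<in> space ?Q. f x \<le> m - t}"
    by (rule measure_eq_AE) (use AEf in auto)
  thus "measure (disorder \<nu>) {J \<in> space (disorder \<nu>). spin_tension \<beta> J n \<Lambda> \<le> m - t}
      \<le> exp (2 * variance_factor CARD('d) \<beta> L * s\<^sup>2 - s * t)"
    unfolding tension_prob[OF nu sub] using 1 by simp
  have 2: "measure ?Q {x \<in> space ?Q. f x \<ge> (\<integral>x. f x \<partial>?Q) + t} \<le> exp (2 * variance_factor CARD('d) \<beta> L * s\<^sup>2 - s * t)"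
    by (rule concentration[OF finE js fm fK fd fv s])
  have "measure ?Q {x \<in> space ?Q. \<not> spin_tension \<beta> x n \<Lambda> < m + t} = measure ?Q {x \<in> space ?Q. f x \<ge> m + t}"
    by (rule measure_eq_AE) (use AEf in auto)
  hence 3: "measure ?Q {x \<in> space ?Q. spin_tension \<beta> x n \<Lambda> \<ge> m + t} \<le> exp (2 * variance_factor CARD('d) \<beta> L * s\<^sup>2 - s * t)"
    using 2 by (simp add: mf not_less)
  let ?P = "disorder \<nu> :: ((real ^ 'd) set \<Rightarrow> real) measure" and ?r = "\<lambda>J. \<lambda>e\<in>edges \<Lambda>. J ((+) 0 ` e)"
  have z: "0 \<in> int_lattice" by (simp add: int_lattice_def)
  note sm = shift_measurable[OF nu z sub] and bl = block_law[OF nu z sub]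
  have "measure ?Q {x \<in> space ?Q. spin_tension \<beta> x n \<Lambda> \<ge> m + t} = measure (distr ?P ?Q ?r) {x \<in> space ?Q. spin_tension \<beta> x n \<Lambda> \<ge> m + t}"
    by (simp only: bl)
  also have "\<dots> = measure ?P (?r -` {x \<in> space ?Q. spin_tension \<beta> x n \<Lambda> \<ge> m + t} \<inter> space ?P)"
    by (rule measure_distr[OF sm]) measurable
  also have "?r -` {x \<in> space ?Q. spin_tension \<beta> x n \<Lambda> \<ge> m + t} \<inter> space ?P = {J \<in> space ?P. spin_tension \<beta> J n \<Lambda> \<ge> m + t}"
    using measurable_space[OF sm] tension_shift[OF nu sub, of \<beta> _ 0 n] by auto
  finally show "measure (disorder \<nu>) {J \<in> space (disorder \<nu>). spin_tension \<beta> J n \<Lambda> \<ge> m + t}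
      \<le> exp (2 * variance_factor CARD('d) \<beta> L * s\<^sup>2 - s * t)" using 3 by simp
qed

end

section \<open>A limit from approximate subadditivity\<close>

text \<open>Here \<open>v\<close> is the infimum over \<open>j\<close> of the lower limits of \<open>a j\<close>; letting first \<open>N\<close> and then
  \<open>L\<close> tend to infinity along a subsequence shows that no upper limit exceeds it. The index \<open>i\<close>
  will run over the shapes of boxes, so that existence of the limit and independence of the
  shape are one statement.\<close>

lemma common_limit:
  fixes a :: "'i \<Rightarrow> nat \<Rightarrow> real"
  assumes ne: "I \<noteq> {}" and nn: "\<And>i N. i \<in> I \<Longrightarrow> 0 \<le> a i N"
    and sub: "\<And>i j \<epsilon>. i \<in> I \<Longrightarrow> j \<in> I \<Longrightarrow> 0 < \<epsilon> \<Longrightarrow>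
      \<forall>\<^sub>F L in sequentially. \<forall>\<^sub>F N in sequentially. a i N \<le> a j L + \<epsilon>"
  obtains v where "0 \<le> v" "\<And>i. i \<in> I \<Longrightarrow> a i \<longlonglongrightarrow> v"
proof -
  define S where "S = {x. \<exists>j\<in>I. \<exists>\<^sub>F L in sequentially. a j L \<le> x}"
  obtain i where i: "i \<in> I" using ne by auto
  have "S \<noteq> {}"
  proof -
    obtain L where "\<forall>\<^sub>F N in sequentially. a i N \<le> a i L + 1"
      using eventually_happens'[OF sequentially_bot sub[OF i i zero_less_one]] by auto
    hence "\<exists>\<^sub>F N in sequentially. a i N \<le> a i L + 1" by (rule eventually_frequently[OF sequentially_bot])
    thus ?thesis using i by (auto simp: S_def)
  qed
  have low: "0 \<le> x" if "x \<in> S" for x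
  proof -
    from that obtain j where j: "j \<in> I" "\<exists>\<^sub>F L in sequentially. a j L \<le> x" unfolding S_def by blast
    then obtain L where "a j L \<le> x" using frequently_ex by blast
    thus ?thesis using nn[OF j(1), of L] by linarith
  qed
  hence bdd: "bdd_below S" by (rule bdd_belowI)
  define v where "v = Inf S"
  show ?thesis
  proof (rule that)
    show "0 \<le> v" unfolding v_def using \<open>S \<noteq> {}\<close> low by (rule cInf_greatest)
    fix i assume i: "i \<in> I"
    show "a i \<longlonglongrightarrow> v"
    proof (rule order_tendstoI)
      fix y assume y: "y < v"
      show "\<forall>\<^sub>F N in sequentially. y < a i N"
      proof (rule ccontr)
        assume "\<not> ?thesis"
        hence "\<exists>\<^sub>F N in sequentially. a i N \<le> y" by (simp add: frequently_def not_le)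
        hence "y \<in> S" using i by (auto simp: S_def)
        hence "v \<le> y" unfolding v_def by (rule cInf_lower[OF _ bdd])
        thus False using y by simp
      qed
    next
      fix y assume y: "v < y"
      then obtain x where x: "x \<in> S" "x < y" using cInf_lessD[OF \<open>S \<noteq> {}\<close>] by (auto simp: v_def)
      obtain j where j: "j \<in> I" "\<exists>\<^sub>F L in sequentially. a j L \<le> x" using x(1) by (auto simp: S_def)
      have "(y - x) / 2 > 0" using x by simp
      from frequently_eventually_frequently[OF j(2) sub[OF i j(1) this]]
      obtain L where L: "a j L \<le> x" "\<forall>\<^sub>F N in sequentially. a i N \<le> a j L + (y - x) / 2"
        using frequently_ex by blast
      from L(2) show "\<forall>\<^sub>F N in sequentially. a i N < y"
      proof eventually_elim
        case (elim N)
        have "(y - x) / 2 < y - x" using x by simp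
        thus ?case using elim L(1) by linarith
      qed
    qed
  qed
qed

section \<open>Boxes of all shapes and their tilings\<close>

definition cube :: "(real ^ 'd) set \<Rightarrow> (real ^ 'd) set" where
  "cube B = {\<Sum>u\<in>B. t u *\<^sub>R u | t. \<forall>u\<in>B. t u \<in> {-1/2..1/2}}"

lemma unit_cubes_iff: "S \<in> unit_cubes n \<longleftrightarrow> (\<exists>B. frame n B \<and> S = cube B)"
  unfolding unit_cubes_frame cube_def by blast

lemma frame_exists:
  fixes n :: "real ^ 'd"
  assumes "norm n = 1"
  obtains B where "frame n B"
proof -
  obtain S where S: "n \<in> S" "pairwise orthogonal S" "\<And>x. x \<in> S \<Longrightarrow> norm x = 1" "span S = UNIV"
    using vector_in_orthonormal_basis[OF assms] by metis
  have "insert n (S - {n}) = S" using S(1) by auto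
  hence "frame n (S - {n})" unfolding frame_def using S by auto
  thus ?thesis by (rule that)
qed

context
  fixes n :: "real ^ 'd" and \<nu> :: "real measure" and \<beta> :: real
  assumes d2: "CARD('d) \<ge> 2" and nu: "coupling_law \<nu>" and n1: "norm n = 1" and b0: "0 \<le> \<beta>"
begin

text \<open>The shape of a box: a lateral frame and the ratio \<open>\<delta>\<close> of its half-height to its side.\<close>

definition frames :: "((real ^ 'd) set \<times> real) set" where
  "frames = {(B, \<delta>). frame n B \<and> \<delta> > 0}"

definition box_of :: "(real ^ 'd) set \<times> real \<Rightarrow> nat \<Rightarrow> (real ^ 'd) set" where
  "box_of i N = box_lattice n (fst i) (real N) (snd i * real N)"

definition area :: "nat \<Rightarrow> real" where "area N = real N ^ (CARD('d) - 1)"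

lemma frames_nonempty: "frames \<noteq> {}"
proof -
  obtain B where "frame n B" by (rule frame_exists[OF n1])
  hence "(B, 1) \<in> frames" by (simp add: frames_def)
  thus ?thesis by auto
qed

lemma frame_of: "i \<in> frames \<Longrightarrow> frame n (fst i)" "i \<in> frames \<Longrightarrow> snd i > 0"
  by (auto simp: frames_def)

lemma area_pos: "N \<ge> 1 \<Longrightarrow> 0 < area N" by (simp add: area_def)

lemma area_nonneg: "0 \<le> area N" by (simp add: area_def)

lemma area_at_top: "filterlim area at_top sequentially"
proof -
  have "filterlim (\<lambda>N. real N ^ (CARD('d) - 1)) at_top sequentially"
    by (rule filterlim_pow_at_top) (use d2 filterlim_real_sequentially in auto)
  thus ?thesis by (simp add: area_def[abs_def])
qed

lemma box_of_lattice: "i \<in> frames \<Longrightarrow> box_of i N \<subseteq> int_lattice"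
  by (auto simp: box_of_def box_lattice_def)

lemma box_of_finite: "i \<in> frames \<Longrightarrow> N \<ge> 1 \<Longrightarrow> finite (box_of i N)"
  unfolding box_of_def by (rule box_finite[OF frame_of(1) d2 _ _ refl]) (auto simp: frames_def)

lemma tension_nonneg:
  assumes "i \<in> frames" "N \<ge> 1" "\<And>e. e \<in> edges (box_of i N) \<Longrightarrow> 0 \<le> J e"
  shows "0 \<le> spin_tension \<beta> J n (box_of i N)"
  unfolding box_of_def
  by (rule spin_tension_nonneg[OF frame_of(1)[OF assms(1)] d2 _ _ refl])
    (use assms b0 frame_of(2)[OF assms(1)] in \<open>auto simp: box_of_def\<close>)

lemma rect_tension_box:
  assumes "i \<in> frames" "N \<ge> 1"
  shows "rect_tension 2 \<beta> J 0 (real N) (snd i * real N) (cube (fst i)) n = spin_tension \<beta> J n (box_of i N) / area N"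
  unfolding box_of_def area_def
  by (rule rect_tension_spin[OF frame_of(1)[OF assms(1)] d2 _ _ refl])
    (use assms frame_of(2)[OF assms(1)] in \<open>auto simp: cube_def\<close>)

text \<open>The conclusion of \<open>subadditivity\<close> as a relation. The couplings are quantified inside, so
  that one tiling serves all of them.\<close>

definition tiles :: "(real ^ 'd) set \<times> real \<Rightarrow> (real ^ 'd) set \<times> real \<Rightarrow> real \<Rightarrow> nat \<Rightarrow> nat \<Rightarrow> (real ^ 'd) set \<Rightarrow> bool" where
  "tiles i j \<epsilon> L N Z \<longleftrightarrow> finite Z \<and> Z \<subseteq> int_lattice \<and> real (card Z) * area L \<le> area N \<and>
    (\<forall>z\<in>Z. \<forall>z'\<in>Z. z \<noteq> z' \<longrightarrow> (+) z ` box_of j L \<inter> (+) z' ` box_of j L = {}) \<and>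
    (\<forall>J. (\<forall>e\<in>edges (box_of i N). 0 \<le> J e \<and> J e \<le> 1) \<longrightarrow>
       spin_tension \<beta> J n (box_of i N) \<le> (\<Sum>z\<in>Z. spin_tension \<beta> (\<lambda>e. J ((+) z ` e)) n (box_of j L)) + \<epsilon> * area N)"

lemma tilesD:
  assumes "tiles i j \<epsilon> L N Z"
  shows "finite Z" "Z \<subseteq> int_lattice" "real (card Z) * area L \<le> area N"
    "\<And>z z'. z \<in> Z \<Longrightarrow> z' \<in> Z \<Longrightarrow> z \<noteq> z' \<Longrightarrow> (+) z ` box_of j L \<inter> (+) z' ` box_of j L = {}"
    "\<And>J. (\<And>e. e \<in> edges (box_of i N) \<Longrightarrow> 0 \<le> J e \<and> J e \<le> 1) \<Longrightarrow>
       spin_tension \<beta> J n (box_of i N) \<le> (\<Sum>z\<in>Z. spin_tension \<beta> (\<lambda>e. J ((+) z ` e)) n (box_of j L)) + \<epsilon> * area N"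
  using assms unfolding tiles_def by simp_all

lemma tiling:
  assumes i: "i \<in> frames" and j: "j \<in> frames" and e: "0 < \<epsilon>"
  shows "\<forall>\<^sub>F L in sequentially. \<forall>\<^sub>F N in sequentially. \<exists>Z. tiles i j \<epsilon> L N Z"
proof -
  define \<epsilon>' where "\<epsilon>' = \<epsilon> / (\<beta> + 1)"
  have e': "\<epsilon>' > 0" "\<beta> * \<epsilon>' \<le> \<epsilon>" using e b0 by (auto simp: \<epsilon>'_def field_simps)
  note sa = subadditivity[OF frame_of(1)[OF i] frame_of(1)[OF j] d2 frame_of(2)[OF i] frame_of(2)[OF j] e'(1),
    folded box_of_def area_def]
  show ?thesis
  proof (rule eventually_mono[OF sa], rule eventually_mono, assumption, elim exE conjE)
    fix L N :: nat and Z
    assume Z: "finite Z" "Z \<subseteq> int_lattice" "real (card Z) * area L \<le> area N"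
      "\<forall>z\<in>Z. \<forall>z'\<in>Z. z \<noteq> z' \<longrightarrow> (+) z ` box_of j L \<inter> (+) z' ` box_of j L = {}"
      "\<forall>\<beta>\<ge>0. \<forall>J. (\<forall>e\<in>edges (box_of i N). 0 \<le> J e \<and> J e \<le> 1) \<longrightarrow>
         spin_tension \<beta> J n (box_of i N) \<le> (\<Sum>z\<in>Z. spin_tension \<beta> (\<lambda>e. J ((+) z ` e)) n (box_of j L)) + \<beta> * \<epsilon>' * area N"
    have le: "\<beta> * \<epsilon>' * area N \<le> \<epsilon> * area N" using e'(2) area_nonneg by (rule mult_right_mono)
    have "spin_tension \<beta> J n (box_of i N) \<le> (\<Sum>z\<in>Z. spin_tension \<beta> (\<lambda>e. J ((+) z ` e)) n (box_of j L)) + \<epsilon> * area N"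
      if "\<forall>e\<in>edges (box_of i N). 0 \<le> J e \<and> J e \<le> 1" for J
      using Z(5)[rule_format, OF b0, of J] that le by fastforce
    thus "\<exists>Z. tiles i j \<epsilon> L N Z" unfolding tiles_def using Z(1-4) by blast
  qed
qed

lemma block_sum_bound:
  assumes c: "real (card Z) * area L \<le> area N" and L: "L \<ge> 1" and N: "N \<ge> 1" and t: "0 \<le> t"
    and le: "x \<le> real (card Z) * t + \<epsilon> * area N"
  shows "x / area N \<le> t / area L + \<epsilon>"
proof -
  have "real (card Z) * t = (real (card Z) * area L) * (t / area L)" using area_pos[OF L] by simp
  also have "\<dots> \<le> area N * (t / area L)" using c t area_nonneg by (intro mult_right_mono) auto
  finally have "x \<le> (t / area L + \<epsilon>) * area N" using le by (simp add: algebra_simps)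
  thus ?thesis using area_pos[OF N] by (simp add: pos_divide_le_eq)
qed

section \<open>Minimal and mean tension\<close>

lemma minimal_tension_limit:
  "0 \<le> minimal_tension 2 \<beta> \<nu> n \<and> (\<forall>i\<in>frames. (\<lambda>N. spin_tension \<beta> (\<lambda>_. J_min \<nu>) n (box_of i N) / area N) \<longlonglongrightarrow> minimal_tension 2 \<beta> \<nu> n)"
proof -
  let ?a = "\<lambda>i N. if N = 0 then 0 else spin_tension \<beta> (\<lambda>_. J_min \<nu>) n (box_of i N) / area N"
  note jb = J_min_bounds[OF nu]
  have tn: "0 \<le> spin_tension \<beta> (\<lambda>_. J_min \<nu>) n (box_of i N)" if "i \<in> frames" "N \<ge> 1" for i N
    by (rule tension_nonneg[OF that]) (use jb in simp)
  obtain v where v: "0 \<le> v" "\<And>i. i \<in> frames \<Longrightarrow> ?a i \<longlonglongrightarrow> v"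
  proof (rule common_limit[OF frames_nonempty, of ?a])
    show "0 \<le> ?a i N" if "i \<in> frames" for i N
      using tn[OF that, of N] area_nonneg[of N] by simp
    fix i j and \<epsilon> :: real assume i: "i \<in> frames" and j: "j \<in> frames" and e: "0 < \<epsilon>"
    show "\<forall>\<^sub>F L in sequentially. \<forall>\<^sub>F N in sequentially. ?a i N \<le> ?a j L + \<epsilon>"
      using tiling[OF i j e] eventually_ge_at_top[of "1 :: nat"]
    proof eventually_elim
      case L: (elim L)
      show ?case using L(1) eventually_ge_at_top[of "1 :: nat"]
      proof eventually_elim
        case N: (elim N)
        then obtain Z where t: "tiles i j \<epsilon> L N Z" by blast
        have Z: "real (card Z) * area L \<le> area N"
          "spin_tension \<beta> (\<lambda>_. J_min \<nu>) n (box_of i N) \<le> (\<Sum>z\<in>Z. spin_tension \<beta> (\<lambda>e. J_min \<nu>) n (box_of j L)) + \<epsilon> * area N"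
          using tilesD(3)[OF t] tilesD(5)[OF t, of "\<lambda>_. J_min \<nu>"] jb by simp_all
        have "spin_tension \<beta> (\<lambda>_. J_min \<nu>) n (box_of i N) / area N \<le> spin_tension \<beta> (\<lambda>_. J_min \<nu>) n (box_of j L) / area L + \<epsilon>"
          by (rule block_sum_bound[OF Z(1) L(2) N(2) tn[OF j L(2)]]) (use Z(2) in simp)
        thus ?case using L(2) N(2) by simp
      qed
    qed
  qed blast
  have lim: "(\<lambda>N. spin_tension \<beta> (\<lambda>_. J_min \<nu>) n (box_of i N) / area N) \<longlonglongrightarrow> v" if "i \<in> frames" for i
    by (rule Lim_transform_eventually[OF v(2)[OF that]]) (use eventually_ge_at_top[of "1::nat"] in eventually_elim, simp)
  have rl: "(\<lambda>N. rect_tension 2 \<beta> (\<lambda>_. J_min \<nu>) 0 (real N) (snd i * real N) (cube (fst i)) n) \<longlonglongrightarrow> v" if "i \<in> frames" for i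
  proof (rule Lim_transform_eventually[OF lim[OF that]])
    show "\<forall>\<^sub>F N in sequentially. spin_tension \<beta> (\<lambda>_. J_min \<nu>) n (box_of i N) / area N =
       rect_tension 2 \<beta> (\<lambda>_. J_min \<nu>) 0 (real N) (snd i * real N) (cube (fst i)) n"
      using eventually_ge_at_top[of "1::nat"] by eventually_elim (simp add: rect_tension_box[OF that])
  qed
  have "minimal_tension 2 \<beta> \<nu> n = v"
    unfolding minimal_tension_def
  proof (rule the_equality)
    show "\<forall>\<delta>>0. \<forall>S\<in>unit_cubes n. (\<lambda>N. rect_tension 2 \<beta> (\<lambda>_. J_min \<nu>) 0 (real N) (\<delta> * real N) S n) \<longlonglongrightarrow> v"
    proof (intro allI impI ballI)
      fix \<delta> :: real and S assume "0 < \<delta>" "S \<in> unit_cubes n"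
      then obtain B where B: "(B, \<delta>) \<in> frames" "S = cube B" by (auto simp: unit_cubes_iff frames_def)
      show "(\<lambda>N. rect_tension 2 \<beta> (\<lambda>_. J_min \<nu>) 0 (real N) (\<delta> * real N) S n) \<longlonglongrightarrow> v" using rl[OF B(1)] B(2) by simp
    qed
    fix t assume t: "\<forall>\<delta>>0. \<forall>S\<in>unit_cubes n. (\<lambda>N. rect_tension 2 \<beta> (\<lambda>_. J_min \<nu>) 0 (real N) (\<delta> * real N) S n) \<longlonglongrightarrow> t"
    obtain i where i: "i \<in> frames" using frames_nonempty by auto
    have "cube (fst i) \<in> unit_cubes n" using frame_of(1)[OF i] unit_cubes_iff by blast
    hence "(\<lambda>N. rect_tension 2 \<beta> (\<lambda>_. J_min \<nu>) 0 (real N) (snd i * real N) (cube (fst i)) n) \<longlonglongrightarrow> t"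
      using t frame_of(2)[OF i] by blast
    thus "t = v" using rl[OF i] LIMSEQ_unique by blast
  qed
  thus ?thesis using v(1) lim by simp
qed

lemma disorder_bounds:
  assumes "J \<in> space (disorder \<nu>)" "\<Lambda> \<subseteq> int_lattice" "e \<in> edges \<Lambda>"
  shows "0 \<le> J e \<and> J e \<le> 1"
  using PiM_coupling_bounds[OF nu, of J "edges int_lattice" e] assms edges_mono[of \<Lambda> int_lattice]
  by (auto simp: disorder_def)

lemma disorder_shift_bounds:
  assumes "J \<in> space (disorder \<nu>)" "\<Lambda> \<subseteq> int_lattice" "z \<in> int_lattice" "e \<in> edges \<Lambda>"
  shows "0 \<le> J ((+) z ` e) \<and> J ((+) z ` e) \<le> 1"
proof (rule disorder_bounds[OF assms(1)])
  show "(+) z ` \<Lambda> \<subseteq> int_lattice" using assms by (auto intro: int_lattice_add)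
  show "(+) z ` e \<in> edges ((+) z ` \<Lambda>)" unfolding edges_shift using assms by blast
qed

lemma tension_integrable:
  assumes i: "i \<in> frames" and N: "N \<ge> 1" and z: "z \<in> int_lattice"
  shows "integrable (disorder \<nu>) (\<lambda>J. spin_tension \<beta> (\<lambda>e. J ((+) z ` e)) n (box_of i N))"
proof -
  interpret P: prob_space "disorder \<nu> :: ((real ^ 'd) set \<Rightarrow> real) measure" by (rule prob_space_disorder[OF nu])
  note sub = box_of_lattice[OF i, of N]
  have H: "0 < real N" "0 < snd i * real N" using N frame_of(2)[OF i] by auto
  show ?thesis
  proof (rule P.integrable_bounded[OF tension_shift_measurable[OF nu sub z]])
    fix J :: "(real ^ 'd) set \<Rightarrow> real" assume J: "J \<in> space (disorder \<nu>)"
    have "0 \<le> spin_tension \<beta> (\<lambda>e. J ((+) z ` e)) n (box_of i N)"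
      by (rule tension_nonneg[OF i N]) (use disorder_shift_bounds[OF J sub z] in blast)
    moreover have "spin_tension \<beta> (\<lambda>e. J ((+) z ` e)) n (box_of i N) \<le>
       \<beta> * (2 * real CARD('d) * ((2 + 2 * real CARD('d)) * (real N + 2 * real CARD('d)) ^ (CARD('d) - 1)))"
      unfolding box_of_def
      by (rule tension_upper_bound[OF frame_of(1)[OF i] d2 H b0])
        (use disorder_shift_bounds[OF J sub z] in \<open>simp add: box_of_def\<close>)
    ultimately show "\<bar>spin_tension \<beta> (\<lambda>e. J ((+) z ` e)) n (box_of i N)\<bar> \<le>
       \<beta> * (2 * real CARD('d) * ((2 + 2 * real CARD('d)) * (real N + 2 * real CARD('d)) ^ (CARD('d) - 1)))" by simp
  qed
qed

lemma tension_integrable0: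
  assumes i: "i \<in> frames" and N: "N \<ge> 1"
  shows "integrable (disorder \<nu>) (\<lambda>J. spin_tension \<beta> J n (box_of i N))"
proof -
  have "0 \<in> int_lattice" by (simp add: int_lattice_def)
  from tension_integrable[OF i N this] show ?thesis by simp
qed

lemma mean_tension_limit:
  obtains q where "0 \<le> q" "\<And>i. i \<in> frames \<Longrightarrow>
    (\<lambda>N. (\<integral>J. spin_tension \<beta> J n (box_of i N) \<partial>disorder \<nu>) / area N) \<longlonglongrightarrow> q"
proof -
  interpret P: prob_space "disorder \<nu> :: ((real ^ 'd) set \<Rightarrow> real) measure" by (rule prob_space_disorder[OF nu])
  let ?m = "\<lambda>i N. \<integral>J. spin_tension \<beta> J n (box_of i N) \<partial>disorder \<nu>"
  let ?a = "\<lambda>i N. if N = 0 then 0 else ?m i N / area N"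
  have mn: "0 \<le> ?m i N" if "i \<in> frames" "N \<ge> 1" for i N
  proof (rule Bochner_Integration.integral_nonneg)
    fix J :: "(real ^ 'd) set \<Rightarrow> real" assume J: "J \<in> space (disorder \<nu>)"
    show "0 \<le> spin_tension \<beta> J n (box_of i N)"
      by (rule tension_nonneg[OF that]) (use disorder_bounds[OF J box_of_lattice[OF that(1)]] in blast)
  qed
  obtain v where v: "0 \<le> v" "\<And>i. i \<in> frames \<Longrightarrow> ?a i \<longlonglongrightarrow> v"
  proof (rule common_limit[OF frames_nonempty, of ?a])
    show "0 \<le> ?a i N" if "i \<in> frames" for i N
      using mn[OF that, of N] area_nonneg[of N] by simp
    fix i j and \<epsilon> :: real assume i: "i \<in> frames" and j: "j \<in> frames" and e: "0 < \<epsilon>"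
    show "\<forall>\<^sub>F L in sequentially. \<forall>\<^sub>F N in sequentially. ?a i N \<le> ?a j L + \<epsilon>"
      using tiling[OF i j e] eventually_ge_at_top[of "1 :: nat"]
    proof eventually_elim
      case L: (elim L)
      show ?case using L(1) eventually_ge_at_top[of "1 :: nat"]
      proof eventually_elim
        case N: (elim N)
        then obtain Z where t: "tiles i j \<epsilon> L N Z" by blast
        note Z = tilesD(1,2,3,5)[OF t]
        have int: "integrable (disorder \<nu>) (\<lambda>J. spin_tension \<beta> (\<lambda>e. J ((+) z ` e)) n (box_of j L))" if "z \<in> Z" for z
          by (rule tension_integrable[OF j L(2)]) (use that Z(2) in auto)
        have "?m i N \<le> (\<integral>J. (\<Sum>z\<in>Z. spin_tension \<beta> (\<lambda>e. J ((+) z ` e)) n (box_of j L)) + \<epsilon> * area N \<partial>disorder \<nu>)"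
        proof (rule integral_mono)
          show "integrable (disorder \<nu>) (\<lambda>J. (\<Sum>z\<in>Z. spin_tension \<beta> (\<lambda>e. J ((+) z ` e)) n (box_of j L)) + \<epsilon> * area N)"
            using int by (intro Bochner_Integration.integrable_add Bochner_Integration.integrable_sum) auto
          fix J :: "(real ^ 'd) set \<Rightarrow> real" assume J: "J \<in> space (disorder \<nu>)"
          show "spin_tension \<beta> J n (box_of i N) \<le> (\<Sum>z\<in>Z. spin_tension \<beta> (\<lambda>e. J ((+) z ` e)) n (box_of j L)) + \<epsilon> * area N"
            by (rule Z(4)) (rule disorder_bounds[OF J box_of_lattice[OF i]])
        qed (rule tension_integrable0[OF i N(2)])
        also have "\<dots> = (\<Sum>z\<in>Z. \<integral>J. spin_tension \<beta> (\<lambda>e. J ((+) z ` e)) n (box_of j L) \<partial>disorder \<nu>) + \<epsilon> * area N"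
          using int by (simp add: P.prob_space)
        also have "\<dots> = (\<Sum>z\<in>Z. ?m j L) + \<epsilon> * area N"
        proof -
          have "(\<integral>J. spin_tension \<beta> (\<lambda>e. J ((+) z ` e)) n (box_of j L) \<partial>disorder \<nu>) = ?m j L" if "z \<in> Z" for z
          proof -
            have z: "z \<in> int_lattice" using that Z(2) by blast
            show ?thesis
              by (rule trans[OF tension_shift_expectation[OF nu box_of_lattice[OF j] z]
                    tension_expectation[OF nu box_of_lattice[OF j], symmetric]])
          qed
          thus ?thesis by simp
        qed
        finally have le: "?m i N \<le> real (card Z) * ?m j L + \<epsilon> * area N" by simp
        have "?m i N / area N \<le> ?m j L / area L + \<epsilon>"
          by (rule block_sum_bound[OF Z(3) L(2) N(2) mn[OF j L(2)] le])
        thus ?case using L(2) N(2) by simp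
      qed
    qed
  qed blast
  show ?thesis
  proof (rule that[OF v(1)])
    fix i assume i: "i \<in> frames"
    show "(\<lambda>N. ?m i N / area N) \<longlonglongrightarrow> v"
      by (rule Lim_transform_eventually[OF v(2)[OF i]]) (use eventually_ge_at_top[of "1::nat"] in eventually_elim, simp)
  qed
qed

section \<open>Lower deviations\<close>

definition low_prob :: "(real ^ 'd) set \<times> real \<Rightarrow> real \<Rightarrow> nat \<Rightarrow> real" where
  "low_prob i \<tau> N = measure (disorder \<nu>) {J \<in> space (disorder \<nu>). spin_tension \<beta> J n (box_of i N) \<le> \<tau> * area N}"

lemma low_prob_le_1: "low_prob i \<tau> N \<le> 1"
proof -
  interpret P: prob_space "disorder \<nu> :: ((real ^ 'd) set \<Rightarrow> real) measure" by (rule prob_space_disorder[OF nu])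
  show ?thesis unfolding low_prob_def by simp
qed

lemma low_prob_nonneg: "0 \<le> low_prob i \<tau> N" by (simp add: low_prob_def)

lemma low_event_measurable:
  assumes "\<Lambda> \<subseteq> int_lattice"
  shows "{J \<in> space (disorder \<nu>). spin_tension \<beta> J n \<Lambda> \<le> t} \<in> sets (disorder \<nu>)"
proof -
  note [measurable] = tension_measurable[OF nu assms, of \<beta> n]
  show ?thesis by measurable
qed

lemma low_prob_mono:
  assumes i: "i \<in> frames" and "\<tau> \<le> \<tau>'"
  shows "low_prob i \<tau> N \<le> low_prob i \<tau>' N"
proof -
  interpret P: prob_space "disorder \<nu> :: ((real ^ 'd) set \<Rightarrow> real) measure" by (rule prob_space_disorder[OF nu])
  have "\<tau> * area N \<le> \<tau>' * area N" using assms area_nonneg by (intro mult_right_mono)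
  thus ?thesis unfolding low_prob_def
    by (intro P.finite_measure_mono low_event_measurable[OF box_of_lattice[OF i]]) auto
qed

text \<open>With positive probability all couplings in the box are within \<open>\<eta>\<close> of their essential
  infimum, and the tension depends continuously on them.\<close>

lemma prob_near_minimal:
  assumes i: "i \<in> frames" and N: "N \<ge> 1" and x: "0 < x"
  shows "0 < measure (disorder \<nu>) {J \<in> space (disorder \<nu>). spin_tension \<beta> J n (box_of i N) \<le> spin_tension \<beta> (\<lambda>_. J_min \<nu>) n (box_of i N) + x}"
proof -
  let ?\<Lambda> = "box_of i N" and ?j = "J_min \<nu>"
  let ?E = "edges ?\<Lambda>"
  let ?Q = "\<Pi>\<^sub>M e\<in>?E. \<nu>"
  interpret M: prob_space \<nu> by (rule coupling_prob_space[OF nu])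
  interpret pp: product_prob_space "\<lambda>_. \<nu>" by unfold_locales
  interpret Q: prob_space ?Q by (rule prob_space_PiM) (rule M.prob_space_axioms)
  have finL: "finite ?\<Lambda>" by (rule box_of_finite[OF i N])
  have finE: "finite ?E" by (rule finite_edges[OF finL])
  define \<eta> where "\<eta> = x / (\<beta> * real (card ?E) + 1)"
  have den: "\<beta> * real (card ?E) + 1 > 0" using b0 by (simp add: add_nonneg_pos)
  have eta: "\<eta> > 0" "\<beta> * \<eta> * real (card ?E) \<le> x"
    using x den b0 by (auto simp: \<eta>_def field_simps)
  define A where "A = {j \<in> space \<nu>. ?j \<le> j \<and> j < ?j + \<eta>}"
  note [measurable] = coupling_measurable_id[OF nu]
  have Am: "A \<in> sets \<nu>" unfolding A_def by measurable
  have "measure \<nu> A = measure \<nu> {j \<in> space \<nu>. j < ?j + \<eta>}"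
  proof (rule M.finite_measure_eq_AE)
    show "AE j in \<nu>. j \<in> A \<longleftrightarrow> j \<in> {j \<in> space \<nu>. j < ?j + \<eta>}"
      using AE_J_min[OF nu] by (rule AE_mp) (auto intro!: AE_I2 simp: A_def)
  qed (use Am coupling_sets[OF nu] in auto)
  hence Ap: "measure \<nu> A > 0" using prob_near_J_min[OF nu eta(1)] by simp
  have "emeasure ?Q (Pi\<^sub>E ?E (\<lambda>_. A)) = (\<Prod>e\<in>?E. emeasure \<nu> A)"
    by (rule pp.emeasure_PiM[OF finE]) (use Am in auto)
  hence "ennreal (measure ?Q (Pi\<^sub>E ?E (\<lambda>_. A))) = ennreal (\<Prod>e\<in>?E. measure \<nu> A)"
    by (simp only: Q.emeasure_eq_measure M.emeasure_eq_measure prod_ennreal measure_nonneg)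
  hence "measure ?Q (Pi\<^sub>E ?E (\<lambda>_. A)) = (\<Prod>e\<in>?E. measure \<nu> A)"
    by (subst (asm) ennreal_inj) (auto intro!: prod_nonneg)
  hence pos: "measure ?Q (Pi\<^sub>E ?E (\<lambda>_. A)) > 0" using Ap by simp
  note [measurable] = tension_PiM_measurable[OF nu box_of_lattice[OF i], of \<beta> n N]
  have "Pi\<^sub>E ?E (\<lambda>_. A) \<subseteq> {J \<in> space ?Q. spin_tension \<beta> J n ?\<Lambda> \<le> spin_tension \<beta> (\<lambda>_. ?j) n ?\<Lambda> + x}"
  proof
    fix J assume J: "J \<in> Pi\<^sub>E ?E (\<lambda>_. A)"
    have Js: "J \<in> space ?Q" using J by (auto simp: space_PiM A_def PiE_def Pi_def)
    have Jb: "?j \<le> J e" "J e \<le> ?j + \<eta>" if "e \<in> ?E" for e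
      using J that by (auto simp: A_def PiE_def Pi_def)
    let ?w = "\<lambda>e. exp (- \<beta> * J e)" and ?u = "\<lambda>e. exp (- \<beta> * ?j)"
    let ?V = "core ?\<Lambda>" and ?X = "lower_boundary 0 n ?\<Lambda>"
    have finV: "finite ?V" using finL by (simp add: core_def)
    have p: "spin_sum ?E ?w ?V {} > 0" "spin_sum ?E ?w ?V ?X > 0" "spin_sum ?E ?u ?V {} > 0" "spin_sum ?E ?u ?V ?X > 0"
      by (intro spin_sum_pos finV exp_gt_zero)+
    have "spin_sum ?E ?w ?V {} \<le> spin_sum ?E ?u ?V {}"
      by (rule spin_sum_mono) (use Jb b0 in \<open>auto intro: mult_left_mono\<close>)
    hence 1: "ln (spin_sum ?E ?w ?V {}) \<le> ln (spin_sum ?E ?u ?V {})" using p by simp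
    have "exp (- (\<beta> * \<eta> * real (card ?E))) * spin_sum ?E ?u ?V ?X \<le> spin_sum ?E ?w ?V ?X"
      unfolding spin_sum_def sum_distrib_left
    proof (rule sum_mono)
      fix A'
      have "exp (- (\<beta> * \<eta> * real (card ?E))) = (\<Prod>e\<in>?E. exp (- (\<beta> * \<eta>)))"
        by (simp add: exp_of_nat_mult[symmetric] mult_ac)
      hence "exp (- (\<beta> * \<eta> * real (card ?E))) * boltzmann ?E ?u (A' \<union> ?X)
         = (\<Prod>e\<in>?E. exp (- (\<beta> * \<eta>)) * (if odd (card (e \<inter> (A' \<union> ?X))) then ?u e else 1))"
        unfolding boltzmann_def by (simp only: prod.distrib)
      also have "\<dots> \<le> boltzmann ?E ?w (A' \<union> ?X)"
        unfolding boltzmann_def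
      proof (rule prod_mono)
        fix e assume e: "e \<in> ?E"
        have "\<beta> * J e \<le> \<beta> * (?j + \<eta>)" using Jb(2)[OF e] b0 by (rule mult_left_mono)
        hence "exp (- (\<beta> * \<eta>)) * ?u e \<le> ?w e" by (simp add: exp_add[symmetric] algebra_simps)
        moreover have "exp (- (\<beta> * \<eta>)) \<le> 1" using b0 eta by simp
        ultimately show "0 \<le> exp (- (\<beta> * \<eta>)) * (if odd (card (e \<inter> (A' \<union> ?X))) then ?u e else 1) \<and>
          exp (- (\<beta> * \<eta>)) * (if odd (card (e \<inter> (A' \<union> ?X))) then ?u e else 1) \<le> (if odd (card (e \<inter> (A' \<union> ?X))) then ?w e else 1)"
          by auto
      qed
      finally show "exp (- (\<beta> * \<eta> * real (card ?E))) * boltzmann ?E ?u (A' \<union> ?X) \<le> boltzmann ?E ?w (A' \<union> ?X)" .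
    qed
    hence "ln (exp (- (\<beta> * \<eta> * real (card ?E))) * spin_sum ?E ?u ?V ?X) \<le> ln (spin_sum ?E ?w ?V ?X)"
      using p by (subst ln_le_cancel_iff) auto
    hence 2: "ln (spin_sum ?E ?u ?V ?X) - \<beta> * \<eta> * real (card ?E) \<le> ln (spin_sum ?E ?w ?V ?X)"
      using p by (simp add: ln_mult)
    have "spin_tension \<beta> J n ?\<Lambda> = ln (spin_sum ?E ?w ?V {}) - ln (spin_sum ?E ?w ?V ?X)"
      unfolding spin_tension_def using p by (simp add: ln_div)
    moreover have "spin_tension \<beta> (\<lambda>_. ?j) n ?\<Lambda> = ln (spin_sum ?E ?u ?V {}) - ln (spin_sum ?E ?u ?V ?X)"
      unfolding spin_tension_def using p by (simp add: ln_div)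
    ultimately have "spin_tension \<beta> J n ?\<Lambda> \<le> spin_tension \<beta> (\<lambda>_. ?j) n ?\<Lambda> + x" using 1 2 eta(2) by linarith
    thus "J \<in> {J \<in> space ?Q. spin_tension \<beta> J n ?\<Lambda> \<le> spin_tension \<beta> (\<lambda>_. ?j) n ?\<Lambda> + x}" using Js by simp
  qed
  hence "measure ?Q (Pi\<^sub>E ?E (\<lambda>_. A)) \<le> measure ?Q {J \<in> space ?Q. spin_tension \<beta> J n ?\<Lambda> \<le> spin_tension \<beta> (\<lambda>_. ?j) n ?\<Lambda> + x}"
    by (rule Q.finite_measure_mono) measurable
  thus ?thesis unfolding tension_prob[OF nu box_of_lattice[OF i]] using pos by linarith
qed

lemma low_prob_tiling:
  assumes i: "i \<in> frames" and j: "j \<in> frames" and Z: "tiles i j \<epsilon> L N Z"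
    and t: "(\<Sum>z\<in>Z. t z * area L) + \<epsilon> * area N \<le> \<tau> * area N"
  shows "(\<Prod>z\<in>Z. low_prob j (t z) L) \<le> low_prob i \<tau> N"
proof -
  interpret P: prob_space "disorder \<nu> :: ((real ^ 'd) set \<Rightarrow> real) measure" by (rule prob_space_disorder[OF nu])
  have "(\<Prod>z\<in>Z. low_prob j (t z) L) =
     measure (disorder \<nu>) {J \<in> space (disorder \<nu>). \<forall>z\<in>Z. spin_tension \<beta> (\<lambda>e. J ((+) z ` e)) n (box_of j L) \<le> t z * area L}"
    unfolding low_prob_def
    by (rule blocks_independent[OF nu box_of_lattice[OF j] tilesD(1,2)[OF Z] tilesD(4)[OF Z], symmetric])
  also have "\<dots> \<le> low_prob i \<tau> N"
    unfolding low_prob_def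
  proof (rule P.finite_measure_mono[OF subsetI low_event_measurable[OF box_of_lattice[OF i]]])
    fix J :: "(real ^ 'd) set \<Rightarrow> real"
    assume "J \<in> {J \<in> space (disorder \<nu>). \<forall>z\<in>Z. spin_tension \<beta> (\<lambda>e. J ((+) z ` e)) n (box_of j L) \<le> t z * area L}"
    hence J: "J \<in> space (disorder \<nu>)" "\<forall>z\<in>Z. spin_tension \<beta> (\<lambda>e. J ((+) z ` e)) n (box_of j L) \<le> t z * area L" by auto
    have "spin_tension \<beta> J n (box_of i N) \<le> (\<Sum>z\<in>Z. spin_tension \<beta> (\<lambda>e. J ((+) z ` e)) n (box_of j L)) + \<epsilon> * area N"
      by (rule tilesD(5)[OF Z]) (rule disorder_bounds[OF J(1) box_of_lattice[OF i]])
    also have "\<dots> \<le> (\<Sum>z\<in>Z. t z * area L) + \<epsilon> * area N"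
      using J(2) by (intro add_right_mono sum_mono) auto
    finally show "J \<in> {J \<in> space (disorder \<nu>). spin_tension \<beta> J n (box_of i N) \<le> \<tau> * area N}" using t J(1) by simp
  qed
  finally show ?thesis .
qed

text \<open>A large box is tiled by boxes in which, independently, the tension is close to its
  minimal value with a fixed positive probability.\<close>

lemma low_prob_exponential:
  assumes i: "i \<in> frames" and \<tau>: "minimal_tension 2 \<beta> \<nu> n < \<tau>"
  obtains K where "0 \<le> K" "\<forall>\<^sub>F N in sequentially. exp (- K * area N) \<le> low_prob i \<tau> N"
proof -
  define t where "t = minimal_tension 2 \<beta> \<nu> n"
  define \<epsilon> where "\<epsilon> = (\<tau> - t) / 3"
  have e: "\<epsilon> > 0" using \<tau> by (simp add: \<epsilon>_def t_def)
  have t0: "0 \<le> t" and lim: "(\<lambda>N. spin_tension \<beta> (\<lambda>_. J_min \<nu>) n (box_of i N) / area N) \<longlonglongrightarrow> t"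
    using minimal_tension_limit i by (auto simp: t_def)
  have "\<forall>\<^sub>F L in sequentially. spin_tension \<beta> (\<lambda>_. J_min \<nu>) n (box_of i L) / area L < t + \<epsilon>"
    by (rule order_tendstoD(2)[OF lim]) (use e in simp)
  from eventually_happens'[OF sequentially_bot eventually_conj[OF this eventually_conj[OF tiling[OF i i e] eventually_ge_at_top[of "1::nat"]]]]
  obtain L where L: "spin_tension \<beta> (\<lambda>_. J_min \<nu>) n (box_of i L) / area L < t + \<epsilon>" "L \<ge> 1"
    and til: "\<forall>\<^sub>F N in sequentially. \<exists>Z. tiles i i \<epsilon> L N Z"
    by blast
  define p where "p = low_prob i (t + 2 * \<epsilon>) L"
  have aL: "0 < area L" by (rule area_pos[OF L(2)])
  have "0 < p"
  proof -
    have "0 < measure (disorder \<nu>) {J \<in> space (disorder \<nu>). spin_tension \<beta> J n (box_of i L) \<le> spin_tension \<beta> (\<lambda>_. J_min \<nu>) n (box_of i L) + \<epsilon> * area L}"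
      by (rule prob_near_minimal[OF i L(2)]) (use e aL in simp)
    also have "\<dots> \<le> p"
    proof -
      interpret P: prob_space "disorder \<nu> :: ((real ^ 'd) set \<Rightarrow> real) measure" by (rule prob_space_disorder[OF nu])
      have "spin_tension \<beta> (\<lambda>_. J_min \<nu>) n (box_of i L) + \<epsilon> * area L \<le> (t + 2 * \<epsilon>) * area L"
        using L(1) aL by (simp add: divide_less_eq algebra_simps)
      thus ?thesis unfolding p_def low_prob_def
        by (intro P.finite_measure_mono low_event_measurable[OF box_of_lattice[OF i]]) auto
    qed
    finally show ?thesis .
  qed
  have p1: "p \<le> 1" unfolding p_def by (rule low_prob_le_1)
  define K where "K = - ln p / area L"
  show ?thesis
  proof (rule that[of K])
    show K0: "0 \<le> K" unfolding K_def by (rule divide_nonneg_pos[OF _ aL]) (use p1 \<open>0 < p\<close> in simp)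
    show "\<forall>\<^sub>F N in sequentially. exp (- K * area N) \<le> low_prob i \<tau> N"
      using til
    proof eventually_elim
      case (elim N)
      then obtain Z where t: "tiles i i \<epsilon> L N Z" by blast
      note Z = tilesD(1-3)[OF t]
      have "(\<Prod>z\<in>Z. low_prob i (t + 2 * \<epsilon>) L) \<le> low_prob i \<tau> N"
      proof (rule low_prob_tiling[OF i i t])
        have "(\<Sum>z\<in>Z. (t + 2 * \<epsilon>) * area L) = (t + 2 * \<epsilon>) * (real (card Z) * area L)" by simp
        also have "\<dots> \<le> (t + 2 * \<epsilon>) * area N" using Z(3) t0 e by (intro mult_left_mono) auto
        finally have "(\<Sum>z\<in>Z. (t + 2 * \<epsilon>) * area L) + \<epsilon> * area N \<le> (t + 3 * \<epsilon>) * area N" by (simp add: algebra_simps)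
        moreover have "t + 3 * \<epsilon> = \<tau>" by (simp add: \<epsilon>_def field_simps)
        ultimately show "(\<Sum>z\<in>Z. (t + 2 * \<epsilon>) * area L) + \<epsilon> * area N \<le> \<tau> * area N" by simp
      qed
      hence "p ^ card Z \<le> low_prob i \<tau> N" by (simp add: p_def)
      moreover have "exp (- K * area N) \<le> p ^ card Z"
      proof -
        have "K * (real (card Z) * area L) \<le> K * area N" using Z(3) K0 by (rule mult_left_mono)
        hence "- ln p * real (card Z) \<le> K * area N" using aL by (simp add: K_def mult_ac)
        hence "- K * area N \<le> real (card Z) * ln p" by (simp add: algebra_simps)
        hence "exp (- K * area N) \<le> exp (real (card Z) * ln p)" by simp
        also have "\<dots> = p ^ card Z" using \<open>0 < p\<close> by (simp add: exp_of_nat_mult)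
        finally show ?thesis .
      qed
      ultimately show ?case by linarith
    qed
  qed
qed

lemma low_prob_pos:
  assumes i: "i \<in> frames" and \<tau>: "minimal_tension 2 \<beta> \<nu> n < \<tau>"
  shows "\<forall>\<^sub>F N in sequentially. 0 < low_prob i \<tau> N"
proof -
  obtain K where "\<forall>\<^sub>F N in sequentially. exp (- K * area N) \<le> low_prob i \<tau> N" by (rule low_prob_exponential[OF i \<tau>])
  thus ?thesis by eventually_elim (rule less_le_trans[OF exp_gt_zero])
qed


section \<open>Existence of the rate function\<close>

definition cost :: "(real ^ 'd) set \<times> real \<Rightarrow> real \<Rightarrow> nat \<Rightarrow> real" where
  "cost i \<tau> N = (if N = 0 then 0 else - ln (low_prob i \<tau> N) / area N)"

lemma cost_nonneg: "0 \<le> cost i \<tau> N"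
proof -
  have "ln (low_prob i \<tau> N) \<le> 0"
    using low_prob_le_1[of i \<tau> N] low_prob_nonneg[of i \<tau> N] by (cases "low_prob i \<tau> N = 0") simp_all
  thus ?thesis using area_nonneg[of N] by (simp add: cost_def divide_nonpos_nonneg)
qed

text \<open>If all tiles have tension at most \<open>\<tau>\<close>, the error of the tiling may push the large box
  slightly above \<open>\<tau>\<close>. To make room for it, a small fraction \<open>\<alpha>\<close> of the tiles is required to have
  tension at most some \<open>\<tau>1 < \<tau>\<close>. By \<open>low_prob_exponential\<close> this costs at most \<open>\<alpha> K\<close> more per
  unit of area. This is where \<open>\<tau>\<close> has to exceed the minimal tension.\<close>

lemma cost_subadditive:
  assumes i: "i \<in> frames" and j: "j \<in> frames" and \<tau>: "minimal_tension 2 \<beta> \<nu> n < \<tau>" and e: "0 < \<epsilon>"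
  shows "\<forall>\<^sub>F L in sequentially. \<forall>\<^sub>F N in sequentially. cost i \<tau> N \<le> cost j \<tau> L + \<epsilon>"
proof -
  obtain \<tau>1 where t1: "minimal_tension 2 \<beta> \<nu> n < \<tau>1" "\<tau>1 < \<tau>" using dense[OF \<tau>] by blast
  have t1p: "0 < \<tau>1" using t1(1) minimal_tension_limit by linarith
  obtain K where K: "0 \<le> K" "\<forall>\<^sub>F N in sequentially. exp (- K * area N) \<le> low_prob j \<tau>1 N"
    by (rule low_prob_exponential[OF j t1(1)])
  define \<alpha> where "\<alpha> = min 1 (\<epsilon> / (2 * (K + 1)))"
  have al: "0 < \<alpha>" "\<alpha> \<le> 1" using e K(1) by (auto simp: \<alpha>_def)
  have "\<alpha> * (K + 1) \<le> \<epsilon> / (2 * (K + 1)) * (K + 1)" using K(1) by (intro mult_right_mono) (auto simp: \<alpha>_def)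
  also have "\<dots> = \<epsilon> / 2" using K(1) by (simp add: field_simps)
  finally have alK: "\<alpha> * K \<le> \<epsilon> / 2" using al by (simp add: algebra_simps)
  have e': "0 < \<alpha> * (\<tau> - \<tau>1)" using al t1 by simp
  show ?thesis
    using tiling[OF i j e'] K(2) eventually_ge_at_top[of "1::nat"]
  proof eventually_elim
    case L: (elim L)
    define P where "P = low_prob j \<tau> L"
    define A where "A = area L"
    have A: "0 < A" unfolding A_def by (rule area_pos[OF L(3)])
    have p1: "exp (- K * A) \<le> low_prob j \<tau>1 L" using L(2) by (simp add: A_def)
    have "low_prob j \<tau>1 L \<le> P" unfolding P_def by (rule low_prob_mono[OF j]) (use t1 in simp)
    hence P: "0 < P" using p1 exp_gt_zero[of "- K * A"] by linarith
    have P1: "P \<le> 1" unfolding P_def by (rule low_prob_le_1)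
    have big: "\<forall>\<^sub>F N in sequentially. 2 * K * A / \<epsilon> \<le> area N"
      using area_at_top unfolding filterlim_at_top by blast
    show ?case using L(1) big eventually_ge_at_top[of "1::nat"]
    proof eventually_elim
      case N: (elim N)
      then obtain Z where til: "tiles i j (\<alpha> * (\<tau> - \<tau>1)) L N Z" by blast
      note Z = tilesD(1-3)[OF til]
      define a where "a = area N"
      have a: "0 < a" unfolding a_def by (rule area_pos[OF N(3)])
      \<comment> \<open>The number of tiles at the lower level \<open>\<tau>1\<close>; rounding up contributes the term \<open>K * A\<close>,
        which is negligible for large \<open>N\<close>.\<close>
      define k where "k = nat \<lceil>\<alpha> * a / A\<rceil>"
      have "0 \<le> \<alpha> * a / A" using al a A by simp
      hence "\<alpha> * a / A \<le> real k" "real k \<le> \<alpha> * a / A + 1" unfolding k_def by linarith+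
      hence k: "\<alpha> * a \<le> real k * A" "real k * A \<le> \<alpha> * a + A" using A by (simp_all add: field_simps)
      obtain Y where Y: "Y \<subseteq> Z" "card Y = min (card Z) k"
        using obtain_subset_with_card_n[of "min (card Z) k" Z] by auto
      have cd: "card (Z - Y) = card Z - card Y" using Y Z(1) by (intro card_Diff_subset finite_subset[OF Y(1)])
      have cY: "card Y \<le> card Z" "card Y \<le> k" using Y by auto
      define t where "t z = (if z \<in> Y then \<tau>1 else \<tau>)" for z
      have "(\<Sum>z\<in>Z. t z * A) = (\<Sum>z\<in>Z - Y. t z * A) + (\<Sum>z\<in>Y. t z * A)" by (rule sum.subset_diff[OF Y(1) Z(1)])
      also have "\<dots> = (\<Sum>z\<in>Z - Y. \<tau> * A) + (\<Sum>z\<in>Y. \<tau>1 * A)"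
        by (intro arg_cong2[where f = "(+)"] sum.cong) (auto simp: t_def)
      also have "\<dots> = real (card Z) * A * \<tau> - real (card Y) * A * (\<tau> - \<tau>1)"
        using cY by (simp add: cd of_nat_diff algebra_simps)
      finally have sum: "(\<Sum>z\<in>Z. t z * A) = real (card Z) * A * \<tau> - real (card Y) * A * (\<tau> - \<tau>1)" .
      have ZA: "real (card Z) * A \<le> a" using Z(3) by (simp add: A_def a_def)
      have "(\<Sum>z\<in>Z. t z * A) + \<alpha> * (\<tau> - \<tau>1) * a \<le> \<tau> * a"
      proof (cases "k \<le> card Z")
        case True
        have "\<alpha> * a * (\<tau> - \<tau>1) \<le> real k * A * (\<tau> - \<tau>1)" using k(1) t1 by (intro mult_right_mono) auto
        moreover have "real (card Z) * A * \<tau> \<le> a * \<tau>" using ZA t1 t1p by (intro mult_right_mono) auto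
        ultimately show ?thesis unfolding sum using True Y(2) by (simp add: algebra_simps)
      next
        case False
        have "real (card Z) * A * \<tau>1 \<le> a * \<tau>1" using ZA t1p by (intro mult_right_mono) auto
        moreover have "\<alpha> * ((\<tau> - \<tau>1) * a) \<le> 1 * ((\<tau> - \<tau>1) * a)" using al t1 a by (intro mult_right_mono) auto
        ultimately show ?thesis unfolding sum using False Y(2) by (simp add: algebra_simps)
      qed
      hence "(\<Prod>z\<in>Z. low_prob j (t z) L) \<le> low_prob i \<tau> N"
        by (intro low_prob_tiling[OF i j til]) (simp add: A_def a_def)
      also have "(\<Prod>z\<in>Z. low_prob j (t z) L) = (\<Prod>z\<in>Z - Y. low_prob j (t z) L) * (\<Prod>z\<in>Y. low_prob j (t z) L)"
        by (rule prod.subset_diff[OF Y(1) Z(1)])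
      also have "\<dots> = (\<Prod>z\<in>Z - Y. P) * (\<Prod>z\<in>Y. low_prob j \<tau>1 L)"
        by (intro arg_cong2[where f = "(*)"] prod.cong) (auto simp: t_def P_def)
      finally have lo: "P ^ (card Z - card Y) * low_prob j \<tau>1 L ^ card Y \<le> low_prob i \<tau> N" by (simp add: cd)
      have "exp (- K * A) ^ card Y \<le> low_prob j \<tau>1 L ^ card Y" using p1 by (intro power_mono) auto
      moreover have "P ^ card Z \<le> P ^ (card Z - card Y)" using P P1 by (intro power_decreasing) auto
      ultimately have "P ^ card Z * exp (- K * A) ^ card Y \<le> P ^ (card Z - card Y) * low_prob j \<tau>1 L ^ card Y"
        using P by (intro mult_mono) auto
      with lo have "P ^ card Z * exp (- K * A) ^ card Y \<le> low_prob i \<tau> N" by linarith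
      hence "ln (P ^ card Z * exp (- K * A) ^ card Y) \<le> ln (low_prob i \<tau> N)"
        using P by (intro ln_mono) auto
      also have "ln (P ^ card Z * exp (- K * A) ^ card Y) = real (card Z) * ln P - real (card Y) * (K * A)"
        using P by (simp add: ln_mult ln_realpow)
      finally have l: "- ln (low_prob i \<tau> N) \<le> - ln P * real (card Z) + K * (real (card Y) * A)" by (simp add: algebra_simps)
      have "real (card Y) * A \<le> real k * A" using cY A by (intro mult_right_mono) auto
      hence "K * (real (card Y) * A) \<le> K * (\<alpha> * a + A)" using k(2) K(1) by (intro mult_left_mono) auto
      moreover have "\<alpha> * K * a \<le> \<epsilon> / 2 * a" using alK a by (intro mult_right_mono) auto
      moreover have "K * A \<le> \<epsilon> / 2 * a" using N(2) e by (simp add: a_def field_simps)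
      ultimately have 1: "K * (real (card Y) * A) \<le> \<epsilon> * a" by (simp add: algebra_simps)
      have "(- ln P / A) * (real (card Z) * A) \<le> (- ln P / A) * a"
        using ZA P P1 A by (intro mult_left_mono) (auto simp: divide_nonpos_pos)
      hence "- ln P * real (card Z) \<le> (- ln P / A) * a" using A by simp
      with l 1 have "- ln (low_prob i \<tau> N) \<le> (- ln P / A + \<epsilon>) * a" by (simp add: algebra_simps)
      hence "- ln (low_prob i \<tau> N) / a \<le> - ln P / A + \<epsilon>" using pos_divide_le_eq[OF a] by blast
      thus ?case using L(3) N(3) by (simp add: cost_def a_def P_def A_def)
    qed
  qed
qed

lemma deviation_cost_eq:
  assumes i: "i \<in> frames" and N: "N \<ge> 1" and p: "0 < low_prob i \<tau> N"
  shows "deviation_cost 2 \<beta> \<nu> (snd i) (cube (fst i)) n \<tau> N = ereal (cost i \<tau> N)"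
proof -
  have "measure (disorder \<nu>) {J \<in> space (disorder \<nu>). rect_tension 2 \<beta> J 0 (real N) (snd i * real N) (cube (fst i)) n \<le> \<tau>}
      = low_prob i \<tau> N"
    unfolding rect_tension_box[OF i N] low_prob_def pos_divide_le_eq[OF area_pos[OF N]] by (rule refl)
  hence "deviation_cost 2 \<beta> \<nu> (snd i) (cube (fst i)) n \<tau> N = ereal (- ln (low_prob i \<tau> N)) / ereal (area N)"
    using p by (simp add: deviation_cost_def neg_log_def area_def)
  thus ?thesis using N area_pos[OF N] by (simp add: cost_def)
qed

lemma rate_above_limit:
  assumes \<tau>: "minimal_tension 2 \<beta> \<nu> n < \<tau>"
  obtains v where "rate_above 2 \<beta> \<nu> n \<tau> = ereal v" "\<And>i. i \<in> frames \<Longrightarrow> cost i \<tau> \<longlonglongrightarrow> v"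
proof -
  obtain v where v: "0 \<le> v" "\<And>i. i \<in> frames \<Longrightarrow> cost i \<tau> \<longlonglongrightarrow> v"
    by (rule common_limit[OF frames_nonempty, of "\<lambda>i. cost i \<tau>"]) (use cost_nonneg cost_subadditive[OF _ _ \<tau>] in blast)+
  have dl: "deviation_cost 2 \<beta> \<nu> (snd i) (cube (fst i)) n \<tau> \<longlonglongrightarrow> ereal v" if i: "i \<in> frames" for i
  proof (rule Lim_transform_eventually)
    show "(\<lambda>N. ereal (cost i \<tau> N)) \<longlonglongrightarrow> ereal v" using v(2)[OF i] by simp
    show "\<forall>\<^sub>F N in sequentially. ereal (cost i \<tau> N) = deviation_cost 2 \<beta> \<nu> (snd i) (cube (fst i)) n \<tau> N"
      using low_prob_pos[OF i \<tau>] eventually_ge_at_top[of "1::nat"] by eventually_elim (simp add: deviation_cost_eq[OF i])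
  qed
  have "rate_above 2 \<beta> \<nu> n \<tau> = ereal v"
    unfolding rate_above_def
  proof (rule the_equality)
    show "\<forall>\<delta>>0. \<forall>S\<in>unit_cubes n. deviation_cost 2 \<beta> \<nu> \<delta> S n \<tau> \<longlonglongrightarrow> ereal v"
    proof (intro allI impI ballI)
      fix \<delta> :: real and S assume "0 < \<delta>" "S \<in> unit_cubes n"
      then obtain B where "(B, \<delta>) \<in> frames" "S = cube B" by (auto simp: unit_cubes_iff frames_def)
      thus "deviation_cost 2 \<beta> \<nu> \<delta> S n \<tau> \<longlonglongrightarrow> ereal v" using dl[of "(B, \<delta>)"] by simp
    qed
    fix w assume w: "\<forall>\<delta>>0. \<forall>S\<in>unit_cubes n. deviation_cost 2 \<beta> \<nu> \<delta> S n \<tau> \<longlonglongrightarrow> w"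
    obtain i where i: "i \<in> frames" using frames_nonempty by auto
    have "cube (fst i) \<in> unit_cubes n" using frame_of(1)[OF i] unit_cubes_iff by blast
    hence "deviation_cost 2 \<beta> \<nu> (snd i) (cube (fst i)) n \<tau> \<longlonglongrightarrow> w" using w frame_of(2)[OF i] by blast
    thus "w = ereal v" using dl[OF i] LIMSEQ_unique by blast
  qed
  thus ?thesis using v(2) by (rule that)
qed

lemma rate_above_antimono:
  assumes \<tau>: "minimal_tension 2 \<beta> \<nu> n < \<tau>" "\<tau> \<le> \<tau>'"
  shows "rate_above 2 \<beta> \<nu> n \<tau>' \<le> rate_above 2 \<beta> \<nu> n \<tau>"
proof -
  obtain i where i: "i \<in> frames" using frames_nonempty by auto
  have \<tau>': "minimal_tension 2 \<beta> \<nu> n < \<tau>'" using \<tau> by simp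
  obtain v where v: "rate_above 2 \<beta> \<nu> n \<tau> = ereal v" "cost i \<tau> \<longlonglongrightarrow> v" using rate_above_limit[OF \<tau>(1)] i by metis
  obtain v' where v': "rate_above 2 \<beta> \<nu> n \<tau>' = ereal v'" "cost i \<tau>' \<longlonglongrightarrow> v'" using rate_above_limit[OF \<tau>'] i by metis
  have "v' \<le> v"
  proof (rule tendsto_le[OF sequentially_bot v(2) v'(2)])
    show "\<forall>\<^sub>F N in sequentially. cost i \<tau>' N \<le> cost i \<tau> N"
      using low_prob_pos[OF i \<tau>(1)] eventually_ge_at_top[of "1::nat"]
    proof eventually_elim
      case (elim N)
      have "ln (low_prob i \<tau> N) \<le> ln (low_prob i \<tau>' N)" using elim(1) low_prob_mono[OF i \<tau>(2)] by (intro ln_mono)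
      thus ?case using area_pos[OF elim(2)] elim(2) by (simp add: cost_def divide_right_mono)
    qed
  qed
  thus ?thesis using v v' by simp
qed

section \<open>Quenched tension and the quadratic bound\<close>

lemma variance_factor_area:
  obtains C where "1 \<le> C" "\<And>N. N \<ge> 1 \<Longrightarrow> variance_factor CARD('d) \<beta> (real N) \<le> C * area N"
proof -
  define d where "d = CARD('d)"
  define c where "c = (1 + 2 * real d) ^ (d - 1)"
  define a where "a = \<beta> * (2 * real d * (2 + 2 * real d)) + 2 * real d * (6 + 2 * real d)"
  have a: "0 \<le> a" using b0 by (simp add: a_def)
  have c: "0 \<le> c" by (simp add: c_def)
  have eb: "1 \<le> exp (2 * \<beta>)" using b0 by simp
  show ?thesis
  proof (rule that[of "exp (2 * \<beta>) * (a * c + 1)"])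
    have "1 * 1 \<le> exp (2 * \<beta>) * (a * c + 1)" using eb a c by (intro mult_mono) auto
    thus "1 \<le> exp (2 * \<beta>) * (a * c + 1)" by simp
    fix N :: nat assume N: "N \<ge> 1"
    have "real N + 2 * real d \<le> (1 + 2 * real d) * real N"
    proof -
      have "2 * real d * 1 \<le> 2 * real d * real N" using N by (intro mult_left_mono) auto
      thus ?thesis by (simp add: algebra_simps)
    qed
    hence "(real N + 2 * real d) ^ (d - 1) \<le> ((1 + 2 * real d) * real N) ^ (d - 1)" by (intro power_mono) auto
    also have "\<dots> = c * area N" by (simp add: power_mult_distrib c_def area_def d_def)
    finally have x: "(real N + 2 * real d) ^ (d - 1) \<le> c * area N" .
    have "1 \<le> area N" using N by (simp add: area_def)
    moreover have "a * (real N + 2 * real d) ^ (d - 1) \<le> a * (c * area N)" using x a by (rule mult_left_mono)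
    ultimately have "a * (real N + 2 * real d) ^ (d - 1) + 1 \<le> (a * c + 1) * area N" by (simp add: algebra_simps)
    hence "exp (2 * \<beta>) * (a * (real N + 2 * real d) ^ (d - 1) + 1) \<le> exp (2 * \<beta>) * ((a * c + 1) * area N)"
      by (rule mult_left_mono) simp
    moreover have "variance_factor CARD('d) \<beta> (real N) = exp (2 * \<beta>) * (a * (real N + 2 * real d) ^ (d - 1) + 1)"
      by (simp add: variance_factor_def a_def d_def algebra_simps)
    ultimately show "variance_factor CARD('d) \<beta> (real N) \<le> exp (2 * \<beta>) * (a * c + 1) * area N" by (simp add: mult.assoc)
  qed
qed

definition mean :: "(real ^ 'd) set \<times> real \<Rightarrow> nat \<Rightarrow> real" where
  "mean i N = (\<integral>J. spin_tension \<beta> J n (box_of i N) \<partial>disorder \<nu>)"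

context
  assumes low: "low_temperature CARD('d) (J_min \<nu>) \<beta>"
begin

lemma box_concentration:
  obtains C where "1 \<le> C"
    "\<And>i N s t. i \<in> frames \<Longrightarrow> N \<ge> 1 \<Longrightarrow> 0 < s \<Longrightarrow> s * exp \<beta> \<le> 1 \<Longrightarrow>
      measure (disorder \<nu>) {J \<in> space (disorder \<nu>). spin_tension \<beta> J n (box_of i N) \<le> mean i N - t} \<le> exp (2 * C * area N * s\<^sup>2 - s * t) \<and>
      measure (disorder \<nu>) {J \<in> space (disorder \<nu>). spin_tension \<beta> J n (box_of i N) \<ge> mean i N + t} \<le> exp (2 * C * area N * s\<^sup>2 - s * t)"
proof -
  obtain C where C: "1 \<le> C" "\<And>N. N \<ge> 1 \<Longrightarrow> variance_factor CARD('d) \<beta> (real N) \<le> C * area N"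
    using variance_factor_area by blast
  show ?thesis
  proof (rule that[OF C(1)])
    fix i and N :: nat and s t :: real
    assume i: "i \<in> frames" and N: "N \<ge> 1" and s: "0 < s" "s * exp \<beta> \<le> 1"
    have pos: "0 < real N" "0 < snd i * real N" using N frame_of(2)[OF i] by auto
    note tc = tension_concentration[OF frame_of(1)[OF i] d2 pos refl low nu refl s, of t, folded box_of_def mean_def]
    have "variance_factor CARD('d) \<beta> (real N) * (2 * s\<^sup>2) \<le> C * area N * (2 * s\<^sup>2)" using C(2)[OF N] by (rule mult_right_mono) simp
    hence "exp (2 * variance_factor CARD('d) \<beta> (real N) * s\<^sup>2 - s * t) \<le> exp (2 * C * area N * s\<^sup>2 - s * t)" by (simp add: mult_ac)
    with tc show "measure (disorder \<nu>) {J \<in> space (disorder \<nu>). spin_tension \<beta> J n (box_of i N) \<le> mean i N - t} \<le> exp (2 * C * area N * s\<^sup>2 - s * t) \<and>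
      measure (disorder \<nu>) {J \<in> space (disorder \<nu>). spin_tension \<beta> J n (box_of i N) \<ge> mean i N + t} \<le> exp (2 * C * area N * s\<^sup>2 - s * t)"
      unfolding mean_def by linarith
  qed
qed

text \<open>The mean tension converges, and the deviations from the mean are exponentially unlikely
  by concentration.\<close>

lemma tension_in_probability:
  assumes q: "(\<lambda>N. mean i N / area N) \<longlonglongrightarrow> q" and i: "i \<in> frames" and e: "0 < \<epsilon>"
  shows "(\<lambda>N. measure (disorder \<nu>) {J \<in> space (disorder \<nu>).
    \<bar>rect_tension 2 \<beta> J 0 (real N) (snd i * real N) (cube (fst i)) n - q\<bar> > \<epsilon>}) \<longlonglongrightarrow> 0"
proof -
  interpret P: prob_space "disorder \<nu> :: ((real ^ 'd) set \<Rightarrow> real) measure" by (rule prob_space_disorder[OF nu])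
  obtain C where C: "1 \<le> C" and conc: "\<And>i N s t. i \<in> frames \<Longrightarrow> N \<ge> 1 \<Longrightarrow> 0 < s \<Longrightarrow> s * exp \<beta> \<le> 1 \<Longrightarrow>
      measure (disorder \<nu>) {J \<in> space (disorder \<nu>). spin_tension \<beta> J n (box_of i N) \<le> mean i N - t} \<le> exp (2 * C * area N * s\<^sup>2 - s * t) \<and>
      measure (disorder \<nu>) {J \<in> space (disorder \<nu>). spin_tension \<beta> J n (box_of i N) \<ge> mean i N + t} \<le> exp (2 * C * area N * s\<^sup>2 - s * t)"
    using box_concentration by blast
  define s where "s = min (exp (- \<beta>)) (\<epsilon> / (8 * C))"
  have s: "0 < s" using e C by (simp add: s_def)
  have "s * exp \<beta> \<le> exp (- \<beta>) * exp \<beta>" by (intro mult_right_mono) (auto simp: s_def)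
  hence s1: "s * exp \<beta> \<le> 1" by (simp add: exp_minus)
  have "s * (8 * C) \<le> \<epsilon> / (8 * C) * (8 * C)" using C by (intro mult_right_mono) (auto simp: s_def)
  hence "s * (8 * C) \<le> \<epsilon>" using C by simp
  hence s2: "2 * C * s \<le> \<epsilon> / 4" by (simp add: algebra_simps)
  define c where "c = s * \<epsilon> / 4"
  have c: "0 < c" using s e by (simp add: c_def)
  let ?D = "\<lambda>N::nat. {J \<in> space (disorder \<nu>). \<bar>rect_tension 2 \<beta> J 0 (real N) (snd i * real N) (cube (fst i)) n - q\<bar> > \<epsilon>}"
  have "filterlim (\<lambda>N. c * area N) at_top sequentially"
    by (rule filterlim_tendsto_pos_mult_at_top[OF tendsto_const c area_at_top])
  hence "(\<lambda>N. exp (- (c * area N))) \<longlonglongrightarrow> 0"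
    by (intro filterlim_compose[OF exp_at_bot] filterlim_compose[OF filterlim_uminus_at_bot_at_top])
  hence lim: "(\<lambda>N. 2 * exp (- (c * area N))) \<longlonglongrightarrow> 0" using tendsto_mult_left[of _ 0 sequentially 2] by fastforce
  have "\<forall>\<^sub>F N in sequentially. dist (mean i N / area N) q < \<epsilon> / 2" using q e by (intro tendstoD) auto
  hence "\<forall>\<^sub>F N in sequentially. measure (disorder \<nu>) (?D N) \<le> 2 * exp (- (c * area N))"
    using eventually_ge_at_top[of "1::nat"]
  proof eventually_elim
    case (elim N)
    let ?T = "\<lambda>J. spin_tension \<beta> J n (box_of i N)" and ?t = "\<epsilon> / 2 * area N"
    let ?A = "{J \<in> space (disorder \<nu>). ?T J \<le> mean i N - ?t}" and ?B = "{J \<in> space (disorder \<nu>). ?T J \<ge> mean i N + ?t}"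
    have a: "0 < area N" by (rule area_pos[OF elim(2)])
    note [measurable] = tension_measurable[OF nu box_of_lattice[OF i], of \<beta> n]
    have mA: "?A \<in> sets (disorder \<nu>)" and mB: "?B \<in> sets (disorder \<nu>)" by measurable
    have "?D N \<subseteq> ?A \<union> ?B"
    proof
      fix J assume "J \<in> ?D N"
      hence J: "J \<in> space (disorder \<nu>)" "\<bar>?T J / area N - q\<bar> > \<epsilon>" by (simp_all add: rect_tension_box[OF i elim(2)])
      from J(2) elim(1) have "?T J / area N \<le> mean i N / area N - \<epsilon> / 2 \<or> mean i N / area N + \<epsilon> / 2 \<le> ?T J / area N"
        unfolding dist_real_def by argo
      hence "?T J / area N \<le> (mean i N - ?t) / area N \<or> (mean i N + ?t) / area N \<le> ?T J / area N"
        using a by (simp add: diff_divide_distrib add_divide_distrib)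
      hence "?T J \<le> mean i N - ?t \<or> mean i N + ?t \<le> ?T J" using a by (simp add: divide_le_cancel)
      thus "J \<in> ?A \<union> ?B" using J(1) by auto
    qed
    hence "measure (disorder \<nu>) (?D N) \<le> measure (disorder \<nu>) (?A \<union> ?B)" using mA mB by (intro P.finite_measure_mono) auto
    also have "\<dots> \<le> measure (disorder \<nu>) ?A + measure (disorder \<nu>) ?B" by (rule measure_Un_le[OF mA mB])
    also have "\<dots> \<le> 2 * exp (2 * C * area N * s\<^sup>2 - s * ?t)" using conc[OF i elim(2) s s1, of ?t] by linarith
    also have "\<dots> \<le> 2 * exp (- (c * area N))"
    proof -
      have "(2 * C * s) * (s * area N) \<le> \<epsilon> / 4 * (s * area N)" using s2 s a by (intro mult_right_mono) auto
      thus ?thesis by (simp add: c_def power2_eq_square algebra_simps)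
    qed
    finally show ?case .
  qed
  thus ?thesis by (rule tendsto_sandwich[OF _ _ tendsto_const lim, rotated]) simp
qed

lemma quenched_tension_eq:
  assumes q: "\<And>i. i \<in> frames \<Longrightarrow> (\<lambda>N. mean i N / area N) \<longlonglongrightarrow> q"
  shows "quenched_tension 2 \<beta> \<nu> n = q"
  unfolding quenched_tension_def
proof (rule the_equality)
  show "\<forall>\<delta>>0. \<forall>S\<in>unit_cubes n. \<forall>\<epsilon>>0. (\<lambda>N. measure (disorder \<nu>) {J \<in> space (disorder \<nu>).
        \<bar>rect_tension 2 \<beta> J 0 (real N) (\<delta> * real N) S n - q\<bar> > \<epsilon>}) \<longlonglongrightarrow> 0"
  proof (intro allI impI ballI)
    fix \<delta> \<epsilon> :: real and S assume "0 < \<delta>" "S \<in> unit_cubes n" and e: "0 < \<epsilon>"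
    then obtain B where B: "(B, \<delta>) \<in> frames" "S = cube B" by (auto simp: unit_cubes_iff frames_def)
    show "(\<lambda>N. measure (disorder \<nu>) {J \<in> space (disorder \<nu>).
        \<bar>rect_tension 2 \<beta> J 0 (real N) (\<delta> * real N) S n - q\<bar> > \<epsilon>}) \<longlonglongrightarrow> 0"
      using tension_in_probability[OF q[OF B(1)] B(1) e] B(2) by simp
  qed
  fix t assume t: "\<forall>\<delta>>0. \<forall>S\<in>unit_cubes n. \<forall>\<epsilon>>0. (\<lambda>N. measure (disorder \<nu>) {J \<in> space (disorder \<nu>).
        \<bar>rect_tension 2 \<beta> J 0 (real N) (\<delta> * real N) S n - t\<bar> > \<epsilon>}) \<longlonglongrightarrow> 0"
  obtain i where i: "i \<in> frames" using frames_nonempty by auto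
  have S: "cube (fst i) \<in> unit_cubes n" using frame_of(1)[OF i] unit_cubes_iff by blast
  interpret P: prob_space "disorder \<nu> :: ((real ^ 'd) set \<Rightarrow> real) measure" by (rule prob_space_disorder[OF nu])
  let ?R = "\<lambda>N J. rect_tension 2 \<beta> J 0 (real N) (snd i * real N) (cube (fst i)) n"
  show "t = q"
  proof (rule ccontr)
    assume "t \<noteq> q"
    define \<epsilon> where "\<epsilon> = \<bar>t - q\<bar> / 3"
    have e: "0 < \<epsilon>" using \<open>t \<noteq> q\<close> by (simp add: \<epsilon>_def)
    let ?A = "\<lambda>x N. {J \<in> space (disorder \<nu>). \<bar>?R N J - x\<bar> > \<epsilon>}"
    have "(\<lambda>N. measure (disorder \<nu>) (?A t N)) \<longlonglongrightarrow> 0" using t frame_of(2)[OF i] S e by blast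
    moreover have "(\<lambda>N. measure (disorder \<nu>) (?A q N)) \<longlonglongrightarrow> 0" by (rule tension_in_probability[OF q[OF i] i e])
    ultimately have "(\<lambda>N. measure (disorder \<nu>) (?A t N) + measure (disorder \<nu>) (?A q N)) \<longlonglongrightarrow> 0 + 0" by (rule tendsto_add)
    moreover have "\<forall>\<^sub>F N in sequentially. 1 \<le> measure (disorder \<nu>) (?A t N) + measure (disorder \<nu>) (?A q N)"
      using eventually_ge_at_top[of "1::nat"]
    proof eventually_elim
      case (elim N)
      note [measurable] = tension_measurable[OF nu box_of_lattice[OF i], of \<beta> n]
      have m: "?A x N \<in> sets (disorder \<nu>)" for x unfolding rect_tension_box[OF i elim] by measurable
      have "space (disorder \<nu>) \<subseteq> ?A t N \<union> ?A q N"
      proof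
        fix J :: "(real ^ 'd) set \<Rightarrow> real" assume J: "J \<in> space (disorder \<nu>)"
        have "\<bar>?R N J - t\<bar> > \<epsilon> \<or> \<bar>?R N J - q\<bar> > \<epsilon>"
          using e unfolding \<epsilon>_def by argo
        thus "J \<in> ?A t N \<union> ?A q N" using J by blast
      qed
      hence "measure (disorder \<nu>) (space (disorder \<nu> :: ((real ^ 'd) set \<Rightarrow> real) measure)) \<le> measure (disorder \<nu>) (?A t N \<union> ?A q N)"
        by (rule P.finite_measure_mono) (intro sets.Un m)
      also have "\<dots> \<le> measure (disorder \<nu>) (?A t N) + measure (disorder \<nu>) (?A q N)" by (rule measure_Un_le[OF m m])
      finally show ?case by (simp add: P.prob_space)
    qed
    ultimately have "(1::real) \<le> 0 + 0" by (rule tendsto_lowerbound[OF _ _ sequentially_bot])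
    thus False by simp
  qed
qed

text \<open>Concentration with \<open>s = k r\<close>, where \<open>k \<le> 1 / (8 C)\<close> lets the linear term dominate and
  \<open>k \<le> exp (- \<beta>) / (q + 1)\<close> keeps \<open>s * exp \<beta> \<le> 1\<close>. The latter works for all \<open>r\<close> because \<open>r \<le> q\<close>:
  the minimal tension is nonnegative.\<close>

lemma quadratic_cost:
  assumes q: "\<And>i. i \<in> frames \<Longrightarrow> (\<lambda>N. mean i N / area N) \<longlonglongrightarrow> q" and q0: "0 \<le> q"
  obtains c where "0 < c"
    "\<And>r. 0 < r \<Longrightarrow> minimal_tension 2 \<beta> \<nu> n < q - r \<Longrightarrow> ereal (c * r\<^sup>2) \<le> rate_above 2 \<beta> \<nu> n (q - r)"
proof -
  interpret P: prob_space "disorder \<nu> :: ((real ^ 'd) set \<Rightarrow> real) measure" by (rule prob_space_disorder[OF nu])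
  obtain C where C: "1 \<le> C" and conc: "\<And>i N s t. i \<in> frames \<Longrightarrow> N \<ge> 1 \<Longrightarrow> 0 < s \<Longrightarrow> s * exp \<beta> \<le> 1 \<Longrightarrow>
      measure (disorder \<nu>) {J \<in> space (disorder \<nu>). spin_tension \<beta> J n (box_of i N) \<le> mean i N - t} \<le> exp (2 * C * area N * s\<^sup>2 - s * t) \<and>
      measure (disorder \<nu>) {J \<in> space (disorder \<nu>). spin_tension \<beta> J n (box_of i N) \<ge> mean i N + t} \<le> exp (2 * C * area N * s\<^sup>2 - s * t)"
    using box_concentration by blast
  obtain i where i: "i \<in> frames" using frames_nonempty by auto
  define k where "k = min (1 / (8 * C)) (exp (- \<beta>) / (q + 1))"
  have k: "0 < k" using C q0 by (simp add: k_def)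
  have "k * (8 * C) \<le> 1 / (8 * C) * (8 * C)" using C by (intro mult_right_mono) (auto simp: k_def)
  hence kC: "2 * C * k \<le> 1 / 4" using C by (simp add: algebra_simps)
  have "k * (q + 1) \<le> exp (- \<beta>) / (q + 1) * (q + 1)" using q0 by (intro mult_right_mono) (auto simp: k_def)
  hence kq: "k * (q + 1) \<le> exp (- \<beta>)" using q0 by simp
  show ?thesis
  proof (rule that[of "k / 4"])
    show "0 < k / 4" using k by simp
    fix r assume r: "0 < r" and \<tau>: "minimal_tension 2 \<beta> \<nu> n < q - r"
    have rq: "r \<le> q + 1" using \<tau> minimal_tension_limit by linarith
    define s where "s = k * r"
    have s: "0 < s" using k r by (simp add: s_def)
    have "s \<le> k * (q + 1)" unfolding s_def using rq k by (intro mult_left_mono) auto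
    hence "s * exp \<beta> \<le> exp (- \<beta>) * exp \<beta>" using kq by (intro mult_right_mono) auto
    hence s1: "s * exp \<beta> \<le> 1" by (simp add: exp_minus)
    obtain v where v: "rate_above 2 \<beta> \<nu> n (q - r) = ereal v" "cost i (q - r) \<longlonglongrightarrow> v"
      using rate_above_limit[OF \<tau>] i by metis
    have "\<forall>\<^sub>F N in sequentially. q - r / 2 < mean i N / area N" using q[OF i] r by (intro order_tendstoD) auto
    hence "\<forall>\<^sub>F N in sequentially. k / 4 * r\<^sup>2 \<le> cost i (q - r) N"
      using low_prob_pos[OF i \<tau>] eventually_ge_at_top[of "1::nat"]
    proof eventually_elim
      case (elim N)
      have a: "0 < area N" by (rule area_pos[OF elim(3)])
      have "(q - r / 2) * area N < mean i N" using elim(1) a by (simp add: pos_less_divide_eq)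
      hence "(q - r) * area N \<le> mean i N - r / 2 * area N" by (simp add: algebra_simps)
      hence "low_prob i (q - r) N \<le> measure (disorder \<nu>) {J \<in> space (disorder \<nu>). spin_tension \<beta> J n (box_of i N) \<le> mean i N - r / 2 * area N}"
        unfolding low_prob_def by (intro P.finite_measure_mono low_event_measurable[OF box_of_lattice[OF i]]) auto
      also have "\<dots> \<le> exp (2 * C * area N * s\<^sup>2 - s * (r / 2 * area N))" using conc[OF i elim(3) s s1] by blast
      also have "\<dots> \<le> exp (- (k / 4 * r\<^sup>2 * area N))"
      proof -
        have "(2 * C * k) * (k * r\<^sup>2 * area N) \<le> 1 / 4 * (k * r\<^sup>2 * area N)" using kC k a by (intro mult_right_mono) auto
        thus ?thesis by (simp add: s_def power2_eq_square algebra_simps)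
      qed
      finally have "ln (low_prob i (q - r) N) \<le> ln (exp (- (k / 4 * r\<^sup>2 * area N)))" using elim(2) by (intro ln_mono) auto
      hence "k / 4 * r\<^sup>2 * area N \<le> - ln (low_prob i (q - r) N)" by simp
      hence "k / 4 * r\<^sup>2 \<le> - ln (low_prob i (q - r) N) / area N" using pos_le_divide_eq[OF a] by blast
      thus ?case using elim(3) by (simp add: cost_def)
    qed
    hence "k / 4 * r\<^sup>2 \<le> v" by (rule tendsto_lowerbound[OF v(2) _ sequentially_bot])
    thus "ereal (k / 4 * r\<^sup>2) \<le> rate_above 2 \<beta> \<nu> n (q - r)" using v(1) by simp
  qed
qed

text \<open>At the minimal tension the rate is defined as a limit from the right, which exists as a
  supremum because the rate is antimonotone; the quadratic bound passes to the limit.\<close>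

lemma quadratic_rate:
  "\<exists>c>0. \<forall>r>0. rate_function 2 \<beta> \<nu> n (quenched_tension 2 \<beta> \<nu> n - r) \<ge> ereal (c * r\<^sup>2)"
proof -
  obtain q where q: "0 \<le> q" "\<And>i. i \<in> frames \<Longrightarrow> (\<lambda>N. mean i N / area N) \<longlonglongrightarrow> q"
    using mean_tension_limit[folded mean_def] by blast
  have qe: "quenched_tension 2 \<beta> \<nu> n = q" by (rule quenched_tension_eq) (rule q(2))
  define m where "m = minimal_tension 2 \<beta> \<nu> n"
  obtain c where c: "0 < c" "\<And>r. 0 < r \<Longrightarrow> m < q - r \<Longrightarrow> ereal (c * r\<^sup>2) \<le> rate_above 2 \<beta> \<nu> n (q - r)"
    using quadratic_cost[OF q(2) q(1), folded m_def] by blast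
  have "ereal (c * r\<^sup>2) \<le> rate_function 2 \<beta> \<nu> n (q - r)" if r: "0 < r" for r
  proof -
    consider "q - r < m" | "q - r = m" | "m < q - r" by linarith
    thus ?thesis
    proof cases
      case 1
      thus ?thesis by (simp add: rate_function_def m_def)
    next
      case 2
      let ?g = "\<lambda>\<epsilon>. rate_above 2 \<beta> \<nu> n (m + \<epsilon>)"
      define S where "S = (SUP \<epsilon>\<in>{0<..}. ?g \<epsilon>)"
      have up: "?g \<epsilon> \<le> S" if "0 < \<epsilon>" for \<epsilon> unfolding S_def using that by (intro SUP_upper) auto
      have "(?g \<longlongrightarrow> S) (at_right 0)"
      proof (rule order_tendstoI)
        fix y assume "y < S"
        then obtain x where x: "0 < x" "y < ?g x" by (auto simp: S_def less_SUP_iff)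
        have "y < ?g \<epsilon>" if "0 < \<epsilon>" "\<epsilon> < x" for \<epsilon>
          by (rule less_le_trans[OF x(2) rate_above_antimono]) (use that in \<open>auto simp: m_def\<close>)
        thus "\<forall>\<^sub>F \<epsilon> in at_right 0. y < ?g \<epsilon>" unfolding eventually_at_right_field using x(1) by blast
      next
        fix y assume "S < y"
        hence "?g \<epsilon> < y" if "0 < \<epsilon>" for \<epsilon> using up[OF that] by (rule le_less_trans[rotated])
        thus "\<forall>\<^sub>F \<epsilon> in at_right 0. ?g \<epsilon> < y" unfolding eventually_at_right_field using zero_less_one by blast
      qed
      hence L: "Lim (at_right 0) ?g = S" by (intro tendsto_Lim) auto
      have "ereal (c * r\<^sup>2) \<le> S"
      proof (rule tendsto_upperbound)
        have "((\<lambda>\<epsilon>. c * (r - \<epsilon>)\<^sup>2) \<longlongrightarrow> c * (r - 0)\<^sup>2) (at_right 0)" by (intro tendsto_intros)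
        thus "((\<lambda>\<epsilon>. ereal (c * (r - \<epsilon>)\<^sup>2)) \<longlongrightarrow> ereal (c * r\<^sup>2)) (at_right 0)" by simp
        have "ereal (c * (r - \<epsilon>)\<^sup>2) \<le> S" if e: "0 < \<epsilon>" "\<epsilon> < r" for \<epsilon>
        proof -
          have eq: "q - (r - \<epsilon>) = m + \<epsilon>" using 2 by simp
          have "ereal (c * (r - \<epsilon>)\<^sup>2) \<le> ?g \<epsilon>" unfolding eq[symmetric] by (rule c(2)) (use e eq in simp_all)
          thus ?thesis using up[OF e(1)] by (rule order_trans)
        qed
        thus "\<forall>\<^sub>F \<epsilon> in at_right 0. ereal (c * (r - \<epsilon>)\<^sup>2) \<le> S" unfolding eventually_at_right_field using r by blast
      qed simp
      thus ?thesis using 2 L by (simp add: rate_function_def m_def)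
    next
      case 3
      thus ?thesis using c(2)[OF r] by (simp add: rate_function_def m_def)
    qed
  qed
  hence "\<forall>r>0. ereal (c * r\<^sup>2) \<le> rate_function 2 \<beta> \<nu> n (q - r)" by simp
  with c(1) show ?thesis unfolding qe by (intro exI[of _ c] conjI)
qed

end

end

theorem theorem1p7:
  fixes n :: "real ^ 'd" and \<nu> :: "real measure"
  assumes "CARD('d) \<ge> 2"
    and "coupling_law \<nu>"
    and "J_min \<nu> > 0"
    and "norm n = 1"
  shows "\<forall>\<^sub>F \<beta> in at_top. \<exists>c>0. \<forall>r>0.
           rate_function 2 \<beta> \<nu> n (quenched_tension 2 \<beta> \<nu> n - r) \<ge> ereal (c * r\<^sup>2)"
proof -
  define x :: real where "x = exp (-1) / 2 ^ (degree_bound CARD('d) + 1)"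
  have x: "0 < x" by (simp add: x_def)
  have "\<forall>\<^sub>F \<beta> in at_top. - ln x / J_min \<nu> \<le> \<beta>" by (rule eventually_ge_at_top)
  thus ?thesis using eventually_ge_at_top[of "0::real"]
  proof eventually_elim
    case (elim \<beta>)
    have "- (\<beta> * J_min \<nu>) \<le> ln x" using elim(1) unfolding pos_divide_le_eq[OF assms(3)] by linarith
    hence "exp (- (\<beta> * J_min \<nu>)) \<le> exp (ln x)" by (simp only: exp_le_cancel_iff)
    hence "low_temperature CARD('d) (J_min \<nu>) \<beta>" using elim(2) x by (simp add: low_temperature_def x_def)
    from quadratic_rate[OF assms(1,2,4) elim(2) this] show ?case .
  qed
qed

end
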